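(* Let $\tilde B$ be an extended exchange matrix of full rank whose principal part $B$ is an (acyclic) exchange matrix of finite type $D$. Let $X=X(\tilde B)$. Then the quotient $\mathring X/T$ is a smooth affine variety isomorphic to $\mathcal{M}_D$, and an isomorphism $\mathbb{C}[\mathcal{M}_D]\cong\mathbb{C}[\mathring X]^T$ is given by $u_\gamma\mapsto f_\gamma$, $\gamma\in\Pi$.
   Context: Cluster set-up. $D$ is a connected finite type Dynkin diagram with vertex set $I$, $n=|I|$, and Cartan matrix $(a_{ij})$. Fix an orientation of the underlying tree of $D$, with edges written $i\to j$; the associated exchange matrix $B$ (of type $D$) has $B_{ij}=-a_{ij}$ if $i\to j$, $B_{ij}=a_{ij}$ if $j\to i$, and $B_{ij}=0$ otherwise. An extended exchange matrix $\tilde B$ is an $(n+m)\times n$ integer matrix with top $n\times n$ block $B$; it has full rank if its rank is $n$. The cluster algebra $\mathcal{A}(\tilde B)$ is the $\mathbb{C}$-algebra generated by all mutable cluster variables, the frozen variables $x_{n+1},\dots,x_{n+m}$ and the inverses of the frozen variables; the exchange relation at a seed with matrix $(b_{ij})$ is $x_kx_k'=\prod_{b_{ik}>0}x_i^{b_{ik}}+\prod_{b_{ik}<0}x_i^{-b_{ik}}$. Indexing. Put $x_{(0,i)}=x_i$ (initial cluster) and, for $t\ge1$, let the cluster $\{x_{(t,i)}\mid i\in I\}$ be obtained from $\{x_{(t-1,i)}\mid i\in I\}$ by mutating exactly once at each $i\in I$, always at a source of the current orientation ($i\to j$ iff $b_{ij}>0$). Let $r_i+1$ be the least positive $t$ such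 that $x_{(t,i)}$ is an initial variable and write $x_{(r_i+1,i)}=x_{(0,i^* )}$; $i\mapsto i^*$ is an involution of $I$. Set $\Pi=\{(s,i)\mid i\in I,\ 0\le s\le r_i\}$; then $\gamma\mapsto x_\gamma$ is a bijection from $\Pi$ to the set of mutable cluster variables. Put $(-1,i):=(r_{i^*},i^* )$ and let $\tau:\Pi\to\Pi$ be the bijection $\tau(t,j)=(t-1,j)$. Compatibility degree. $(\omega\|\gamma)\in\mathbb{Z}_{\ge0}$, for $\omega,\gamma\in\Pi$, is the unique function with $(\tau\omega\|\tau\gamma)=(\omega\|\gamma)$ and such that $((0,i)\|\gamma)$ is $\max(0,d_i)$, where $d_i$ is the exponent of $x_i$ in the denominator of the Laurent expansion of $x_\gamma$ in the initial cluster (so $(\gamma\|\gamma)=0$). Cluster configuration space. $\mathcal{M}_D=\operatorname{Spec}(\mathbb{C}[u_\gamma^{\pm1}\mid\gamma\in\Pi]/I_D)$, where $I_D$ is generated by $R_\gamma=u_\gamma+\prod_{\omega\in\Pi}u_\omega^{(\omega\|\gamma)}-1$, $\gamma\in\Pi$. Quotient. $X(\tilde B)=\operatorname{Spec}\mathcal{A}(\tilde B)$; $\mathring X=\operatorname{Spec}\big(\mathcal{A}(\tilde B)[1/x\mid x\text{ a mutable cluster variable}]\big)$ is the locus where all mutable cluster variables are non-vanishing. $T=T(\tilde B)$ is the cluster automorphism group: the group of algebra automorphisms $\phi$ of $\mathcal{A}(\tilde B)$ such that for each mutable or frozen variable $x$, $\phi(x)=\zeta(x)x$ with $\zeta(x)\in\mathbb{C}^*$;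 it is the algebraic group $\operatorname{Hom}(\mathbb{Z}^{n+m}/\tilde B\mathbb{Z}^n,\mathbb{C}^* )$ and acts on $\mathring X$. $\mathring X/T:=\operatorname{Spec}(\mathbb{C}[\mathring X]^T)$. The functions $f_\gamma$. For $\gamma=(t,j)\in\Pi$ there is a (primitive) exchange relation $x_{\tau\gamma}x_\gamma=M+M'$, where $M'$ involves only frozen variables and $M$ is a monomial in frozen variables times $\prod_{i\to j}x_{(t,i)}^{-a_{ij}}\prod_{j\to i}x_{(t-1,i)}^{-a_{ij}}$. Define $f_\gamma=M/(x_{\tau\gamma}x_\gamma)\in\mathbb{C}[\mathring X]^T$. (If $D=A_1$ there is a single exchange relation and $M$ is taken to be $\prod_{b_{i1}>0}x_i^{b_{i1}}$ for $\gamma=(0,1)$ and $\prod_{b_{i1}<0}x_i^{-b_{i1}}$ for $\gamma=(1,1)$, with $(b_{i1})=\tilde B$.) *)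

theory Defs
  imports
    Complex_Main
    "HOL-Library.Poly_Mapping"
    "HOL-Library.Extended_Nat"
    "HOL-Computational_Algebra.Fraction_Field"
    "HOL-Algebra.Embedded_Algebras"
    "HOL-Algebra.Generated_Rings"
    "HOL-Algebra.Ideal_Product"
    "HOL-Algebra.QuotRing"
    "HOL-Algebra.Algebraic_Closure_Type"
    "Jordan_Normal_Form.DL_Rank"
begin

section \<open>Smooth affine varieties over the complex numbers\<close>

text \<open>
  A complex algebra is a ring record R together with its structure map
  \<eta> :: complex \<Rightarrow> 'a. Affine schemes are represented by their coordinate algebras.
\<close>

definition algebra_iso ::
  "('a, 'm) ring_scheme \<Rightarrow> (complex \<Rightarrow> 'a) \<Rightarrow> ('b, 'k) ring_scheme \<Rightarrow> (complex \<Rightarrow> 'b) \<Rightarrow> ('a \<Rightarrow> 'b) set"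
  where "algebra_iso R \<eta> S \<theta> = {\<phi> \<in> ring_iso R S. \<forall>c. \<phi> (\<eta> c) = \<theta> c}"

definition finitely_generated_algebra :: "('a, 'm) ring_scheme \<Rightarrow> (complex \<Rightarrow> 'a) \<Rightarrow> bool"
  where "finitely_generated_algebra R \<eta> \<longleftrightarrow>
    (\<exists>G. finite G \<and> G \<subseteq> carrier R \<and> carrier R = generate_ring R (range \<eta> \<union> G))"

text \<open>Dimension of the local ring at a prime P: the supremum of the lengths of chains of
  primes ending in P.\<close>

definition local_dim :: "('a, 'm) ring_scheme \<Rightarrow> 'a set \<Rightarrow> enat"
  where "local_dim R P =
    Sup {enat k | k. \<exists>Q :: nat \<Rightarrow> 'a set. (\<forall>i\<le>k. primeideal (Q i) R) \<and> (\<forall>i<k. Q i \<subset> Q (Suc i)) \<and> Q k = P}"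

text \<open>The Zariski cotangent space at a maximal ideal M is M modulo the square of M, viewed as a
  subspace of R modulo the square of M.\<close>

definition cotangent_dim :: "('a, 'm) ring_scheme \<Rightarrow> (complex \<Rightarrow> 'a) \<Rightarrow> 'a set \<Rightarrow> nat \<Rightarrow> bool"
  where "cotangent_dim R \<eta> M d \<longleftrightarrow>
    (let M2 = ideal_prod R M M in
     ring.dimension (R Quot M2) d (range (\<lambda>c. M2 +>\<^bsub>R\<^esub> \<eta> c)) ((\<lambda>a. M2 +>\<^bsub>R\<^esub> a) ` M))"

definition smooth_affine_variety :: "('a, 'm) ring_scheme \<Rightarrow> (complex \<Rightarrow> 'a) \<Rightarrow> bool"
  where "smooth_affine_variety R \<eta> \<longleftrightarrow>
    domain R \<and> \<eta> \<in> Ring.ring_hom (ring_of_type_algebra :: complex ring) R \<and>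
    finitely_generated_algebra R \<eta> \<and>
    (\<forall>M. maximalideal M R \<longrightarrow> (\<exists>d. cotangent_dim R \<eta> M d \<and> local_dim R M = enat d))"


section \<open>Dynkin diagrams, orientations and exchange matrices\<close>

text \<open>Vertices are numbered from 0: the vertex set is \<open>{..<n}\<close>.\<close>

definition connected_finite_type_cartan :: "nat \<Rightarrow> int mat \<Rightarrow> bool"
  where "connected_finite_type_cartan n A \<longleftrightarrow>
    n \<ge> 1 \<and> A \<in> carrier_mat n n \<and>
    (\<forall>i<n. A $$ (i, i) = 2) \<and>
    (\<forall>i<n. \<forall>j<n. i \<noteq> j \<longrightarrow> A $$ (i, j) \<le> 0 \<and> (A $$ (i, j) = 0 \<longleftrightarrow> A $$ (j, i) = 0)) \<and>
    (\<exists>d :: nat \<Rightarrow> real.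
       (\<forall>i<n. d i > 0) \<and>
       (\<forall>i<n. \<forall>j<n. d i * of_int (A $$ (i, j)) = d j * of_int (A $$ (j, i))) \<and>
       (\<forall>v :: nat \<Rightarrow> real. (\<exists>i<n. v i \<noteq> 0) \<longrightarrow>
          (\<Sum>i<n. \<Sum>j<n. d i * of_int (A $$ (i, j)) * v i * v j) > 0)) \<and>
    (\<forall>i<n. \<forall>j<n. (i, j) \<in> {(k, l). k < n \<and> l < n \<and> A $$ (k, l) \<noteq> 0}\<^sup>*)"

definition orientation :: "nat \<Rightarrow> int mat \<Rightarrow> (nat \<times> nat) set \<Rightarrow> bool"
  where "orientation n A E \<longleftrightarrow>
    E \<subseteq> {(i, j). i < n \<and> j < n \<and> i \<noteq> j \<and> A $$ (i, j) \<noteq> 0} \<and>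
    (\<forall>i<n. \<forall>j<n. i \<noteq> j \<and> A $$ (i, j) \<noteq> 0 \<longrightarrow> ((i, j) \<in> E) \<noteq> ((j, i) \<in> E))"

definition exchange_matrix :: "nat \<Rightarrow> int mat \<Rightarrow> (nat \<times> nat) set \<Rightarrow> int mat"
  where "exchange_matrix n A E = mat n n
    (\<lambda>(i, j). if (i, j) \<in> E then - A $$ (i, j) else if (j, i) \<in> E then A $$ (i, j) else 0)"

definition extends_matrix :: "nat \<Rightarrow> nat \<Rightarrow> int mat \<Rightarrow> int mat \<Rightarrow> bool"
  where "extends_matrix n m B Bt \<longleftrightarrow>
    Bt \<in> carrier_mat (n + m) n \<and> (\<forall>i<n. \<forall>j<n. Bt $$ (i, j) = B $$ (i, j))"

definition full_rank :: "int mat \<Rightarrow> bool"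
  where "full_rank Bt \<longleftrightarrow> vec_space.rank (dim_row Bt) (map_mat rat_of_int Bt) = dim_col Bt"


section \<open>Seeds and mutation\<close>

text \<open>
  The ambient field contains the rational functions in the initial variables \<open>init_var 0\<close>,
  \<open>init_var 1\<close>, and so on. For an extended exchange matrix with n columns and n + m rows only
  the first n + m of them occur; those with index at least n are the frozen ones.
\<close>

type_synonym ambient = "((nat \<Rightarrow>\<^sub>0 nat) \<Rightarrow>\<^sub>0 complex) fract"

definition scalar :: "complex \<Rightarrow> ambient"
  where "scalar c = Fract (Poly_Mapping.single 0 c) 1"

definition init_var :: "nat \<Rightarrow> ambient"
  where "init_var i = Fract (Poly_Mapping.single (Poly_Mapping.single i 1) 1) 1"

abbreviation ambient_ring :: "ambient ring"
  where "ambient_ring \<equiv> ring_of_type_algebra"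

type_synonym seed = "(nat \<Rightarrow> ambient) \<times> int mat"

definition mutate_matrix :: "nat \<Rightarrow> int mat \<Rightarrow> int mat"
  where "mutate_matrix k B = mat (dim_row B) (dim_col B)
    (\<lambda>(i, j). if i = k \<or> j = k then - B $$ (i, j)
              else B $$ (i, j) + (\<bar>B $$ (i, k)\<bar> * B $$ (k, j) + B $$ (i, k) * \<bar>B $$ (k, j)\<bar>) div 2)"

definition pos_monomial :: "seed \<Rightarrow> nat \<Rightarrow> ambient"
  where "pos_monomial \<Sigma> k = (case \<Sigma> of (y, B) \<Rightarrow>
    \<Prod>i \<in> {i. i < dim_row B \<and> B $$ (i, k) > 0}. y i ^ nat (B $$ (i, k)))"

definition neg_monomial :: "seed \<Rightarrow> nat \<Rightarrow> ambient"
  where "neg_monomial \<Sigma> k = (case \<Sigma> of (y, B) \<Rightarrow>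
    \<Prod>i \<in> {i. i < dim_row B \<and> B $$ (i, k) < 0}. y i ^ nat (- B $$ (i, k)))"

definition mutate :: "nat \<Rightarrow> seed \<Rightarrow> seed"
  where "mutate k \<Sigma> =
    ((fst \<Sigma>)(k := (pos_monomial \<Sigma> k + neg_monomial \<Sigma> k) / fst \<Sigma> k), mutate_matrix k (snd \<Sigma>))"

definition initial_seed :: "int mat \<Rightarrow> seed"
  where "initial_seed Bt = (init_var, Bt)"

inductive_set seeds :: "int mat \<Rightarrow> seed set" for Bt :: "int mat" where
  initial: "initial_seed Bt \<in> seeds Bt"
| mutation: "\<Sigma> \<in> seeds Bt \<Longrightarrow> k < dim_col Bt \<Longrightarrow> mutate k \<Sigma> \<in> seeds Bt"

definition mutable_variables :: "int mat \<Rightarrow> ambient set"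
  where "mutable_variables Bt = {fst \<Sigma> k | \<Sigma> k. \<Sigma> \<in> seeds Bt \<and> k < dim_col Bt}"

definition frozen_variables :: "int mat \<Rightarrow> ambient set"
  where "frozen_variables Bt = init_var ` {dim_col Bt..<dim_row Bt}"

definition frozen_monomials :: "int mat \<Rightarrow> ambient set"
  where "frozen_monomials Bt =
    {\<Prod>i\<in>{dim_col Bt..<dim_row Bt}. init_var i ^ e i | e :: nat \<Rightarrow> nat. True}"


section \<open>The cluster algebra, its localization and the torus of cluster automorphisms\<close>

definition cluster_algebra :: "int mat \<Rightarrow> ambient ring"
  where "cluster_algebra Bt = ambient_ring \<lparr> carrier := generate_ring ambient_ring
    (range scalar \<union> mutable_variables Bt \<union> frozen_variables Bt \<union> inverse ` frozen_variables Bt) \<rparr>"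

text \<open>The coordinate ring of the locus where no mutable cluster variable vanishes.\<close>

definition localized_cluster_algebra :: "int mat \<Rightarrow> ambient ring"
  where "localized_cluster_algebra Bt = ambient_ring \<lparr> carrier := generate_ring ambient_ring
    (carrier (cluster_algebra Bt) \<union> inverse ` mutable_variables Bt) \<rparr>"

definition cluster_torus :: "int mat \<Rightarrow> (ambient \<Rightarrow> ambient) set"
  where "cluster_torus Bt =
    {\<phi> \<in> algebra_iso (cluster_algebra Bt) scalar (cluster_algebra Bt) scalar.
       \<forall>x \<in> mutable_variables Bt \<union> frozen_variables Bt. \<exists>\<zeta>. \<zeta> \<noteq> 0 \<and> \<phi> x = scalar \<zeta> * x}"

text \<open>An automorphism of the cluster algebra acts on the localization through fractions whose
  denominators are products of mutable cluster variables.\<close>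

definition denominators :: "int mat \<Rightarrow> ambient set"
  where "denominators Bt = {prod_list xs | xs. set xs \<subseteq> mutable_variables Bt}"

definition torus_act :: "int mat \<Rightarrow> (ambient \<Rightarrow> ambient) \<Rightarrow> ambient \<Rightarrow> ambient"
  where "torus_act Bt \<phi> g =
    (THE h. \<exists>a \<in> carrier (cluster_algebra Bt). \<exists>s \<in> denominators Bt. g = a / s \<and> h = \<phi> a / \<phi> s)"

definition invariant_ring :: "int mat \<Rightarrow> ambient ring"
  where "invariant_ring Bt = ambient_ring \<lparr> carrier :=
    {g \<in> carrier (localized_cluster_algebra Bt). \<forall>\<phi> \<in> cluster_torus Bt. torus_act Bt \<phi> g = g} \<rparr>"


section \<open>Indexing of the mutable cluster variables\<close>

definition is_source :: "int mat \<Rightarrow> nat \<Rightarrow> bool"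
  where "is_source B k \<longleftrightarrow> (\<forall>i < dim_col B. \<not> B $$ (i, k) > 0)"

fun source_sequence :: "int mat \<Rightarrow> nat list \<Rightarrow> bool" where
  "source_sequence B [] \<longleftrightarrow> True"
| "source_sequence B (k # ks) \<longleftrightarrow> is_source B k \<and> source_sequence (mutate_matrix k B) ks"

text \<open>One round of source mutations. The order is chosen arbitrarily: any two admissible orders
  differ by interchanging mutations at non-adjacent vertices, which commute.\<close>

definition sweep :: "seed \<Rightarrow> seed"
  where "sweep \<Sigma> = fold mutate
    (SOME ks. distinct ks \<and> set ks = {..<dim_col (snd \<Sigma>)} \<and> source_sequence (snd \<Sigma>) ks) \<Sigma>"

fun cvar :: "int mat \<Rightarrow> nat \<times> nat \<Rightarrow> ambient"
  where "cvar Bt (t, i) = fst ((sweep ^^ t) (initial_seed Bt)) i"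

definition return_time :: "int mat \<Rightarrow> nat \<Rightarrow> nat"
  where "return_time Bt i = (LEAST t. t > 0 \<and> cvar Bt (t, i) \<in> init_var ` {..<dim_col Bt})"

definition rr :: "int mat \<Rightarrow> nat \<Rightarrow> nat"
  where "rr Bt i = return_time Bt i - 1"

definition star :: "int mat \<Rightarrow> nat \<Rightarrow> nat"
  where "star Bt i = (THE j. j < dim_col Bt \<and> cvar Bt (rr Bt i + 1, i) = cvar Bt (0, j))"

definition PiD :: "int mat \<Rightarrow> (nat \<times> nat) set"
  where "PiD Bt = {(s, i). i < dim_col Bt \<and> s \<le> rr Bt i}"

text \<open>The case t = 0 implements the convention \<open>(-1, i) := (r_{i*}, i*)\<close>.\<close>

fun tauD :: "int mat \<Rightarrow> nat \<times> nat \<Rightarrow> nat \<times> nat"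
  where "tauD Bt (t, i) = (if t = 0 then (rr Bt (star Bt i), star Bt i) else (t - 1, i))"


section \<open>Laurent polynomials and the compatibility degree\<close>

type_synonym 'v laurent = "('v \<Rightarrow>\<^sub>0 int) \<Rightarrow>\<^sub>0 complex"

definition laurent_eval :: "('v \<Rightarrow> ambient) \<Rightarrow> 'v laurent \<Rightarrow> ambient"
  where "laurent_eval y p = (\<Sum>e \<in> Poly_Mapping.keys p.
    scalar (Poly_Mapping.lookup p e) * (\<Prod>v \<in> Poly_Mapping.keys e. y v powi Poly_Mapping.lookup e v))"

text \<open>The exponent of \<open>init_var i\<close> in the denominator of the Laurent expansion of g; it is negative
  if every term of the expansion contains a positive power of \<open>init_var i\<close>.\<close>

definition denom_exponent :: "nat \<Rightarrow> ambient \<Rightarrow> int"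
  where "denom_exponent i g = (THE d. \<exists>p :: nat laurent. laurent_eval init_var p = g \<and>
    d = - Min ((\<lambda>e. Poly_Mapping.lookup e i) ` Poly_Mapping.keys p))"

text \<open>\<open>compat_degree Bt \<omega> \<gamma>\<close> is the compatibility degree \<open>(\<omega> || \<gamma>)\<close>; outside of \<open>PiD Bt\<close> it is
  set to 0 so that it is determined uniquely.\<close>

definition compat_degree :: "int mat \<Rightarrow> nat \<times> nat \<Rightarrow> nat \<times> nat \<Rightarrow> nat"
  where "compat_degree Bt = (THE c.
    (\<forall>\<omega> \<in> PiD Bt. \<forall>\<gamma> \<in> PiD Bt. c (tauD Bt \<omega>) (tauD Bt \<gamma>) = c \<omega> \<gamma>) \<and>
    (\<forall>i < dim_col Bt. \<forall>\<gamma> \<in> PiD Bt. int (c (0, i) \<gamma>) = max 0 (denom_exponent i (cvar Bt \<gamma>))) \<and>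
    (\<forall>\<omega> \<gamma>. \<omega> \<notin> PiD Bt \<or> \<gamma> \<notin> PiD Bt \<longrightarrow> c \<omega> \<gamma> = 0))"


section \<open>The cluster configuration space\<close>

definition laurent_ring :: "'v set \<Rightarrow> 'v laurent ring"
  where "laurent_ring V = ring_of_type_algebra \<lparr> carrier :=
    {p. \<forall>e \<in> Poly_Mapping.keys p. Poly_Mapping.keys e \<subseteq> V} \<rparr>"

definition laurent_const :: "complex \<Rightarrow> 'v laurent"
  where "laurent_const c = Poly_Mapping.single 0 c"

definition laurent_var :: "'v \<Rightarrow> 'v laurent"
  where "laurent_var v = Poly_Mapping.single (Poly_Mapping.single v 1) 1"

text \<open>The configuration space is determined by the diagram and its orientation alone, so B is here the
  principal exchange matrix, without frozen rows.\<close>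

definition config_relation :: "int mat \<Rightarrow> nat \<times> nat \<Rightarrow> (nat \<times> nat) laurent"
  where "config_relation B \<gamma> =
    laurent_var \<gamma> + (\<Prod>\<omega> \<in> PiD B. laurent_var \<omega> ^ compat_degree B \<omega> \<gamma>) - 1"

definition config_ideal :: "int mat \<Rightarrow> (nat \<times> nat) laurent set"
  where "config_ideal B = Idl\<^bsub>laurent_ring (PiD B)\<^esub> (config_relation B ` PiD B)"

definition config_ring :: "int mat \<Rightarrow> (nat \<times> nat) laurent set ring"
  where "config_ring B = laurent_ring (PiD B) Quot config_ideal B"

definition config_class :: "int mat \<Rightarrow> (nat \<times> nat) laurent \<Rightarrow> (nat \<times> nat) laurent set"
  where "config_class B p = config_ideal B +>\<^bsub>laurent_ring (PiD B)\<^esub> p"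

definition config_scalar :: "int mat \<Rightarrow> complex \<Rightarrow> (nat \<times> nat) laurent set"
  where "config_scalar B c = config_class B (laurent_const c)"

definition config_var :: "int mat \<Rightarrow> nat \<times> nat \<Rightarrow> (nat \<times> nat) laurent set"
  where "config_var B \<gamma> = config_class B (laurent_var \<gamma>)"


section \<open>The functions \<open>f_\<gamma>\<close>\<close>

definition exchange_relation :: "int mat \<Rightarrow> ambient \<Rightarrow> ambient \<Rightarrow> ambient \<Rightarrow> ambient \<Rightarrow> bool"
  where "exchange_relation Bt y y' P Q \<longleftrightarrow>
    (\<exists>\<Sigma> \<in> seeds Bt. \<exists>k < dim_col Bt. y = fst \<Sigma> k \<and> y' = fst (mutate k \<Sigma>) k \<and>
       (P = pos_monomial \<Sigma> k \<and> Q = neg_monomial \<Sigma> k \<or> P = neg_monomial \<Sigma> k \<and> Q = pos_monomial \<Sigma> k))"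

text \<open>The mutable part of M for \<open>\<gamma> = (t, j)\<close>. An edge from i to j is recorded by
  \<open>Bt $$ (i, j) > 0\<close>, and then \<open>- a_ij = Bt $$ (i, j)\<close>; for an edge from j to i,
  \<open>- a_ij = - Bt $$ (i, j)\<close>. The variable \<open>x_{(t-1,i)}\<close> is that of \<open>tauD Bt (t, i)\<close>, also for t = 0.\<close>

fun mutable_part :: "int mat \<Rightarrow> nat \<times> nat \<Rightarrow> ambient"
  where "mutable_part Bt (t, j) =
    (\<Prod>i \<in> {i. i < dim_col Bt \<and> Bt $$ (i, j) > 0}. cvar Bt (t, i) ^ nat (Bt $$ (i, j))) *
    (\<Prod>i \<in> {i. i < dim_col Bt \<and> Bt $$ (j, i) > 0}. cvar Bt (tauD Bt (t, i)) ^ nat (- Bt $$ (i, j)))"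

text \<open>In rank one both monomials of the unique exchange relation are frozen, and M is fixed by
  convention.\<close>

definition MM :: "int mat \<Rightarrow> nat \<times> nat \<Rightarrow> ambient"
  where "MM Bt \<gamma> =
    (if dim_col Bt = 1 then
       (if \<gamma> = (0, 0) then pos_monomial (initial_seed Bt) 0 else neg_monomial (initial_seed Bt) 0)
     else THE M. \<exists>M'. exchange_relation Bt (cvar Bt (tauD Bt \<gamma>)) (cvar Bt \<gamma>) M M' \<and>
       M' \<in> frozen_monomials Bt \<and> (\<exists>q \<in> frozen_monomials Bt. M = q * mutable_part Bt \<gamma>))"

definition ff :: "int mat \<Rightarrow> nat \<times> nat \<Rightarrow> ambient"
  where "ff Bt \<gamma> = MM Bt \<gamma> / (cvar Bt (tauD Bt \<gamma>) * cvar Bt \<gamma>)"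

end

(* On the bipartite belt, the order of vanishing of one cluster variable along another obeys the
tropical exchange relations, hence a Chebyshev recursion for the Cartan matrix. Positive definiteness
makes its solutions sign coherent and periodic. This determines the compatibility degrees, shows that
the belt contains all mutable cluster variables, and, on comparing exponents in the exchange
relations, yields the u-equations for the functions f.

Modulo the relations, every Laurent polynomial in the u is a fraction of Laurent polynomials in n
monomials in the u, with invertible denominators. The images of these monomials are algebraically
independent because the columns of Bt are, so no further relations hold between the f. The cluster
torus separates exponents modulo the column lattice of Bt, so an invariant is a polynomial in the f
and their inverses. Finally, the n independent units parametrize the ring up to invertible
denominators. The residue fields are the complex numbers, the ring having countable dimension, so the
n units minus their values at a point generate its cotangent space, freely by partial derivatives. *)
theory Submission
 imports Defs "HOL-Analysis.Continuum_Not_Denumerable"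
begin

text \<open>Vertex \<open>k\<close> after \<open>t\<close> sweeps is placed at position
  \<open>2 * t + ht k\<close>. Quantities attached to two cluster variables then depend on two
  vertices and one difference of positions, and all orientations are treated alike. Orders are
  computed for quotients of Laurent polynomials with nonnegative integer coefficients: leading terms
  cannot cancel there, so the order of a sum is exactly the minimum. An energy preserved by the
  recursion takes the place of roots and of the classification; the first vanishing row of the
  recursion yields the Coxeter number h and the involution \<open>kap\<close>, and the period is h +
  2 up to \<open>kap\<close>. The Laurent property is obtained from the invariance of upper bounds
  under mutation, by an argument that uses independent columns. The group of exponents modulo the
  columns of \<open>Bt\<close> may have torsion, so exponents are separated by characters whose
  values are roots of unity.\<close>

abbreviation iff (infixr "<->" 25) where "P <-> Q \<equiv> (P::bool) = Q"
type_synonym 'v ex = "'v \<Rightarrow>\<^sub>0 int"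
lemmas pm_eqI = poly_mapping_eqI
lemmas ifi = infinite_finite_induct
abbreviation lookup where "lookup \<equiv> Poly_Mapping.lookup"
abbreviation keys where "keys \<equiv> Poly_Mapping.keys"
abbreviation single where "single \<equiv> Poly_Mapping.single"

section \<open>Linear algebra\<close>

lemma two_sided_inverse_exists:
 fixes M :: "nat => nat => 'a :: field"
 assumes ker: "!!v. ALL i<n. (SUM j<n. M i j * v j) = 0 ==> ALL j<n. v j = 0"
 shows "EX P. (ALL i<n. ALL k<n. (SUM j<n. M i j * P j k) = (if i = k then 1 else 0)) &
  (ALL i<n. ALL k<n. (SUM j<n. P i j * M j k) = (if i = k then 1 else 0))"
proof -
 define A where "A = mat n n (%(i, j). M i j)"
 have A: "A : carrier_mat n n" by (simp add: A_def)
 have "det A ~= 0"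
 proof
  assume "det A = 0"
  then obtain v where v: "v : carrier_vec n" "v ~= 0\<^sub>v n" "A *\<^sub>v v = 0\<^sub>v n"
   unfolding det_0_iff_vec_prod_zero_field[OF A] by blast
  have z: "(SUM j<n. M i j * v $ j) = 0" if "i < n" for i
  proof -
   have "(A *\<^sub>v v) $ i = 0" using v(3) that by simp
   thus ?thesis using that v(1) by (simp add: A_def scalar_prod_def lessThan_atLeast0)
  qed
  have "ALL j<n. v $ j = 0" by (rule ker) (simp add: z)
  hence "v = 0\<^sub>v n" using v(1) by (intro eq_vecI) auto
  thus False using v by simp
 qed
 hence "A : Units (ring_mat TYPE('a) n ())" by (rule det_non_zero_imp_unit[OF A])
 then obtain B where B: "B : carrier_mat n n" "A * B = 1\<^sub>m n" "B * A = 1\<^sub>m n"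
  by (auto simp: Units_def ring_mat_def)
 show ?thesis
 proof (intro exI[of _ "%i j. B $$ (i, j)"] conjI allI impI)
  fix i k assume ik: "i < n" "k < n"
  have "(A * B) $$ (i, k) = (if i = k then 1 else 0)" using B(2) ik by simp
  thus "(SUM j<n. M i j * B $$ (j, k)) = (if i = k then 1 else 0)"
   using ik B(1) by (simp add: A_def scalar_prod_def lessThan_atLeast0)
 next
  fix i k assume ik: "i < n" "k < n"
  have "(B * A) $$ (i, k) = (if i = k then 1 else 0)" using B(3) ik by simp
  thus "(SUM j<n. B $$ (i, j) * M j k) = (if i = k then 1 else 0)"
   using ik B(1) by (simp add: A_def scalar_prod_def lessThan_atLeast0)
 qed
qed

section \<open>Chebyshev recursion on a Cartan matrix\<close>

locale cartan =
 fixes n :: nat and A :: "int mat"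
 assumes cft: "connected_finite_type_cartan n A"
begin

definition sym_weight :: "nat => real" where
 "sym_weight = (SOME d. (ALL i<n. d i > 0) &
   (ALL i<n. ALL j<n. d i * of_int (A $$ (i, j)) = d j * of_int (A $$ (j, i))) &
   (ALL v :: nat => real. (EX i<n. v i ~= 0) -->
     (SUM i<n. SUM j<n. d i * of_int (A $$ (i, j)) * v i * v j) > 0))"

text \<open>The Cartan matrix is 2 I - \<open>adj\<close>. The value 0 outside the vertex set makes
  range conditions follow from \<open>adj j k > 0\<close>.\<close>

definition adj :: "nat => nat => int" where
 "adj j k = (if j < n & k < n & j ~= k then - A $$ (j, k) else 0)"

text \<open>Rows of the recursion are multiplied by \<open>adj\<close> from the right, and it is the
  reciprocal weights that make this action self-adjoint.\<close>

definition cw :: "nat => real" where "cw k = inverse (sym_weight k)"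

lemma sym_weight:
 shows sym_weight_pos: "!!i. i < n ==> sym_weight i > 0"
  and sym_weight_sym: "!!i j. i < n ==> j < n ==>
   sym_weight i * of_int (A $$ (i, j)) = sym_weight j * of_int (A $$ (j, i))"
  and sym_weight_posdef: "!!v i. i < n ==> v i ~= 0 ==>
     (SUM i<n. SUM j<n. sym_weight i * of_int (A $$ (i, j)) * v i * v j) > (0::real)"
proof -
 have "EX d :: nat => real. (ALL i<n. d i > 0) &
   (ALL i<n. ALL j<n. d i * of_int (A $$ (i, j)) = d j * of_int (A $$ (j, i))) &
   (ALL v :: nat => real. (EX i<n. v i ~= 0) -->
     (SUM i<n. SUM j<n. d i * of_int (A $$ (i, j)) * v i * v j) > 0)"
  using cft unfolding connected_finite_type_cartan_def by blast
 from someI_ex[OF this, folded sym_weight_def]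
 show "!!i. i < n ==> sym_weight i > 0"
  "!!i j. i < n ==> j < n ==>
   sym_weight i * of_int (A $$ (i, j)) = sym_weight j * of_int (A $$ (j, i))"
  "!!v i. i < n ==> v i ~= 0 ==>
     (SUM i<n. SUM j<n. sym_weight i * of_int (A $$ (i, j)) * v i * v j) > (0::real)" by blast+
qed

lemma n_pos: "n >= 1" and A_diag: "i < n ==> A $$ (i, i) = 2"
 using cft by (auto simp: connected_finite_type_cartan_def)

lemma A_off: "i < n ==> j < n ==> i ~= j ==> A $$ (i, j) <= 0"
 and A_zero_iff: "i < n ==> j < n ==> i ~= j ==> A $$ (i, j) = 0 <-> A $$ (j, i) = 0"
 using cft by (auto simp: connected_finite_type_cartan_def)

lemma adj_nonneg [simp]: "adj j k >= 0" using A_off by (auto simp: adj_def)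

lemma adj_self [simp]: "adj j j = 0" by (simp add: adj_def)

lemma adj_pos_iff: "adj j k > 0 <-> adj j k ~= 0" using adj_nonneg[of j k] by linarith

lemma adj_pos_sym: "adj j k > 0 <-> adj k j > 0"
using A_zero_iff[of j k] adj_nonneg[of j k] adj_nonneg[of k j] by (auto simp: adj_def)

lemma A_eq_adj: "i < n ==> j < n ==> A $$ (i, j) = (if i = j then 2 else 0) - adj i j"
 by (auto simp: adj_def A_diag)

lemma cw_pos: "i < n ==> cw i > 0" using sym_weight_pos by (simp add: cw_def)

lemma adj_cw: "adj j k * cw k = adj k j * cw j"
using sym_weight_sym sym_weight_pos[of j] sym_weight_pos[of k] by (cases "j < n & k < n & j ~= k") (auto simp: adj_def cw_def field_simps)

lemma posdef_cw:
 assumes "i < n" "x i ~= 0"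
 shows "2 * (SUM i<n. cw i * x i * x i) - (SUM i<n. SUM j<n. x i * adj i j * cw j * x j) > (0::real)"
proof -
 have "0 < (SUM i<n. SUM j<n. sym_weight i * of_int (A $$ (i, j)) * (cw i * x i) * (cw j * x j))"
  using assms cw_pos[of i] by (intro sym_weight_posdef[of i]) auto
 also have "... = (SUM i<n. SUM j<n. of_int (A $$ (i, j)) * x i * (cw j * x j))"
 proof (intro sum.cong refl)
  fix i j assume "i : {..<n}"
  thus "sym_weight i * of_int (A $$ (i, j)) * (cw i * x i) * (cw j * x j) =
   of_int (A $$ (i, j)) * x i * (cw j * x j)" using sym_weight_pos[of i] by (simp add: cw_def)
 qed
 also have "... = (SUM i<n. SUM j<n. (if i = j then 2 * cw i * x i * x i else 0) - x i * adj i j * cw j * x j)"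
  by (intro sum.cong refl) (auto simp: A_eq_adj)
 also have "... = 2 * (SUM i<n. cw i * x i * x i) - (SUM i<n. SUM j<n. x i * adj i j * cw j * x j)"
  by (simp add: sum_subtractf sum_distrib_left algebra_simps)
 finally show ?thesis .
qed

lemma posdef_sym:
 assumes "i < n" "x i ~= 0"
 shows "(SUM i<n. SUM j<n. sym_weight i * x i * ((if i = j then 2 else 0) - of_int (adj i j)) * x j) > (0::real)"
proof -
 have "0 < (SUM i<n. SUM j<n. sym_weight i * of_int (A $$ (i, j)) * x i * x j)"
  using assms by (intro sym_weight_posdef)
 also have "... = (SUM i<n. SUM j<n. sym_weight i * x i * ((if i = j then 2 else 0) - of_int (adj i j)) * x j)"
  by (intro sum.cong refl) (auto simp: A_eq_adj)
 finally show ?thesis .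
qed

text \<open>\<open>\<xi>\<close> is the inverse Cartan matrix applied to the all-ones vector. If its
  negative part m were nonzero, the weighted pairing of m with A \<xi> = 1 would be nonnegative; but
  since off-diagonal entries of A are nonpositive, it is at most minus the positive definite form at
  m.\<close>

lemma positive_vector_exists:
 obtains \<xi> :: "nat => real" where "!!j. j < n ==> \<xi> j >= 0"
  and "!!j. j < n ==> (SUM k<n. real_of_int (adj j k) * \<xi> k) = 2 * \<xi> j - 1"
proof -
 define M where "M i j = (if i = j then 2 else 0) - real_of_int (adj i j)" for i j
 have M_sum: "(SUM j<n. M i j * v j) = 2 * v i - (SUM j<n. adj i j * v j)" if "i < n" for i and v :: "nat => real"
  using that by (simp add: M_def left_diff_distrib sum_subtractf if_distrib[of "%a. a * _"] )
 have pd: "(SUM i<n. sym_weight i * x i * (SUM j<n. M i j * x j)) > 0" if "i < n" "x i ~= 0" for x i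
  using posdef_sym that by (simp add: M_def sum_distrib_left mult.assoc)
 have ker: "ALL j<n. v j = 0" if "ALL i<n. (SUM j<n. M i j * v j) = 0" for v
 proof (intro allI impI)
  fix j assume "j < n"
  show "v j = 0"
  proof (rule ccontr)
   assume "v j ~= 0"
   with `j < n` have "0 < (SUM i<n. sym_weight i * v i * (SUM j<n. M i j * v j))" by (rule pd)
   thus False using that by simp
  qed
 qed
 obtain P where "ALL i<n. ALL k<n. (SUM j<n. M i j * P j k) = (if i = k then 1 else 0)"
  using two_sided_inverse_exists[of n M, OF ker] by blast
 hence P: "!!i k. i < n ==> k < n ==> (SUM j<n. M i j * P j k) = (if i = k then 1 else 0)" by blast
 define \<xi> where "\<xi> j = (SUM k<n. P j k)" for j
 have M\<xi>: "(SUM j<n. M i j * \<xi> j) = 1" if "i < n" for i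
 proof -
  have "(SUM j<n. M i j * \<xi> j) = (SUM k<n. SUM j<n. M i j * P j k)"
   unfolding \<xi>_def sum_distrib_left by (rule sum.swap)
  also have "... = 1" using that by (simp add: P)
  finally show ?thesis .
 qed
 have "\<xi> j >= 0" if "j < n" for j
 proof (rule ccontr)
  assume neg: "~ \<xi> j >= 0"
  define m where "m i = max 0 (- \<xi> i)" for i
  have mj: "m j ~= 0" using neg by (simp add: m_def)
  have "(SUM i<n. sym_weight i * m i * (SUM j<n. M i j * \<xi> j)) <=
     (SUM i<n. sym_weight i * m i * (SUM j<n. M i j * (- m j)))"
  proof (intro sum_mono)
   fix i assume i: "i : {..<n}"
   have "m i * (SUM j<n. M i j * \<xi> j) <= m i * (SUM j<n. M i j * (- m j))"
   proof -
    have *: "m i * (M i j * \<xi> j) <= m i * (M i j * (- m j))" for j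
    proof (cases "i = j")
     case True
     thus ?thesis by (cases "\<xi> j < 0") (simp_all add: m_def)
    next
     case False
     hence "M i j <= 0" by (simp add: M_def)
     moreover have "\<xi> j >= - m j" by (simp add: m_def)
     ultimately have "M i j * \<xi> j <= M i j * (- m j)" by (metis mult_left_mono_neg)
     thus ?thesis by (rule mult_left_mono) (simp add: m_def)
    qed
    show ?thesis by (subst (1 2) sum_distrib_left) (intro sum_mono *)
   qed
   thus "sym_weight i * m i * (SUM j<n. M i j * \<xi> j) <= sym_weight i * m i * (SUM j<n. M i j * (- m j))"
    using sym_weight_pos i by simp
  qed
  also have "... = - (SUM i<n. sym_weight i * m i * (SUM j<n. M i j * m j))" by (simp add: sum_negf)
  also have "... < 0" using pd[OF that, of m] mj by simp
  finally have "(SUM i<n. sym_weight i * m i * (SUM j<n. M i j * \<xi> j)) < 0" .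
  moreover have "(SUM i<n. sym_weight i * m i * (SUM j<n. M i j * \<xi> j)) >= 0"
   by (intro sum_nonneg) (auto simp: M\<xi> m_def less_imp_le[OF sym_weight_pos])
  ultimately show False by simp
 qed
 moreover have "(SUM k<n. real_of_int (adj j k) * \<xi> k) = 2 * \<xi> j - 1" if "j < n" for j
  using M\<xi>[OF that] M_sum[OF that, of \<xi>] by simp
 ultimately show ?thesis by (rule that)
qed

text \<open>A nonnegative solution pairs with the vector \<open>\<xi>\<close> to a concave sequence, whose slope drops
 forever unless the solution vanishes.\<close>

lemma nonneg_solution_zero:
 fixes a :: "nat => nat => int"
 assumes rec: "!!s k. k < n ==> a (Suc (Suc s)) k = (SUM j<n. a (Suc s) j * adj j k) - a s k"
  and nn: "!!s k. k < n ==> a s k >= 0"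
  and "k < n"
 shows "a s k = 0"
proof (rule ccontr)
 assume ne: "a s k ~= 0"
 obtain \<xi> :: "nat => real" where \<xi>0: "!!j. j < n ==> \<xi> j >= 0"
  and \<xi>: "!!j. j < n ==> (SUM k<n. real_of_int (adj j k) * \<xi> k) = 2 * \<xi> j - 1"
  using positive_vector_exists by blast
 define T where "T s = (SUM k<n. \<xi> k * a s k)" for s
 define H where "H s = (SUM j<n. a s j)" for s
 define D where "D s = T (Suc s) - T s" for s
 have T0: "T s >= 0" for s unfolding T_def by (intro sum_nonneg mult_nonneg_nonneg) (auto simp: nn \<xi>0)
 have H0: "H s >= 0" for s unfolding H_def by (intro sum_nonneg) (auto simp: nn)
 \<comment> \<open>The second difference of \<open>T\<close> is \<open>- H\<close>; this is where
   the equation of \<open>\<xi>\<close> enters.\<close>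
 have T_rec: "T (Suc (Suc s)) + T s = 2 * T (Suc s) - H (Suc s)" for s
 proof -
  have "T (Suc (Suc s)) + T s = (SUM k<n. SUM j<n. \<xi> k * (a (Suc s) j * adj j k))"
   unfolding T_def by (simp add: rec algebra_simps sum_distrib_left sum_subtractf)
  also have "... = (SUM j<n. SUM k<n. \<xi> k * (a (Suc s) j * adj j k))" by (rule sum.swap)
  also have "... = (SUM j<n. a (Suc s) j * (SUM k<n. real_of_int (adj j k) * \<xi> k))"
   by (simp add: sum_distrib_left mult_ac)
  also have "... = (SUM j<n. a (Suc s) j * (2 * \<xi> j - 1))" by (simp add: \<xi>)
  also have "... = 2 * T (Suc s) - H (Suc s)"
   by (simp add: T_def H_def algebra_simps sum_subtractf sum_distrib_left)
  finally show ?thesis .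
 qed
 have D_Suc: "D (Suc s) = D s - H (Suc s)" for s using T_rec[of s] by (simp add: D_def)
 have D_mono: "D (s + m) <= D s" for s m
 proof (induction m)
  case (Suc m)
  thus ?case using D_Suc H0[of "Suc (s + m)"] by simp
 qed simp
 have D0: "D s >= 0" for s
 proof (rule ccontr)
  assume neg: "~ D s >= 0"
  have lin: "T (s + m) <= T s + real m * D s" for m
  proof (induction m)
   case (Suc m)
   have "T (s + Suc m) = T (s + m) + D (s + m)" by (simp add: D_def)
   moreover have "real (Suc m) * D s = real m * D s + D s" by (simp add: algebra_simps)
   ultimately show ?case using Suc D_mono[of s m] by linarith
  qed simp
  from neg have "- D s > 0" by simp
  then obtain m :: nat where m: "T s < real m * (- D s)" using reals_Archimedean3 by blast
  have "T (s + m) < 0" using lin[of m] m by (auto)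
  thus False using T0[of "s + m"] by linarith
 qed
 \<comment> \<open>Two consecutive zero rows would propagate through the recursion in both
   directions and make the whole solution vanish.\<close>
 have nz: "H (Suc s) + H (Suc (Suc s)) >= 1" for s
 proof (rule ccontr)
  assume "~ ?thesis"
  hence "H (Suc s) = 0" "H (Suc (Suc s)) = 0" using H0[of "Suc s"] H0[of "Suc (Suc s)"] by auto
  hence z: "a (Suc s) j = 0" "a (Suc (Suc s)) j = 0" if "j < n" for j
  proof -
   have "ALL j:{..<n}. a (Suc s) j = 0"
    using `H (Suc s) = 0` nn unfolding H_def by (subst (asm) sum_nonneg_eq_0_iff) auto
   moreover have "ALL j:{..<n}. a (Suc (Suc s)) j = 0"
    using `H (Suc (Suc s)) = 0` nn unfolding H_def by (subst (asm) sum_nonneg_eq_0_iff) auto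
   ultimately show "a (Suc s) j = 0" "a (Suc (Suc s)) j = 0" using that by auto
  qed
  have up: "a (Suc s + m) j = 0 & a (Suc (Suc s + m)) j = 0" if "j < n" for j m using that
  proof (induction m arbitrary: j)
   case (Suc m)
   thus ?case using rec[of j "Suc s + m"] by simp
  qed (simp add: z)
  have down: "a (Suc s - m) j = 0 & a (Suc (Suc s) - m) j = 0" if "m <= Suc s" "j < n" for j m
   using that
  proof (induction m arbitrary: j)
   case (Suc m)
   define r where "r = s - m"
   have r: "Suc s - m = Suc r" "Suc (Suc s) - m = Suc (Suc r)" "Suc s - Suc m = r"
    using Suc.prems by (auto simp: r_def)
   have "a (Suc r) j = 0" "a (Suc (Suc r)) j = 0" if "j < n" for j using Suc.IH that r by auto
   thus ?case using rec Suc.prems r by auto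
  qed (auto simp: z)
  have "a s' j = 0" if "j < n" for s' j
  proof (cases "s' >= Suc s")
   case True
   thus ?thesis using up[OF that, of "s' - Suc s"] by simp
  next
   case False
   thus ?thesis using down[OF _ that, of "Suc s - s'"] by simp
  qed
  thus False using ne `k < n` by blast
 qed
 have "D (2 * m) <= D 0 - m" for m
 proof (induction m)
  case (Suc m)
  have "D (2 * Suc m) = D (2 * m) - (H (Suc (2 * m)) + H (Suc (Suc (2 * m))))" by (simp add: D_Suc)
  thus ?case using Suc nz[of "2 * m"] by linarith
 qed simp
 moreover obtain m :: nat where "real m > D 0" using reals_Archimedean2 by blast
 ultimately have "D (2 * m) < 0" by (meson diff_less_0_iff_less order_le_less_trans)
 thus False using D0[of "2 * m"] by simp
qed

end

section \<open>Matrix Chebyshev polynomials, the Coxeter number and the diagram involution\<close>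

context cartan
begin

text \<open>The matrix \<open>cheb s\<close> is U_{s-1}(adj / 2), with U the Chebyshev polynomials
  of the second kind.\<close>

fun cheb :: "nat => nat => nat => int" where
 "cheb 0 i k = 0"
| "cheb (Suc 0) i k = (if i = k then 1 else 0)"
| "cheb (Suc (Suc s)) i k = (SUM j<n. cheb (Suc s) i j * adj j k) - cheb s i k"

declare cheb.simps(3) [simp del]

lemmas cheb_rec = cheb.simps(3)

lemma cheb_comm:
 assumes "i < n" "k < n"
 shows "(SUM j<n. adj i j * cheb s j k) = (SUM j<n. cheb s i j * adj j k)" using assms
proof (induction s arbitrary: i k rule: induct_nat_012)
 case (ge2 s)
 have "(SUM j<n. adj i j * cheb (Suc (Suc s)) j k) =
   (SUM j<n. SUM l<n. adj i j * cheb (Suc s) j l * adj l k) - (SUM j<n. adj i j * cheb s j k)"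
  by (simp add: cheb_rec right_diff_distrib sum_subtractf sum_distrib_left mult.assoc)
 also have "(SUM j<n. SUM l<n. adj i j * cheb (Suc s) j l * adj l k) =
   (SUM l<n. (SUM j<n. adj i j * cheb (Suc s) j l) * adj l k)"
  by (subst sum.swap) (simp add: sum_distrib_right)
 also have "... = (SUM l<n. (SUM j<n. cheb (Suc s) i j * adj j l) * adj l k)" using ge2 by simp
 also have "... = (SUM l<n. (cheb (Suc (Suc s)) i l + cheb s i l) * adj l k)" by (simp add: cheb_rec)
 finally show ?case using ge2.IH(1)[OF ge2.prems] by (simp add: distrib_right)
qed (auto simp: if_distrib[of "%x. _ * x"] if_distrib[of "%x. x * _"] cong: if_cong)

lemma cheb_left:
 "i < n ==> k < n ==> cheb (Suc (Suc s)) i k = (SUM j<n. adj i j * cheb (Suc s) j k) - cheb s i k"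
 by (simp only: cheb_rec cheb_comm)

text \<open>For the scalar recursion w = x b - a the expression a^2 + b^2 - x a b is invariant; this
  is its matrix form in the inner product weighted by \<open>cw\<close>.\<close>

definition energy :: "(nat => int) => (nat => int) => real" where
 "energy a b = (SUM k<n. a k * a k * cw k) + (SUM k<n. b k * b k * cw k)
  - (SUM j<n. SUM k<n. a j * adj j k * cw k * b k)"

lemma energy_step:
 assumes "!!k. k < n ==> w k = (SUM j<n. b j * adj j k) - a k"
 shows "energy b w = energy a b"
proof -
 define v where "v k = (SUM j<n. b j * adj j k)" for k
 have w: "w k = v k - a k" if "k < n" for k using assms that by (simp add: v_def)
 have 1: "(SUM j<n. SUM k<n. b j * adj j k * cw k * w k) = (SUM k<n. v k * cw k * w k)"
  by (subst sum.swap) (simp add: v_def sum_distrib_right)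
 have "(SUM j<n. SUM k<n. a j * adj j k * cw k * b k) = (SUM j<n. SUM k<n. a j * (adj k j * cw j) * b k)"
  by (simp add: adj_cw mult.assoc)
 also have "... = (SUM j<n. a j * cw j * v j)" by (simp add: v_def sum_distrib_left mult_ac)
 finally have 2: "(SUM j<n. SUM k<n. a j * adj j k * cw k * b k) = (SUM j<n. a j * cw j * v j)" .
 have "(SUM k<n. w k * w k * cw k) - (SUM k<n. v k * cw k * w k)
   = (SUM k<n. a k * a k * cw k) - (SUM j<n. a j * cw j * v j)" unfolding sum_subtractf[symmetric]
  by (intro sum.cong refl) (simp add: w algebra_simps)
 thus ?thesis unfolding energy_def 1 2 by simp
qed

text \<open>Four times the energy is the form 2 - adj at a + b plus the form 2 + adj at a - b, and
  the second form dominates the first one taken at absolute values.\<close>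

lemma energy_pos:
 assumes "k < n" "a k ~= 0 \<or> b k ~= 0"
 shows "energy a b > 0"
proof -
 define q where "q x = 2 * (SUM i<n. cw i * x i * x i) - (SUM i<n. SUM j<n. x i * adj i j * cw j * x j)"
  for x :: "nat => real"
 define q' where "q' x = 2 * (SUM i<n. cw i * x i * x i) + (SUM i<n. SUM j<n. x i * adj i j * cw j * x j)"
  for x :: "nat => real"
 define x where "x i = real_of_int (a i + b i)" for i
 define y where "y i = real_of_int (a i - b i)" for i
 have q0: "q x >= 0" for x
 proof (cases "EX i<n. x i ~= 0")
  case True
  thus ?thesis using posdef_cw by (force simp: q_def)
 qed (auto simp: q_def)
 have qq': "q' x >= q (%i. \<bar>x i\<bar>)" for x
 proof -
  have *: "x i * adj i j * cw j * x j >= - (\<bar>x i\<bar> * adj i j * cw j * \<bar>x j\<bar>)" if "j < n" for i j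
  proof -
   have "\<bar>x i * adj i j * cw j * x j\<bar> = \<bar>x i\<bar> * adj i j * cw j * \<bar>x j\<bar>"
    using cw_pos[OF that] by (simp add: abs_mult)
   thus ?thesis by linarith
  qed
  have "(SUM i<n. SUM j<n. x i * adj i j * cw j * x j) >= (SUM i<n. SUM j<n. - (\<bar>x i\<bar> * adj i j * cw j * \<bar>x j\<bar>))"
   by (intro sum_mono *) auto
  thus ?thesis by (simp add: q_def q'_def sum_negf mult.assoc)
 qed
 have eq: "4 * energy a b = q x + q' y"
 proof -
  have sw: "(SUM i<n. SUM j<n. b i * (adj i j * cw j) * a j) = (SUM i<n. SUM j<n. a i * (adj i j * cw j) * b j)"
  using adj_cw by (subst sum.swap, intro sum.cong refl) (auto)
  have "(SUM i<n. SUM j<n. x i * adj i j * cw j * x j) - (SUM i<n. SUM j<n. y i * adj i j * cw j * y j)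
   = (SUM i<n. SUM j<n. 2 * (a i * (adj i j * cw j) * b j) + 2 * (b i * (adj i j * cw j) * a j))"
   unfolding sum_subtractf[symmetric] x_def y_def by (intro sum.cong refl) (simp add: algebra_simps)
  also have "... = 4 * (SUM i<n. SUM j<n. a i * adj i j * cw j * b j)"
   unfolding sum.distrib sum_distrib_left[symmetric] sw by (simp add: mult.assoc)
  finally have 1: "(SUM i<n. SUM j<n. x i * adj i j * cw j * x j) - (SUM i<n. SUM j<n. y i * adj i j * cw j * y j) = ..." .
  have 2: "(SUM i<n. cw i * x i * x i) + (SUM i<n. cw i * y i * y i) =
    2 * (SUM k<n. a k * a k * cw k) + 2 * (SUM k<n. b k * b k * cw k)"
   unfolding x_def y_def sum.distrib[symmetric] sum_distrib_left
   by (intro sum.cong refl) (simp add: algebra_simps)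
  show ?thesis using 1 2 unfolding q_def q'_def energy_def by simp
 qed
 show ?thesis
 proof (cases "x k = 0")
  case False
  hence "q x > 0" using posdef_cw assms(1) by (simp add: q_def)
  thus ?thesis using eq q0 qq' by (smt (verit))
 next
  case True
  hence "y k ~= 0" using assms by (auto simp: x_def y_def)
  hence "q (%i. \<bar>y i\<bar>) > 0" using posdef_cw assms(1) by (simp add: q_def)
  thus ?thesis using eq q0 qq'[of y] by (smt (verit))
 qed
qed

text \<open>For diagrams that are not simply laced, the rows of vertex \<open>i\<close> are integral
  in a finer sense: rescaled by \<open>cw\<close> they consist of integer multiples of
  \<open>cw i\<close>. This makes \<open>cw i\<close> the least possible positive energy.\<close>

definition int_rel :: "nat => (nat => int) => bool" where
 "int_rel i a <-> (ALL k<n. EX m::int. a k * cw k = m * cw i)"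

lemma int_rel_step:
 assumes "int_rel i a" "int_rel i b" "!!k. k < n ==> w k = (SUM j<n. b j * adj j k) - a k"
 shows "int_rel i w" unfolding int_rel_def
proof (intro allI impI)
 fix k assume k: "k < n"
 obtain f g where f: "!!k. k < n ==> a k * cw k = of_int (f k) * cw i"
  and g: "!!k. k < n ==> b k * cw k = of_int (g k) * cw i"
  using assms(1,2) unfolding int_rel_def by metis
 have "w k * cw k = (SUM j<n. b j * (adj j k * cw k)) - a k * cw k"
  unfolding assms(3)[OF k] by (simp add: left_diff_distrib sum_distrib_right mult.assoc)
 also have "(SUM j<n. b j * (adj j k * cw k)) = (SUM j<n. (b j * cw j) * adj k j)"
 using adj_cw by (intro sum.cong refl) (auto simp: mult_ac)
 also have "... = (SUM j<n. g j * cw i * adj k j)" by (simp add: g)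
 also have "... - a k * cw k = real_of_int ((SUM j<n. g j * adj k j) - f k) * cw i"
  using f[OF k] by (simp add: algebra_simps sum_distrib_left)
 finally show "EX m::int. w k * cw k = m * cw i" by blast
qed

lemma energy_int:
 assumes "int_rel i a" "int_rel i b"
 shows "EX m::int. energy a b = m * cw i"
proof -
 obtain f g where f: "!!k. k < n ==> a k * cw k = of_int (f k) * cw i"
  and g: "!!k. k < n ==> b k * cw k = of_int (g k) * cw i"
  using assms(1,2) unfolding int_rel_def by metis
 have "energy a b = (SUM k<n. a k * (a k * cw k)) + (SUM k<n. b k * (b k * cw k))
  - (SUM j<n. SUM k<n. a j * adj j k * (b k * cw k))" by (simp add: energy_def mult_ac)
 also have "... = (SUM k<n. a k * (f k * cw i)) + (SUM k<n. b k * (g k * cw i))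
  - (SUM j<n. SUM k<n. a j * adj j k * (g k * cw i))" by (simp add: f g)
 also have "... = real_of_int ((SUM k<n. a k * f k) + (SUM k<n. b k * g k) - (SUM j<n. SUM k<n. a j * adj j k * g k)) * cw i"
  by (simp add: distrib_right left_diff_distrib sum_distrib_right mult.assoc)
 finally show ?thesis by blast
qed

text \<open>Splitting into positive and negative parts does not increase the energy, and each nonzero
 part already has at least the energy of the whole.\<close>

lemma energy_sign_coherent:
 assumes "i < n" "int_rel i a" "int_rel i b" "energy a b = cw i"
 shows "(ALL k<n. a k >= 0 & b k >= 0) \<or> (ALL k<n. a k <= 0 & b k <= 0)"
proof (rule ccontr)
 assume neg: "~ ?thesis"
 define pp where "pp f k = max 0 (f k)" for f :: "nat => int" and k :: nat
 define mm where "mm f k = max 0 (- f k)" for f :: "nat => int" and k :: nat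
 have int_pp: "int_rel i (pp f)" if fi: "int_rel i f" for f unfolding int_rel_def
 proof (intro allI impI)
  fix k assume "k < n"
  then obtain m :: int where "f k * cw k = m * cw i" using fi by (auto simp: int_rel_def)
  hence "pp f k * cw k = (if f k >= 0 then m else 0) * cw i" by (simp add: pp_def)
  thus "EX m::int. pp f k * cw k = m * cw i" by blast
 qed
 have int_mm: "int_rel i (mm f)" if fi: "int_rel i f" for f unfolding int_rel_def
 proof (intro allI impI)
  fix k assume "k < n"
  then obtain m :: int where "f k * cw k = m * cw i" using fi by (auto simp: int_rel_def)
  hence "mm f k * cw k = (if f k <= 0 then - m else 0) * cw i" by (simp add: mm_def)
  thus "EX m::int. mm f k * cw k = m * cw i" by blast
 qed
 have ge: "energy f g >= cw i" if fg: "int_rel i f" "int_rel i g" "k < n" "f k ~= 0 \<or> g k ~= 0" for f g k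
 proof -
  obtain m :: int where m: "energy f g = m * cw i" using energy_int[OF fg(1,2)] by blast
  have "energy f g > 0" using energy_pos[OF fg(3)] fg(4) by blast
  thus ?thesis using m by (auto simp: zero_less_mult_iff)
 qed
 obtain k1 where "k1 < n" "a k1 < 0 \<or> b k1 < 0" using neg by auto
 hence M: "energy (mm a) (mm b) >= cw i"
  by (intro ge[OF int_mm[OF assms(2)] int_mm[OF assms(3)], of k1]) (auto simp: mm_def)
 obtain k2 where "k2 < n" "a k2 > 0 \<or> b k2 > 0" using neg by auto
 hence P: "energy (pp a) (pp b) >= cw i"
  by (intro ge[OF int_pp[OF assms(2)] int_pp[OF assms(3)], of k2]) (auto simp: pp_def)
 have sq: "(SUM k<n. of_int (f k) * of_int (f k) * cw k) = (SUM k<n. of_int (pp f k) * of_int (pp f k) * cw k) +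
   (SUM k<n. of_int (mm f k) * of_int (mm f k) * cw k)" for f
  unfolding sum.distrib[symmetric] by (intro sum.cong refl) (auto simp: pp_def mm_def max_def)
 have cross: "(SUM j<n. SUM k<n. a j * adj j k * cw k * b k) <=
  (SUM j<n. SUM k<n. pp a j * adj j k * cw k * pp b k) + (SUM j<n. SUM k<n. mm a j * adj j k * cw k * mm b k)"
  unfolding sum.distrib[symmetric]
 proof (intro sum_mono)
  fix j k assume jk: "j : {..<n}" "k : {..<n}"
  define u where "u = adj j k * cw k"
  have u: "u >= 0" using cw_pos[of k] jk by (simp add: u_def)
  have "a j * b k <= pp a j * pp b k + mm a j * mm b k" by (auto simp: pp_def mm_def max_def)
  hence "real_of_int (a j * b k) * u <= real_of_int (pp a j * pp b k + mm a j * mm b k) * u"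
   using u by (intro mult_right_mono) linarith+
  thus "a j * adj j k * cw k * b k <=
   pp a j * adj j k * cw k * pp b k + mm a j * adj j k * cw k * mm b k"
   by (simp add: u_def algebra_simps)
 qed
 have "energy a b >= energy (pp a) (pp b) + energy (mm a) (mm b)"
  using cross sq[of a] sq[of b] unfolding energy_def by linarith
 thus False using M P assms(4) cw_pos[OF assms(1)] by linarith
qed

lemma cheb_invariant:
 assumes "i < n"
 shows "int_rel i (cheb s i) & int_rel i (cheb (Suc s) i) & energy (cheb s i) (cheb (Suc s) i) = cw i"
proof (induction s)
 case 0
 have "int_rel i (cheb 0 i)" by (auto simp: int_rel_def)
 moreover have "int_rel i (cheb (Suc 0) i)" unfolding int_rel_def by (intro allI impI) (auto)
 moreover have "energy (cheb 0 i) (cheb (Suc 0) i) = (SUM k<n. if i = k then cw k else 0)"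
  unfolding energy_def by (simp add: if_distrib[of "%x. x * _"] if_distrib[of real_of_int] cong: if_cong)
 moreover have "(SUM k<n. if i = k then cw k else 0) = cw i" using assms by simp
 ultimately show ?case by metis
next
 case (Suc s)
 have w: "!!k. k < n ==> cheb (Suc (Suc s)) i k = (SUM j<n. cheb (Suc s) i j * adj j k) - cheb s i k"
  by (rule cheb_rec)
 show ?case using Suc int_rel_step[of i "cheb s i" "cheb (Suc s) i", OF _ _ w]
   energy_step[of "cheb (Suc (Suc s)) i" "cheb (Suc s) i" "cheb s i", OF w] by metis
qed

lemma cheb_sign_coherent:
 "i < n ==> (ALL k<n. cheb s i k >= 0 & cheb (Suc s) i k >= 0) \<or> (ALL k<n. cheb s i k <= 0 & cheb (Suc s) i k <= 0)"
 using energy_sign_coherent cheb_invariant by blast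

text \<open>The Coxeter number. It is defined by the vanishing of one row; that all rows vanish at
  the same index is \<open>cheb_cox\<close>.\<close>

definition cox :: nat where
 "cox = (LEAST s. s >= 1 & (EX i<n. ALL k<n. cheb s i k = 0))"

lemma cox_exists: "EX s. s >= 1 & (EX i<n. ALL k<n. cheb s i k = 0)"
proof -
 have "EX s. EX k<n. cheb s 0 k < 0"
 proof (rule ccontr)
  assume "~ ?thesis"
  hence nn: "!!s k. k < n ==> cheb s 0 k >= 0" by (meson not_less)
  have "cheb (Suc 0) 0 0 = 0"
   by (rule nonneg_solution_zero[where a = "%s. cheb s 0", OF cheb_rec nn]) (use n_pos in auto)
  thus False by simp
 qed
 define s where "s = (LEAST s. EX k<n. cheb s 0 k < 0)"
 have s: "EX k<n. cheb s 0 k < 0" and smin: "!!t. t < s ==> ~ (EX k<n. cheb t 0 k < 0)"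
  unfolding s_def using LeastI_ex[OF \<open>EX s. EX k<n. cheb s 0 k < 0\<close>] not_less_Least by blast+
 have "s ~= 0" "s ~= Suc 0" using s by (auto split: if_splits intro: gr0I)
 then obtain t where t: "s = Suc t" "t >= 1" by (metis Suc_le_eq not0_implies_Suc neq0_conv One_nat_def)
 \<comment> \<open>By minimality of \<open>s\<close> the row \<open>t\<close> is nonnegative; sign
   coherence with the row \<open>s\<close>, which has a negative entry, makes it
   nonpositive.\<close>
 have "cheb t 0 k = 0" if "k < n" for k using cheb_sign_coherent[of 0 t] s t(1) smin that by force
 moreover have "0 < n" using n_pos by simp
 ultimately show ?thesis using t(2) by blast
qed

lemma cox_ge_1: "cox >= 1" and cox_row: "EX i<n. ALL k<n. cheb cox i k = 0"
 using LeastI_ex[OF cox_exists] by (auto simp: cox_def)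

lemma row_nonzero: "s >= 1 ==> s < cox ==> i < n ==> EX k<n. cheb s i k ~= 0"
 using not_less_Least[of s "%s. s >= 1 & (EX i<n. ALL k<n. cheb s i k = 0)"] by (auto simp: cox_def)

text \<open>No row strictly between 0 and \<open>cox\<close> vanishes, and a nonzero row passes its
  sign on to the next one by sign coherence.\<close>

lemma cheb_nonneg: "s <= cox ==> i < n ==> k < n ==> cheb s i k >= 0"
proof (induction s arbitrary: k)
 case (Suc s)
 show ?case
 proof (cases s)
  case (Suc t)
  obtain l where "l < n" "cheb s i l ~= 0" using row_nonzero[of s i] Suc Suc.prems by auto
  thus ?thesis using Suc.IH[of l] Suc.prems cheb_sign_coherent[of i s] by auto
 qed auto
qed auto

lemma connected_induct:
 assumes "i < n" "P i" "k < n" "!!j l. j < n ==> l < n ==> P j ==> adj j l > 0 ==> P l"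
 shows "P k"
proof -
 have "(i, k) : {(k, l). k < n & l < n & A $$ (k, l) ~= 0}\<^sup>*"
  using cft assms(1,3) unfolding connected_finite_type_cartan_def by blast
 thus ?thesis
 proof (induction rule: rtrancl_induct)
  case (step j l)
  show ?case using step A_off[of j l] assms(4)[of j l] by (cases "j = l") (auto simp: adj_def)
 qed (rule assms(2))
qed

lemma cheb_cox: "i < n ==> k < n ==> cheb cox i k = 0"
proof -
 assume k: "k < n" and i: "i < n"
 obtain i0 where i0: "i0 < n" "ALL k<n. cheb cox i0 k = 0" using cox_row by blast
 obtain h where h: "cox = Suc h" using cox_ge_1 by (cases cox) auto
 have "ALL k<n. cheb cox i k = 0"
 proof (rule connected_induct[where P = "%i. ALL k<n. cheb cox i k = 0", OF i0 i], intro allI impI)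
  fix j l x assume *: "j < n" "l < n" "ALL k<n. cheb cox j k = 0" "adj j l > 0" "x < n"
  \<comment> \<open>The recursion may be run with \<open>adj\<close> on either side. A vanishing row
    of \<open>j\<close> thus makes a nonnegative combination of the rows of its neighbours
    vanish.\<close>
  have "(SUM m<n. adj j m * cheb cox m x) = 0" using cheb_left[of j x h] * h by (simp add: cheb_rec)
  moreover have "adj j m * cheb cox m x >= 0" if "m < n" for m
   using cheb_nonneg[of cox m x] that * by simp
  ultimately have "ALL m:{..<n}. adj j m * cheb cox m x = 0"
   by (subst (asm) sum_nonneg_eq_0_iff) auto
  hence "adj j l * cheb cox l x = 0" using * by blast
  thus "cheb cox l x = 0" using * by simp
 qed
 thus ?thesis using k by blast
qed

lemma cox_ge_2: "cox >= 2"
proof -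
 have "cox ~= Suc 0" using cheb_cox[of 0 0] n_pos by auto
 thus ?thesis using cox_ge_1 by auto
qed

text \<open>The diagram involution of the indexing, found as the place of the entry 1 in the last
  nonzero row; \<open>star\<close> shows the agreement.\<close>

definition kap :: "nat => nat" where
 "kap i = (SOME k. k < n & (ALL x<n. cheb (cox - Suc 0) i x = (if x = k then 1 else 0)))"

lemma kap:
 assumes "i < n"
 shows kap_less: "kap i < n" and cheb_kap_eq: "!!x. x < n ==> cheb (cox - Suc 0) i x = (if x = kap i then 1 else 0)"
proof -
 define a where "a = cheb (cox - Suc 0) i"
 have a0: "a k >= 0" if "k < n" for k using cheb_nonneg that assms by (simp add: a_def)
 have sc: "Suc (cox - Suc 0) = cox" using cox_ge_1 by simp
 have inv: "int_rel i a" "energy a (cheb cox i) = cw i"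
  using cheb_invariant[OF assms, of "cox - Suc 0"] unfolding sc a_def by auto
 \<comment> \<open>With the next row zero, the energy is a plain sum of squares. Divided by
   \<open>cw i\<close> it says that the nonnegative integers \<open>a k * f k\<close> add up to
   1.\<close>
 have en: "(SUM k<n. a k * a k * cw k) = cw i"
  using inv(2) assms unfolding energy_def by (simp add: cheb_cox)
 obtain f where f: "!!k. k < n ==> a k * cw k = of_int (f k) * cw i"
  using inv(1) unfolding int_rel_def by metis
 have f0: "f k >= 0" "f k = 0 <-> a k = 0" if "k < n" for k
 proof -
  show "f k >= 0" using f[OF that] a0[OF that] cw_pos[OF that] of_int_0_le_iff cw_pos[OF assms] zero_le_mult_iff
by (smt (verit))
  show "f k = 0 <-> a k = 0" using f[OF that] cw_pos[OF assms] cw_pos[OF that] by auto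
 qed
 have "(SUM k<n. a k * (a k * cw k)) = (SUM k<n. a k * (of_int (f k) * cw i))" by (simp add: f)
 also have "... = real_of_int (SUM k<n. a k * f k) * cw i"
  unfolding of_int_sum sum_distrib_right by (intro sum.cong refl) simp
 finally have "real_of_int (SUM k<n. a k * f k) * cw i = 1 * cw i" using en by (simp add: mult.assoc)
 hence "real_of_int (SUM k<n. a k * f k) = 1" using cw_pos[OF assms] by (metis less_irrefl mult_right_cancel)
 hence sum1: "(SUM k<n. a k * f k) = 1" by linarith
 have t0: "a k * f k >= 0" if "k < n" for k using a0 f0 that by simp
 obtain k where k: "k < n" "a k * f k ~= 0" using sum1 by (metis (no_types, lifting) lessThan_iff sum.neutral zero_neq_one)
 have "(SUM k<n. a k * f k) = a k * f k + (SUM x:{..<n} - {k}. a x * f x)"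
  using k by (intro sum.remove) auto
 moreover have "(SUM x:{..<n} - {k}. a x * f x) >= 0" by (intro sum_nonneg t0) auto
 ultimately have *: "a k * f k = 1" "(SUM x:{..<n} - {k}. a x * f x) = 0"
  using sum1 k(2) t0[OF k(1)] by linarith+
 have ak: "a k = 1" using *(1) a0[OF k(1)] by (simp add: zmult_eq_1_iff)
 have ax: "a x = 0" if "x < n" "x ~= k" for x
 proof -
  have "a x * f x = 0" using *(2) t0 that by (subst (asm) sum_nonneg_eq_0_iff) auto
  thus ?thesis using f0(2)[OF that(1)] by auto
 qed
 have "EX k. k < n & (ALL x<n. cheb (cox - Suc 0) i x = (if x = k then 1 else 0))"
  using k ak ax by (auto simp: a_def)
 from someI_ex[OF this, folded kap_def]
 show "kap i < n" "!!x. x < n ==> cheb (cox - Suc 0) i x = (if x = kap i then 1 else 0)" by blast+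
qed

text \<open>The recursion is symmetric under reversal, and read backwards from \<open>cox\<close> it
  starts with the zero row and the unit vector of \<open>kap i\<close>.\<close>

lemma cheb_reflect: "r <= cox ==> i < n ==> k < n ==> cheb (cox - r) i k = cheb r (kap i) k"
proof (induction r arbitrary: k rule: induct_nat_012)
 case (ge2 r)
 define s where "s = cox - Suc (Suc r)"
 have s: "cox - Suc r = Suc s" "cox - r = Suc (Suc s)" using ge2.prems by (auto simp: s_def)
 have "cheb s i k = (SUM j<n. cheb (Suc s) i j * adj j k) - cheb (Suc (Suc s)) i k" by (simp add: cheb_rec)
 also have "... = (SUM j<n. cheb (Suc r) (kap i) j * adj j k) - cheb r (kap i) k"
  using ge2 by (simp add: s)
 finally show ?case by (simp add: s_def cheb_rec)
qed (use cheb_cox cheb_kap_eq kap_less in auto)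

lemma kap_kap [simp]: "i < n ==> kap (kap i) = i"
proof -
 assume i: "i < n"
 have "cheb (Suc 0) i i = cheb (cox - Suc 0) (kap i) i"
  using cheb_reflect[of "cox - Suc 0" i i] cox_ge_1 i by simp
 thus ?thesis using cheb_kap_eq[OF kap_less[OF i] i] by (auto split: if_splits)
qed

lemma kap_eq_iff: "i < n ==> j < n ==> kap i = j <-> i = kap j" by auto

text \<open>The matrix \<open>cheb (cox - 1)\<close> is the permutation matrix of
  \<open>kap\<close>, and it commutes with \<open>adj\<close>.\<close>

lemma adj_kap: "i < n ==> k < n ==> adj (kap i) k = adj i (kap k)"
proof -
 assume i: "i < n" and k: "k < n"
 have "adj (kap i) k = (SUM j<n. cheb (cox - Suc 0) i j * adj j k)"
  using kap_less[OF i] by (simp add: cheb_kap_eq[OF i] if_distrib[of "%x. x * _"] cong: if_cong)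
 also have "... = (SUM j<n. adj i j * cheb (cox - Suc 0) j k)" using cheb_comm[OF i k] by simp
 also have "... = (SUM j<n. if j = kap k then adj i j else 0)"
  using k by (intro sum.cong refl) (auto simp: cheb_kap_eq)
 also have "... = adj i (kap k)" using kap_less[OF k] by simp
 finally show ?thesis .
qed

lemma adj_kap_kap: "i < n ==> k < n ==> adj (kap i) (kap k) = adj i k"
 by (simp add: adj_kap kap_less)

lemma sum_kap: "(SUM j<n. f (kap j)) = (SUM j<n. f j)"
 by (rule sum.reindex_bij_witness[of _ kap kap]) (auto simp: kap_less)

lemma cheb_kap: "i < n ==> k < n ==> cheb s (kap i) k = cheb s i (kap k)"
proof (induction s arbitrary: k rule: induct_nat_012)
 case (ge2 s)
 have "(SUM j<n. cheb (Suc s) (kap i) j * adj j k) = (SUM j<n. cheb (Suc s) (kap i) (kap j) * adj (kap j) k)"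
  by (rule sum_kap[symmetric])
 also have "... = (SUM j<n. cheb (Suc s) i j * adj j (kap k))"
  using ge2 by (intro sum.cong refl) (simp add: adj_kap kap_less)
 finally show ?case using ge2 by (simp add: cheb_rec)
qed (auto simp: kap_eq_iff)

end

section \<open>The periodic solution of the tropical exchange relations\<close>

context cartan
begin

definition per :: int where "per = int cox + 2"

text \<open>One period of orders: 1 on the variable itself, then minus the Chebyshev rows 0 to
  \<open>cox\<close>. The first and the last of these are zero and separate consecutive
  periods.\<close>

definition period_row :: "nat => nat => nat => int" where
 "period_row i k r = (if r = 0 then (if i = k then 1 else 0) else - cheb (r - 1) i k)"

definition kap_pow :: "int => nat => nat" where
 "kap_pow a k = (if even a then k else kap k)"

text \<open>The order of vanishing of a cluster variable along another one, as a function of the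
 vertices and of the difference of the positions of the two variables on the belt.\<close>

definition trop :: "nat => nat => int => int" where
 "trop i k s = period_row i (kap_pow (s div per) k) (nat (s mod per))"

lemma per_pos: "per > 0" "per >= 4" using cox_ge_2 by (auto simp: per_def)

lemma kap_pow_less [simp]: "k < n ==> kap_pow a k < n" by (simp add: kap_pow_def kap_less)

lemma kap_pow_Suc: "k < n ==> kap_pow (a + 1) k = kap (kap_pow a k)" by (simp add: kap_pow_def)

lemma kap_pow_diff: "k < n ==> kap_pow (a - 1) k = kap (kap_pow a k)" by (simp add: kap_pow_def)

lemma trop_eq: "0 <= r ==> r < per ==> trop i k (a * per + r) = period_row i (kap_pow a k) (nat r)"
 by (simp add: trop_def)

lemma trop_eqI: "s = a * per + r ==> 0 <= r ==> r < per ==>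
  trop i k s = period_row i (kap_pow a k) (nat r)" by (simp add: trop_eq)

lemma trop_cases:
 obtains a r where "s = a * per + r" "0 <= r" "r < per"
 using per_pos by (metis div_mult_mod_eq pos_mod_sign pos_mod_bound)

lemma trop_shift: "k < n ==> trop i k (s + per) = trop i (kap k) s"
 using per_pos by (simp add: trop_def kap_pow_def)

lemma period_row_kap: "i < n ==> k < n ==> period_row (kap i) k r = period_row i (kap k) r"
 by (auto simp: period_row_def cheb_kap)

lemma trop_kap: "i < n ==> k < n ==> trop (kap i) k s = trop i (kap k) s"
 by (auto simp: trop_def kap_pow_def period_row_kap kap_less)

lemma trop_shift_left: "i < n ==> k < n ==> trop (kap i) k (s - per) = trop i k s"
 using trop_kap trop_shift[of k i "s - per"] by simp

lemma period_row_reflect: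
 assumes "0 < r" "r < per" "i < n" "k < n"
 shows "period_row i (kap k) (nat (per - r)) = period_row i k (nat r)"
proof -
 define t where "t = nat r - 1"
 have t: "nat r = Suc t" "t <= cox" "nat (per - r) = Suc (cox - t)"
  using assms by (auto simp: t_def per_def)
 have "period_row i (kap k) (nat (per - r)) = - cheb (cox - t) i (kap k)"
  unfolding t(3) by (simp add: period_row_def)
 also have "... = - cheb t (kap i) (kap k)" using cheb_reflect[OF t(2)] assms by (simp add: kap_less)
 also have "... = - cheb t i k" using assms by (simp add: cheb_kap kap_less)
 finally show ?thesis by (simp add: t(1) period_row_def)
qed

lemma trop_minus: "i < n ==> k < n ==> trop i k (- s) = trop i k s"
proof -
 assume ik: "i < n" "k < n"
 obtain a r where s: "s = a * per + r" "0 <= r" "r < per" using trop_cases by blast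
 show ?thesis
 proof (cases "r = 0")
  case True
  hence "- s = (- a) * per + 0" "s = a * per + 0" using s by auto
  thus ?thesis using trop_eq[of 0 i k "- a"] trop_eq[of 0 i k a] per_pos by (simp add: kap_pow_def)
 next
  case False
  have e: "- s = (- a - 1) * per + (per - r)" using s by (simp add: algebra_simps)
  have "trop i k (- s) = period_row i (kap_pow (- a - 1) k) (nat (per - r))"
   by (rule trop_eqI[OF e]) (use s False in auto)
  also have "kap_pow (- a - 1) k = kap (kap_pow a k)" using ik by (simp add: kap_pow_def)
  also have "period_row i (kap (kap_pow a k)) (nat (per - r)) = period_row i (kap_pow a k) (nat r)"
   using s False ik by (intro period_row_reflect) auto
  finally show ?thesis using trop_eq s by simp
 qed
qed

lemma adj_kap_pow_sum:
 assumes "k < n"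
 shows "(SUM j<n. f (kap_pow a j) * adj j k) = (SUM j<n. f j * adj j (kap_pow a k))"
proof (cases "even a")
 case False
 have "(SUM j<n. f (kap j) * adj j k) = (SUM j<n. f (kap (kap j)) * adj (kap j) k)"
  by (rule sum_kap[symmetric])
 also have "... = (SUM j<n. f j * adj j (kap k))" using assms by (intro sum.cong refl) (simp add: adj_kap)
 finally show ?thesis by (simp add: kap_pow_def)
qed (simp add: kap_pow_def)

lemma trop_nonpos: "i < n ==> k < n ==> s mod per ~= 0 ==> trop i k s <= 0"
proof -
 assume *: "i < n" "k < n" "s mod per ~= 0"
 have "s mod per < per" "s mod per >= 0" using per_pos by auto
 hence "nat (s mod per) - 1 <= cox" "nat (s mod per) ~= 0" using *(3) unfolding per_def by linarith+
 thus ?thesis using cheb_nonneg[of "nat (s mod per) - 1" i "kap_pow (s div per) k"] *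
  by (simp add: trop_def period_row_def)
qed

lemma trop_zero_mod: "s mod per = 0 ==> trop i k s = (if i = kap_pow (s div per) k then 1 else 0)"
 by (simp add: trop_def period_row_def)

text \<open>At a multiple of \<open>per\<close> a row of \<open>trop\<close> is a unit vector,
  elsewhere it is nonpositive, so truncating before or after the summation gives the same. The first
  form is the tropical exchange relation of the cluster variables, the second one governs the y-hat
  variables.\<close>

lemma trop_rec:
 assumes "i < n" "k < n"
 shows "trop i k (s + 1) + trop i k (s - 1) = min 0 (SUM j<n. trop i j s * adj j k)"
  and "trop i k (s + 1) + trop i k (s - 1) = (SUM j<n. min 0 (trop i j s) * adj j k)"
proof -
 obtain a r where s: "s = a * per + r" "0 <= r" "r < per" using trop_cases by blast
 define x where "x = kap_pow a k"
 have x: "x < n" using assms by (simp add: x_def)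
 have tj: "trop i j s = period_row i (kap_pow a j) (nat r)" for j using trop_eq s by simp
 have S1: "(SUM j<n. trop i j s * adj j k) = (SUM j<n. period_row i j (nat r) * adj j x)"
  unfolding tj x_def using adj_kap_pow_sum[OF assms(2), of "%j. period_row i j (nat r)"] by simp
 have S2: "(SUM j<n. min 0 (trop i j s) * adj j k) = (SUM j<n. min 0 (period_row i j (nat r)) * adj j x)"
  unfolding tj x_def using adj_kap_pow_sum[OF assms(2), of "%j. min 0 (period_row i j (nat r))"] by simp
 have up: "trop i k (s + 1) = (if r + 1 < per then period_row i x (nat (r + 1)) else period_row i (kap x) 0)"
 proof (cases "r + 1 < per")
  case True
  have e: "s + 1 = a * per + (r + 1)" using s by simp
  show ?thesis using trop_eqI[OF e, of i k] s True by (simp add: x_def)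
 next
  case False
  have e: "s + 1 = (a + 1) * per + 0" using s False by (simp add: algebra_simps)
  show ?thesis using trop_eqI[OF e, of i k] per_pos False assms by (simp add: x_def kap_pow_Suc)
 qed
 have down: "trop i k (s - 1) = (if r > 0 then period_row i x (nat (r - 1)) else period_row i (kap x) (nat (per - 1)))"
 proof (cases "r > 0")
  case True
  have e: "s - 1 = a * per + (r - 1)" using s by simp
  show ?thesis using trop_eqI[OF e, of i k] s True by (simp add: x_def)
 next
  case False
  have e: "s - 1 = (a - 1) * per + (per - 1)" using s False by (simp add: algebra_simps)
  show ?thesis using trop_eqI[OF e, of i k] per_pos False assms by (simp add: x_def kap_pow_diff)
 qed
 have "trop i k (s + 1) + trop i k (s - 1) = min 0 (SUM j<n. trop i j s * adj j k) &
  trop i k (s + 1) + trop i k (s - 1) = (SUM j<n. min 0 (trop i j s) * adj j k)"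
 proof (cases "r = 0")
  case True
  have "period_row i (kap x) (nat (per - 1)) = 0"
   using assms x by (simp add: period_row_def per_def cheb_cox kap_less nat_add_distrib)
  moreover have "(SUM j<n. trop i j s * adj j k) >= 0"
   unfolding S1 using True by (intro sum_nonneg) (auto simp: period_row_def)
  moreover have "(SUM j<n. min 0 (trop i j s) * adj j k) = 0"
   unfolding S2 using True by (intro sum.neutral) (auto simp: period_row_def)
  ultimately show ?thesis using up down True per_pos by (simp add: period_row_def)
 next
  case False
  define t where "t = nat (r - 1)"
  have t: "nat r = Suc t" "int t + 1 = r" "t <= cox" using s False by (auto simp: t_def per_def)
  have neg: "period_row i j (nat r) <= 0" if "j < n" for j
   using t assms cheb_nonneg that by (simp add: period_row_def)
  have eq: "(SUM j<n. min 0 (trop i j s) * adj j k) = - (SUM j<n. cheb t i j * adj j x)"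
   unfolding S2 sum_negf[symmetric]
  proof (intro sum.cong refl)
   fix j assume "j : {..<n}"
   thus "min 0 (period_row i j (nat r)) * adj j x = - (cheb t i j * adj j x)"
    using neg by (simp add: t period_row_def)
  qed
  have eq1: "(SUM j<n. trop i j s * adj j k) = - (SUM j<n. cheb t i j * adj j x)"
   unfolding S1 sum_negf[symmetric] by (intro sum.cong refl) (simp add: t period_row_def)
  have nn: "(SUM j<n. cheb t i j * adj j x) >= 0"
   using t assms by (intro sum_nonneg mult_nonneg_nonneg cheb_nonneg) auto
  have "trop i k (s + 1) + trop i k (s - 1) = - (SUM j<n. cheb t i j * adj j x)"
  proof (cases t)
   case 0
   thus ?thesis using up down t(2)[symmetric] cox_ge_2 by (auto simp: period_row_def per_def)
  next
   case (Suc u)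
   have dn: "trop i k (s - 1) = - cheb u i x"
    using down t(2)[symmetric] Suc by (simp add: period_row_def nat_add_distrib)
   show ?thesis
   proof (cases "t < cox")
    case True
    thus ?thesis using up t(2)[symmetric] dn Suc
by (auto simp: period_row_def per_def nat_add_distrib cheb_rec)
   next
    case False
    \<comment> \<open>At the end of a period the recursion turns the last nonzero row, the unit
      vector of \<open>kap i\<close>, into the unit vector that opens the next period; this forces
      the twist by \<open>kap\<close>.\<close>
    hence tc: "t = cox" using t by simp
    hence "trop i k (s + 1) = period_row i (kap x) 0" using up t(2)[symmetric] by (simp add: per_def)
    moreover have "cheb u i x = (if x = kap i then 1 else 0)"
     using cheb_kap_eq[OF assms(1) x] tc Suc by (metis diff_Suc_Suc diff_zero)
    moreover have "(SUM j<n. cheb t i j * adj j x) = 0" using tc assms by (simp add: cheb_cox)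
    ultimately show ?thesis using dn assms x by (auto simp: period_row_def)
   qed
  qed
  thus ?thesis using eq eq1 nn by simp
 qed
 thus "trop i k (s + 1) + trop i k (s - 1) = min 0 (SUM j<n. trop i j s * adj j k)"
  "trop i k (s + 1) + trop i k (s - 1) = (SUM j<n. min 0 (trop i j s) * adj j k)" by auto
qed

text \<open>\<open>qdeg\<close> becomes the compatibility degree as a function of the difference of
  positions. The other part \<open>tdelta\<close> of \<open>trop\<close> indicates that two
  positions carry the same variable.\<close>

definition qdeg :: "nat => nat => int => int" where "qdeg i k s = max 0 (- trop i k s)"

definition tdelta :: "nat => nat => int => int" where "tdelta i k s = max 0 (trop i k s)"

lemma qdeg_nonneg [simp]: "qdeg i k s >= 0" by (simp add: qdeg_def)

lemma qdeg_shift_left: "i < n ==> k < n ==> qdeg (kap i) k (s - per) = qdeg i k s"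
 by (simp add: qdeg_def trop_shift_left)

lemma qdeg_shift: "k < n ==> qdeg i k (s + per) = qdeg i (kap k) s"
 by (simp add: qdeg_def trop_shift)

lemma qdeg_rec:
 assumes "i < n" "k < n"
 shows "qdeg i k (s + 1) + qdeg i k (s - 1)
  = (SUM j<n. qdeg i j s * adj j k) + tdelta i k (s + 1) + tdelta i k (s - 1)"
proof -
 have "(SUM j<n. qdeg i j s * adj j k) = - (SUM j<n. min 0 (trop i j s) * adj j k)"
  unfolding sum_negf[symmetric] by (intro sum.cong refl) (simp add: qdeg_def min_def)
 thus ?thesis using trop_rec(2)[OF assms, of s] by (simp add: qdeg_def tdelta_def)
qed

lemma qdeg_comm:
 assumes "i < n" "k < n"
 shows "(SUM j<n. adj i j * qdeg j k s) = (SUM j<n. qdeg i j s * adj j k)"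
proof -
 obtain a r where s: "s = a * per + r" "0 <= r" "r < per" using trop_cases by blast
 define x where "x = kap_pow a k"
 have x: "x < n" using assms by (simp add: x_def)
 define c where "c i j = (if r = 0 then 0 else cheb (nat r - 1) i j)" for i j
 have nr: "nat r - 1 <= cox" using s by (auto simp: per_def)
 have q: "qdeg i j s = c i (kap_pow a j)" if "i < n" "j < n" for i j
 using trop_eq s that cheb_nonneg[OF nr that(1), of "kap_pow a j"] by (auto simp: qdeg_def c_def period_row_def)
 have "(SUM j<n. adj i j * qdeg j k s) = (SUM j<n. adj i j * c j x)"
  using assms by (intro sum.cong refl) (simp add: q x_def)
 also have "... = (SUM j<n. c i j * adj j x)"
  using cheb_comm[OF assms(1) x, of "nat r - 1"] by (cases "r = 0") (simp_all add: c_def)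
 also have "... = (SUM j<n. c i (kap_pow a j) * adj j k)"
  unfolding x_def using adj_kap_pow_sum[OF assms(2), of "c i"] by simp
 finally show ?thesis using assms q by simp
qed

lemma tdelta_eq: "i < n ==> k < n ==> tdelta i k s = (if s mod per = 0 & i = kap_pow (s div per) k then 1 else 0)"
 using trop_nonpos trop_zero_mod by (cases "s mod per = 0") (simp_all add: tdelta_def)

end

section \<open>Height functions\<close>

text \<open>Without a vertex of degree at most one in \<open>J\<close>, the vector with entries \<open>1 / sqrt (d i)\<close> would
 contradict positive definiteness.\<close>

lemma (in cartan) leaf_exists:
 assumes "J <= {..<n}" "J ~= {}"
 obtains i where "i : J" "!!j l. j : J ==> l : J ==> adj i j > 0 ==> adj i l > 0 ==> j = l"
proof (rule ccontr)
 assume no: "~ thesis"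
 note found = that
 have two: "EX j l. j : J & l : J & adj i j > 0 & adj i l > 0 & j ~= l" if i: "i : J" for i
 proof (rule ccontr)
  assume "~ ?thesis"
  hence thesis by (intro found[OF i]) blast
  with no show False ..
 qed
 define v where "v i = (if i : J then 1 / sqrt (sym_weight i) else 0)" for i
 have fin: "finite J" using assms finite_subset by blast
 obtain i0 where i0: "i0 : J" using assms by blast
 have dpos: "sym_weight i > 0" if "i : J" for i using assms that sym_weight_pos by blast
 define s where "s i j = sym_weight i * v i * adj i j * v j" for i j
 \<comment> \<open>For adjacent vertices in \<open>J\<close>, \<open>s\<close> is symmetric and its
   square is the positive integer \<open>adj i j * adj j i\<close>. Two neighbours therefore already
   balance the diagonal term 2.\<close>
 have s_ge: "s i j >= 1" if "i : J" "j : J" "adj i j > 0" for i j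
 proof -
  have ij: "i < n" "j < n" using assms that by auto
  have adj1: "adj i j >= 1" "adj j i >= 1" using that adj_pos_sym[of i j] by linarith+
  have e: "s i j = s j i"
   using adj_cw[of i j] dpos[OF that(1)] dpos[OF that(2)] by (simp add: s_def cw_def field_simps)
  have "s i j * s j i = real_of_int (adj i j * adj j i)"
  using dpos[OF that(1)] dpos[OF that(2)] that by (auto simp: v_def s_def mult_ac)
  moreover have "adj i j * adj j i >= 1 * 1" using adj1 by (intro mult_mono) auto
  hence "real_of_int (adj i j * adj j i) >= 1" by linarith
  ultimately have "s i j * s i j >= 1" using e by simp
  moreover have "s i j > 0" using that dpos by (simp add: s_def v_def)
  ultimately show ?thesis by (smt (verit) mult_less_cancel_right1)
 qed
 have s_nn: "s i j >= 0" for i j using dpos by (auto simp: s_def v_def less_imp_le)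
 have "0 < (SUM i<n. SUM j<n. sym_weight i * v i * ((if i = j then 2 else 0) - of_int (adj i j)) * v j)"
  using i0 assms dpos[OF i0] by (intro posdef_sym[of i0]) (auto simp: v_def)
 also have "... = (SUM i<n. (SUM j<n. if i = j then 2 * (sym_weight i * v i * v i) else 0) - (SUM j<n. s i j))"
  unfolding sum_subtractf[symmetric] by (intro sum.cong refl) (auto simp: s_def)
 also have "... <= 0"
 proof (intro sum_nonpos)
  fix i assume "i : {..<n}"
  hence i: "i < n" by simp
  show "(SUM j<n. if i = j then 2 * (sym_weight i * v i * v i) else 0) - (SUM j<n. s i j) <= 0"
  proof (cases "i : J")
   case True
   obtain j l where jl: "j : J" "l : J" "adj i j > 0" "adj i l > 0" "j ~= l" using two[OF True] by blast
   have "s i j + s i l = (SUM x:{j, l}. s i x)" using jl by simp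
   also have "... <= (SUM j<n. s i j)" using jl assms s_nn by (intro sum_mono2) auto
   finally have "(SUM j<n. s i j) >= 2" using s_ge[OF True jl(1) jl(3)] s_ge[OF True jl(2) jl(4)] by linarith
   moreover have "sym_weight i * v i * v i = 1" using dpos[OF True] True by (simp add: v_def)
   ultimately show ?thesis by simp
  next
   case False
   thus ?thesis by (simp add: v_def s_def)
  qed
 qed
 finally show False by simp
qed

text \<open>The diagram is a tree: a leaf is removed, and the height is extended to it from its only
  neighbour.\<close>

lemma (in cartan) height_exists:
 assumes "orientation n A E"
 obtains ht :: "nat => int" where "!!i j. (i, j) : E ==> ht j = ht i + 1"
proof -
 have E: "i < n" "j < n" "adj i j > 0" "adj j i > 0" if "(i, j) : E" for i j
 using assms that adj_nonneg[of i j] adj_pos_sym by (auto simp: orientation_def adj_def)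
 have asym: "(j, i) ~: E" if "(i, j) : E" for i j
  using assms that unfolding orientation_def by blast
 have "EX ht :: nat => int. ALL i j. i : J --> j : J --> (i, j) : E --> ht j = ht i + 1" if "J <= {..<n}" for J
  using finite_subset[OF that] that
 proof (induction "card J" arbitrary: J rule: less_induct)
  case less
  show ?case
  proof (cases "J = {}")
   case False
   obtain i where i: "i : J" "!!j l. j : J ==> l : J ==> adj i j > 0 ==> adj i l > 0 ==> j = l"
    using leaf_exists[OF less.prems(2) False] by blast
   have "card (J - {i}) < card J" using i less.prems by (metis card_Diff1_less finite_lessThan)
   then obtain ht :: "nat => int" where ht: "ALL k j. k : J - {i} --> j : J - {i} --> (k, j) : E --> ht j = ht k + 1"
    using less.hyps[of "J - {i}"] less.prems by auto
   define ht' where "ht' = ht(i := if EX j:J. (i, j) : E then ht (SOME j. j : J & (i, j) : E) - 1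
     else ht (SOME j. j : J & (j, i) : E) + 1)"
   have "ht' j = ht' k + 1" if kj: "k : J" "j : J" "(k, j) : E" for k j
   proof -
    have ne: "k ~= j" using asym kj by blast
    consider "k = i" | "j = i" | "k ~= i" "j ~= i" by blast
    thus ?thesis
    proof cases
     case 1
     hence "(SOME j. j : J & (i, j) : E) = j" using kj i(2) E by (intro some_equality) auto
     thus ?thesis using 1 kj ne by (auto simp: ht'_def)
    next
     case 2
     have "(SOME j. j : J & (j, i) : E) = k" using 2 kj i(2) E by (intro some_equality) auto
     moreover have "~ (EX j:J. (i, j) : E)"
     proof
      assume "EX j:J. (i, j) : E"
      then obtain l where l: "l : J" "(i, l) : E" by blast
      hence "l = k" using i(2)[of l k] E[OF l(2)] E[OF kj(3)] kj 2 by auto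
      thus False using asym l 2 kj by blast
     qed
     ultimately show ?thesis using 2 kj ne by (auto simp: ht'_def)
    next
     case 3
     thus ?thesis using ht kj by (simp add: ht'_def)
    qed
   qed
   thus ?thesis by blast
  qed auto
 qed
 from this[of "{..<n}"] obtain ht :: "nat => int" where
  "ALL i j. i : {..<n} --> j : {..<n} --> (i, j) : E --> ht j = ht i + 1" by blast
 thus ?thesis by (intro that[of ht]) (use E in auto)
qed

text \<open>Only the size of the steps is recorded here; the orientation enters later through the
  matrix entries \<open>(ht j - ht i) * adj i j\<close>.\<close>

locale height = cartan +
 fixes ht :: "nat => int"
 assumes height_step: "!!i j. adj i j > 0 ==> \<bar>ht i - ht j\<bar> = 1"
begin

text \<open>Entries of \<open>cheb (Suc s)\<close> come from walks of length at most
  \<open>s\<close> and of the parity of \<open>s\<close>, and each edge changes the height by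
  one.\<close>

lemma cheb_height:
 "cheb (Suc s) i k ~= 0 ==> \<bar>ht i - ht k\<bar> <= int s & even (ht i - ht k - int s)"
proof (induction s arbitrary: k rule: induct_nat_012)
 case 1
 have "adj i k ~= 0"
 proof
  assume "adj i k = 0"
  hence "(SUM j<n. cheb (Suc 0) i j * adj j k) = 0" by (intro sum.neutral) auto
  thus False using 1 by (simp add: cheb_rec)
 qed
 hence "\<bar>ht i - ht k\<bar> = 1" using height_step adj_pos_iff by blast
 thus ?case by (auto ; presburger)
next
 case (ge2 s)
 show ?case
 proof (cases "cheb (Suc s) i k = 0")
  case True
  hence "(SUM j<n. cheb (Suc (Suc s)) i j * adj j k) ~= 0" using ge2.prems by (simp add: cheb_rec)
  then obtain j where j: "cheb (Suc (Suc s)) i j ~= 0" "adj j k ~= 0"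
   by (metis (no_types, lifting) mult_zero_left mult_zero_right sum.neutral)
  have "\<bar>ht j - ht k\<bar> = 1" using height_step j by (simp add: adj_pos_iff)
  moreover have "\<bar>ht i - ht j\<bar> <= int (Suc s) & even (ht i - ht j - int (Suc s))"
   using ge2.IH(2)[OF j(1)] .
  ultimately show ?thesis by (simp add: abs_if split: if_splits) presburger+
 next
  case False
  thus ?thesis using ge2.IH(1)[of k] by auto
 qed
qed (auto split: if_splits)

definition adjrel :: "nat rel" where "adjrel = {(j, l). adj j l > 0}"

lemma cheb_relpow: "i < n ==> cheb s i k ~= 0 ==> EX m<s. (i, k) : adjrel ^^ m"
proof (induction s arbitrary: k rule: induct_nat_012)
 case 1
 thus ?case by (auto split: if_splits)
next
 case (ge2 s)
 show ?case
 proof (cases "cheb s i k = 0")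
  case True
  hence "(SUM j<n. cheb (Suc s) i j * adj j k) ~= 0" using ge2.prems by (simp add: cheb_rec)
  then obtain j where j: "cheb (Suc s) i j ~= 0" "adj j k ~= 0"
   by (metis (no_types, lifting) mult_zero_left mult_zero_right sum.neutral)
  then obtain m where "m < Suc s" "(i, j) : adjrel ^^ m" using ge2 by blast
  moreover have "(j, k) : adjrel" using j by (simp add: adjrel_def adj_pos_iff)
  ultimately have "(i, k) : adjrel ^^ Suc m" by auto
  thus ?thesis using `m < Suc s` by (intro exI[of _ "Suc m"]) auto
 next
  case False
  thus ?thesis using ge2.IH(1)[OF ge2.prems(1)] by (meson less_SucI)
 qed
qed auto

lemma adjrel_less: "(j, k) : adjrel ==> j < n & k < n"
 by (auto simp: adjrel_def adj_def split: if_splits)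

text \<open>At the graph distance the subtracted term of the recursion is zero, because there is no
  shorter walk.\<close>

lemma cheb_dist:
 assumes "i < n" "m <= cox" "(i, k) : adjrel ^^ m" "!!m'. m' < m ==> (i, k) ~: adjrel ^^ m'"
 shows "cheb (Suc m) i k > 0" using assms(2-4)
proof (induction m arbitrary: k)
 case (Suc m)
 obtain j where j: "(i, j) : adjrel ^^ m" "(j, k) : adjrel" using Suc.prems(2) by auto
 have jk: "j < n" "k < n" "adj j k > 0" using j adjrel_less by (auto simp: adjrel_def)
 have "(i, j) ~: adjrel ^^ m'" if "m' < m" for m'
 proof
  assume "(i, j) : adjrel ^^ m'"
  hence "(i, k) : adjrel ^^ Suc m'" using j(2) by auto
  thus False using Suc.prems(3)[of "Suc m'"] that by simp
 qed
 hence pos: "cheb (Suc m) i j > 0" using Suc.IH Suc.prems j by simp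
 have "cheb m i k = 0" using cheb_relpow[OF assms(1), of m k] Suc.prems(3) by (meson less_SucI)
 hence "cheb (Suc (Suc m)) i k = (SUM j<n. cheb (Suc m) i j * adj j k)" by (simp add: cheb_rec)
 also have "... > 0"
  using pos jk Suc.prems assms(1) by (intro sum_pos2[of _ j]) (auto intro!: mult_nonneg_nonneg cheb_nonneg)
 finally show ?case .
qed auto

lemma height_diam:
 assumes "i < n" "k < n"
 shows "\<bar>ht i - ht k\<bar> <= int cox - 2"
proof -
 have "(EX m. (i, k) : adjrel ^^ m)"
 proof (rule connected_induct[OF assms(1) _ assms(2)])
  show "EX m. (i, i) : adjrel ^^ m" by (rule exI[of _ 0]) simp
  fix j l assume "EX m. (i, j) : adjrel ^^ m" "adj j l > 0"
  then obtain m where "(i, j) : adjrel ^^ m" by blast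
  hence "(i, l) : adjrel ^^ Suc m" using `adj j l > 0` by (auto simp: adjrel_def)
  thus "EX m. (i, l) : adjrel ^^ m" by blast
 qed
 then obtain M where M: "(i, k) : adjrel ^^ M" by blast
 have short: "(i, k) : adjrel ^^ M ==> EX m<=cox - 2. (i, k) : adjrel ^^ m" for M k
 proof (induction M arbitrary: k)
  case 0
  thus ?case by (intro exI[of _ 0]) auto
 next
  case (Suc M)
  then obtain j where j: "(i, j) : adjrel ^^ M" "(j, k) : adjrel" by auto
  obtain m where m: "m <= cox - 2" "(i, j) : adjrel ^^ m" using Suc.IH[OF j(1)] by blast
  have jm: "(i, k) : adjrel ^^ Suc m" using m j by auto
  show ?case
  proof (rule ccontr)
   assume no: "~ ?case"
   hence "~ Suc m <= cox - 2" using jm by blast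
   hence sm: "Suc m = cox - 1" using m cox_ge_2 by auto
   \<comment> \<open>A shortest walk of length \<open>cox - 1\<close> would produce a positive entry
     in the row \<open>cox\<close>, which is zero. Hence distances are at most
     \<open>cox - 2\<close>.\<close>
   have "cheb (Suc (cox - 1)) i k > 0" using assms jm no sm by (intro cheb_dist) (auto)
   thus False using cheb_cox[OF assms(1)] j adjrel_less cox_ge_2 by auto
  qed
 qed
 obtain m where m: "m <= cox - 2" "(i, k) : adjrel ^^ m" using short[OF M] by blast
 have "(i, k) : adjrel ^^ m ==> \<bar>ht i - ht k\<bar> <= int m" for k m
 proof (induction m arbitrary: k)
  case (Suc m)
  then obtain j where j: "(i, j) : adjrel ^^ m" "(j, k) : adjrel" by auto
  have "\<bar>ht j - ht k\<bar> = 1" using height_step j by (simp add: adjrel_def)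
  thus ?case using Suc.IH[OF j(1)] by linarith
 qed auto
 from this[OF m(2)] have "\<bar>ht i - ht k\<bar> <= int m" .
 thus ?thesis using m(1) cox_ge_2 by linarith
qed

text \<open>The Chebyshev entry at index \<open>\<bar>ht i - ht k\<bar> - 1\<close> is zero, since a
  nonzero one needs a larger index by \<open>cheb_height\<close>. So distinct variables of one
  cluster have order 0 along each other.\<close>

lemma trop_base: "i < n ==> k < n ==> trop i k (ht k - ht i) = (if i = k then 1 else 0)"
proof -
 assume ik: "i < n" "k < n"
 define s where "s = \<bar>ht i - ht k\<bar>"
 have s: "s <= int cox - 2" "s >= 0" using height_diam[OF ik] by (auto simp: s_def)
 have "trop i k (ht k - ht i) = trop i k s"
  using trop_minus[OF ik, of "ht k - ht i"] by (auto simp: s_def abs_if)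
 also have "... = period_row i k (nat s)"
  using trop_eq[of s i k 0] s by (simp add: per_def kap_pow_def)
 also have "... = (if i = k then 1 else 0)"
 proof (cases "s = 0")
  case False
  hence ne: "i ~= k" by (auto simp: s_def)
  have "cheb (nat s - 1) i k = 0"
  proof (rule ccontr)
   assume nz: "cheb (nat s - 1) i k ~= 0"
   then obtain t where t: "nat s - 1 = Suc t" by (cases "nat s - 1") auto
   have "\<bar>ht i - ht k\<bar> <= int t" using cheb_height nz t by simp
   thus False using t by (simp add: s_def)
  qed
  thus ?thesis using ne by (simp add: period_row_def)
 qed (simp add: period_row_def)
 finally show ?thesis .
qed

text \<open>The number r_k of the indexing, solved from
  \<open>2 * (rC k + 1) + ht k = ht (kap k) + per\<close>: after \<open>rC k + 1\<close> sweeps,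
  \<open>k\<close> sits one period above the initial position of \<open>kap k\<close>.\<close>

definition rC :: "nat => nat" where "rC k = nat ((ht (kap k) - ht k + int cox) div 2)"

lemma rC: "k < n ==> 2 * int (rC k) = ht (kap k) - ht k + int cox"
proof -
 assume k: "k < n"
 have b: "\<bar>ht (kap k) - ht k\<bar> <= int cox - 2" using height_diam k kap_less by simp
 have "cheb (Suc (cox - 2)) k (kap k) ~= 0"
  using cheb_kap_eq[OF k kap_less[OF k]] cox_ge_2 by (simp add: numeral_2_eq_2 Suc_diff_Suc)
 hence "even (ht k - ht (kap k) - int (cox - 2))" using cheb_height by blast
 hence ev: "even (ht (kap k) - ht k + int cox)" using cox_ge_2 by auto
 thus "2 * int (rC k) = ht (kap k) - ht k + int cox" using b by (simp add: rC_def)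
qed

lemma rC_step: "j < n ==> k < n ==> adj j k > 0 ==> ht k = ht j + 1 ==>
  rC j = rC k & ht (kap k) = ht (kap j) + 1 \<or> rC j = Suc (rC k) & ht (kap j) = ht (kap k) + 1"
 using rC[of j] rC[of k] height_step[of "kap j" "kap k"] adj_kap_kap by auto

end

section \<open>Laurent polynomials\<close>

lemma pm_decomp:
 fixes p :: "'a \<Rightarrow>\<^sub>0 'b::comm_monoid_add"
 shows "p = (SUM e:keys p. single e (lookup p e))"
by (rule pm_eqI) (auto simp: lookup_sum lookup_single when_def in_keys_iff)

lemma pm_induct [case_names zero single add]:
 fixes p :: "'a \<Rightarrow>\<^sub>0 'b::comm_monoid_add"
 assumes "P 0" "!!e c. P (single e c)" "!!p q. P p ==> P q ==> P (p + q)"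
 shows "P p"
proof -
 have "P (SUM e:A. single e (lookup p e))" if "finite A" for A
  using that by induction (auto intro: assms)
 from this[OF finite_keys, of p] show ?thesis using pm_decomp by metis
qed

subsection \<open>Monomials\<close>

declare lookup_add [simp] lookup_minus [simp] lookup_single [simp] when_def [simp] lookup_sum [simp] mult_single [simp]

definition mev :: "('v => 'k::field) => 'v ex => 'k" where
 "mev y e = (PROD v:keys e. y v powi lookup e v)"

lemma mev_superset:
 assumes "finite S" "keys e <= S"
 shows "mev y e = (PROD v:S. y v powi lookup e v)" unfolding mev_def using assms
 by (intro prod.mono_neutral_left) (auto simp: in_keys_iff)

lemma mev_0 [simp]: "mev y 0 = 1" by (simp add: mev_def)

lemma mev_single [simp]: "mev y (single v k) = y v powi k" by (cases "k = 0") (auto simp: mev_def)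

lemma mev_cong: "(!!v. v : keys e ==> y v = y' v) ==> mev y e = mev y' e" by (simp add: mev_def)

locale nzf =
 fixes y :: "'v => 'k::field"
 assumes nz [simp]: "y v ~= 0"
begin

lemma mev_nz [simp]: "mev y e ~= 0" by (simp add: mev_def)

lemma mev_add: "mev y (e + e') = mev y e * mev y e'"
proof -
 define S where "S = keys e \<union> keys e'"
 show ?thesis using Poly_Mapping.keys_add[of e e']
by (auto simp: S_def mev_superset[of S] power_int_add)
qed

lemma mev_uminus: "mev y (- e) = inverse (mev y e)"
 using mev_add[of e "- e"] by (simp add: field_simps)

lemma mev_diff: "mev y (e - e') = mev y e / mev y e'"
 using mev_add[of e "- e'"] by (simp add: mev_uminus field_simps)

lemma mev_cmul: "mev y (frag_cmul m e) = mev y e powi m"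
proof -
 have p: "(PROD v:A. g v) powi m = (PROD v:A. g v powi m)" for g :: "'v => 'k" and A
  by (induction A rule: ifi) (simp_all add: power_int_mult_distrib)
 have "mev y (frag_cmul m e) = (PROD v:keys e. y v powi (lookup e v * m))"
  using keys_cmul by (subst mev_superset[of "keys e"]) (simp_all add: mult.commute)
 thus ?thesis by (simp add: mev_def p power_int_mult)
qed

lemma mev_sum: "mev y (sum f A) = (PROD x:A. mev y (f x))"
 by (induction A rule: ifi) (auto simp: mev_add)

end

subsection \<open>Evaluation\<close>

definition pvars :: "'v set => ('v ex \<Rightarrow>\<^sub>0 'c::zero) => bool" where
 "pvars S p <-> (ALL e:keys p. keys e <= S)"

lemma pvars_0 [simp]: "pvars S 0" by (simp add: pvars_def)

lemma pvars_single: "keys e <= S ==> pvars S (single e c)" by (simp add: pvars_def)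

lemma pvars_1 [simp]: "pvars S (1 :: 'v ex \<Rightarrow>\<^sub>0 'c::comm_ring_1)"
 by (simp add: pvars_def)

lemma pvars_add [intro]: "pvars S p ==> pvars S q ==> pvars S (p + q)"
 using Poly_Mapping.keys_add by (fastforce simp: pvars_def)

lemma pvars_uminus [intro]: "pvars S p ==> pvars S (- p :: 'v ex \<Rightarrow>\<^sub>0 'c::comm_ring_1)"
 by (auto simp: pvars_def)

lemma pvars_diff [intro]: "pvars S p ==> pvars S q ==> pvars S (p - q :: 'v ex \<Rightarrow>\<^sub>0 'c::comm_ring_1)"
 using pvars_add[of S p "- q"] pvars_uminus[of S q] by simp

lemma pvars_mult [intro]:
 fixes p q :: "'v ex \<Rightarrow>\<^sub>0 'c::comm_ring_1"
 assumes "pvars S p" "pvars S q"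
 shows "pvars S (p * q)" unfolding pvars_def
proof
 fix e assume "e : keys (p * q)"
 then obtain a b where "a : keys p" "b : keys q" "e = a + b" using keys_mult by blast
 thus "keys e <= S" using assms Poly_Mapping.keys_add by (fastforce simp: pvars_def)
qed

lemma pvars_power [intro]: "pvars S p ==> pvars S (p ^ m :: 'v ex \<Rightarrow>\<^sub>0 'c::comm_ring_1)"
 by (induction m) auto

lemma pvars_sum [intro]: "(!!x. x : A ==> pvars S (f x)) ==> pvars S (sum f A)"
 by (induction A rule: ifi) auto

lemma pvars_mono: "pvars S p ==> S <= S' ==> pvars S' p" by (auto simp: pvars_def)

text \<open>The coefficient map is a parameter: positivity and the Laurent property are treated over
  the integers, the quotient and its equations over the complex numbers.\<close>

definition leval :: "('c => 'k::field) => ('v => 'k) => ('v ex \<Rightarrow>\<^sub>0 'c::zero) => 'k" where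
 "leval \<iota> y p = (SUM e:keys p. \<iota> (lookup p e) * mev y e)"

abbreviation ev where "ev \<equiv> leval scalar"

locale coeff_hom =
 fixes \<iota> :: "'c::idom => 'k::field"
 assumes hom_0 [simp]: "\<iota> 0 = 0" and hom_1 [simp]: "\<iota> 1 = 1"
  and hom_add: "\<iota> (a + b) = \<iota> a + \<iota> b" and hom_mult: "\<iota> (a * b) = \<iota> a * \<iota> b"
begin

lemma hom_uminus: "\<iota> (- a) = - \<iota> a"
 using hom_add[of a "- a"] by (simp add: eq_neg_iff_add_eq_0 add.commute)

lemma leval_superset:
 assumes "finite T" "keys p <= T"
 shows "leval \<iota> y p = (SUM e:T. \<iota> (lookup p e) * mev y e)"
 unfolding leval_def using assms by (intro sum.mono_neutral_left) (auto simp: in_keys_iff)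

lemma leval_0 [simp]: "leval \<iota> y 0 = 0" by (simp add: leval_def)

lemma leval_single [simp]: "leval \<iota> y (single e c) = \<iota> c * mev y e"
 by (simp add: leval_def)

lemma leval_1 [simp]: "leval \<iota> y 1 = 1" using leval_single[of y 0 1] by simp

lemma leval_add: "leval \<iota> y (p + q) = leval \<iota> y p + leval \<iota> y q"
proof -
 define T where "T = keys p \<union> keys q"
 show ?thesis using Poly_Mapping.keys_add[of p q]
by (auto simp: T_def leval_superset[of T] hom_add distrib_right)
qed

lemma leval_sum: "leval \<iota> y (sum f A) = (SUM x:A. leval \<iota> y (f x))"
 by (induction A rule: ifi) (auto simp: leval_add)

lemma leval_uminus: "leval \<iota> y (- p) = - leval \<iota> y p"
 using leval_add[of y p "- p"] by (simp add: eq_neg_iff_add_eq_0 add.commute)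

lemma leval_diff: "leval \<iota> y (p - q) = leval \<iota> y p - leval \<iota> y q"
 using leval_add[of y p "- q"] by (simp add: leval_uminus)

lemma leval_mult:
 assumes "nzf y"
 shows "leval \<iota> y (p * q) = leval \<iota> y p * leval \<iota> y q"
proof (induction p rule: pm_induct)
 case (single e c)
 show ?case by (induction q rule: pm_induct)
(auto simp: hom_mult nzf.mev_add[OF assms] distrib_left leval_add)
qed (auto simp: distrib_right leval_add)

lemma leval_power:
 assumes "nzf y"
 shows "leval \<iota> y (p ^ m) = leval \<iota> y p ^ m"
 by (induction m) (auto simp: leval_mult[OF assms])

lemma leval_cong: "pvars S p ==> (!!v. v : S ==> y v = y' v) ==> leval \<iota> y p = leval \<iota> y' p"
 unfolding leval_def by (intro sum.cong refl arg_cong2[of _ _ _ _ "(*)"] mev_cong) (auto simp: pvars_def)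

definition lring :: "('v => 'k) => 'v set => 'k set" where
 "lring y S = {leval \<iota> y p | p. pvars S p}"

definition indep :: "('v => 'k) => 'v set => bool" where
 "indep y S <-> (ALL p. pvars S p --> leval \<iota> y p = 0 --> p = 0)"

lemma indep_eq:
 assumes "indep y S" "pvars S p" "pvars S q" "leval \<iota> y p = leval \<iota> y q"
 shows "p = q" using assms by (auto simp: leval_diff indep_def)

lemma lring_memI: "pvars S p ==> leval \<iota> y p : lring y S" by (auto simp: lring_def)

lemma lring_coeff: "\<iota> c : lring y S"
 using lring_memI[of S "single 0 c" y] by (simp add: pvars_single)

lemma lring_add: "a : lring y S ==> b : lring y S ==> a + b : lring y S"
 using leval_add pvars_add unfolding lring_def by (smt (verit) mem_Collect_eq)

lemma lring_uminus: "a : lring y S ==> - a : lring y S"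
 using leval_uminus pvars_uminus unfolding lring_def by (smt (verit) mem_Collect_eq)

lemma lring_mult: "nzf y ==> a : lring y S ==> b : lring y S ==> a * b : lring y S"
 using leval_mult pvars_mult unfolding lring_def by (smt (verit) mem_Collect_eq)

lemma lring_mev: "keys e <= S ==> mev y e : lring y S"
 using lring_memI[of S "single e 1" y] by (simp add: pvars_single)

lemma lring_var: "v : S ==> y v : lring y S" using lring_mev[of "single v 1" S y] by simp

lemma lring_inverse_var: "v : S ==> inverse (y v) : lring y S"
 using lring_mev[of "single v (-1)" S y] by simp

end

subsection \<open>Gradings\<close>

definition weight :: "('v ex => int) => bool" where
 "weight w <-> (ALL a b. w (a + b) = w a + w b)"

lemma weight_lookup: "weight (%e. lookup e k)" by (simp add: weight_def)

lemma weight_0: "weight w ==> w 0 = 0" by (metis weight_def add_cancel_right_left)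

lemma weight_uminus: "weight w ==> w (- a) = - w a"
 using weight_0 by (metis weight_def add.inverse_unique add.right_inverse)

definition hcomp :: "('v ex => int) => int => ('v ex \<Rightarrow>\<^sub>0 'c) => ('v ex \<Rightarrow>\<^sub>0 'c::zero)" where
 "hcomp w d p = Poly_Mapping.mapp (%e c. if w e = d then c else 0) p"

lemma lookup_hcomp: "lookup (hcomp w d p) e = (if w e = d then lookup p e else 0)"
 by (auto simp: hcomp_def lookup_mapp in_keys_iff)

lemma keys_hcomp: "keys (hcomp w d p) = {e : keys p. w e = d}"
 by (auto simp: in_keys_iff lookup_hcomp split: if_splits)

lemma hcomp_0 [simp]: "hcomp w d 0 = 0" by (rule pm_eqI) (simp add: lookup_hcomp)

lemma hcomp_add: "hcomp w d (p + q) = hcomp w d p + hcomp w d q"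
 by (rule pm_eqI) (simp add: lookup_hcomp)

lemma hcomp_sum: "hcomp w d (sum f A) = (SUM x:A. hcomp w d (f x))"
 by (induction A rule: ifi) (auto simp: hcomp_add)

lemma hcomp_single: "hcomp w d (single e c) = (if w e = d then single e c else 0)"
 by (rule pm_eqI) (auto simp: lookup_hcomp)

lemma hcomp_hcomp: "hcomp w d (hcomp w d' p) = (if d = d' then hcomp w d p else 0)"
 by (rule pm_eqI) (auto simp: lookup_hcomp)

lemma pvars_hcomp [intro]: "pvars S p ==> pvars S (hcomp w d p)"
 by (auto simp: pvars_def keys_hcomp)

lemma hcomp_decomp: "p = (SUM d:w ` keys p. hcomp w d p)"
by (rule pm_eqI) (auto simp: lookup_hcomp in_keys_iff)

lemma hcomp_eq_0: "d ~: w ` keys p ==> hcomp w d p = 0"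
 by (rule pm_eqI) (auto simp: lookup_hcomp in_keys_iff)

lemma hcomp_single_mult:
 fixes p :: "'v ex \<Rightarrow>\<^sub>0 'c::comm_ring_1"
 assumes "weight w"
 shows "hcomp w d (single e c * p) = single e c * hcomp w (d - w e) p"
proof (induction p rule: pm_induct)
 case (single e' c')
 show ?case using assms by (auto simp: hcomp_single weight_def)
qed (auto simp: hcomp_add distrib_left)

lemma hcomp_homog_mult:
 fixes p q :: "'v ex \<Rightarrow>\<^sub>0 'c::comm_ring_1"
 assumes "weight w" "!!e. e : keys q ==> w e = a"
 shows "hcomp w d (q * p) = q * hcomp w (d - a) p"
proof -
 have "hcomp w d (q * p) = (SUM e:keys q. hcomp w d (single e (lookup q e) * p))"
  by (subst pm_decomp[of q]) (simp add: sum_distrib_right hcomp_sum)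
 also have "... = (SUM e:keys q. single e (lookup q e) * hcomp w (d - a) p)"
  using assms by (intro sum.cong refl) (simp add: hcomp_single_mult)
 also have "... = q * hcomp w (d - a) p"
  by (subst (3) pm_decomp[of q]) (simp add: sum_distrib_right)
 finally show ?thesis .
qed

lemma hcomp_mult:
 fixes p q :: "'v ex \<Rightarrow>\<^sub>0 'c::comm_ring_1"
 assumes "weight w"
 shows "hcomp w d (p * q) = (SUM a:w ` keys p. hcomp w a p * hcomp w (d - a) q)"
proof -
 have "hcomp w d (p * q) = (SUM a:w ` keys p. hcomp w d (hcomp w a p * q))"
  by (subst hcomp_decomp[of p w]) (simp add: sum_distrib_right hcomp_sum)
 also have "... = (SUM a:w ` keys p. hcomp w a p * hcomp w (d - a) q)"
  by (intro sum.cong refl hcomp_homog_mult[OF assms]) (auto simp: keys_hcomp)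
 finally show ?thesis .
qed

lemma homog_1_plus:
 fixes r :: "'v ex"
 assumes "weight w" "w r = 0" "e : keys ((1 + single r (1::'c::comm_ring_1)) ^ m)"
 shows "w e = 0" using assms(3)
proof (induction m arbitrary: e)
 case 0
 thus ?case using weight_0[OF assms(1)] by simp
next
 case (Suc m)
 then obtain a b where ab: "a : keys (1 + single r (1::'c))"
  "b : keys ((1 + single r (1::'c)) ^ m)" "e = a + b"
  using keys_mult[of "1 + single r (1::'c)" "(1 + single r (1::'c)) ^ m"] by auto
 have "a = 0 \<or> a = r" using ab(1) Poly_Mapping.keys_add[of 1 "single r (1::'c)"] by auto
 thus ?case using ab Suc.IH[OF ab(2)] assms weight_0[OF assms(1)] by (auto simp: weight_def)
qed

lemma hcomp_1_plus_mult:
 fixes p :: "'v ex \<Rightarrow>\<^sub>0 'c::comm_ring_1"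
 assumes "weight w" "w r = 0"
 shows "hcomp w d ((1 + single r 1) ^ m * p) = (1 + single r 1) ^ m * hcomp w d p"
proof -
 have "hcomp w d ((1 + single r 1) ^ m * p) = (1 + single r 1) ^ m * hcomp w (d - 0) p"
  by (rule hcomp_homog_mult[OF assms(1)]) (rule homog_1_plus[OF assms])
 thus ?thesis by simp
qed

text \<open>If \<open>1 + x\<close> multiplies \<open>p\<close> into a graded subgroup that is stable under the monomial \<open>x\<close> of
 nonzero degree, then \<open>p\<close> lies in that subgroup: peel off homogeneous components one by one.\<close>

lemma graded_regular_pos:
 fixes p :: "'v ex \<Rightarrow>\<^sub>0 'c::comm_ring_1"
 assumes w: "weight w" and b: "w b > 0"
  and V: "!!d. 0 : V d" "!!d x y. x : V d ==> y : V d ==> x - y : V d"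
   "!!d x. x : V d ==> single b 1 * x : V (d + w b)"
  and p: "!!d. hcomp w d ((1 + single b 1) * p) : V d"
 shows "hcomp w d p : V d"
proof -
 have eq: "hcomp w d ((1 + single b 1) * p) = hcomp w d p + single b 1 * hcomp w (d - w b) p" for d
  by (simp add: distrib_right hcomp_add hcomp_single_mult[OF w])
 define D where "D = (if keys p = {} then 0 else Min (w ` keys p))"
 have low: "hcomp w d p = 0" if "d < D" for d
 proof (rule hcomp_eq_0)
  show "d ~: w ` keys p" using that by (auto simp: D_def split: if_splits)
 qed
 show ?thesis
 proof (induction "nat (d - D + 1)" arbitrary: d rule: less_induct)
  case less
  show ?case
  proof (cases "d < D")
   case True
   thus ?thesis using low V(1) by simp
  next
   case False
   hence "hcomp w (d - w b) p : V (d - w b)" using b by (intro less) auto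
   hence "single b 1 * hcomp w (d - w b) p : V d" using V(3)[of _ "d - w b"] by simp
   hence "hcomp w d ((1 + single b 1) * p) - single b 1 * hcomp w (d - w b) p : V d"
    using p V(2) by blast
   thus ?thesis by (simp add: eq)
  qed
 qed
qed

lemma graded_regular:
 fixes p :: "'v ex \<Rightarrow>\<^sub>0 'c::comm_ring_1"
 assumes w: "weight w" and b: "w b ~= 0"
  and V: "!!d. 0 : V d" "!!d x y. x : V d ==> y : V d ==> x - y : V d"
   "!!d x. x : V d ==> single b 1 * x : V (d + w b)"
  and p: "!!d. hcomp w d ((1 + single b 1) * p) : V d"
 shows "hcomp w d p : V d"
proof (cases "w b > 0")
 case True
 thus ?thesis using graded_regular_pos assms by blast
next
 case False
 \<comment> \<open>A negative degree is reduced to a positive one by reversing the grading.\<close>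
 define w' where "w' e = - w e" for e
 define V' where "V' d = V (- d)" for d
 have hc: "hcomp w' d q = hcomp w (- d) q" for d and q :: "'v ex \<Rightarrow>\<^sub>0 'c"
  by (rule pm_eqI) (auto simp: lookup_hcomp w'_def)
 have "hcomp w' (- d) p : V' (- d)"
 proof (rule graded_regular_pos)
  show "weight w'" using w by (simp add: weight_def w'_def)
  show "w' b > 0" using False b by (simp add: w'_def)
  show "0 : V' d" for d using V by (simp add: V'_def)
  show "x - y : V' d" if "x : V' d" "y : V' d" for d x y using V(2) that by (simp add: V'_def)
  show "single b 1 * x : V' (d + w' b)" if "x : V' d" for d x
   using V(3)[of x "- d"] that by (simp add: V'_def w'_def)
  show "hcomp w' d ((1 + single b 1) * p) : V' d" for d using p by (simp add: hc V'_def)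
 qed
 thus ?thesis by (simp add: hc V'_def)
qed

subsection \<open>Exchanging one variable\<close>

definition flip :: "'v => 'v ex => 'v ex" where
 "flip k e = e - single k (2 * lookup e k)"

lemma lookup_flip: "lookup (flip k e) v = (if v = k then - lookup e v else lookup e v)"
 by (auto simp: flip_def)

lemma flip_flip [simp]: "flip k (flip k e) = e" by (rule pm_eqI) (simp add: lookup_flip)

lemma keys_flip [simp]: "keys (flip k e) = keys e"
 by (auto simp: in_keys_iff lookup_flip split: if_splits)

text \<open>\<open>exch k M p q\<close> is \<open>p ^ M\<close> times the result of substituting \<open>p / x\<^sub>k\<close> for \<open>x\<^sub>k\<close> in \<open>q\<close>.\<close>

definition exch :: "'v => nat => ('v ex \<Rightarrow>\<^sub>0 'c) => ('v ex \<Rightarrow>\<^sub>0 'c) => ('v ex \<Rightarrow>\<^sub>0 'c::comm_ring_1)" where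
 "exch k M p q = (SUM e:keys q. single (flip k e) (lookup q e) *
   p ^ nat (int M + lookup e k))"

lemma exch_bound_exists: "EX M. ALL e:keys q. int M + lookup e k >= 0"
proof -
 define M where "M = nat (SUM e:keys q. \<bar>lookup e k\<bar>)"
 have "\<bar>lookup e k\<bar> <= int M" if "e : keys q" for e
 proof -
  have "\<bar>lookup e k\<bar> <= (SUM e:keys q. \<bar>lookup e k\<bar>)"
   by (rule member_le_sum[OF that]) auto
  thus ?thesis by (simp add: M_def)
 qed
 thus ?thesis by (smt (verit))
qed

text \<open>The part of \<open>q\<close> of degree \<open>d\<close> in the variable
  \<open>k\<close>, moved to degree \<open>- d\<close>; \<open>hcomp_exch\<close> finds it inside
  \<open>exch\<close> up to a power of \<open>p\<close>.\<close>

definition part_deg :: "'v => int => ('v ex \<Rightarrow>\<^sub>0 'c::comm_ring_1) => ('v ex \<Rightarrow>\<^sub>0 'c)" where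
 "part_deg k d q = (SUM e:{e : keys q. lookup e k = d}.
   single (flip k e) (lookup q e))"

lemma lookup_part_deg: "lookup (part_deg k d q) (flip k e) =
  (if lookup e k = d then lookup q e else 0)"
proof -
 have "lookup (part_deg k d q) (flip k e) =
   (SUM x:{e : keys q. lookup e k = d}. if x = e then lookup q e else 0)"
  unfolding part_deg_def lookup_sum
 proof (intro sum.cong refl)
  fix x
  have "flip k x = flip k e <-> x = e" by (metis flip_flip)
  thus "lookup (single (flip k x) (lookup q x)) (flip k e) =
   (if x = e then lookup q e else 0)" by (auto simp: lookup_single)
 qed
 also have "... = (if lookup e k = d then lookup q e else 0)" by (auto simp: in_keys_iff)
 finally show ?thesis .
qed

lemma hcomp_exch:
 fixes p q :: "'v ex \<Rightarrow>\<^sub>0 'c::comm_ring_1"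
 assumes "!!e. e : keys p ==> lookup e k = 0"
 shows "hcomp (%e. lookup e k) (- d) (exch k M p q) = part_deg k d q * p ^ nat (int M + d)"
proof -
 let ?w = "%e. lookup e k"
 have pk: "?w e = 0" if "e : keys (p ^ m)" for m e using that
 proof (induction m arbitrary: e)
  case (Suc m)
  then obtain a b where "a : keys p" "b : keys (p ^ m)" "e = a + b"
   using keys_mult[of p "p ^ m"] by auto
  thus ?case using assms Suc.IH by simp
 qed simp
 have hp: "hcomp ?w c (p ^ m) = (if c = 0 then p ^ m else 0)" for c m
  using pk by (intro pm_eqI) (auto simp: lookup_hcomp in_keys_iff)
 have "hcomp ?w (- d) (exch k M p q) = (SUM e:keys q. single (flip k e) (lookup q e) *
   (if ?w e = d then p ^ nat (int M + ?w e) else 0))"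
  unfolding exch_def hcomp_sum hcomp_single_mult[OF weight_lookup] hp
  by (intro sum.cong refl) (simp add: lookup_flip)
 also have "... = (SUM e:{e : keys q. ?w e = d}. single (flip k e) (lookup q e) *
   p ^ nat (int M + d))" by (rule sum.mono_neutral_cong_right) auto
 finally show ?thesis by (simp add: part_deg_def sum_distrib_right)
qed

lemma pvars_part_deg: "pvars S q ==> pvars S (part_deg k d q)"
 unfolding part_deg_def by (intro pvars_sum pvars_single) (auto simp: pvars_def)

lemma pvars_exch: "pvars S p ==> pvars S q ==> pvars S (exch k M p q)"
 unfolding exch_def by (intro pvars_sum pvars_mult pvars_power pvars_single) (auto simp: pvars_def)

context coeff_hom
begin

lemma leval_exch:
 assumes y: "nzf y" and P: "P = leval \<iota> y p" "P ~= 0"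
  and M: "ALL e:keys q. int M + lookup e k >= 0"
 shows "leval \<iota> y (exch k M p q) = P ^ M * leval \<iota> (y(k := P / y k)) q"
proof -
 interpret nzf y by (rule y)
 have "nzf (y(k := P / y k))" using P by (simp add: nzf_def)
 then interpret y': nzf "y(k := P / y k)" .
 have "leval \<iota> y (exch k M p q) = (SUM e:keys q. \<iota> (lookup q e) * mev y (flip k e) *
   P ^ nat (int M + lookup e k))"
  by (simp add: exch_def leval_sum leval_mult[OF y] leval_power[OF y] P)
 also have "... = (SUM e:keys q. P ^ M * (\<iota> (lookup q e) * mev (y(k := P / y k)) e))"
 proof (intro sum.cong refl)
  fix e assume e: "e : keys q"
  define c where "c = lookup e k"
  define e0 where "e0 = e - single k c"
  have e0k: "k ~: keys e0" by (simp add: e0_def c_def in_keys_iff)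
  have e1: "e = e0 + single k c" "flip k e = e0 + single k (- c)"
   by (rule pm_eqI, simp add: e0_def c_def lookup_flip)+
  have "mev (y(k := P / y k)) e0 = mev y e0" using e0k by (intro mev_cong) auto
  hence "mev (y(k := P / y k)) e = mev y e0 * (P powi c / y k powi c)"
   unfolding e1(1) y'.mev_add by (simp add: power_int_divide_distrib)
  moreover have "mev y (flip k e) = mev y e0 / y k powi c"
   unfolding e1(2) mev_add by (simp add: power_int_minus divide_inverse)
  moreover have "P ^ nat (int M + c) = P ^ M * P powi c"
  proof -
   have "P ^ nat (int M + c) = P powi (int M + c)" using M e by (simp add: power_int_def c_def)
   also have "... = P ^ M * P powi c" using P(2) by (simp add: power_int_add)
   finally show ?thesis .
  qed
  ultimately show "\<iota> (lookup q e) * mev y (flip k e) * P ^ nat (int M + lookup e k) =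
   P ^ M * (\<iota> (lookup q e) * mev (y(k := P / y k)) e)" by (simp add: c_def)
 qed
 finally show ?thesis by (simp add: leval_def sum_distrib_left)
qed

end

context coeff_hom
begin

text \<open>A relation between the exchanged variables, cleared of denominators, says that
  \<open>exch\<close> is zero. Its homogeneous components are the \<open>part_deg\<close> times
  powers of the nonzero \<open>p\<close>, so the relation was trivial.\<close>

lemma indep_exchange:
 fixes y :: "'v::linorder => 'k"
 assumes y: "nzf y" and ind: "indep y S" and k: "k : S"
  and P: "P = leval \<iota> y p" "P ~= 0" and p: "pvars (S - {k}) p"
 shows "indep (y(k := P / y k)) S" unfolding indep_def
proof (intro allI impI)
 fix q :: "'v ex \<Rightarrow>\<^sub>0 'c" assume q: "pvars S q" and z: "leval \<iota> (y(k := P / y k)) q = 0"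
 obtain M where M: "ALL e:keys q. int M + lookup e k >= 0" using exch_bound_exists[of q k] by auto
 have "leval \<iota> y (exch k M p q) = 0" using leval_exch[OF y P M] z by simp
 moreover have pS: "pvars S p" using p by (rule pvars_mono) auto
 ultimately have 0: "exch k M p q = 0" using ind pvars_exch[OF pS q] unfolding indep_def by blast
 have pk: "lookup e k = 0" if "e : keys p" for e
  using p that by (meson Diff_iff in_keys_iff insertI1 pvars_def subsetD)
 have p0: "p ~= 0" using P by auto
 have "part_deg k d q = 0" for d using hcomp_exch[of p k d M q, OF pk] p0 by (simp add: 0)
 hence "lookup q e = 0" for e using lookup_part_deg[of k "lookup e k" q e] by simp
 thus "q = 0" by (intro pm_eqI) simp
qed

definition wset :: "'v set => 'v => 'v ex => ('v ex \<Rightarrow>\<^sub>0 'c) set" where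
 "wset S k r = {s. pvars S s & (ALL d. EX c. pvars S c &
  hcomp (%e. lookup e k) d s = (1 + single r 1) ^ nat (- d) * c)}"

text \<open>Laurent polynomials in both of two adjacent charts are those whose components of degree
 \<open>- d\<close> in the exchanged variable are divisible by the \<open>d\<close>-th power of the exchange binomial.\<close>

lemma wset_of_lring:
 fixes y :: "'v::linorder => 'k"
 assumes y: "nzf y" and ind: "indep y S" and k: "k : S"
  and r: "keys r <= S - {k}" and u: "keys u <= S - {k}"
  and P: "P = mev y u * (1 + mev y r)" "P ~= 0"
  and z: "leval \<iota> y s = z" "pvars S s" "z : lring (y(k := P / y k)) S"
 shows "s : wset S k r"
proof -
 let ?w = "%e. lookup e k"
 define p :: "'v ex \<Rightarrow>\<^sub>0 'c" where "p = single u 1 * (1 + single r 1)"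
 have P': "P = leval \<iota> y p" by (simp add: p_def P leval_mult[OF y] leval_add)
 have pv: "pvars (S - {k}) p" unfolding p_def using r u by (intro pvars_mult pvars_add pvars_single pvars_1)
 have pS: "pvars S p" using pv by (rule pvars_mono) auto
 have pk: "?w e = 0" if "e : keys p" for e
  using pv that by (meson Diff_iff in_keys_iff insertI1 pvars_def subsetD)
 have p0: "p ~= 0" using P P' by auto
 obtain q where q: "z = leval \<iota> (y(k := P / y k)) q" "pvars S q" using z by (auto simp: lring_def)
 obtain M where M: "ALL e:keys q. int M + ?w e >= 0" using exch_bound_exists[of q k] by auto
 \<comment> \<open>The expansions in the two charts, cleared of denominators, agree as Laurent
   polynomials; comparing degrees in the exchanged variable gives the divisibility.\<close>
 have "leval \<iota> y (p ^ M * s) = leval \<iota> y (exch k M p q)"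
  using leval_exch[OF y P' P(2) M] z q P' by (simp add: leval_mult[OF y] leval_power[OF y])
 hence eq: "p ^ M * s = exch k M p q"
  using pS z q by (intro indep_eq[OF ind]) (auto intro: pvars_exch)
 have pM: "?w e = 0" if "e : keys (p ^ m)" for m e using that
 proof (induction m arbitrary: e)
  case (Suc m)
  then obtain a b where "a : keys p" "b : keys (p ^ m)" "e = a + b"
   using keys_mult[of p "p ^ m"] by auto
  thus ?case using pk Suc.IH by simp
 qed simp
 have "EX c. pvars S c & hcomp ?w d s = (1 + single r 1) ^ nat (- d) * c" for d
 proof (cases "d < 0")
  case True
  have "p ^ M * hcomp ?w d s = hcomp ?w d (p ^ M * s)"
  proof -
   have "hcomp ?w d (p ^ M * s) = p ^ M * hcomp ?w (d - 0) s"
    by (rule hcomp_homog_mult[OF weight_lookup]) (rule pM)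
   thus ?thesis by simp
  qed
  also have "... = part_deg k (- d) q * p ^ nat (int M - d)"
   using hcomp_exch[of p k "- d" M q, OF pk] by (simp add: eq)
  also have "p ^ nat (int M - d) = p ^ M * p ^ nat (- d)"
  proof -
   have "nat (int M - d) = M + nat (- d)" using True by linarith
   thus ?thesis by (simp add: power_add)
  qed
  finally have "hcomp ?w d s = part_deg k (- d) q * p ^ nat (- d)" using p0 by simp
  also have "... = (1 + single r 1) ^ nat (- d) * (single u 1 ^ nat (- d) * part_deg k (- d) q)"
   by (simp add: p_def power_mult_distrib)
  finally have "hcomp ?w d s = ..." .
  moreover have "pvars S (single u (1::'c) ^ nat (- d) * part_deg k (- d) q)"
   using u q by (intro pvars_mult pvars_power pvars_single pvars_part_deg) auto
  ultimately show ?thesis by blast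
 next
  case False
  thus ?thesis using pvars_hcomp[OF z(2), of ?w d] by auto
 qed
 thus ?thesis using z(2) by (simp add: wset_def)
qed

text \<open>The elements that are Laurent in both charts are generated by the coefficients, the
  common variables with their inverses, \<open>y k\<close> and \<open>(1 + mev y r) / y k\<close>.
  Hence any set closed under sums and products that contains these contains them all.\<close>

lemma wset_eval:
 assumes y: "nzf y" and k: "k : S"
  and r: "keys r <= S - {k}"
  and Y: "!!a b. a : Y ==> b : Y ==> a + b : Y" "!!a b. a : Y ==> b : Y ==> a * b : Y" "!!c. \<iota> c : Y"
  and gen: "!!j. j : S - {k} ==> y j : Y" "!!j. j : S - {k} ==> inverse (y j) : Y" "y k : Y"
   "(1 + mev y r) / y k : Y"
  and s: "s : wset S k r"
 shows "leval \<iota> y s : Y"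
proof -
 interpret nzf y by (rule y)
 let ?w = "%e. lookup e k"
 have Y0: "0 : Y" and Y1: "1 : Y" using Y(3)[of 0] Y(3)[of 1] by auto
 have Ypow: "a ^ m : Y" if "a : Y" for a m using that by (induction m) (auto intro: Y Y1)
 have Ysum: "sum f A : Y" if "!!a. a : A ==> f a : Y" for f :: "'w => 'k" and A
  using that by (induction A rule: ifi) (auto intro: Y Y0)
 have Ypow': "y j powi m : Y" if "j : S - {k}" for j m
  using Ypow gen(1,2)[OF that] by (auto simp: power_int_def)
 have Yprod: "prod f A : Y" if "!!a. a : A ==> f a : Y" for f :: "'v => 'k" and A
  using that by (induction A rule: ifi) (auto intro: Y Y1)
 have trm: "\<iota> c * ((1 + mev y r) ^ nat (- ?w e) * mev y e) : Y" if e: "keys e <= S" for c e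
 proof -
  define e0 where "e0 = e - single k (?w e)"
  have e0: "keys e0 <= S - {k}"
  proof
   fix v assume "v : keys e0"
   hence "lookup e0 v ~= 0" by (simp add: in_keys_iff)
   hence "v ~= k" "lookup e v ~= 0" by (auto simp: e0_def split: if_splits)
   thus "v : S - {k}" using e by (auto simp: in_keys_iff)
  qed
  have "e = e0 + single k (?w e)" by (simp add: e0_def)
  hence me: "mev y e = mev y e0 * y k powi ?w e" by (metis mev_add mev_single)
  have "mev y e0 : Y" unfolding mev_def using e0 by (intro Yprod Ypow') auto
  moreover have "(1 + mev y r) ^ nat (- ?w e) * y k powi ?w e : Y"
  using Ypow[OF gen(3)] Ypow[OF gen(4)] by (cases "?w e >= 0") (auto simp: power_int_def power_mult_distrib divide_inverse)
  ultimately have "\<iota> c * (mev y e0 * ((1 + mev y r) ^ nat (- ?w e) * y k powi ?w e)) : Y"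
   by (rule Y(2)[OF Y(3) Y(2)])
  thus ?thesis by (simp add: me mult_ac)
 qed
 have comp: "leval \<iota> y (hcomp ?w d s) : Y" for d
 proof -
  obtain c where c: "pvars S c" "hcomp ?w d s = (1 + single r 1) ^ nat (- d) * c"
   using s unfolding wset_def by blast
  have rk: "?w r = 0" using r by (auto simp: in_keys_iff)
  define c' where "c' = hcomp ?w d c"
  have c': "hcomp ?w d s = (1 + single r 1) ^ nat (- d) * c'"
   using arg_cong[OF c(2), of "hcomp ?w d"] by (simp add: hcomp_hcomp hcomp_1_plus_mult[of ?w r, OF weight_lookup rk] c'_def)
  have "leval \<iota> y (hcomp ?w d s) = (SUM e:keys c'. \<iota> (lookup c' e) *
    ((1 + mev y r) ^ nat (- d) * mev y e))"
   unfolding c' leval_mult[OF y] leval_power[OF y] leval_add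
by (simp add: leval_def sum_distrib_left mult_ac)
  also have "... : Y"
  proof (intro Ysum)
   fix e assume e: "e : keys c'"
   hence d: "?w e = d" "e : keys c" by (auto simp: c'_def keys_hcomp)
   hence "keys e <= S" using c(1) by (simp add: pvars_def)
   from trm[OF this, of "lookup c' e"]
   show "\<iota> (lookup c' e) * ((1 + mev y r) ^ nat (- d) * mev y e) : Y" by (simp add: d)
  qed
  finally show ?thesis .
 qed
 have "leval \<iota> y s = (SUM d:?w ` keys s. leval \<iota> y (hcomp ?w d s))"
  by (subst hcomp_decomp[of s ?w]) (simp add: leval_sum)
 also have "... : Y" by (intro Ysum comp)
 finally show ?thesis .
qed

lemma lring_of_wset:
 assumes y: "nzf y" and k: "k : S"
  and r: "keys r <= S - {k}" and u: "keys u <= S - {k}"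
  and P: "P = mev y u * (1 + mev y r)" "P ~= 0"
  and s: "s : wset S k r"
 shows "leval \<iota> y s : lring (y(k := P / y k)) S"
proof -
 let ?y = "y(k := P / y k)"
 interpret nzf y by (rule y)
 have y': "nzf ?y" using P by (simp add: nzf_def)
 have eq: "mev ?y e = mev y e" if "keys e <= S - {k}" for e using that by (intro mev_cong) auto
 show ?thesis
 proof (rule wset_eval[OF y k r _ _ _ _ _ _ _ s])
  show "a + b : lring ?y S" "a * b : lring ?y S" if "a : lring ?y S" "b : lring ?y S" for a b
   using that lring_add lring_mult[OF y'] by auto
  show "\<iota> c : lring ?y S" for c by (rule lring_coeff)
  show "y j : lring ?y S" if "j : S - {k}" for j using lring_var[of j S ?y] that by auto
  show "inverse (y j) : lring ?y S" if "j : S - {k}" for j using lring_inverse_var[of j S ?y] that by auto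
  have kk: "?y k : lring ?y S" "inverse (?y k) : lring ?y S" using lring_var[OF k, of ?y] lring_inverse_var[OF k, of ?y] by auto
  have u': "mev y u : lring ?y S" "inverse (mev y u) : lring ?y S"
   using lring_mev[of u S ?y] lring_mev[of "- u" S ?y] eq eq u by (auto simp: mev_uminus)
  have r': "1 + mev y r : lring ?y S"
   using lring_add[of 1 ?y S] lring_coeff[of 1 ?y S] lring_mev[of r S ?y] eq r by auto
  have "y k = (mev y u * (1 + mev y r)) * inverse (?y k)" using P by simp
  also have "... : lring ?y S" by (intro lring_mult[OF y'] u' r' kk)
  finally show "y k : lring ?y S" .
  have "(1 + mev y r) / y k = inverse (mev y u) * ?y k" by (simp add: P)
  also have "... : lring ?y S" by (intro lring_mult[OF y'] u' kk)
  finally show "(1 + mev y r) / y k : lring ?y S" .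
 qed
qed

lemma wset_pvars: "s : wset S k r ==> pvars S s" by (simp add: wset_def)

lemma wset_add:
 assumes "s : wset S k r" "t : wset S k r"
 shows "s + t : wset S k r"
proof -
 let ?w = "%e. lookup e k" and ?q = "1 + single r (1::'c)"
 have "EX c. pvars S c & hcomp ?w d (s + t) = ?q ^ nat (- d) * c" for d
 proof -
  obtain c c' where "pvars S c" "hcomp ?w d s = ?q ^ nat (- d) * c" "pvars S c'" "hcomp ?w d t = ?q ^ nat (- d) * c'"
   using assms unfolding wset_def by blast
  thus ?thesis by (intro exI[of _ "c + c'"]) (auto simp: hcomp_add distrib_left)
 qed
 thus ?thesis using assms by (auto simp: wset_def)
qed

lemma wset_mult:
 assumes r: "keys r <= S" and s: "s : wset S k r" and t: "t : wset S k r"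
 shows "s * t : wset S k r"
proof -
 let ?w = "%e. lookup e k" and ?q = "1 + single r (1::'c)"
 have q: "pvars S ?q" using r by (intro pvars_add pvars_1 pvars_single)
 have "EX c. pvars S c & hcomp ?w d (s * t) = ?q ^ nat (- d) * c" for d
 proof -
  have "EX c. pvars S c & hcomp ?w a s * hcomp ?w (d - a) t = ?q ^ nat (- d) * c" for a
  proof -
   obtain c where c: "pvars S c" "hcomp ?w a s = ?q ^ nat (- a) * c" using s unfolding wset_def by blast
   obtain c' where c': "pvars S c'" "hcomp ?w (d - a) t = ?q ^ nat (- (d - a)) * c'" using t unfolding wset_def by blast
   define m where "m = nat (- a) + nat (- (d - a)) - nat (- d)"
   have m: "nat (- a) + nat (- (d - a)) = nat (- d) + m" unfolding m_def by linarith
   have "hcomp ?w a s * hcomp ?w (d - a) t = ?q ^ (nat (- a) + nat (- (d - a))) * (c * c')"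
    using c c' by (simp add: power_add)
   also have "... = ?q ^ nat (- d) * (?q ^ m * (c * c'))" unfolding m by (simp add: power_add)
   finally show ?thesis using c c' q by (intro exI[of _ "?q ^ m * (c * c')"]) auto
  qed
  then obtain f where f: "!!a. pvars S (f a)" "!!a. hcomp ?w a s * hcomp ?w (d - a) t = ?q ^ nat (- d) * f a" by metis
  have "hcomp ?w d (s * t) = ?q ^ nat (- d) * (SUM a:?w ` keys s. f a)"
   by (simp add: hcomp_mult[OF weight_lookup] f sum_distrib_left)
  thus ?thesis using f(1) by blast
 qed
 thus ?thesis using s t by (auto simp: wset_def)
qed

lemma wset_single: "keys e <= S ==> lookup e k >= 0 ==> single e c : wset S k r"
 unfolding wset_def mem_Collect_eq hcomp_single
 by (metis (no_types, lifting) mult_1 mult_zero_right nat_0_iff neg_le_0_iff_le power_0 pvars_0 pvars_single)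

lemma wset_binomial:
 assumes "k : S" "keys r <= S - {k}"
 shows "single (single k (-1)) 1 * (1 + single r 1) : wset S k r"
proof -
 let ?w = "%e. lookup e k" and ?q = "1 + single r (1::'c)"
 let ?x = "single (single k (-1)) (1::'c)"
 have rk: "?w r = 0" using assms by (metis Diff_iff in_keys_iff insertI1 subsetD)
 have q: "pvars S ?q" "pvars S ?x" using assms by (auto intro!: pvars_single)
 have "hcomp ?w d (?x * ?q) = ?q ^ nat (- d) * (if d = -1 then ?x else 0)" for d
  using hcomp_1_plus_mult[of ?w r d 1 ?x, OF weight_lookup rk] by (simp add: hcomp_single mult.commute)
 moreover have "pvars S (if d = -1 then ?x else 0)" for d :: int using q by simp
 ultimately have "ALL d. EX c. pvars S c & hcomp ?w d (?x * ?q) = ?q ^ nat (- d) * c" by blast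
 thus ?thesis using pvars_mult[OF q(2,1)] unfolding wset_def by blast
qed

text \<open>Cancels \<open>1 + single b 1\<close> from the divisibility condition without unique
  factorization, by peeling off degrees: in the variable \<open>k\<close> if it occurs in
  \<open>b\<close>, otherwise in a weight for which \<open>1 + single r 1\<close> is homogeneous
  while \<open>b\<close> has nonzero degree.\<close>

lemma wset_regular:
 assumes r: "keys r <= S" "lookup r k = 0" and b: "keys b <= S"
  and p: "pvars S p" "(1 + single b 1) * p : wset S k r"
  and cases: "lookup b k > 0 \<or> lookup b k = 0 & (EX w. weight w & w r = 0 & w b ~= 0)"
 shows "p : wset S k r"
proof -
 let ?w = "%e. lookup e k" and ?q = "1 + single r (1::'c)"
 have q: "pvars S ?q" using r by (intro pvars_add pvars_1 pvars_single)
 define V where "V d = {?q ^ nat (- d) * c | c. pvars S c}" for d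
 have V0: "0 : V d" for d unfolding V_def using pvars_0 by (metis (mono_tags, lifting) mem_Collect_eq mult_zero_right)
 have Vd: "x - y : V d" if xy: "x : V d" "y : V d" for x y d
 proof -
  obtain c c' where "x = ?q ^ nat (- d) * c" "pvars S c" "y = ?q ^ nat (- d) * c'" "pvars S c'"
   using xy by (auto simp: V_def)
  hence "x - y = ?q ^ nat (- d) * (c - c')" "pvars S (c - c')" by (auto simp: right_diff_distrib)
  thus ?thesis by (auto simp: V_def)
 qed
 have bV: "single b 1 * x : V d" if xy: "x : V d" for x d
 proof -
  obtain c where "x = ?q ^ nat (- d) * c" "pvars S c" using xy by (auto simp: V_def)
  hence "single b 1 * x = ?q ^ nat (- d) * (single b 1 * c)"
   "pvars S (single b 1 * c)" using b by (auto intro!: pvars_single)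
  thus ?thesis by (auto simp: V_def)
 qed
 have sV: "sum f A : V d" if "!!x. x : A ==> f x : V d" for f :: "int => _" and A d using that
 proof (induction A rule: ifi)
  case (insert x A)
  have "f x - (0 - sum f A) : V d" using insert V0 by (intro Vd) auto
  thus ?case using insert by simp
 qed (auto simp: V0)
 have pV: "hcomp ?w d ((1 + single b 1) * p) : V d" for d
  using p(2) unfolding wset_def V_def by blast
 have "hcomp ?w d p : V d" for d
 proof (cases "?w b > 0")
  case True
  have up: "single b 1 * x : V (d + ?w b)" if x: "x : V d" for d x
  proof -
   obtain c where c: "single b 1 * x = ?q ^ nat (- d) * c" "pvars S c" using bV[OF x] by (auto simp: V_def)
   have e: "nat (- d) = nat (- (d + ?w b)) + (nat (- d) - nat (- (d + ?w b)))" using True by linarith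
   have "single b 1 * x = ?q ^ nat (- (d + ?w b)) * (?q ^ (nat (- d) - nat (- (d + ?w b))) * c)"
    unfolding c(1) by (subst e) (simp only: power_add mult.assoc)
   moreover have "pvars S (?q ^ (nat (- d) - nat (- (d + ?w b))) * c)" using q c by auto
   ultimately show ?thesis unfolding V_def by blast
  qed
  show ?thesis by (rule graded_regular_pos[OF weight_lookup True V0 Vd up pV])
 next
  case False
  then obtain w where w: "weight w" "w r = 0" "w b ~= 0" and b0: "?w b = 0" using cases by blast
  have h: "hcomp ?w d ((1 + single b 1) * p) = (1 + single b 1) * hcomp ?w d p"
   using hcomp_1_plus_mult[of ?w b d 1 p, OF weight_lookup b0] by simp
  obtain c where c: "hcomp ?w d ((1 + single b 1) * p) = ?q ^ nat (- d) * c" "pvars S c"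
   using pV unfolding V_def by blast
  have pV': "hcomp w x ((1 + single b 1) * hcomp ?w d p) : V d" for x
  proof -
   have "hcomp w x ((1 + single b 1) * hcomp ?w d p) = ?q ^ nat (- d) * hcomp w x c"
    unfolding h[symmetric] c(1) by (rule hcomp_1_plus_mult[OF w(1,2)])
   thus ?thesis using c(2) unfolding V_def by blast
  qed
  have "hcomp w x (hcomp ?w d p) : V d" for x
   by (rule graded_regular[where V = "%_. V d", OF w(1) w(3) V0 Vd bV pV'])
  thus ?thesis by (subst hcomp_decomp[of _ w]) (rule sV)
 qed
 thus ?thesis using p(1) unfolding wset_def V_def by blast
qed

end

section \<open>Seeds\<close>

lemma scalar_hom [simp]: "scalar 0 = 0" "scalar 1 = 1" "scalar (a + b) = scalar a + scalar b" "scalar (a * b) = scalar a * scalar b"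
 by (simp_all add: scalar_def Zero_fract_def One_fract_def single_add)

interpretation C: coeff_hom scalar by unfold_locales (simp_all)

interpretation Z: coeff_hom "of_int :: int => ambient" by unfold_locales simp_all

lemma scalar_of_int: "scalar (of_int m) = of_int m"
proof -
 have nat: "scalar (of_nat k) = of_nat k" for k by (induction k) (simp_all)
 show ?thesis using nat[of "nat m"] nat[of "nat (- m)"] C.hom_uminus by (cases "m >= 0") (auto)
qed

instance fract :: ("{idom, ring_char_0}") ring_char_0
proof
 show "inj (of_nat :: nat => 'a fract)"
 proof
  fix m k :: nat assume "(of_nat m :: 'a fract) = of_nat k"
  hence "Fract (of_nat m :: 'a) 1 = Fract (of_nat k) 1" by (simp add: Fract_of_nat_eq)
  thus "m = k" by (simp add: eq_fract)
 qed
qed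

lemma indep_int:
 assumes "C.indep y S"
 shows "Z.indep y S" unfolding Z.indep_def
proof (intro allI impI)
 fix p :: "('a \<Rightarrow>\<^sub>0 int) \<Rightarrow>\<^sub>0 int" assume p: "pvars S p" "leval of_int y p = 0"
 define q :: "('a \<Rightarrow>\<^sub>0 int) \<Rightarrow>\<^sub>0 complex" where "q = Poly_Mapping.map of_int p"
 have l: "lookup q e = of_int (lookup p e)" for e by (simp add: q_def Poly_Mapping.map.rep_eq)
 hence k: "keys q = keys p" by (auto simp: in_keys_iff)
 have "q = 0" using assms p by (auto simp: leval_def l k scalar_of_int C.indep_def pvars_def)
 thus "p = 0" using l by (intro pm_eqI) (metis lookup_zero of_int_eq_0_iff)
qed

definition pvec :: "nat => (nat => int) => nat ex" where
 "pvec N f = (SUM i<N. single i (f i))"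

lemma lookup_pvec [simp]: "lookup (pvec N f) i = (if i < N then f i else 0)" by (simp add: pvec_def)

lemma keys_pvec [simp]: "keys (pvec N f) = {i. i < N & f i ~= 0}"
 by (auto simp: in_keys_iff split: if_splits)

lemma mev_pvec: "mev y (pvec N f) = (PROD i<N. y i powi f i)"
proof -
 have "mev y (pvec N f) = (PROD i<N. y i powi lookup (pvec N f) i)" by (rule mev_superset) (auto)
 thus ?thesis by simp
qed

definition ycol :: "seed => nat => nat ex" where
 "ycol U k = pvec (dim_row (snd U)) (%i. snd U $$ (i, k))"

definition nexp :: "seed => nat => nat ex" where
 "nexp U k = pvec (dim_row (snd U)) (%i. max 0 (- snd U $$ (i, k)))"

definition pexp :: "seed => nat => nat ex" where
 "pexp U k = pvec (dim_row (snd U)) (%i. max 0 (snd U $$ (i, k)))"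

text \<open>The y-hat variables of the theory of cluster algebras: Laurent monomials whose exponents
  are the columns of the extended matrix.\<close>

definition yhat :: "seed => nat => ambient" where
 "yhat U k = mev (fst U) (ycol U k)"

definition exch_sum :: "seed => nat => ambient" where
 "exch_sum U k = pos_monomial U k + neg_monomial U k"

lemma pos_monomial_eq: "pos_monomial U k = mev (fst U) (pexp U k)"
proof -
 have "mev (fst U) (pexp U k) = (PROD i<dim_row (snd U). fst U i ^ nat (snd U $$ (i, k)))"
  unfolding pexp_def mev_pvec by (intro prod.cong refl) (simp add: power_int_def max_def)
 also have "... = (PROD i:{i. i < dim_row (snd U) & snd U $$ (i, k) > 0}. fst U i ^ nat (snd U $$ (i, k)))"
  by (rule prod.mono_neutral_right) (auto, metis linorder_not_less nat_0_iff power_0)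
 finally show ?thesis by (simp add: pos_monomial_def case_prod_beta)
qed

lemma neg_monomial_eq: "neg_monomial U k = mev (fst U) (nexp U k)"
proof -
 have "mev (fst U) (nexp U k) = (PROD i<dim_row (snd U). fst U i ^ nat (- snd U $$ (i, k)))"
  unfolding nexp_def mev_pvec by (intro prod.cong refl) (simp add: power_int_def max_def)
 also have "... = (PROD i:{i. i < dim_row (snd U) & snd U $$ (i, k) < 0}. fst U i ^ nat (- snd U $$ (i, k)))"
  by (rule prod.mono_neutral_right) (auto, metis linorder_not_less nat_0_iff neg_le_0_iff_le power_0)
 finally show ?thesis by (simp add: neg_monomial_def case_prod_beta)
qed

lemma pexp_eq: "pexp U k = nexp U k + ycol U k"
 by (rule pm_eqI) (simp add: pexp_def nexp_def ycol_def max_def)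

lemma fst_mutate: "fst (mutate k U) = (fst U)(k := exch_sum U k / fst U k)"
 by (simp add: mutate_def exch_sum_def)

lemma snd_mutate: "snd (mutate k U) = mutate_matrix k (snd U)" by (simp add: mutate_def)

lemma mutate_entry:
 assumes "i < dim_row B" "j < dim_col B"
 shows "mutate_matrix k B $$ (i, j) = (if i = k \<or> j = k then - B $$ (i, j)
  else B $$ (i, j) + max 0 (B $$ (i, k)) * max 0 (B $$ (k, j)) - max 0 (- B $$ (i, k)) * max 0 (- B $$ (k, j)))"
using assms by (auto simp: abs_if mutate_matrix_def)

lemma dim_mutate [simp]: "dim_row (mutate_matrix k B) = dim_row B" "dim_col (mutate_matrix k B) = dim_col B"
 by (simp_all add: mutate_matrix_def)

locale seed_sizes =
 fixes n N :: nat and d :: "nat => real"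
 assumes nN: "n <= N" and d_pos: "!!i. i < n ==> d i > 0"
begin

text \<open>The properties that mutation preserves. Values are required to be nonzero at all
  indices, also beyond the \<open>N\<close> rows, so that \<open>nzf\<close> holds and evaluation of
  monomials is multiplicative.\<close>

definition vseed :: "seed => bool" where
 "vseed U <-> snd U : carrier_mat N n &
  (ALL i<n. ALL j<n. d i * of_int (snd U $$ (i, j)) = - (d j * of_int (snd U $$ (j, i)))) &
  (ALL i. fst U i ~= 0) & C.indep (fst U) {..<N} & (ALL i>=n. fst U i = init_var i)"

context
 fixes U :: seed assumes v: "vseed U"
begin

lemma vseed_dim: "snd U : carrier_mat N n" "dim_row (snd U) = N" "dim_col (snd U) = n"
 using v by (auto simp: vseed_def)

lemma vseed_nz: "fst U i ~= 0" using v by (simp add: vseed_def)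

lemma vseed_fam: "nzf (fst U)" using vseed_nz by (simp add: nzf_def)

lemma vseed_indep: "C.indep (fst U) {..<N}" "Z.indep (fst U) {..<N}"
 using v indep_int by (auto simp: vseed_def)

lemma vseed_frozen: "i >= n ==> fst U i = init_var i" using v by (simp add: vseed_def)

lemma vseed_skew: "i < n ==> j < n ==> d i * of_int (snd U $$ (i, j)) = - (d j * of_int (snd U $$ (j, i)))"
 using v unfolding vseed_def by blast

lemma vseed_diag: "i < n ==> snd U $$ (i, i) = 0" using vseed_skew[of i i] d_pos[of i] by simp

lemma vseed_sign: "i < n ==> j < n ==> snd U $$ (i, j) > 0 <-> snd U $$ (j, i) < 0"
proof -
 assume ij: "i < n" "j < n"
 have "snd U $$ (i, j) > 0 <-> d i * of_int (snd U $$ (i, j)) > 0"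
  using d_pos[OF ij(1)] by (simp add: zero_less_mult_iff)
 also have "... <-> d j * of_int (snd U $$ (j, i)) < 0" using vseed_skew[OF ij] by simp
 also have "... <-> snd U $$ (j, i) < 0" using d_pos[OF ij(2)] by (simp add: mult_less_0_iff)
 finally show ?thesis .
qed

lemma exps_keys:
 assumes "k < n"
 shows "keys (ycol U k) <= {..<N} - {k}" "keys (nexp U k) <= {..<N} - {k}"
  "keys (pexp U k) <= {..<N} - {k}"
 using vseed_diag[OF assms] by (auto simp: ycol_def nexp_def pexp_def vseed_dim)

lemma exch_sum_eq: "exch_sum U k = mev (fst U) (nexp U k) * (1 + yhat U k)"
 using nzf.mev_add[OF vseed_fam]
 by (simp add: exch_sum_def pos_monomial_eq neg_monomial_eq yhat_def pexp_eq algebra_simps)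

lemma pos_neg_monomial: "pos_monomial U k = neg_monomial U k * yhat U k"
 using nzf.mev_add[OF vseed_fam] by (simp add: pos_monomial_eq neg_monomial_eq yhat_def pexp_eq)

lemma pos_monomial_nz [simp]: "pos_monomial U k ~= 0" and neg_monomial_nz [simp]: "neg_monomial U k ~= 0"
 and yhat_nz [simp]: "yhat U k ~= 0"
 using nzf.mev_nz[OF vseed_fam] by (auto simp: pos_monomial_eq neg_monomial_eq yhat_def)

lemma exch_sum_nz:
 assumes "k < n"
 shows "exch_sum U k ~= 0"
proof
 define p :: "nat laurent" where
  "p = single (pexp U k) 1 + single (nexp U k) 1"
 assume "exch_sum U k = 0"
 hence "ev (fst U) p = 0"
  by (simp add: p_def C.leval_add exch_sum_def pos_monomial_eq neg_monomial_eq)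
 moreover have "pvars {..<N} p" unfolding p_def using exps_keys[OF assms] by (intro pvars_add pvars_single) auto
 ultimately have "p = 0" using vseed_indep unfolding C.indep_def by blast
 moreover have "lookup p (nexp U k) ~= 0" by (auto simp: p_def)
 ultimately show False by simp
qed

lemma yhat_plus_1_nz:
 assumes "k < n"
 shows "1 + yhat U k ~= 0" using exch_sum_nz[OF assms] exch_sum_eq by auto

lemma vseed_mutate:
 assumes "k < n"
 shows "vseed (mutate k U)"
proof -
 let ?b = "%i j. snd U $$ (i, j)"
 have ent: "snd (mutate k U) $$ (i, j) = (if i = k \<or> j = k then - ?b i j
  else ?b i j + max 0 (?b i k) * max 0 (?b k j) - max 0 (- ?b i k) * max 0 (- ?b k j))" if "i < N" "j < n" for i j
  using that mutate_entry by (simp add: snd_mutate vseed_dim)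
 have skew: "d i * of_int (snd (mutate k U) $$ (i, j)) = - (d j * of_int (snd (mutate k U) $$ (j, i)))"
  if ij: "i < n" "j < n" for i j
 proof -
  have iN: "i < N" "j < N" using ij nN by auto
  have di: "d i > 0" "d j > 0" "d k > 0" using d_pos ij assms by auto
  have sc: "d a * of_int (max 0 (?b a c)) = d c * of_int (max 0 (- ?b c a))" if "a < n" "c < n" for a c
  using vseed_sign[OF that] vseed_skew[OF that] by (cases "?b a c > 0") (auto)
  have 1: "d i * (of_int (max 0 (?b i k)) * of_int (max 0 (?b k j))) = d j * (of_int (max 0 (- ?b j k)) * of_int (max 0 (- ?b k i)))"
  using sc[OF ij(1) assms] sc[OF assms ij(2)] mult_ac by (smt (verit))
  have 2: "d i * (of_int (max 0 (- ?b i k)) * of_int (max 0 (- ?b k j))) = d j * (of_int (max 0 (?b j k)) * of_int (max 0 (?b k i)))"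
  using sc[OF assms ij(1)] sc[OF ij(2) assms] mult_ac by (smt (verit))
  show ?thesis using 1 2 vseed_skew[OF ij] by (simp add: ent iN ij algebra_simps)
 qed
 let ?p = "single (pexp U k) (1::complex) + single (nexp U k) 1"
 have "C.indep (fst (mutate k U)) {..<N}" unfolding fst_mutate
 proof (rule C.indep_exchange[OF vseed_fam vseed_indep(1)])
  show "k : {..<N}" using assms nN by simp
  show "exch_sum U k = ev (fst U) ?p"
   by (simp add: C.leval_add exch_sum_def pos_monomial_eq neg_monomial_eq)
  show "pvars ({..<N} - {k}) ?p" using exps_keys[OF assms] by (intro pvars_add pvars_single)
  show "exch_sum U k ~= 0" by (rule exch_sum_nz[OF assms])
 qed
 moreover have "snd (mutate k U) : carrier_mat N n"
  using vseed_dim by (simp add: snd_mutate mutate_matrix_def)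
 moreover have "fst (mutate k U) i ~= 0" for i
  using vseed_nz exch_sum_nz[OF assms] by (simp add: fst_mutate)
 moreover have "fst (mutate k U) i = init_var i" if "i >= n" for i
  using vseed_frozen that assms by (simp add: fst_mutate)
 ultimately show ?thesis using skew unfolding vseed_def by blast
qed

lemma mutate_mutate:
 assumes "k < n"
 shows "mutate k (mutate k U) = U"
proof -
 let ?b = "%i j. snd U $$ (i, j)"
 have kk: "?b k k = 0" by (rule vseed_diag[OF assms])
 have k: "k < N" using assms nN by simp
 have ent: "snd (mutate k U) $$ (i, j) = (if i = k \<or> j = k then - ?b i j
  else ?b i j + max 0 (?b i k) * max 0 (?b k j) - max 0 (- ?b i k) * max 0 (- ?b k j))" if "i < N" "j < n" for i j
  using that mutate_entry by (simp add: snd_mutate vseed_dim)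
 have "snd (mutate k (mutate k U)) = snd U"
 using mutate_entry assms k by (auto simp: snd_mutate vseed_dim)
 moreover have "pexp (mutate k U) k = nexp U k" "nexp (mutate k U) k = pexp U k"
  by (rule pm_eqI, use ent assms in "simp add: pexp_def nexp_def lookup_pvec snd_mutate vseed_dim")+
 moreover have "mev (fst (mutate k U)) (pexp U k) = mev (fst U) (pexp U k)"
  "mev (fst (mutate k U)) (nexp U k) = mev (fst U) (nexp U k)"
  using exps_keys[OF assms] by (intro mev_cong; auto simp: fst_mutate)+
 ultimately show ?thesis using exch_sum_nz[OF assms]
by (auto simp: exch_sum_def pos_monomial_eq neg_monomial_eq add.commute fst_mutate prod_eq_iff)
qed

text \<open>The mutation rule of Y-patterns; by the exchange relation the two factors equal yhat_k /
  (1 + yhat_k) and 1 + yhat_k.\<close>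

lemma yhat_mutate:
 assumes "k < n" "l < n" "k ~= l"
 shows "snd U $$ (k, l) >= 0 ==>
   yhat (mutate k U) l = yhat U l * (pos_monomial U k / exch_sum U k) ^ nat (snd U $$ (k, l))"
  and "snd U $$ (k, l) <= 0 ==>
   yhat (mutate k U) l = yhat U l * (exch_sum U k / neg_monomial U k) ^ nat (- snd U $$ (k, l))"
proof -
 let ?b = "%i j. snd U $$ (i, j)" and ?y = "fst U"
 interpret nzf ?y by (rule vseed_fam)
 have k: "k < N" "l < N" using assms nN by auto
 define b where "b = ?b k l"
 define e0 where "e0 = pvec N (%i. if i = k then 0 else snd (mutate k U) $$ (i, l))"
 have ent: "snd (mutate k U) $$ (i, l) = (if i = k then - ?b i l
  else ?b i l + max 0 (?b i k) * max 0 (?b k l) - max 0 (- ?b i k) * max 0 (- ?b k l))" if "i < N" for i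
  using that mutate_entry assms by (simp add: snd_mutate vseed_dim)
 have "ycol (mutate k U) l = e0 + single k (- b)" using ent k by (intro pm_eqI)
(simp add: ycol_def e0_def when_def snd_mutate vseed_dim b_def)
 moreover have "nzf (fst (mutate k U))"
  using vseed_mutate[OF assms(1)] by (simp add: vseed_def nzf_def)
 ultimately have "yhat (mutate k U) l = mev (fst (mutate k U)) e0 * fst (mutate k U) k powi (- b)"
  by (simp add: yhat_def nzf.mev_add)
 also have "mev (fst (mutate k U)) e0 = mev ?y e0"
  by (intro mev_cong) (auto simp: fst_mutate e0_def)
 also have "fst (mutate k U) k powi (- b) = ?y k powi b * exch_sum U k powi (- b)"
  by (simp add: fst_mutate power_int_mult_distrib power_int_inverse power_int_minus divide_inverse)
 finally have main: "yhat (mutate k U) l = mev ?y e0 * ?y k powi b * exch_sum U k powi (- b)" by simp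
 have kk: "?b k k = 0" by (rule vseed_diag[OF assms(1)])
 have main': "mev ?y e0 * ?y k powi b = mev ?y (e0 + single k b)" by (simp add: mev_add)
 have lk: "lookup (e0 + single k b) i =
   (if i < N then (if i = k then b else ?b i l + max 0 (?b i k) * max 0 b - max 0 (- ?b i k) * max 0 (- b)) else 0)" for i
  using ent k by (auto simp: e0_def b_def)
 show "yhat (mutate k U) l = yhat U l * (pos_monomial U k / exch_sum U k) ^ nat (?b k l)" if ge: "?b k l >= 0"
 proof -
  have "e0 + single k b = ycol U l + frag_cmul b (pexp U k)"
  proof (rule pm_eqI)
   fix i
   show "lookup (e0 + single k b) i = lookup (ycol U l + frag_cmul b (pexp U k)) i"
    unfolding lk using kk ge by (auto simp: ycol_def pexp_def vseed_dim b_def)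
  qed
  hence "mev ?y e0 * ?y k powi b = yhat U l * pos_monomial U k powi b"
   unfolding main' by (simp add: mev_add mev_cmul yhat_def pos_monomial_eq)
  thus ?thesis using ge unfolding main b_def
by (simp add: power_int_def divide_inverse power_mult_distrib)
 qed
 show "yhat (mutate k U) l = yhat U l * (exch_sum U k / neg_monomial U k) ^ nat (- ?b k l)" if ge: "?b k l <= 0"
 proof -
  have "e0 + single k b = ycol U l + frag_cmul b (nexp U k)"
  proof (rule pm_eqI)
   fix i
   show "lookup (e0 + single k b) i = lookup (ycol U l + frag_cmul b (nexp U k)) i"
    unfolding lk using kk ge by (auto simp: ycol_def nexp_def vseed_dim b_def)
  qed
  hence "mev ?y e0 * ?y k powi b = yhat U l * neg_monomial U k powi b"
   unfolding main' by (simp add: mev_add mev_cmul yhat_def neg_monomial_eq)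
  thus ?thesis using ge unfolding main b_def
   by (cases "?b k l = 0") (simp_all add: power_int_def divide_inverse power_mult_distrib)
 qed
qed

end

definition full_col :: "int mat => bool" where
 "full_col B <-> (ALL w :: nat => int. (ALL i<N. (SUM j<n. B $$ (i, j) * w j) = 0) --> (ALL j<n. w j = 0))"

text \<open>Up to the sign of row and column \<open>k\<close>, mutation adds multiples of row
  \<open>k\<close> to the other rows, which does not affect a kernel vector, and multiples of column
  \<open>k\<close> to the other columns. The latter are collected in \<open>s\<close>, so only the
  coordinate \<open>k\<close> of a kernel vector changes.\<close>

lemma full_col_mutate:
 assumes v: "vseed U" and f: "full_col (snd U)" and k: "k < n"
 shows "full_col (snd (mutate k U))" unfolding full_col_def
proof (intro allI impI)
 fix w :: "nat => int" and j
 let ?b = "%i j. snd U $$ (i, j)"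
 assume w: "ALL i<N. (SUM j<n. snd (mutate k U) $$ (i, j) * w j) = 0" and j: "j < n"
 have kN: "k < N" using k nN by simp
 have ent: "snd (mutate k U) $$ (i, j) = (if i = k \<or> j = k then - ?b i j
  else ?b i j + max 0 (?b i k) * max 0 (?b k j) - max 0 (- ?b i k) * max 0 (- ?b k j))" if "i < N" "j < n" for i j
  using that mutate_entry by (simp add: snd_mutate vseed_dim[OF v])
 have kk: "?b k k = 0" by (rule vseed_diag[OF v k])
 define s where "s = (SUM j:{..<n} - {k}. max 0 (- ?b k j) * w j)"
 define w' where "w' = w(k := - w k + s)"
 have split: "(SUM j<n. g j) = g k + (SUM j:{..<n} - {k}. g j)" for g :: "nat => int"
  using k by (intro sum.remove) auto
 have row_k: "(SUM j:{..<n} - {k}. ?b k j * w j) = 0"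
 proof -
  have "(SUM j<n. snd (mutate k U) $$ (k, j) * w j) = - (SUM j<n. ?b k j * w j)"
   unfolding sum_negf[symmetric] using kN by (intro sum.cong refl) (simp add: ent)
  hence "(SUM j<n. ?b k j * w j) = 0" using w kN by simp
  thus ?thesis using split kk by simp
 qed
 have "(SUM j<n. ?b i j * w' j) = 0" if i: "i < N" for i
 proof (cases "i = k")
  case True
  have "(SUM j<n. ?b k j * w' j) = (SUM j:{..<n} - {k}. ?b k j * w' j)" using split kk by simp
  also have "... = (SUM j:{..<n} - {k}. ?b k j * w j)" by (intro sum.cong refl) (simp add: w'_def)
  finally show ?thesis using row_k True by simp
 next
  case False
  have mm: "max 0 (?b i k) * max 0 x - max 0 (- ?b i k) * max 0 (- x) = max 0 (?b i k) * x + ?b i k * max 0 (- x)" for x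
   by (auto simp: max_def)
  have "0 = (SUM j<n. snd (mutate k U) $$ (i, j) * w j)" using w i by simp
  also have "... = - ?b i k * w k + (SUM j:{..<n} - {k}. snd (mutate k U) $$ (i, j) * w j)"
   using split ent[OF i k] by simp
  also have "(SUM j:{..<n} - {k}. snd (mutate k U) $$ (i, j) * w j) =
   (SUM j:{..<n} - {k}. ?b i j * w j + (max 0 (?b i k) * (?b k j * w j) + ?b i k * (max 0 (- ?b k j) * w j)))"
  proof (intro sum.cong refl)
   fix j assume "j : {..<n} - {k}"
   hence "snd (mutate k U) $$ (i, j) = ?b i j + (max 0 (?b i k) * ?b k j + ?b i k * max 0 (- ?b k j))"
    using ent[OF i, of j] False mm by simp
   thus "snd (mutate k U) $$ (i, j) * w j =
    ?b i j * w j + (max 0 (?b i k) * (?b k j * w j) + ?b i k * (max 0 (- ?b k j) * w j))"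
    by (simp add: algebra_simps)
  qed
  also have "... = (SUM j:{..<n} - {k}. ?b i j * w j) + ?b i k * s"
   by (simp add: sum_distrib_left[symmetric] row_k s_def)
  also have "(SUM j:{..<n} - {k}. ?b i j * w j) = (SUM j:{..<n} - {k}. ?b i j * w' j)"
   by (intro sum.cong refl) (simp add: w'_def)
  finally show ?thesis using split by (simp add: w'_def algebra_simps)
 qed
 hence w'0: "w' j = 0" if "j < n" for j using f that unfolding full_col_def by blast
 have wj: "w j = 0" if "j < n" "j ~= k" for j using w'0[OF that(1)] that by (simp add: w'_def)
 hence "s = 0" unfolding s_def by (intro sum.neutral) auto
 thus "w j = 0" using w'0[OF k] wj[OF j] by (cases "j = k") (auto simp: w'_def)
qed

end

section \<open>The Laurent phenomenon\<close>

context seed_sizes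
begin

definition ZL :: "seed => ambient set" where "ZL U = Z.lring (fst U) {..<N}"

text \<open>The upper bound at a seed. Integer coefficients are kept because the units among them
  are only 1 and -1.\<close>

definition upper :: "seed => ambient set" where
 "upper U = {z : ZL U. ALL k<n. z : ZL (mutate k U)}"

lemma ZL_wset:
 assumes v: "vseed U" and l: "l < n" and z: "z : ZL U" "z : ZL (mutate l U)"
 obtains s where "s : Z.wset {..<N} l (ycol U l)" "leval of_int (fst U) s = z"
proof -
 obtain s where s: "leval of_int (fst U) s = z" "pvars {..<N} s" using z(1) by (auto simp: ZL_def Z.lring_def)
 have "s : Z.wset {..<N} l (ycol U l)"
 proof (rule Z.wset_of_lring[OF vseed_fam[OF v] vseed_indep(2)[OF v] _ exps_keys(1)[OF v l] exps_keys(2)[OF v l] _ _ s])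
  show "exch_sum U l = mev (fst U) (nexp U l) * (1 + mev (fst U) (ycol U l))"
   using exch_sum_eq[OF v] by (simp add: yhat_def)
  show "z : Z.lring ((fst U)(l := exch_sum U l / fst U l)) {..<N}"
   using z(2) by (simp add: ZL_def fst_mutate)
 qed (use l nN exch_sum_nz[OF v l] in auto)
 thus ?thesis using s that by blast
qed

lemma wset_ZL:
 assumes v: "vseed U" and l: "l < n" and s: "s : Z.wset {..<N} l (ycol U l)"
 shows "leval of_int (fst U) s : ZL (mutate l U)" unfolding ZL_def fst_mutate
proof (rule Z.lring_of_wset[OF vseed_fam[OF v] _ exps_keys(1)[OF v l] exps_keys(2)[OF v l] _ _ s])
 show "exch_sum U l = mev (fst U) (nexp U l) * (1 + mev (fst U) (ycol U l))"
  using exch_sum_eq[OF v] by (simp add: yhat_def)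
qed (use l nN exch_sum_nz[OF v l] in auto)

text \<open>Independent columns \<open>k\<close> and \<open>l\<close> have a nonzero 2 x 2 minor, in
  some rows \<open>a\<close> and \<open>b\<close>. As a function of its other column, the minor with
  one column fixed to \<open>l\<close> is the weight.\<close>

lemma separating_weight:
 assumes f: "full_col B" and kl: "k < n" "l < n" "k ~= l" and om: "om = pvec N (%i. B $$ (i, k)) \<or> om = - pvec N (%i. B $$ (i, k))"
 shows "EX w. weight w & w (pvec N (%i. B $$ (i, l))) = 0 & w om ~= 0"
proof -
 let ?r = "%i. B $$ (i, l)" and ?s = "%i. B $$ (i, k)"
 have "EX a<N. EX b<N. ?r a * ?s b ~= ?r b * ?s a"
 proof (rule ccontr)
  assume "~ ?thesis"
  hence z: "?r a * ?s b = ?r b * ?s a" if "a < N" "b < N" for a b using that by blast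
  have "EX a<N. ?r a ~= 0"
  proof (rule ccontr)
   assume "~ ?thesis"
   hence z: "?r i = 0" if "i < N" for i using that by blast
   define w :: "nat => int" where "w j = of_bool (j = l)" for j
   have "(SUM j<n. B $$ (i, j) * w j) = 0" if "i < N" for i
    using z[OF that] by (intro sum.neutral) (auto simp: w_def)
   hence "w l = 0" using f kl unfolding full_col_def by blast
   thus False by (simp add: w_def)
  qed
  then obtain a where a: "a < N" "?r a ~= 0" by blast
  define w :: "nat => int" where "w j = (if j = k then ?r a else if j = l then - ?s a else 0)" for j
  have "(SUM j<n. B $$ (i, j) * w j) = 0" if i: "i < N" for i
  proof -
   have "(SUM j<n. B $$ (i, j) * w j) = (SUM j:{k, l}. B $$ (i, j) * w j)"
    using kl by (intro sum.mono_neutral_right) (auto simp: w_def)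
   also have "... = 0" using kl z[OF a(1) i] by (simp add: w_def mult.commute)
   finally show ?thesis .
  qed
  hence "w k = 0" using f kl unfolding full_col_def by blast
  thus False using a by (simp add: w_def)
 qed
 then obtain a b where ab: "a < N" "b < N" "?r a * ?s b ~= ?r b * ?s a" by blast
 define w where "w e = ?r a * lookup e b - ?r b * lookup e a" for e
 have "weight w" by (simp add: weight_def w_def algebra_simps)
 moreover have "w (pvec N ?r) = 0" using ab by (simp add: w_def)
 moreover have "w om ~= 0" using om ab by (auto simp: w_def)
 ultimately show ?thesis by blast
qed

text \<open>In the chart of \<open>mutate k U\<close>, an element that is Laurent in \<open>U\<close> and \<open>mutate l U\<close> satisfies the
 divisibility condition for direction \<open>l\<close> after multiplication by a power of the binomial
 \<open>1 + \<w>\<close> of direction \<open>k\<close>, hence satisfies it.\<close>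

lemma ZL_step:
 assumes v: "vseed U" and f: "full_col (snd U)" and k: "k < n" and l: "l < n" and kl: "k ~= l"
  and z: "z : ZL U" "z : ZL (mutate l U)" "z : ZL (mutate k U)"
 shows "z : ZL (mutate l (mutate k U))"
proof -
 define U' where "U' = mutate k U"
 have v': "vseed U'" unfolding U'_def by (rule vseed_mutate[OF v k])
 have f': "full_col (snd U')" unfolding U'_def by (rule full_col_mutate[OF v f k])
 let ?y = "fst U" and ?y' = "fst U'" and ?b = "%i j. snd U $$ (i, j)"
 interpret y: nzf ?y by (rule vseed_fam[OF v])
 interpret y': nzf ?y' by (rule vseed_fam[OF v'])
 have kN: "k < N" "l < N" using k l nN by auto
 define r' where "r' = ycol U' l"
 define W where "W = Z.wset {..<N} l r'"
 \<comment> \<open>The sign is chosen such that \<open>om\<close> contains the variable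
   \<open>l\<close> with the nonnegative exponent \<open>\<bar>?b l k\<bar>\<close> and the exchange
   polynomial of \<open>k\<close> is \<open>u\<close> times \<open>1 + om\<close>, with
   \<open>u\<close> free of the variable \<open>l\<close>.\<close>
 define pos where "pos <-> ?b k l >= 0"
 define om where "om = (if pos then ycol U' k else - ycol U' k)"
 define u where "u = (if pos then pexp U k else nexp U k)"
 define q where "q = 1 + mev ?y' om"
 have y'_eq: "?y' j = ?y j" if "j ~= k" for j using that by (simp add: U'_def fst_mutate)
 have bk': "snd U' $$ (i, k) = - ?b i k" if "i < N" for i
  using that mutate_entry k by (simp add: U'_def snd_mutate vseed_dim[OF v])
 have yk': "ycol U' k = - ycol U k"
  by (rule pm_eqI) (simp add: ycol_def vseed_dim[OF v] vseed_dim[OF v'] bk')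
 have r'_keys: "keys r' <= {..<N} - {l}" unfolding r'_def by (rule exps_keys(1)[OF v' l])
 have r'_keys': "keys r' <= {..<N}" using r'_keys by blast
 have r'_l: "lookup r' l = 0" using r'_keys by (auto simp: in_keys_iff)
 have om_keys: "keys om <= {..<N}" using exps_keys(1)[OF v' k] by (auto simp: om_def)
 have om_k: "k ~: keys om" using exps_keys(1)[OF v' k] by (auto simp: om_def)
 have u_keys: "keys u <= {..<N} - {k}" using exps_keys(2,3)[OF v k] by (auto simp: u_def)
 have sgn: "?b l k > 0 <-> ?b k l < 0" "?b k l > 0 <-> ?b l k < 0" using vseed_sign[OF v] k l by auto
 have om_l: "lookup om l = \<bar>?b l k\<bar>"
 using kN sgn by (auto simp: ycol_def vseed_dim[OF v'] bk' om_def pos_def)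
 have u_l: "lookup u l = 0" using sgn by (auto simp: u_def pexp_def nexp_def pos_def)
 have om_eval: "mev ?y' om = (if pos then 1 / yhat U k else yhat U k)"
 proof -
  have "mev ?y' om = mev ?y om" using om_k y'_eq by (intro mev_cong) metis
  thus ?thesis by (simp add: om_def yk' y.mev_uminus yhat_def divide_inverse)
 qed
 have u_eval: "mev ?y' u = (if pos then pos_monomial U k else neg_monomial U k)"
 proof -
  have "mev ?y' u = mev ?y u" using u_keys y'_eq by (intro mev_cong) auto
  thus ?thesis by (simp add: u_def pos_monomial_eq neg_monomial_eq)
 qed
 have E: "exch_sum U k = mev ?y' u * q"
  using exch_sum_eq[OF v, of k] pos_neg_monomial[OF v, of k] yhat_nz[OF v, of k] unfolding u_eval q_def om_eval
  by (auto simp: neg_monomial_eq distrib_left)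
 have q0: "q ~= 0" using E exch_sum_nz[OF v k] by auto
 have yy': "?y k = mev ?y' u * q / ?y' k"
  using E exch_sum_nz[OF v k] by (simp add: U'_def fst_mutate)
 define m where "m = nat \<bar>?b k l\<bar>"
 \<comment> \<open>The generator of direction \<open>l\<close> at \<open>U\<close>, expressed at
   \<open>U'\<close>. The y-hat variable changes by \<open>q ^ m\<close>, and for
   \<open>m > 0\<close> the difference \<open>q ^ m - 1\<close> is divisible by a monomial that
   contains the variable \<open>l\<close>.\<close>
 have yl: "(1 + yhat U l) / ?y l = (if pos then (1 + yhat U' l) / ?y' l + yhat U' l * ((q ^ m - 1) / ?y' l)
   else ((1 + yhat U' l) / ?y' l + (q ^ m - 1) / ?y' l) / q ^ m)"
 proof (cases pos)
  case True
  hence "pos_monomial U k / exch_sum U k = 1 / q" using E pos_monomial_nz[OF v, of k] by (simp add: u_eval)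
  hence "yhat U' l = yhat U l / q ^ m"
   using yhat_mutate(1)[OF v k l kl] True by (simp add: pos_def m_def U'_def power_divide)
  hence e: "yhat U l = yhat U' l * q ^ m" using q0 by simp
  show ?thesis using True kl unfolding e by (simp add: y'_eq add_divide_distrib[symmetric] algebra_simps)
 next
  case False
  hence "exch_sum U k / neg_monomial U k = q" using E neg_monomial_nz[OF v, of k] by (simp add: u_eval)
  hence e: "yhat U' l = yhat U l * q ^ m"
   using yhat_mutate(2)[OF v k l kl] False by (simp add: pos_def m_def U'_def)
  show ?thesis using False kl q0 unfolding e by (simp add: y'_eq field_simps)
 qed
 define q' :: "nat ex \<Rightarrow>\<^sub>0 int" where "q' = 1 + single om 1"
 have q'_eval: "leval of_int ?y' q' = q" by (simp add: q'_def q_def Z.leval_add)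
 have Wmult: "s * t : W" if "s : W" "t : W" for s t using that Z.wset_mult[OF r'_keys'] by (simp add: W_def)
 have Wadd: "s + t : W" if "s : W" "t : W" for s t using that Z.wset_add by (simp add: W_def)
 have Wsingle: "single e c : W" if "keys e <= {..<N}" "lookup e l >= 0" for e c
  using that Z.wset_single by (simp add: W_def)
 have W1: "1 : W" using Wsingle[of 0 1] by simp
 have q'W: "q' : W" unfolding q'_def by (intro Wadd W1 Wsingle om_keys) (simp add: om_l)
 have q'pW: "q' ^ i : W" for i by (induction i) (auto intro: W1 Wmult q'W)
 \<comment> \<open>The elements that satisfy the divisibility condition at \<open>U'\<close> after
   multiplication by a power of \<open>q\<close>. They form a ring in which \<open>q\<close> is
   invertible, so \<open>wset_eval\<close> applies.\<close>
 define Y where "Y = {x. EX i. EX p:W. q ^ i * x = leval of_int ?y' p}"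
 note ev = Z.leval_mult[OF y'.nzf_axioms] Z.leval_power[OF y'.nzf_axioms] Z.leval_add
 have Ybase: "leval of_int ?y' p : Y" if "p : W" for p
  using that unfolding Y_def by (intro CollectI exI[of _ 0] bexI[of _ p]) auto
 have Ymono: "mev ?y' e : Y" if "keys e <= {..<N}" "lookup e l >= 0" for e
  using Ybase[OF Wsingle[OF that, of 1]] by simp
 have Yadd: "a + b : Y" if ab: "a : Y" "b : Y" for a b
 proof -
  obtain i p where ip: "p : W" "q ^ i * a = leval of_int ?y' p" using ab(1) by (auto simp: Y_def)
  obtain j p' where jp: "p' : W" "q ^ j * b = leval of_int ?y' p'" using ab(2) by (auto simp: Y_def)
  have "q ^ (i + j) * (a + b) = leval of_int ?y' (q' ^ j * p + q' ^ i * p')"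
   by (simp add: ev q'_eval ip(2)[symmetric] jp(2)[symmetric] power_add algebra_simps)
  moreover have "q' ^ j * p + q' ^ i * p' : W" using ip jp by (intro Wadd Wmult q'pW)
  ultimately show ?thesis unfolding Y_def by blast
 qed
 have Ymult: "a * b : Y" if ab: "a : Y" "b : Y" for a b
 proof -
  obtain i p where ip: "p : W" "q ^ i * a = leval of_int ?y' p" using ab(1) by (auto simp: Y_def)
  obtain j p' where jp: "p' : W" "q ^ j * b = leval of_int ?y' p'" using ab(2) by (auto simp: Y_def)
  have "q ^ (i + j) * (a * b) = leval of_int ?y' (p * p')"
   by (simp add: ev ip(2)[symmetric] jp(2)[symmetric] power_add)
  moreover have "p * p' : W" using ip jp by (intro Wmult)
  ultimately show ?thesis unfolding Y_def by blast
 qed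
 have Yinv: "x / q ^ i : Y" if x: "x : Y" for x i
 proof -
  obtain j p where "p : W" "q ^ j * x = leval of_int ?y' p" using x by (auto simp: Y_def)
  moreover have "q ^ (i + j) * (x / q ^ i) = q ^ j * x" using q0 by (simp add: power_add)
  ultimately show ?thesis unfolding Y_def by (metis (mono_tags, lifting) mem_Collect_eq)
 qed
 have Y1: "1 : Y" using Ybase[OF W1] by simp
 have Yc: "of_int c : Y" for c using Ybase[OF Wsingle[of 0 c]] by simp
 have Yq: "q : Y" using Ybase[OF q'W] q'_eval by simp
 have Yqp: "q ^ i : Y" for i by (induction i) (auto intro: Y1 Ymult Yq)
 have Ysum: "(SUM i<a. q ^ i) : Y" for a using Yc[of 0] by (induction a) (auto intro: Yadd Yqp)
 have sing_keys: "keys (a + single j c) <= {..<N}" if "keys a <= {..<N}" "j < N" for a j and c :: int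
  using that Poly_Mapping.keys_add[of a "single j c"] by (auto split: if_splits)
 have geo: "(q ^ m - 1) / ?y' l : Y"
 proof (cases "m = 0")
  case True
  thus ?thesis using Yc[of 0] by simp
 next
  case False
  hence "\<bar>?b l k\<bar> >= 1" using sgn by (auto simp: m_def)
  hence "mev ?y' (om + single l (-1)) : Y"
   using om_keys kN by (intro Ymono sing_keys) (simp_all add: om_l)
  hence "mev ?y' om / ?y' l : Y" by (simp add: y'.mev_add divide_inverse)
  moreover have "q ^ m - 1 = mev ?y' om * (SUM i<m. q ^ i)"
   using power_diff_1_eq[of q m] by (simp add: q_def)
  ultimately show ?thesis using Ymult[OF `mev ?y' om / ?y' l : Y` Ysum[of m]] by (auto)
 qed
 obtain s where s: "s : Z.wset {..<N} l (ycol U l)" "leval of_int ?y s = z"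
  using ZL_wset[OF v l z(1,2)] by blast
 have "leval of_int ?y s : Y"
 proof (rule Z.wset_eval[OF y.nzf_axioms _ exps_keys(1)[OF v l] Yadd Ymult Yc _ _ _ _ s(1)])
  show "l : {..<N}" using kN by simp
  have single: "?y' j powi c : Y" if "j < N" "j ~= l" for j c
   using Ymono[of "single j c"] that by auto
  have umono: "mev ?y' u : Y" "mev ?y' (- u) : Y" using u_keys u_l by (intro Ymono; auto)+
  have "?y k = mev ?y' u * q * ?y' k powi (-1)" unfolding yy' by (simp add: divide_inverse)
  hence yk: "?y k : Y" using umono(1) Yq single[OF kN(1) kl, of "-1"] by (simp only: Ymult)
  have "inverse (?y k) = (mev ?y' (- u) * ?y' k powi 1) / q ^ 1"
   unfolding yy' by (simp add: y'.mev_uminus divide_inverse)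
  hence yk': "inverse (?y k) : Y" using umono(2) single[OF kN(1) kl, of 1] by (simp only: Ymult Yinv)
  show "?y j : Y" if "j : {..<N} - {l}" for j
   using single[of j 1] that yk by (cases "j = k") (auto simp: y'_eq)
  show "inverse (?y j) : Y" if "j : {..<N} - {l}" for j
   using single[of j "-1"] that yk' by (cases "j = k") (auto simp: y'_eq)
  show "?y l : Y" using Ymono[of "single l 1"] kN kl by (simp add: y'_eq)
  have bin: "(1 + yhat U' l) / ?y' l : Y"
   using Ybase[OF Z.wset_binomial[OF _ r'_keys, folded W_def]] kN
   by (simp add: ev yhat_def r'_def divide_inverse mult.commute)
  have "yhat U' l : Y" using Ymono[OF r'_keys'] r'_l by (simp add: yhat_def r'_def)
  hence "yhat U' l * ((q ^ m - 1) / ?y' l) : Y" using geo by (rule Ymult)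
  hence "(1 + yhat U l) / ?y l : Y"
   unfolding yl using Yadd[OF bin] Yinv[OF Yadd[OF bin geo], of m] by (cases pos) simp_all
  thus "(1 + mev ?y (ycol U l)) / ?y l : Y" by (simp add: yhat_def)
 qed
 then obtain i p1 where p1: "p1 : W" "q ^ i * z = leval of_int ?y' p1" by (auto simp: Y_def s(2))
 obtain p0 where p0: "pvars {..<N} p0" "z = leval of_int ?y' p0"
  using z(3) by (auto simp: ZL_def Z.lring_def U'_def)
 have q'v: "pvars {..<N} q'" using om_keys unfolding q'_def by (intro pvars_add pvars_1 pvars_single)
 have "q' ^ i * p0 = p1"
 proof (rule Z.indep_eq[OF vseed_indep(2)[OF v']])
  show "pvars {..<N} (q' ^ i * p0)" using q'v p0 by auto
  show "pvars {..<N} p1" using p1 Z.wset_pvars by (auto simp: W_def)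
  show "leval of_int ?y' (q' ^ i * p0) = leval of_int ?y' p1" using p1 p0 by (simp add: ev q'_eval)
 qed
 hence "q' ^ i * p0 : W" using p1 by simp
 \<comment> \<open>The powers of \<open>q'\<close> are cancelled one at a time. If the variable
   \<open>l\<close> does not occur in \<open>om\<close>, the independence of the columns
   \<open>k\<close> and \<open>l\<close> supplies the weight.\<close>
 hence "p0 : W"
 proof (induction i)
  case (Suc i)
  have "q' ^ i * p0 : W" unfolding W_def
  proof (rule Z.wset_regular[OF r'_keys' r'_l om_keys])
   show "pvars {..<N} (q' ^ i * p0)" using q'v p0 by auto
   show "(1 + single om 1) * (q' ^ i * p0) : Z.wset {..<N} l r'"
    using Suc.prems by (simp add: W_def q'_def mult.assoc)
   show "0 < lookup om l \<or> lookup om l = 0 & (EX w. weight w & w r' = 0 & w om ~= 0)"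
   proof (cases "?b l k = 0")
    case True
    hence "lookup om l = 0" by (simp add: om_l)
    thus ?thesis using separating_weight[OF f' k l kl, of om]
     by (auto simp: om_def r'_def ycol_def vseed_dim[OF v'])
   qed (simp add: om_l)
  qed
  thus ?case by (rule Suc.IH)
 qed simp
 thus ?thesis using wset_ZL[OF v' l] p0 by (simp add: W_def r'_def U'_def)
qed

lemma upper_mutate_subset:
 assumes "vseed U" "full_col (snd U)" "k < n"
 shows "upper U <= upper (mutate k U)"
proof
 fix z assume z: "z : upper U"
 have "z : ZL (mutate l (mutate k U))" if "l < n" for l
  using z that ZL_step[OF assms(1,2,3), of l z] mutate_mutate[OF assms(1,3)] assms(3) by (cases "k = l") (auto simp: upper_def)
 thus "z : upper (mutate k U)" using z assms(3) by (auto simp: upper_def)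
qed

lemma upper_mutate:
 assumes "vseed U" "full_col (snd U)" "k < n"
 shows "upper (mutate k U) = upper U"
 using upper_mutate_subset[OF assms] upper_mutate_subset[OF vseed_mutate[OF assms(1,3)] full_col_mutate[OF assms] assms(3)]
  mutate_mutate[OF assms(1,3)] by auto

lemma var_in_upper:
 assumes v: "vseed U" and i: "i < N"
 shows "fst U i : upper U"
proof -
 have self: "fst U i : ZL U" if "vseed U" for U
  using i Z.lring_var[of i "{..<N}" "fst U"] by (simp add: ZL_def)
 have "fst U i : ZL (mutate k U)" if k: "k < n" for k
 proof (cases "i = k")
  case False
  thus ?thesis using self[OF vseed_mutate[OF v k]] by (simp add: fst_mutate)
 next
  case True
  define U' where "U' = mutate k U"
  have v': "vseed U'" unfolding U'_def by (rule vseed_mutate[OF v k])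
  have "fst U i = fst (mutate k U') k" using mutate_mutate[OF v k] True by (simp add: U'_def)
  also have "... = exch_sum U' k * inverse (fst U' k)" by (simp add: fst_mutate divide_inverse)
  also have "... : ZL U'" unfolding ZL_def exch_sum_def pos_monomial_eq neg_monomial_eq
   using exps_keys(2,3)[OF v' k] k nN
   by (intro Z.lring_mult[OF vseed_fam[OF v']] Z.lring_add Z.lring_mev Z.lring_inverse_var) auto
  finally show ?thesis by (simp add: U'_def)
 qed
 thus ?thesis using self[OF v] by (auto simp: upper_def)
qed

lemma seeds_closed:
 assumes "vseed (initial_seed Bt)" "U : seeds Bt"
 shows "vseed U" "full_col Bt ==> full_col (snd U)" "full_col Bt ==> upper U = upper (initial_seed Bt)"
proof -
 have n: "dim_col Bt = n" using vseed_dim(3)[OF assms(1)] by (simp add: initial_seed_def)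
 have "vseed U & (full_col Bt --> full_col (snd U) & upper U = upper (initial_seed Bt))"
  using assms(2)
 proof induction
  case initial
  thus ?case using assms(1) by (simp add: initial_seed_def)
 next
  case (mutation U k)
  thus ?case using vseed_mutate full_col_mutate upper_mutate by (simp add: n)
 qed
 thus "vseed U" "full_col Bt ==> full_col (snd U)" "full_col Bt ==> upper U = upper (initial_seed Bt)" by auto
qed

end

section \<open>Subtraction-free elements and their orders of vanishing\<close>

definition nneg :: "('e \<Rightarrow>\<^sub>0 int) => bool" where
 "nneg p <-> (ALL e. lookup p e >= 0)"

text \<open>The monomial valuation of weight \<open>w\<close>. It is meaningful for nonzero
  \<open>p\<close> only, which is why orders below are defined by nonzero numerators and
  denominators.\<close>

definition minw :: "('e => int) => ('e \<Rightarrow>\<^sub>0 'c::zero) => int" where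
 "minw w p = Min (w ` keys p)"

lemma nneg_single: "c >= 0 ==> nneg (single e c)" by (simp add: nneg_def)

lemma nneg_add: "nneg p ==> nneg q ==> nneg (p + q)" by (simp add: nneg_def)

lemma nneg_mult: "nneg p ==> nneg q ==> nneg (p * q :: 'v ex \<Rightarrow>\<^sub>0 int)"
proof -
 assume p: "nneg p" and q: "nneg q"
 have s: "nneg (sum f A)" if "!!a. a : A ==> nneg (f a)" for f :: "'x => 'v ex \<Rightarrow>\<^sub>0 int" and A
  using that by (induction A rule: ifi) (auto intro: nneg_add simp: nneg_def)
 have "p * q = (SUM a:keys p. SUM b:keys q.
   single a (lookup p a) * single b (lookup q b))"
  by (subst pm_decomp[of p], subst pm_decomp[of q]) (simp add: sum_product)
 also have "nneg ..." using p q by (intro s) (simp add: nneg_single nneg_def nneg_def)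
 finally show "nneg (p * q)" .
qed

lemma keys_add_nneg:
 assumes "nneg p" "nneg q"
 shows "keys (p + q) = keys p \<union> keys q"
proof -
 have "lookup p e + lookup q e ~= 0 <-> lookup p e ~= 0 \<or> lookup q e ~= 0" for e
  using assms unfolding nneg_def by (metis add_nonneg_eq_0_iff)
 thus ?thesis by (auto simp: in_keys_iff)
qed

lemma minw_le: "e : keys p ==> minw w p <= w e" by (simp add: minw_def)

lemma minw_attained: "p ~= 0 ==> EX e:keys p. w e = minw w p"
proof -
 assume "p ~= 0"
 hence "minw w p : w ` keys p" unfolding minw_def by (intro Min_in) auto
 thus ?thesis by auto
qed

lemma minw_eqI: "e : keys p ==> (!!e'. e' : keys p ==> w e <= w e') ==> minw w p = w e"
 unfolding minw_def by (intro Min_eqI) auto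

lemma minw_single [simp]: "c ~= 0 ==> minw w (single e c) = w e" by (simp add: minw_def)

lemma minw_mult:
 fixes p q :: "('v::linorder \<Rightarrow>\<^sub>0 int) \<Rightarrow>\<^sub>0 'c::idom"
 assumes w: "weight w" and p: "p ~= 0" and q: "q ~= 0"
 shows "minw w (p * q) = minw w p + minw w q"
proof -
 let ?a = "minw w p" and ?b = "minw w q"
 have eq: "hcomp w d (p * q) = (if d = ?a + ?b then hcomp w ?a p * hcomp w ?b q else 0)" if "d <= ?a + ?b" for d
 proof -
  have z: "hcomp w a p * hcomp w (d - a) q = (if a = ?a & d = ?a + ?b then hcomp w ?a p * hcomp w ?b q else 0)"
   if "a : w ` keys p" for a
  proof (cases "a = ?a & d = ?a + ?b")
   case False
   have "?a <= a" using that minw_le by auto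
   hence "d - a < ?b" using False `d <= ?a + ?b` by auto
   hence "d - a ~: w ` keys q" using minw_le[of _ q w] by force
   thus ?thesis using hcomp_eq_0 by auto
  qed simp
  have "?a : w ` keys p" using minw_attained[OF p, of w] by force
  thus ?thesis by (simp add: hcomp_mult[OF w] z)
 qed
 have nz: "hcomp w (minw w r) r ~= 0" if "r ~= 0" for r :: "'v ex \<Rightarrow>\<^sub>0 'c"
  using minw_attained[OF that, of w] keys_hcomp by (metis (mono_tags, lifting) empty_iff keys_zero mem_Collect_eq)
 have "hcomp w (?a + ?b) (p * q) ~= 0" using nz[OF p] nz[OF q] by (simp add: eq)
 then obtain e where e: "e : keys (p * q)" "w e = ?a + ?b"
  using keys_hcomp by (metis (mono_tags, lifting) equals0I keys_eq_empty mem_Collect_eq)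
 have "w e <= w e'" if "e' : keys (p * q)" for e'
 proof (rule ccontr)
  assume "~ w e <= w e'"
  hence "hcomp w (w e') (p * q) = 0" using eq e by auto
  thus False using keys_hcomp[of w "w e'" "p * q"] that by auto
 qed
 thus ?thesis using minw_eqI[OF e(1), of w] e by simp
qed

lemma weight_neg: "weight w ==> weight (%e. - w e)" by (simp add: weight_def)

text \<open>Smallest and largest exponents are both additive under multiplication, so in every
  coordinate a factor of a monomial has equal smallest and largest exponent.\<close>

lemma unit_single:
 fixes p q :: "('v::linorder \<Rightarrow>\<^sub>0 int) \<Rightarrow>\<^sub>0 int"
 assumes "p * q = single e 1"
 obtains e' c where "p = single e' c"
proof -
 have "p * q ~= 0" unfolding assms by (metis lookup_single_eq lookup_zero zero_neq_one)
 hence nz: "p ~= 0" "q ~= 0" by auto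
 have eq: "lookup a i = minw (%e. lookup e i) p" if a: "a : keys p" for a i
 proof -
  let ?w = "%e. lookup e i"
  have "minw ?w p + minw ?w q = ?w e" "minw (%e. - ?w e) p + minw (%e. - ?w e) q = - ?w e"
   using minw_mult[OF weight_lookup[of i] nz] minw_mult[OF weight_neg[OF weight_lookup[of i]] nz] unfolding assms by auto
  moreover obtain b where "b : keys q" using nz by (metis all_not_in_conv keys_eq_empty)
  ultimately show ?thesis
   using minw_le[of a p ?w] minw_le[of a p "%e. - ?w e"] a minw_le[of b q ?w] minw_le[of b q "%e. - ?w e"] by force
 qed
 obtain e' where e': "e' : keys p" using nz by (metis all_not_in_conv keys_eq_empty)
 have "a = e'" if "a : keys p" for a using eq[OF that] eq[OF e'] by (intro pm_eqI) simp
 hence "p = single e' (lookup p e')" by (intro pm_eqI) (auto simp: in_keys_iff)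
 thus ?thesis by (rule that)
qed

text \<open>\<open>sford y S w z m\<close>: the element \<open>z\<close> is a quotient of Laurent polynomials in \<open>y\<close> with nonnegative
 coefficients, and its order with respect to the monomial valuation of weight \<open>w\<close> is \<open>m\<close>.\<close>

definition sford :: "(nat => ambient) => nat set => (nat ex => int) => ambient => int => bool" where
 "sford y S w z m <-> (EX p q. pvars S p & pvars S q & p ~= 0 & q ~= 0 & nneg p & nneg q &
  z * leval of_int y q = leval of_int y p & m = minw w p - minw w q)"

locale chart = nzf y for y :: "nat => ambient" +
 fixes S :: "nat set"
 assumes indep: "Z.indep y S"
begin

lemmas lmult = Z.leval_mult[OF nzf_axioms]

lemma leval_nz: "pvars S p ==> p ~= 0 ==> leval of_int y p ~= 0"
 using indep unfolding Z.indep_def by blast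

lemma sford_nz: "sford y S w z m ==> z ~= 0" unfolding sford_def using leval_nz by force

lemma sford_unique:
 assumes w: "weight w" and 1: "sford y S w z m" and 2: "sford y S w z m'"
 shows "m = m'"
proof -
 obtain p q where pq: "pvars S p" "pvars S q" "p ~= 0" "q ~= 0" "z * leval of_int y q = leval of_int y p" "m = minw w p - minw w q"
  using 1 unfolding sford_def by blast
 obtain p' q' where pq': "pvars S p'" "pvars S q'" "p' ~= 0" "q' ~= 0" "z * leval of_int y q' = leval of_int y p'" "m' = minw w p' - minw w q'"
  using 2 unfolding sford_def by blast
 have "leval of_int y (p * q') = leval of_int y (p' * q)" by (simp add: lmult pq(5)[symmetric] pq'(5)[symmetric])
 thus ?thesis using Z.indep_eq[OF indep] pq pq' pvars_mult minw_mult[OF w] by (smt (verit))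
qed

lemma sford_mono: "weight w ==> keys e <= S ==> sford y S w (mev y e) (w e)" unfolding sford_def
 by (intro exI[of _ "single e 1"] exI[of _ 1])
  (auto simp: pvars_single minw_def weight_0 nneg_def lookup_one)

lemma sford_1: "weight w ==> sford y S w 1 0" using sford_mono[of w 0] by (simp add: weight_0)

lemma sford_var: "weight w ==> v : S ==> sford y S w (y v) (w (single v 1))"
 using sford_mono[of w "single v 1"] by simp

lemma sford_mult:
 assumes w: "weight w" and 1: "sford y S w z m" and 2: "sford y S w z' m'"
 shows "sford y S w (z * z') (m + m')"
proof -
 obtain p q where pq: "pvars S p" "pvars S q" "p ~= 0" "q ~= 0" "nneg p" "nneg q" "z * leval of_int y q = leval of_int y p" "m = minw w p - minw w q"
  using 1 unfolding sford_def by blast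
 obtain p' q' where pq': "pvars S p'" "pvars S q'" "p' ~= 0" "q' ~= 0" "nneg p'" "nneg q'" "z' * leval of_int y q' = leval of_int y p'" "m' = minw w p' - minw w q'"
  using 2 unfolding sford_def by blast
 show ?thesis unfolding sford_def using pq pq' by (intro exI[of _ "p * p'"] exI[of _ "q * q'"])
   (auto simp: lmult minw_mult[OF w] nneg_mult pq'(7)[symmetric])
qed

lemma sford_inverse:
 assumes "sford y S w z m"
 shows "sford y S w (inverse z) (- m)"
proof -
 obtain p q where pq: "pvars S p" "pvars S q" "p ~= 0" "q ~= 0" "nneg p" "nneg q" "z * leval of_int y q = leval of_int y p" "m = minw w p - minw w q"
  using assms unfolding sford_def by blast
 show ?thesis unfolding sford_def
  using pq sford_nz[OF assms] by (intro exI[of _ q] exI[of _ p]) (auto simp: pq(7)[symmetric])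
qed

lemma sford_divide: "weight w ==> sford y S w z m ==> sford y S w z' m' ==> sford y S w (z / z') (m - m')"
 using sford_mult[of w z m "inverse z'" "- m'"] sford_inverse by (simp add: divide_inverse)

text \<open>Nonnegative coefficients cannot cancel, so the order of a sum is exactly the
  minimum.\<close>

lemma sford_add:
 assumes w: "weight w" and 1: "sford y S w z m" and 2: "sford y S w z' m'"
 shows "sford y S w (z + z') (min m m')"
proof -
 obtain p q where pq: "pvars S p" "pvars S q" "p ~= 0" "q ~= 0" "nneg p" "nneg q" "z * leval of_int y q = leval of_int y p" "m = minw w p - minw w q"
  using 1 unfolding sford_def by blast
 obtain p' q' where pq': "pvars S p'" "pvars S q'" "p' ~= 0" "q' ~= 0" "nneg p'" "nneg q'" "z' * leval of_int y q' = leval of_int y p'" "m' = minw w p' - minw w q'"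
  using 2 unfolding sford_def by blast
 have nn: "nneg (p * q')" "nneg (p' * q)" using pq pq' nneg_mult by auto
 have k: "keys (p * q' + p' * q) = keys (p * q') \<union> keys (p' * q)"
  by (rule keys_add_nneg[OF nn])
 hence nz: "p * q' + p' * q ~= 0" using pq pq' by (metis Un_empty keys_eq_empty no_zero_divisors)
 have ne: "keys (p * q') ~= {}" "keys (p' * q) ~= {}" using pq pq' by auto
 have "minw w (p * q' + p' * q) = min (minw w (p * q')) (minw w (p' * q))"
  unfolding minw_def k image_Un using ne by (intro Min_Un) auto
 hence m: "min m m' = minw w (p * q' + p' * q) - minw w (q * q')"
  using pq pq' by (simp add: minw_mult[OF w])
 have ev: "(z + z') * leval of_int y (q * q') = leval of_int y (p * q' + p' * q)"
  by (simp add: lmult Z.leval_add pq(7)[symmetric] pq'(7)[symmetric] algebra_simps)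
 show ?thesis unfolding sford_def
  using pq pq' m ev nz by (intro exI[of _ "p * q' + p' * q"] exI[of _ "q * q'"]) (auto intro: nneg_mult nneg_add)
qed

lemma sford_powi: "weight w ==> sford y S w z m ==> sford y S w (z powi k) (k * m)"
proof -
 assume w: "weight w" and z: "sford y S w z m"
 have nat: "sford y S w (z ^ j) (int j * m)" for j
 proof (induction j)
  case (Suc j)
  thus ?case using sford_mult[OF w z Suc] by (simp add: algebra_simps)
 qed (simp add: sford_1[OF w])
 show ?thesis
 using nat[of "nat k"] sford_inverse[OF nat[of "nat (- k)"]] by (cases "k >= 0") (auto simp: power_int_def power_inverse)
qed

lemma sford_prod: "weight w ==> (!!i. i : A ==> sford y S w (f i) (g i)) ==> sford y S w (prod f A) (sum g A)"
 by (induction A rule: ifi) (auto intro: sford_1 sford_mult)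

lemma sford_mev:
 assumes "weight w" "!!v. v : keys e ==> sford y S w (y' v) (g v)"
 shows "sford y S w (mev y' e) (SUM v:keys e. lookup e v * g v)"
 unfolding mev_def using assms by (intro sford_prod sford_powi) auto

lemma sford_leval:
 assumes w: "weight w" and p: "nneg p" "p ~= 0"
  and e: "!!e. e : keys p ==> sford y S w (mev y' e) (w' e)"
 shows "sford y S w (leval of_int y' p) (minw w' p)"
proof -
 have const: "sford y S w (of_int c) 0" if "c > 0" for c
 proof -
  have "sford y S w (of_nat (Suc k)) 0" for k
  proof (induction k)
   case (Suc k)
   thus ?case using sford_add[OF w sford_1[OF w] Suc] by simp
  qed (simp add: sford_1[OF w])
  from this[of "nat (c - 1)"] show ?thesis using that by simp
 qed
 have "sford y S w (SUM e:A. of_int (lookup p e) * mev y' e) (Min (w' ` A))"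
  if "finite A" "A ~= {}" "A <= keys p" for A using that
 proof (induction A rule: finite_ne_induct)
  case (singleton x)
  thus ?case using p sford_mult[OF w const e[of x]] by (auto simp: nneg_def order_less_le)
 next
  case (insert x A)
  thus ?case using p sford_mult[OF w const e[of x]] sford_add[OF w]
by (auto simp: nneg_def in_keys_iff order_less_le)
 qed
 from this[of "keys p"] show ?thesis using p by (simp add: leval_def minw_def)
qed

text \<open>Orders are compared across charts: substitution into a Laurent polynomial with
  nonnegative coefficients is exact for orders, hence it suffices to know the orders of the
  variables substituted.\<close>

lemma sford_transfer:
 assumes w: "weight w" and w': "weight w'" and var: "!!v. v : S' ==> sford y S w (y' v) (w' (single v 1))"
  and z: "sford y' S' w' z m" and ch: "chart y' S'"
 shows "sford y S w z m"
proof -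
 interpret y': chart y' S' by (rule ch)
 obtain p q where pq: "pvars S' p" "pvars S' q" "p ~= 0" "q ~= 0" "nneg p" "nneg q"
  "z * leval of_int y' q = leval of_int y' p" "m = minw w' p - minw w' q"
  using z unfolding sford_def by blast
 have mono: "sford y S w (mev y' e) (w' e)" if "keys e <= S'" for e
 proof -
  have "w' (single v (int k)) = int k * w' (single v 1)" for v k
   by (induction k) (use w' in "simp_all add: weight_0 single_add weight_def algebra_simps")
  hence s: "w' (single v c) = c * w' (single v 1)" for v c
   using weight_uminus[OF w', of "single v (- c)"] by (cases c rule: int_cases2) (auto simp: single_uminus)
  have "w' (sum f A) = (SUM a:A. w' (f a))" for f :: "nat => _" and A
   using w' by (induction A rule: ifi) (auto simp: weight_0 weight_def)
  hence "w' e = (SUM v:keys e. lookup e v * w' (single v 1))"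
   by (subst pm_decomp[of e]) (simp add: s[of _ "lookup e _"])
  thus ?thesis using sford_mev[OF w, of e y' "%v. w' (single v 1)"] var that by auto
 qed
 have "sford y S w (leval of_int y' p) (minw w' p)" "sford y S w (leval of_int y' q) (minw w' q)"
  using pq mono by (intro sford_leval[OF w]; simp add: pvars_def)+
 from sford_divide[OF w this] show ?thesis using y'.leval_nz[OF pq(2,4)] by (simp add: pq(7)[symmetric] pq(8))
qed

lemma sford_lookup_ge:
 assumes w: "weight w" and z: "sford y S w (leval of_int y p) m" and p: "pvars S p" and e: "e : keys p"
 shows "m <= w e"
proof -
 obtain p' q where pq: "pvars S p'" "pvars S q" "p' ~= 0" "q ~= 0" "leval of_int y p * leval of_int y q = leval of_int y p'" "m = minw w p' - minw w q"
  using z unfolding sford_def by blast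
 hence "p * q = p'" using p by (intro Z.indep_eq[OF indep]) (auto simp: lmult)
 moreover have "p ~= 0" using e by auto
 ultimately show ?thesis using pq minw_mult[OF w, of p q] minw_le[OF e] by (auto)
qed

lemma sford_minus_one: "~ sford y S w (- 1) m"
proof
 assume "sford y S w (- 1) m"
 then obtain p q where pq: "pvars S p" "pvars S q" "p ~= 0" "q ~= 0" "nneg p" "nneg q" "- leval of_int y q = leval of_int y p"
  unfolding sford_def by auto
 hence "p + q = 0" using indep unfolding Z.indep_def by (metis Z.leval_add add.left_inverse pvars_add)
 thus False using keys_add_nneg[OF pq(5,6)] pq by auto
qed

end

context seed_sizes
begin

lemma vseed_chart: "vseed U ==> chart (fst U) {..<N}"
 using vseed_fam vseed_indep(2) by (simp add: chart_def chart_axioms_def)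

text \<open>Mutations are involutions, so an induction over all seeds may start at an arbitrary
  one.\<close>

lemma seeds_connected:
 assumes v: "vseed (initial_seed Bt)" and s: "U : seeds Bt" "U' : seeds Bt" and Q: "Q U"
  and step: "!!U k. vseed U ==> Q U ==> k < n ==> Q (mutate k U)"
 shows "Q U'"
proof -
 have n: "dim_col Bt = n" using vseed_dim(3)[OF v] by (simp add: initial_seed_def)
 have "Q (initial_seed Bt)" using s(1) Q
 proof induction
  case (mutation U k)
  note vs = seeds_closed(1)[OF v mutation(1)]
  have k: "k < n" using mutation(2) n by simp
  show ?case
   using step[OF vseed_mutate[OF vs k] mutation.prems k] mutate_mutate[OF vs k] mutation.IH by simp
 qed
 thus ?thesis using s(2)
 proof (induction rule: seeds.induct[consumes 2, OF s(2)])
 qed (use step seeds_closed(1)[OF v] n in auto)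
qed

text \<open>The exchange relation made tropical: products become sums, the sum of the two monomials
  becomes a minimum.\<close>

lemma sford_mutate:
 assumes v: "vseed U" and v': "vseed U'" and w: "weight w" and k: "k < n"
  and g: "!!i. i < N ==> sford (fst U) {..<N} w (fst U' i) (g i)"
 shows "sford (fst U) {..<N} w (fst (mutate k U') k)
  (min (SUM i<N. max 0 (snd U' $$ (i, k)) * g i) (SUM i<N. max 0 (- snd U' $$ (i, k)) * g i) - g k)"
proof -
 interpret chart "fst U" "{..<N}" by (rule vseed_chart[OF v])
 have "sford (fst U) {..<N} w (mev (fst U') (pvec N f)) (SUM i<N. f i * g i)" for f
  unfolding mev_pvec using g by (intro sford_prod sford_powi w) auto
 from sford_add[OF w this this] show ?thesis
  unfolding fst_mutate exch_sum_def pos_monomial_eq neg_monomial_eq pexp_def nexp_def vseed_dim[OF v']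
using g k nN by (auto intro: sford_divide[OF w])
qed

lemma seeds_sford:
 assumes v: "vseed (initial_seed Bt)" and s: "U : seeds Bt" "U' : seeds Bt" and w: "weight w" and i: "i < N"
 shows "EX m. sford (fst U) {..<N} w (fst U' i) m"
proof -
 note vs = seeds_closed(1)[OF v s(1)]
 interpret chart "fst U" "{..<N}" by (rule vseed_chart[OF vs])
 define Q where "Q T <-> (ALL i<N. EX m. sford (fst U) {..<N} w (fst T i) m)" for T :: seed
 have "Q U'"
 proof (rule seeds_connected[OF v s])
  show "Q U" unfolding Q_def using sford_var[OF w] by blast
  fix T k assume T: "vseed T" "Q T" "k < n"
  then obtain g where "!!i. i < N ==> sford (fst U) {..<N} w (fst T i) (g i)" unfolding Q_def by metis
  from sford_mutate[OF vs T(1) w T(3) this] show "Q (mutate k T)"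
   using T(2) unfolding Q_def by (auto simp: fst_mutate)
 qed
 thus ?thesis using i by (simp add: Q_def)
qed

text \<open>At most one of the two monomials of an exchange relation contains a given frozen
  variable, so the minimum is 0 and orders along that variable never change.\<close>

lemma sford_frozen:
 assumes v: "vseed (initial_seed Bt)" and s: "U : seeds Bt" "U' : seeds Bt" and f: "n <= f" "f < N" and i: "i < N"
 shows "sford (fst U) {..<N} (%e. lookup e f) (fst U' i) (of_bool (i = f))"
proof -
 let ?w = "%e. lookup e f"
 note vs = seeds_closed(1)[OF v s(1)]
 interpret chart "fst U" "{..<N}" by (rule vseed_chart[OF vs])
 define Q where "Q T <-> (ALL i<N. sford (fst U) {..<N} ?w (fst T i) (of_bool (i = f)))" for T :: seed
 have "Q U'"
 proof (rule seeds_connected[OF v s])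
  show "Q U" unfolding Q_def
  proof (intro allI impI)
   fix i assume "i < N"
   thus "sford (fst U) {..<N} ?w (fst U i) (of_bool (i = f))"
    using sford_var[OF weight_lookup, of i f] by (cases "i = f") simp_all
  qed
  fix T k assume T: "vseed T" "Q T" "k < n"
  have [simp]: "(SUM i<N. h i * of_bool (i = f)) = h f" for h :: "nat => int" using f by simp
  have "min (max 0 (snd T $$ (f, k))) (max 0 (- snd T $$ (f, k))) = 0" by auto
  thus "Q (mutate k T)"
   using sford_mutate[OF vs T(1) weight_lookup T(3), of f "%i. of_bool (i = f)"] T f unfolding Q_def by (auto simp: fst_mutate)
 qed
 thus ?thesis using i by (simp add: Q_def)
qed

text \<open>A cluster variable \<open>x\<close> that vanishes along the cluster variable \<open>v\<close> is divisible by it in the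
 upper cluster algebra; in a chart containing \<open>x\<close>, \<open>v\<close> is then a divisor of a monomial.\<close>

lemma monomial_of_pos_order:
 assumes v: "vseed (initial_seed Bt)" and f: "full_col Bt" and s: "U : seeds Bt" "U' : seeds Bt"
  and l: "l < n" and i: "i < N" and m: "sford (fst U) {..<N} (%e. lookup e l) (fst U' i) m" "m >= 1"
 obtains e where "keys e <= {..<N}" "fst U l = mev (fst U') e"
proof -
 let ?w = "%e. lookup e l" and ?y = "fst U" and ?x = "fst U' i"
 note vs = seeds_closed(1)[OF v s(1)] and vs' = seeds_closed(1)[OF v s(2)]
 have dimc: "dim_col Bt = n" using vseed_dim(3)[OF v] by (simp add: initial_seed_def)
 interpret y: chart ?y "{..<N}" by (rule vseed_chart[OF vs])
 interpret y': chart "fst U'" "{..<N}" by (rule vseed_chart[OF vs'])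
 have lN: "l < N" using l nN by simp
 \<comment> \<open>Order at least 1 means that every term of the Laurent expansion of
   \<open>?x\<close> contains the variable \<open>l\<close>; division by it leaves a Laurent
   polynomial without negative powers of that variable.\<close>
 have div: "?x / fst T l : ZL T" and low: "EX p. pvars {..<N} p & leval of_int (fst T) p = ?x / fst T l & (ALL e:keys p. ?w e >= 0)"
  if T: "T : seeds Bt" and mT: "sford (fst T) {..<N} ?w ?x m" for T
 proof -
  note vT = seeds_closed(1)[OF v T]
  interpret t: chart "fst T" "{..<N}" by (rule vseed_chart[OF vT])
  have "?x : upper U'" by (rule var_in_upper[OF vs' i])
  hence "?x : upper T" using seeds_closed(3)[OF v _ f] T s by auto
  then obtain p where p: "pvars {..<N} p" "leval of_int (fst T) p = ?x" by (auto simp: upper_def ZL_def Z.lring_def)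
  define q :: "nat ex \<Rightarrow>\<^sub>0 int" where "q = single (single l (-1)) 1 * p"
  have q: "leval of_int (fst T) q = ?x / fst T l" by (simp add: q_def t.lmult p divide_inverse)
  have pq: "pvars {..<N} q" unfolding q_def using lN p by (intro pvars_mult pvars_single) auto
  have "?w e >= 0" if e: "e : keys q" for e
  proof -
   obtain a b where ab: "a : keys (single (single l (-1::int)) (1::int))" "b : keys p" "e = a + b"
    using e keys_mult unfolding q_def by blast
   show ?thesis using t.sford_lookup_ge[OF weight_lookup, of l p m b] mT p ab m by auto
  qed
  thus "EX p. pvars {..<N} p & leval of_int (fst T) p = ?x / fst T l & (ALL e:keys p. ?w e >= 0)" using pq q by blast
  show "?x / fst T l : ZL T" unfolding ZL_def q[symmetric] by (rule Z.lring_memI[OF pq])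
 qed
 have "?x / ?y l : upper U" unfolding upper_def
 proof (intro CollectI conjI allI impI)
  show "?x / ?y l : ZL U" by (rule div[OF s(1) m(1)])
  fix k assume k: "k < n"
  define T where "T = mutate k U"
  have T: "T : seeds Bt" unfolding T_def using s k dimc by (auto intro: seeds.mutation)
  show "?x / ?y l : ZL (mutate k U)"
  proof (cases "k = l")
   case True
   \<comment> \<open>Without negative powers of the variable \<open>l\<close>, the divisibility
     condition for the exchange at \<open>l\<close> is empty.\<close>
   obtain p where p: "pvars {..<N} p" "leval of_int ?y p = ?x / ?y l" "ALL e:keys p. ?w e >= 0"
    using low[OF s(1) m(1)] by blast
   have "(SUM e:A. single e (lookup p e)) : Z.wset {..<N} l (ycol U l)" if "A <= keys p" for A
    using finite_subset[OF that finite_keys] that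
   proof (induction A rule: finite_induct)
    case empty
    thus ?case using Z.wset_single[of 0 "{..<N}" l 0] by simp
   next
    case (insert e A)
    hence "keys e <= {..<N}" "?w e >= 0" using p by (auto simp: pvars_def)
    hence "single e (lookup p e) : Z.wset {..<N} l (ycol U l)" by (intro Z.wset_single)
    from Z.wset_add[OF this] show ?case using insert by simp
   qed
   thus ?thesis using pm_decomp[of p] order_refl wset_ZL[OF vs l, of p] p(2) True by (smt (verit))
  next
   case False
   note vT = seeds_closed(1)[OF v T]
   interpret t: chart "fst T" "{..<N}" by (rule vseed_chart[OF vT])
   \<comment> \<open>Mutation at \<open>k\<close> keeps the variable \<open>l\<close> and introduces
     one of order 0 along it, so \<open>?x\<close> has the same order in the charts of
     \<open>U\<close> and \<open>T\<close>.\<close>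
   obtain m' where m': "sford (fst T) {..<N} ?w ?x m'" using seeds_sford[OF v T s(2) weight_lookup i] by blast
   define g :: "nat => int" where "g i = of_bool (i = l)" for i
   have g: "sford ?y {..<N} ?w (?y i) (g i)" if "i < N" for i
    using y.sford_var[OF weight_lookup, of i l] that by (cases "i = l") (simp_all add: g_def)
   have [simp]: "(SUM i<N. h i * g i) = h l" for h :: "nat => int" using lN by (simp add: g_def)
   have "min (max 0 (snd U $$ (l, k))) (max 0 (- snd U $$ (l, k))) = 0" by auto
   hence gT: "sford ?y {..<N} ?w (fst T i) (g i)" if "i < N" for i
   proof (cases "i = k")
    case True
    have "g k = 0" using False by (simp add: g_def)
    thus ?thesis
     using sford_mutate[OF vs vs weight_lookup k g] `min _ _ = 0` True by (simp add: T_def)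
   qed (use g[OF that] in "simp add: T_def fst_mutate")
   have "sford ?y {..<N} ?w ?x m'"
   proof (rule y.sford_transfer[OF weight_lookup weight_lookup _ m' t.chart_axioms])
    fix v assume "v : {..<N}"
    thus "sford ?y {..<N} ?w (fst T v) (?w (single v 1))"
     using gT[of v] by (cases "v = l") (simp_all add: g_def)
   qed
   thus ?thesis using y.sford_unique[OF weight_lookup m(1)] div[OF T] m' False
    by (auto simp: T_def fst_mutate)
  qed
 qed
 moreover have "upper U = upper U'" using seeds_closed(3)[OF v _ f] s by simp
 ultimately have "?x / ?y l : upper U'" "?y l : upper U'" using var_in_upper[OF vs lN] by auto
 hence "?x / ?y l : ZL U'" "?y l : ZL U'" by (auto simp: upper_def)
 then obtain p q where p: "pvars {..<N} p" "leval of_int (fst U') p = ?x / ?y l"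
  and q: "pvars {..<N} q" "leval of_int (fst U') q = ?y l" unfolding ZL_def Z.lring_def by fastforce
 \<comment> \<open>In the chart of \<open>U'\<close> the two factors multiply to the single variable
   \<open>?x\<close>, so both are monomials up to sign.\<close>
 have qp: "q * p = single (single i 1) 1"
  using p q i by (intro Z.indep_eq[OF y'.indep]) (auto simp: y'.lmult intro: pvars_single)
 obtain e c where ec: "q = single e c" using unit_single[OF qp] by blast
 obtain e' c' where ec': "p = single e' c'" using unit_single qp by (metis mult.commute)
 have "c * c' = 1" using arg_cong[OF qp, of "%p. lookup p (single i 1)"]
  by (auto simp: ec ec' mult_single split: if_splits)
 hence "\<bar>c\<bar> = 1" by (metis abs_zmult_eq_1 abs_one)
 moreover have e: "keys e <= {..<N}" using q(1) ec \<open>\<bar>c\<bar> = 1\<close> by (auto simp: pvars_def)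
 \<comment> \<open>The sign is excluded because -1 is not a quotient of Laurent polynomials with
   nonnegative coefficients.\<close>
 moreover have "c ~= - 1"
 proof
  assume "c = - 1"
  hence "- 1 = ?y l / mev (fst U') e" using q(2) ec by (auto simp: field_simps)
  moreover obtain m' where "sford (fst U') {..<N} ?w (?y l) m'" using seeds_sford[OF v s(2,1) weight_lookup lN] by blast
  ultimately show False using y'.sford_minus_one y'.sford_divide[OF weight_lookup] y'.sford_mono[OF weight_lookup e] by metis
 qed
 ultimately show ?thesis using that[OF e] q(2) ec by (cases "c = 1") auto
qed

end

section \<open>The initial seed\<close>

lemma init_var_nz [simp]: "init_var i ~= 0"
proof
 assume "init_var i = 0"
 hence "(single (single i 1) 1 :: (nat \<Rightarrow>\<^sub>0 nat) \<Rightarrow>\<^sub>0 complex) = 0"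
  by (simp add: init_var_def Zero_fract_def eq_fract)
 thus False by (metis lookup_single_eq lookup_zero zero_neq_one)
qed

interpretation init: nzf init_var by unfold_locales simp

lemma init_var_indep: "C.indep init_var S" unfolding C.indep_def
proof (intro allI impI)
 fix p :: "nat laurent"
 assume z: "ev init_var p = 0"
 \<comment> \<open>Multiplication by the monomial \<open>e0\<close> clears all negative exponents
   and reduces the claim to polynomials inside their fraction field.\<close>
 define e0 where "e0 = (SUM e:keys p. Poly_Mapping.map abs e)"
 define nx where "nx e = Poly_Mapping.map nat (e + e0)" for e
 have e0: "lookup e v + lookup e0 v >= 0" if "e : keys p" for e v
 proof -
  have l: "lookup (Poly_Mapping.map abs e) v = \<bar>lookup e v\<bar>" for e :: "nat ex"
   by (simp add: Poly_Mapping.map.rep_eq)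
  have "\<bar>lookup e v\<bar> <= lookup e0 v"
   unfolding e0_def lookup_sum l by (rule member_le_sum[OF that]) auto
  thus ?thesis by linarith
 qed
 have nx: "lookup (nx e) v = nat (lookup e v + lookup e0 v)" for e v
  by (simp add: nx_def Poly_Mapping.map.rep_eq)
 have inj: "inj_on nx (keys p)"
 proof (rule inj_onI)
  fix a b assume ab: "a : keys p" "b : keys p" "nx a = nx b"
  show "a = b"
  proof (rule pm_eqI)
   fix v show "lookup a v = lookup b v"
    using nx[of a v] nx e0[OF ab(1), of v] e0[OF ab(2), of v] ab(3) by simp
  qed
 qed
 have mono: "mev init_var (e + e0) = Fract (single (nx e) 1) 1" if "e : keys p" for e
 proof -
  have pw: "init_var v ^ k = Fract (single (single v k) 1) 1" for v k
   by (induction k) (simp_all add: One_fract_def init_var_def single_add[symmetric])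
  have "mev init_var (e + e0) = (PROD v:keys (e + e0). init_var v ^ lookup (nx e) v)"
   unfolding mev_def using e0[OF that] by (intro prod.cong refl) (simp add: power_int_def nx)
  also have "... = Fract (single (SUM v:A. single v (lookup (nx e) v)) 1) 1"
   if "A = keys (e + e0)" for A
   unfolding that[symmetric] pw by (induction A rule: ifi) (simp_all add: One_fract_def)
  finally have "mev init_var (e + e0) =
    Fract (single (SUM v:keys (e + e0). single v (lookup (nx e) v)) 1) 1" by blast
  also have "(SUM v:keys (e + e0). single v (lookup (nx e) v)) = nx e"
  by (rule pm_eqI) (auto simp: nx in_keys_iff)
  finally show ?thesis .
 qed
 have "0 = ev init_var p * mev init_var e0" using z by simp
 also have "... = (SUM e:keys p. scalar (lookup p e) * mev init_var (e + e0))"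
  by (simp add: leval_def sum_distrib_right init.mev_add mult.assoc)
 also have "... = (SUM e:keys p. Fract (single (nx e) (lookup p e)) 1)"
  by (intro sum.cong refl) (simp add: mono scalar_def)
 also have "... = Fract (SUM e:A. single (nx e) (lookup p e)) 1" if "A = keys p" for A
  unfolding that[symmetric] by (induction A rule: ifi) (simp_all add: Zero_fract_def)
 finally have s0: "(SUM e:keys p. single (nx e) (lookup p e)) = 0"
  by (simp add: Zero_fract_def eq_fract)
 have "lookup p e = 0" for e
 proof (cases "e : keys p")
  case True
  have "0 = lookup (SUM e':keys p. single (nx e') (lookup p e')) (nx e)" by (simp add: s0)
  also have "... = (SUM e':keys p. if e' = e then lookup p e' else 0)"
   unfolding lookup_sum using inj True by (intro sum.cong refl) (auto dest: inj_onD)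
  finally show ?thesis using True by simp
 qed (simp add: in_keys_iff)
 thus "p = 0" by (intro pm_eqI) simp
qed

section \<open>The bipartite belt\<close>

lemma fold_mutate_snd: "snd (fold mutate ks U) = fold mutate_matrix ks (snd U)"
 by (induction ks arbitrary: U) (simp_all add: snd_mutate)

lemma fold_mutate_fst: "i ~: set ks ==> fst (fold mutate ks U) i = fst U i"
 by (induction ks arbitrary: U) (simp_all add: fst_mutate)

lemma source_sequence_nth:
 "source_sequence B ks ==> m < length ks ==> is_source (fold mutate_matrix (take m ks) B) (ks ! m)"
proof (induction ks arbitrary: B m)
 case (Cons k ks)
 thus ?case by (cases m) auto
qed simp

declare cvar.simps [simp del]

text \<open>The principal part is encoded by heights: an edge runs from the lower to the higher
  vertex.\<close>

locale belt = height +
 fixes N :: nat and Bt :: "int mat"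
 assumes nN: "n <= N" and Bt: "Bt : carrier_mat N n"
  and Bt_entry: "!!i j. i < n ==> j < n ==> Bt $$ (i, j) = (ht j - ht i) * adj i j"

sublocale belt \<subseteq> seed_sizes n N sym_weight
 by unfold_locales (use nN sym_weight_pos in auto)

context belt
begin

lemma height_cases: "adj i j > 0 ==> ht j = ht i + 1 & ht i ~= ht j + 1 \<or> ht i = ht j + 1 & ht j ~= ht i + 1"
 using height_step[of i j] by linarith

lemma adj_nonpos: "~ 0 < adj i j ==> adj i j = 0" "adj i j <= 0 ==> adj i j = 0"
 using adj_nonneg[of i j] by linarith+

lemma adj_dom: "adj i j > 0 ==> i < n & j < n" by (auto simp: adj_def split: if_splits)

lemma initial_vseed: "vseed (initial_seed Bt)"
proof -
 have "sym_weight i * of_int (Bt $$ (i, j)) = - (sym_weight j * of_int (Bt $$ (j, i)))" if "i < n" "j < n" for i j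
 using sym_weight_sym[OF that] A_eq_adj[OF that] A_eq_adj[OF that(2,1)] that by (cases "i = j") (auto simp: Bt_entry algebra_simps)
 thus ?thesis using Bt init_var_indep init_var_nz unfolding vseed_def initial_seed_def fst_conv snd_conv by blast
qed

lemma dimc: "dim_col Bt = n" and dimr: "dim_row Bt = N" using Bt by auto

text \<open>The matrix when exactly the vertices of \<open>D\<close> have been mutated in the
  current sweep. Mutation at a source only reverses the arrows there, so signs change exactly
  between \<open>D\<close> and its complement.\<close>

definition blk :: "nat set => int mat => bool" where
 "blk D M <-> M : carrier_mat N n &
  (ALL i<n. ALL j<n. M $$ (i, j) = (ht j - ht i) * adj i j * (if (i : D) = (j : D) then 1 else - 1))"

lemma blk_entry: "blk D M ==> i < n ==> j < n ==> M $$ (i, j) = (ht j - ht i) * adj i j * (if (i : D) = (j : D) then 1 else - 1)"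
 unfolding blk_def by blast

lemma blk_source:
 assumes b: "blk D M" and k: "k < n" "k ~: D"
 shows "is_source M k <-> (ALL i. adj i k > 0 --> (i : D <-> ht k = ht i + 1))"
proof -
 have "M $$ (i, k) > 0 <-> adj i k > 0 & (i : D <-> ht k ~= ht i + 1)" if i: "i < n" for i
 proof (cases "adj i k > 0")
  case True
  thus ?thesis using blk_entry[OF b i k(1)] height_cases[OF True] k by auto
 next
  case False
  hence "adj i k = 0" by (rule adj_nonpos)
  thus ?thesis using blk_entry[OF b i k(1)] by simp
 qed
 moreover have "dim_col M = n" using b by (auto simp: blk_def)
 ultimately show ?thesis using adj_dom unfolding is_source_def by blast
qed

lemma blk_col:
 assumes b: "blk D M" and k: "k < n" "k ~: D" and s: "is_source M k" and i: "i < n"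
 shows "M $$ (i, k) = - adj i k" "M $$ (k, i) = adj k i"
proof -
 consider "adj i k = 0" "adj k i = 0" | "adj i k > 0"
  using adj_nonneg[of i k] adj_nonneg[of k i] adj_pos_sym[of i k] by linarith
 hence "M $$ (i, k) = - adj i k & M $$ (k, i) = adj k i"
 proof cases
  case 1
  thus ?thesis using blk_entry[OF b i k(1)] blk_entry[OF b k(1) i] by simp
 next
  case 2
  thus ?thesis using s blk_source[OF b k] blk_entry[OF b i k(1)] blk_entry[OF b k(1) i] height_cases[OF 2] k
   by (auto)
 qed
 thus "M $$ (i, k) = - adj i k" "M $$ (k, i) = adj k i" by auto
qed

lemma blk_mutate:
 assumes b: "blk D M" and k: "k < n" "k ~: D" and s: "is_source M k"
 shows "blk (insert k D) (mutate_matrix k M)"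
proof -
 have M: "M : carrier_mat N n" using b by (simp add: blk_def)
 have "mutate_matrix k M $$ (i, j) = (ht j - ht i) * adj i j * (if (i : insert k D) = (j : insert k D) then 1 else - 1)"
  if ij: "i < n" "j < n" for i j
 using ij nN mutate_entry M blk_col[OF b k s ij(1)] blk_col[OF b k s ij(2)] k by (auto simp: blk_entry[OF b ij])
 thus ?thesis using M by (auto simp: blk_def)
qed

lemma source_sequence_sorted:
 assumes "blk D M" "distinct ks" "set ks \<inter> D = {}" "D \<union> set ks = {..<n}" "sorted (map ht ks)"
  "!!i k. i : D ==> k : set ks ==> ht i <= ht k"
 shows "source_sequence M ks" using assms
proof (induction ks arbitrary: D M)
 case (Cons k ks)
 have k: "k < n" "k ~: D" using Cons.prems by auto
 have "i : D <-> ht k = ht i + 1" if a: "adj i k > 0" for i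
 proof -
  have "i : D \<or> i : set ks \<or> i = k" using Cons.prems(4) adj_dom[OF a] by auto
  thus ?thesis using height_cases[OF a] Cons.prems(3,5) Cons.prems(6)[of i k] by auto
 qed
 hence s: "is_source M k" using blk_source[OF Cons.prems(1) k] by blast
 have "source_sequence (mutate_matrix k M) ks"
  using Cons.prems by (intro Cons.IH[OF blk_mutate[OF Cons.prems(1) k s]]) auto
 thus ?case using s by simp
qed simp

lemma sweep_exists:
 assumes "blk {} M"
 shows "EX ks. distinct ks & set ks = {..<dim_col M} & source_sequence M ks"
proof (intro exI conjI)
 let ?ks = "sort_key ht [0..<n]"
 show "set ?ks = {..<dim_col M}" using assms by (auto simp: blk_def)
 show "source_sequence M ?ks" using assms by (intro source_sequence_sorted[of "{}"]) auto
qed simp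

definition S :: "nat => seed" where "S t = (sweep ^^ t) (initial_seed Bt)"

text \<open>The very choice made inside \<open>sweep\<close>. Nothing is known about its order
  except that it is admissible.\<close>

definition ks :: "nat => nat list" where
 "ks t = (SOME ks. distinct ks & set ks = {..<dim_col (snd (S t))} & source_sequence (snd (S t)) ks)"

definition part :: "nat => nat => seed" where "part t m = fold mutate (take m (ks t)) (S t)"

lemma cvar_S: "cvar Bt (t, i) = fst (S t) i" by (simp add: S_def cvar.simps)

lemma S_0: "S 0 = initial_seed Bt" by (simp add: S_def)

lemma ks_props:
 assumes "blk {} (snd (S t))"
 shows "distinct (ks t)" "set (ks t) = {..<n}" "source_sequence (snd (S t)) (ks t)" "length (ks t) = n"
  "S (Suc t) = part t n"
proof -
 have "dim_col (snd (S t)) = n" using assms by (auto simp: blk_def)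
 thus *: "distinct (ks t)" "set (ks t) = {..<n}" "source_sequence (snd (S t)) (ks t)"
  using someI_ex[OF sweep_exists[OF assms], folded ks_def] by auto
 show l: "length (ks t) = n" using distinct_card[OF *(1)] *(2) by simp
 have "S (Suc t) = sweep (S t)" by (simp add: S_def)
 also have "... = fold mutate (ks t) (S t)" by (simp only: sweep_def ks_def)
 finally show "S (Suc t) = part t n" by (simp add: part_def l)
qed

lemma part_Suc: "m < length (ks t) ==> part t (Suc m) = mutate (ks t ! m) (part t m)"
 by (simp add: part_def take_Suc_conv_app_nth)

lemma part_aux:
 assumes "blk {} (snd (S t))" "S t : seeds Bt" "m <= n"
 shows "blk (set (take m (ks t))) (snd (part t m)) & part t m : seeds Bt" using assms(3)
proof (induction m)
 case (Suc m)
 note k = ks_props[OF assms(1)]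
 have km: "ks t ! m < n" "ks t ! m ~: set (take m (ks t))"
  using Suc.prems k nth_mem[of m "ks t"] by (auto simp: in_set_conv_nth nth_eq_iff_index_eq)
 have "is_source (snd (part t m)) (ks t ! m)"
  using source_sequence_nth[OF k(3), of m] Suc.prems k(4) by (simp add: part_def fold_mutate_snd)
 thus ?case using Suc km k part_Suc blk_mutate seeds.mutation
by (simp add: take_Suc_conv_app_nth snd_mutate dimc)
qed (simp add: part_def assms)

lemma S_blk: "blk {} (snd (S t))" and S_seeds: "S t : seeds Bt"
proof (induction t)
 case 0
 show "blk {} (snd (S 0))" using Bt by (simp add: S_0 initial_seed_def blk_def Bt_entry)
 show "S 0 : seeds Bt" by (simp add: S_0 seeds.initial)
next
 case (Suc t)
 from part_aux[OF Suc.IH, of n] ks_props[OF Suc.IH(1)]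
 have *: "blk {..<n} (snd (S (Suc t)))" "S (Suc t) : seeds Bt" by auto
 thus "blk {} (snd (S (Suc t)))" by (simp add: blk_def)
 show "S (Suc t) : seeds Bt" by (rule *)
qed

lemmas ksp = ks_props[OF S_blk]

lemma part_blk: "m <= n ==> blk (set (take m (ks t))) (snd (part t m))" and part_seeds: "m <= n ==> part t m : seeds Bt"
 using part_aux[OF S_blk S_seeds] by auto

lemmas seeds_vseed = seeds_closed(1)[OF initial_vseed]

definition pos :: "nat => nat => nat" where "pos t k = (LEAST m. ks t ! m = k)"

lemma pos: "k < n ==> pos t k < n" "k < n ==> ks t ! pos t k = k"
proof -
 assume "k < n"
 then obtain m where m: "m < n" "ks t ! m = k" using ksp(2,4) by (metis in_set_conv_nth lessThan_iff)
 thus "ks t ! pos t k = k" unfolding pos_def by (metis (mono_tags, lifting) LeastI)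
 show "pos t k < n" using m Least_le[of "%m. ks t ! m = k" m] unfolding pos_def by simp
qed

lemma pos_eq: "m < n ==> pos t (ks t ! m) = m"
proof -
 assume m: "m < n"
 hence "ks t ! m < n" using ksp(2,4) nth_mem[of m "ks t"] by auto
 thus ?thesis using pos ksp(1,4) m by (metis nth_eq_iff_index_eq)
qed

lemma in_take: "k < n ==> m <= n ==> k : set (take m (ks t)) <-> pos t k < m"
 using pos pos_eq ksp(4) by (auto simp: in_set_conv_nth)

lemma ks_less: "m < n ==> ks t ! m < n" using ksp(2,4) nth_mem[of m "ks t"] by auto

lemma part_source: "m < n ==> is_source (snd (part t m)) (ks t ! m)"
 using source_sequence_nth[OF ksp(3), of m] ksp(4) by (simp add: part_def fold_mutate_snd)

lemma part_var: "i < n ==> m <= n ==> fst (part t m) i = (if pos t i < m then cvar Bt (Suc t, i) else cvar Bt (t, i))"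
proof -
 assume i: "i < n" and m: "m <= n"
 show ?thesis
 proof (cases "pos t i < m")
  case True
  have "i ~: set (drop m (ks t))" using True pos_eq ksp(4) i by (auto simp: in_set_conv_nth)
  hence "fst (fold mutate (drop m (ks t)) (part t m)) i = fst (part t m) i" by (rule fold_mutate_fst)
  moreover have "fold mutate (drop m (ks t)) (part t m) = S (Suc t)"
   unfolding ksp(5) part_def using ksp(4) by (simp flip: fold_append[THEN fun_cong, unfolded comp_def])
  ultimately show ?thesis using True by (simp add: cvar_S)
 next
  case False
  hence "i ~: set (take m (ks t))" using in_take i m by blast
  thus ?thesis using False fold_mutate_fst by (simp add: part_def cvar_S)
 qed
qed

text \<open>The seed of sweep \<open>Suc t\<close> in which \<open>k\<close> is about to be
  mutated.\<close>

definition mid :: "nat => nat => seed" where "mid t k = part t (pos t k)"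

context
 fixes t k :: nat assumes k: "k < n"
begin

lemma mid_seeds: "mid t k : seeds Bt" using part_seeds pos(1)[OF k, of t] by (simp add: mid_def)

lemmas mid_vseed = seeds_vseed[OF mid_seeds]

lemma mid_source: "is_source (snd (mid t k)) k"
 using part_source[of "pos t k" t] pos[OF k, of t] by (simp add: mid_def)

lemma mid_blk: "blk {i. i < n & pos t i < pos t k} (snd (mid t k))"
proof -
 have "set (take (pos t k) (ks t)) = {i. i < n & pos t i < pos t k}"
  using in_take pos(1)[OF k, of t] set_take_subset[of "pos t k" "ks t"] ksp(2) by auto
 thus ?thesis using part_blk[of "pos t k" t] pos(1)[OF k, of t] by (simp add: mid_def)
qed

lemma mid_col: "i < n ==> snd (mid t k) $$ (i, k) = - adj i k" "i < n ==> snd (mid t k) $$ (k, i) = adj k i"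
 using blk_col[OF mid_blk k _ mid_source] by auto

text \<open>When its turn comes, \<open>k\<close> is a source, so precisely its lower neighbours
  have been mutated before. This is how later arguments use the chosen order of a sweep.\<close>

lemma pos_nbr: "adj i k > 0 ==> pos t i < pos t k <-> ht k = ht i + 1"
 using blk_source[OF mid_blk k] mid_source adj_dom by auto

lemma mid_var: "adj i k > 0 ==> fst (mid t k) i = (if ht k = ht i + 1 then cvar Bt (Suc t, i) else cvar Bt (t, i))"
 using part_var pos(1)[OF k, of t] adj_dom pos_nbr by (simp add: mid_def)

lemma mid_self: "fst (mid t k) k = cvar Bt (t, k)"
 using part_var pos(1)[OF k, of t] k by (simp add: mid_def)

lemma mid_mutate: "mutate k (mid t k) = part t (Suc (pos t k))"
 using part_Suc pos[OF k, of t] ksp(4) by (simp add: mid_def)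

lemma mid_exchange: "fst (mutate k (mid t k)) k = cvar Bt (Suc t, k)"
 using part_var pos(1)[OF k, of t] k by (simp add: mid_mutate)

lemma exchange_eq: "cvar Bt (Suc t, k) * cvar Bt (t, k) = pos_monomial (mid t k) k + neg_monomial (mid t k) k"
 using vseed_nz[OF mid_vseed, of k] by (simp add: mid_exchange[symmetric] fst_mutate exch_sum_def mid_self[symmetric])

end

end

context seed_sizes
begin

definition vord :: "seed => (nat ex => int) => ambient => int" where
 "vord U w z = (THE m. sford (fst U) {..<N} w z m)"

lemma vord_eq: "vseed U ==> weight w ==> sford (fst U) {..<N} w z m ==> vord U w z = m"
 unfolding vord_def using chart.sford_unique[OF vseed_chart] by blast

end

context belt
begin

lemma sford_vord:
 assumes "U : seeds Bt" "U' : seeds Bt" "weight w" "i < N"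
 shows "sford (fst U) {..<N} w (fst U' i) (vord U w (fst U' i))"
 using seeds_sford[OF initial_vseed assms] vord_eq[OF seeds_vseed[OF assms(1)] assms(3)] by auto

lemma sford_cvar: "U : seeds Bt ==> weight w ==> i < n ==> sford (fst U) {..<N} w (cvar Bt (t, i)) (vord U w (cvar Bt (t, i)))"
 using sford_vord[OF _ S_seeds, of U w i t] nN by (simp add: cvar_S)

text \<open>The neighbour \<open>i\<close> of \<open>k\<close> in the seed in which \<open>k\<close> is exchanged for the \<open>Suc t\<close>-th time.\<close>

definition nbr :: "(nat => nat => 'x) => nat => nat => nat => 'x" where
 "nbr f t k i = (if ht k = ht i + 1 then f (Suc t) i else f t i)"

text \<open>Frozen exponents of the positive monomial at \<open>mid t k\<close>, as
  \<open>gn\<close> for the negative one. Since \<open>k\<close> is a source there, all mutable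
  variables lie in the negative monomial.\<close>

definition gp :: "nat => nat => nat ex" where
 "gp t k = pvec N (%i. if i < n then 0 else max 0 (snd (mid t k) $$ (i, k)))"

definition gn :: "nat => nat => nat ex" where
 "gn t k = pvec N (%i. if i < n then 0 else max 0 (- snd (mid t k) $$ (i, k)))"

lemma mid_monomials:
 assumes k: "k < n"
 shows "pos_monomial (mid t k) k = mev init_var (gp t k)"
  and "neg_monomial (mid t k) k = mev init_var (gn t k) *
   (PROD i<n. nbr (%t i. cvar Bt (t, i)) t k i powi adj i k)"
proof -
 let ?y = "fst (mid t k)"
 note v = mid_vseed[OF k, of t]
 have split: "(PROD i<N. f i) = (PROD i<n. f i) * (PROD i:{n..<N}. f i)" for f :: "nat => ambient"
  using prod.union_disjoint[of "{..<n}" "{n..<N}" f] nN by (simp add: ivl_disj_un_one(2) ivl_disj_int_one(2))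
 have fr: "?y i = init_var i" if "i : {n..<N}" for i using vseed_frozen[OF v] that by simp
 have "pos_monomial (mid t k) k = (PROD i<n. 1) * (PROD i:{n..<N}. init_var i powi max 0 (snd (mid t k) $$ (i, k)))"
  unfolding pos_monomial_eq pexp_def mev_pvec vseed_dim[OF v] split
  using fr mid_col(1)[OF k] by (intro arg_cong2[of _ _ _ _ "(*)"] prod.cong refl) (auto)
 also have "... = mev init_var (gp t k)" unfolding gp_def mev_pvec split by simp
 finally show "pos_monomial (mid t k) k = mev init_var (gp t k)" .
 have nb: "?y i powi max 0 (- snd (mid t k) $$ (i, k)) = nbr (%t i. cvar Bt (t, i)) t k i powi adj i k" if "i < n" for i
  using mid_var[OF k, of i t] mid_col(1)[OF k that, of t] adj_nonpos[of i k]
  by (cases "adj i k > 0") (auto simp: nbr_def)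
 have "neg_monomial (mid t k) k = (PROD i<n. nbr (%t i. cvar Bt (t, i)) t k i powi adj i k) *
   (PROD i:{n..<N}. init_var i powi max 0 (- snd (mid t k) $$ (i, k)))"
  unfolding neg_monomial_eq nexp_def mev_pvec vseed_dim[OF v] split
  using fr nb by (intro arg_cong2[of _ _ _ _ "(*)"] prod.cong refl) auto
 also have "(PROD i:{n..<N}. init_var i powi max 0 (- snd (mid t k) $$ (i, k))) = mev init_var (gn t k)"
  unfolding gn_def mev_pvec split by simp
 finally show "neg_monomial (mid t k) k = mev init_var (gn t k) *
   (PROD i<n. nbr (%t i. cvar Bt (t, i)) t k i powi adj i k)" by simp
qed

lemma gp_gn:
 shows gp_keys: "keys (gp t k) <= {n..<N}" and gn_keys: "keys (gn t k) <= {n..<N}"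
  and gp_ge: "lookup (gp t k) i >= 0" and gn_ge: "lookup (gn t k) i >= 0"
 by (auto simp: gp_def gn_def)

lemma vord_cvar_rec:
 assumes s: "U : seeds Bt" and w: "weight w" and fr: "!!f. f : {n..<N} ==> w (single f 1) = 0" and k: "k < n"
 shows "vord U w (cvar Bt (Suc t, k)) + vord U w (cvar Bt (t, k)) =
  min 0 (SUM i<n. nbr (%t i. vord U w (cvar Bt (t, i))) t k i * adj i k)"
proof -
 note v = seeds_vseed[OF s]
 interpret chart "fst U" "{..<N}" by (rule vseed_chart[OF v])
 have fr0: "sford (fst U) {..<N} w (mev init_var e) 0" if "keys e <= {n..<N}" for e
 proof -
  have "sford (fst U) {..<N} w (init_var f) 0" if "f : {n..<N}" for f
   using sford_var[OF w, of f] vseed_frozen[OF v, of f] fr[OF that] that by simp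
  hence "sford (fst U) {..<N} w (init_var f) 0" if "f : keys e" for f using that `_ <= _` by blast
  from sford_mev[OF w this] show ?thesis by simp
 qed
 have "sford (fst U) {..<N} w (nbr (%t i. cvar Bt (t, i)) t k i) (nbr (%t i. vord U w (cvar Bt (t, i))) t k i)" if "i < n" for i
  using sford_cvar[OF s w that] by (simp add: nbr_def)
 hence "sford (fst U) {..<N} w (PROD i<n. nbr (%t i. cvar Bt (t, i)) t k i powi adj i k)
   (SUM i<n. adj i k * nbr (%t i. vord U w (cvar Bt (t, i))) t k i)"
  by (intro sford_prod sford_powi w) auto
 from sford_add[OF w fr0[OF gp_keys] sford_mult[OF w fr0[OF gn_keys] this]]
 have "sford (fst U) {..<N} w (cvar Bt (Suc t, k) * cvar Bt (t, k))
   (min 0 (SUM i<n. adj i k * nbr (%t i. vord U w (cvar Bt (t, i))) t k i))"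
  unfolding exchange_eq[OF k] mid_monomials[OF k] by simp
 from sford_unique[OF w this sford_mult[OF w sford_cvar[OF s w k] sford_cvar[OF s w k]]] show ?thesis
  by (simp add: mult.commute)
qed

text \<open>Both sides obey the same recursion and agree on the cluster \<open>S s\<close> by
  \<open>trop_base\<close>. Within a sweep the recursion is solved in the order of mutation, and
  towards smaller \<open>t\<close> in the opposite order.\<close>

lemma vord_cvar:
 assumes i: "i < n" and k: "k < n"
 shows "vord (S s) (%e. lookup e i) (cvar Bt (t, k)) = trop i k (2 * (int t - int s) + ht k - ht i)"
proof -
 let ?w = "%e. lookup e i"
 let ?V = "%t k. vord (S s) ?w (cvar Bt (t, k))" and ?T = "%t k. trop i k (2 * (int t - int s) + ht k - ht i)"
 have recV: "?V (Suc t) k + ?V t k = min 0 (SUM j<n. nbr ?V t k j * adj j k)" if "k < n" for t k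
  using i that by (intro vord_cvar_rec[OF S_seeds weight_lookup]) (auto)
 have recT: "?T (Suc t) k + ?T t k = min 0 (SUM j<n. nbr ?T t k j * adj j k)" if k: "k < n" for t k
 proof -
  \<comment> \<open>The position midway between the two exchanged variables; the neighbours that
    enter the exchange relation all sit there.\<close>
  define p where "p = 2 * (int t - int s) + ht k - ht i + 1"
  have p: "2 * (int (Suc t) - int s) + ht k - ht i = p + 1" "2 * (int t - int s) + ht k - ht i = p - 1" by (simp_all add: p_def)
  have "nbr ?T t k j * adj j k = trop i j p * adj j k" for j
  proof (cases "adj j k > 0")
   case True
   thus ?thesis using height_cases[OF True] by (auto simp: nbr_def p_def algebra_simps)
  next
   case False
   hence "adj j k = 0" by (rule adj_nonpos)
   thus ?thesis by simp
  qed
  hence "(SUM j<n. nbr ?T t k j * adj j k) = (SUM j<n. trop i j p * adj j k)" by (rule sum.cong[OF refl])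
  thus ?thesis using trop_rec(1)[OF i k, of p] unfolding p by (simp only:)
 qed
 have nb: "nbr ?V t k j * adj j k = nbr ?T t k j * adj j k"
  if "adj j k > 0 ==> nbr ?V t k j = nbr ?T t k j" for t k j
  using that adj_nonpos by (cases "adj j k > 0") auto
 have fwd: "?V (Suc t) k = ?T (Suc t) k" if t: "!!k. k < n ==> ?V t k = ?T t k" and k: "k < n" for t k
  using k
 proof (induction "pos t k" arbitrary: k rule: less_induct)
  case less
  have "nbr ?V t k j = nbr ?T t k j" if a: "adj j k > 0" for j
   using t less.hyps adj_dom[OF a] pos_nbr[OF less.prems a, of t] by (auto simp: nbr_def)
  hence "(SUM j<n. nbr ?V t k j * adj j k) = (SUM j<n. nbr ?T t k j * adj j k)" by (intro sum.cong refl nb) auto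
  thus ?case using recV[OF less.prems, of t] recT[OF less.prems, of t] t[OF less.prems] by linarith
 qed
 have bwd: "?V t k = ?T t k" if t: "!!k. k < n ==> ?V (Suc t) k = ?T (Suc t) k" and k: "k < n" for t k
  using k
 proof (induction "n - pos t k" arbitrary: k rule: less_induct)
  case less
  have "nbr ?V t k j = nbr ?T t k j" if a: "adj j k > 0" for j
  proof (cases "ht k = ht j + 1")
   case False
   thus ?thesis using a height_cases[OF a] adj_dom[OF a] pos_nbr[of j k t] adj_pos_sym pos(1)[of j t] less.hyps
by (auto simp: nbr_def)
  qed (use t[of j] adj_dom[OF a] in "simp add: nbr_def")
  hence "(SUM j<n. nbr ?V t k j * adj j k) = (SUM j<n. nbr ?T t k j * adj j k)" by (intro sum.cong refl nb) auto
  thus ?case using recV[OF less.prems, of t] recT[OF less.prems, of t] t[OF less.prems] by linarith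
 qed
 have base: "?V s k = ?T s k" if "k < n" for k
 using chart.sford_var[OF vseed_chart[OF seeds_vseed[OF S_seeds]] weight_lookup, of k s i] that nN vord_eq[OF seeds_vseed[OF S_seeds] weight_lookup] trop_base[OF i that] by (auto simp: cvar_S)
 show ?thesis
 proof (cases "t >= s")
  case True
  hence "ALL k<n. ?V t k = ?T t k"
  proof (induction t rule: dec_induct)
   case (step t)
   thus ?case using fwd by blast
  qed (use base in blast)
  thus ?thesis using k by blast
 next
  case False
  hence "t <= s" by simp
  hence "ALL k<n. ?V t k = ?T t k"
  proof (induction t rule: inc_induct)
   case (step t)
   thus ?case using bwd by blast
  qed (use base in blast)
  thus ?thesis using k by blast
 qed
qed

lemma two_rC: "k < n ==> 2 * (int (rC k) + 1) = ht (kap k) - ht k + per"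
 using rC by (simp add: per_def)

text \<open>The left variable has order 1 along the right one, which is therefore a monomial in the
  later cluster. The exponents of this monomial are its orders, and they are those of the single
  variable \<open>k\<close>.\<close>

lemma cvar_periodic:
 assumes f: "full_col Bt" and k: "k < n"
 shows "cvar Bt (t + rC k + 1, k) = cvar Bt (t, kap k)"
proof -
 define t' where "t' = t + rC k + 1"
 have kk: "kap k < n" "kap k < N" "k < N" using k kap_less nN by (auto intro: less_le_trans)
 have tt: "2 * (int t' - int t) = ht (kap k) - ht k + per" using two_rC[OF k] by (simp add: t'_def)
 have fk: "fst (S t') k = cvar Bt (t', k)" by (simp add: cvar_S)
 have "trop (kap k) k per = trop (kap k) (kap k) 0" using trop_shift[OF k, of "kap k" 0] by simp
 also have "... = 1" using trop_base[OF kk(1) kk(1)] by simp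
 also have "per = 2 * (int t' - int t) + ht k - ht (kap k)" using tt by simp
 finally have "trop (kap k) k (2 * (int t' - int t) + ht k - ht (kap k)) = 1" .
 hence "sford (fst (S t)) {..<N} (%e. lookup e (kap k)) (fst (S t') k) 1"
  using sford_cvar[OF S_seeds weight_lookup k, of t "kap k" t'] vord_cvar[OF kk(1) k, of t t'] by (simp add: fk)
 from monomial_of_pos_order[OF initial_vseed f S_seeds S_seeds kk(1) kk(3) this]
 obtain e where e: "keys e <= {..<N}" "fst (S t) (kap k) = mev (fst (S t')) e" by auto
 note ch = vseed_chart[OF seeds_vseed[OF S_seeds[of t']]]
 have sf: "sford (fst (S t')) {..<N} (%e. lookup e i) (fst (S t) (kap k)) (lookup e i)" for i
  unfolding e(2) by (rule chart.sford_mono[OF ch weight_lookup e(1)])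
 have "lookup e i = lookup (single k 1) i" for i
 proof (cases "i < n")
  case True
  have "lookup e i = trop i (kap k) (2 * (int t - int t') + ht (kap k) - ht i)"
   using vord_cvar[OF True kk(1), of t' t] vord_eq[OF seeds_vseed[OF S_seeds] weight_lookup sf] by (simp add: cvar_S)
  also have "2 * (int t - int t') + ht (kap k) - ht i = ht k - ht i - per" using tt by simp
  also have "trop i (kap k) (ht k - ht i - per) = trop i k (ht k - ht i)" using trop_shift[OF k, of i "ht k - ht i - per"] by simp
  also have "... = lookup (single k 1) i" using trop_base[OF True k] by auto
  finally show ?thesis .
 next
  case False
  hence "lookup e i = 0"
  proof (cases "i < N")
   case True
   thus ?thesis
    using chart.sford_unique[OF ch weight_lookup sf sford_frozen[OF initial_vseed S_seeds S_seeds _ True kk(2)]] False kk by auto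
  qed (use e(1) in "auto simp: in_keys_iff")
  thus ?thesis using False k by auto
 qed
 hence "e = single k 1" by (rule pm_eqI)
 thus ?thesis using e(2) by (simp add: t'_def cvar_S)
qed

lemma per_pos: "per >= 4" using cox_ge_2 by (simp add: per_def)

lemma cvar_per:
 assumes "full_col Bt" "k < n"
 shows "cvar Bt (t + nat per, k) = cvar Bt (t, k)"
proof -
 have "nat per = (rC k + 1) + (rC (kap k) + 1)"
  using two_rC[OF assms(2)] two_rC[OF kap_less[OF assms(2)]] assms(2) by simp
 thus ?thesis
  using cvar_periodic[OF assms, of "t + rC (kap k) + 1"] cvar_periodic[OF assms(1) kap_less[OF assms(2)], of t] assms(2)
  by (simp add: algebra_simps)
qed

text \<open>If all belt variables had nonpositive order along a cluster variable \<open>v\<close>, the exchange relations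
 would make the negatives of these orders a nonnegative solution of the linear recursion, so all
 of them would vanish.\<close>

lemma mutable_is_belt_monomial:
 assumes f: "full_col Bt" and v: "v : mutable_variables Bt"
 obtains t e where "keys e <= {..<N}" "v = mev (fst (S t)) e"
proof -
 obtain U l where s: "U : seeds Bt" and l: "l < n" and vl: "v = fst U l"
  using v by (auto simp: mutable_variables_def dimc)
 let ?w = "%e. lookup e l"
 define V where "V t k = vord U ?w (cvar Bt (t, k))" for t k
 have rec: "V (Suc t) k + V t k = min 0 (SUM i<n. nbr V t k i * adj i k)" if "k < n" for t k
  using vord_cvar_rec[OF s weight_lookup[of l] _ that, of t] l unfolding V_def by simp
 have "EX t k. k < n & V t k >= 1"
 proof (rule ccontr)
  assume "~ ?thesis"
  hence V0: "V t k <= 0" if "k < n" for t k using that by (meson int_one_le_iff_zero_less not_le)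
  have rec': "V (Suc t) k + V t k = (SUM i<n. nbr V t k i * adj i k)" if "k < n" for t k
  proof -
   have "(SUM i<n. nbr V t k i * adj i k) <= 0"
    using V0 by (intro sum_nonpos) (auto simp: nbr_def mult_nonpos_nonneg)
   thus ?thesis using rec[OF that, of t] by simp
  qed
  \<comment> \<open>Positions are shifted by the largest height, so that all of them belong to
    nonnegative numbers of sweeps; in \<open>a\<close>, a position of the wrong parity for its
    vertex gets 0.\<close>
  define c where "c = Max (ht ` {..<n})"
  have c: "ht k <= c" if "k < n" for k using that by (simp add: c_def)
  define a where "a s k = (if even (int s + c - ht k) then - V (nat ((int s + c - ht k) div 2)) k else 0)" for s k
  have a: "a s k = - V t k" if "int s + c = 2 * int t + ht k" for s k t
   using that by (simp add: a_def)
  have "a s k = 0" if "k < n" for s k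
  proof (rule nonneg_solution_zero[of a, OF _ _ that])
   fix s k assume k: "k < n"
   show "a s k >= 0" using V0[OF k] by (simp add: a_def)
   show "a (Suc (Suc s)) k = (SUM j<n. a (Suc s) j * adj j k) - a s k"
   proof (cases "even (int s + c - ht k)")
    case True
    define t where "t = nat ((int s + c - ht k) div 2)"
    have t: "int s + c = 2 * int t + ht k" using True c[OF k] by (simp add: t_def)
    have "a (Suc s) j * adj j k = - (nbr V t k j * adj j k)" for j
    proof (cases "adj j k > 0")
     case True
     thus ?thesis using height_cases[OF True] a[of "Suc s" "Suc t" j] a[of "Suc s" t j] t by (auto simp: nbr_def)
    next
     case False
     hence "adj j k = 0" by (rule adj_nonpos)
     thus ?thesis by simp
    qed
    hence "(SUM j<n. a (Suc s) j * adj j k) = - (SUM j<n. nbr V t k j * adj j k)" by (simp add: sum_negf)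
    thus ?thesis using rec'[OF k, of t] a[of s t k] a[of "Suc (Suc s)" "Suc t" k] t by simp
   next
    case False
    have "a (Suc s) j * adj j k = 0" for j
    proof (cases "adj j k > 0")
     case True
     thus ?thesis using height_cases[OF True] False by (auto simp: a_def)
    next
     case False
     thus ?thesis using adj_nonpos by simp
    qed
    thus ?thesis using False by (simp add: a_def)
   qed
  qed
  moreover define t where "t = nat (c - Min (ht ` {..<n}))"
  moreover have "c - ht k <= int t" if "k < n" for k
  proof -
   have "Min (ht ` {..<n}) <= ht k" using that by simp
   thus ?thesis by (simp add: t_def)
  qed
  ultimately have a0: "!!k s. k < n ==> a s k = 0" and tb: "!!k. k < n ==> c - ht k <= int t" by blast+
  have Vt: "V t k = 0" if "k < n" for k
   using a[of "nat (2 * int t + ht k - c)" t k] a0[OF that] tb[OF that] by simp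
  note vs = seeds_vseed[OF s]
  define Q where "Q T <-> (ALL i<N. sford (fst U) {..<N} ?w (fst T i) 0)" for T :: seed
  \<comment> \<open>If a whole cluster has order 0 along \<open>v\<close>, then by the exchange
    relations so has every cluster variable; but \<open>v\<close> has order 1 along itself.\<close>
  have "Q U"
  proof (rule seeds_connected[OF initial_vseed S_seeds[of t] s])
   show "Q (S t)" unfolding Q_def
   proof (intro allI impI)
    fix i assume "i < N"
    show "sford (fst U) {..<N} ?w (fst (S t) i) 0"
    proof (cases "i < n")
     case True
     thus ?thesis using sford_cvar[OF s weight_lookup True, of l t] Vt[OF True] by (simp add: V_def cvar_S)
    next
     case False
     thus ?thesis using l vseed_frozen[OF vs] vseed_frozen[OF seeds_vseed[OF S_seeds]] chart.sford_var[OF vseed_chart[OF vs] weight_lookup, of i l] `i < N`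
      by (auto)
    qed
   qed
   fix T k assume T: "vseed T" "Q T" "k < n"
   thus "Q (mutate k T)"
    using sford_mutate[OF vs T(1) weight_lookup T(3), of l "%_. 0"] unfolding Q_def by (auto simp: fst_mutate)
  qed
  hence "sford (fst U) {..<N} ?w (fst U l) 0" using l nN by (simp add: Q_def)
  moreover have "sford (fst U) {..<N} ?w (fst U l) 1"
   using chart.sford_var[OF vseed_chart[OF vs] weight_lookup, of l l] l nN by simp
  ultimately show False using chart.sford_unique[OF vseed_chart[OF vs] weight_lookup] by fastforce
 qed
 then obtain t k where tk: "k < n" "V t k >= 1" by blast
 have "sford (fst U) {..<N} ?w (fst (S t) k) (V t k)"
  using sford_cvar[OF s weight_lookup tk(1), of l t] by (simp add: V_def cvar_S)
 from monomial_of_pos_order[OF initial_vseed f s S_seeds l _ this tk(2)] show ?thesis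
  using that tk(1) nN by (metis vl less_le_trans)
qed

end

section \<open>The y-hat variables along the belt and their orders\<close>

context belt
begin

definition yh :: "nat => nat => ambient" where "yh t k = yhat (mid t k) k"
text \<open>By \<open>Fh_Gh_eq\<close>, \<open>Fh\<close> and \<open>Gh\<close> are the negative and
  the positive monomial of the exchange at \<open>mid t k\<close> divided by the product of the
  exchanged variables. \<open>Fh\<close> becomes the function f, and \<open>Gh\<close> is its
  complement to 1.\<close>

definition Fh :: "nat => nat => ambient" where "Fh t k = 1 / (1 + yh t k)"
definition Gh :: "nat => nat => ambient" where "Gh t k = yh t k / (1 + yh t k)"

lemma yh_nz: "k < n ==> yh t k ~= 0" "k < n ==> 1 + yh t k ~= 0"
 using yhat_nz[OF mid_vseed] yhat_plus_1_nz[OF mid_vseed] by (auto simp: yh_def)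

lemma Fh_Gh: "k < n ==> Fh t k + Gh t k = 1" "k < n ==> Fh t k ~= 0" "k < n ==> Gh t k ~= 0"
 using yh_nz by (auto simp: Fh_def Gh_def add_divide_distrib[symmetric])

lemma Fh_Gh_eq:
 assumes k: "k < n"
 shows "Fh t k = neg_monomial (mid t k) k / (cvar Bt (t, k) * cvar Bt (Suc t, k))"
  "Gh t k = pos_monomial (mid t k) k / (cvar Bt (t, k) * cvar Bt (Suc t, k))"
proof -
 have e: "cvar Bt (t, k) * cvar Bt (Suc t, k) = neg_monomial (mid t k) k * (1 + yh t k)"
  using exchange_eq[OF k, of t] pos_neg_monomial[OF mid_vseed[OF k], of t k] by (simp add: yh_def algebra_simps)
 show "Fh t k = neg_monomial (mid t k) k / (cvar Bt (t, k) * cvar Bt (Suc t, k))"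
  "Gh t k = pos_monomial (mid t k) k / (cvar Bt (t, k) * cvar Bt (Suc t, k))"
  unfolding e using pos_neg_monomial[OF mid_vseed[OF k], of t k] neg_monomial_nz[OF mid_vseed[OF k], of t k]
  by (simp_all add: Fh_def Gh_def yh_def)
qed

lemma yhat_mutate_self:
 assumes v: "vseed U" and k: "k < n"
 shows "yhat (mutate k U) k = inverse (yhat U k)"
proof -
 have "ycol (mutate k U) k = - ycol U k" using mutate_entry k
by (intro pm_eqI) (simp add: ycol_def snd_mutate vseed_dim[OF v])
 moreover have "mev (fst (mutate k U)) (ycol U k) = mev (fst U) (ycol U k)"
  using exps_keys(1)[OF v k] by (intro mev_cong) (auto simp: fst_mutate)
 ultimately show ?thesis
  using nzf.mev_uminus[OF vseed_fam[OF vseed_mutate[OF v k]]] by (simp add: yhat_def)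
qed

lemma yhat_part_Suc:
 assumes m: "m < n" and k: "k < n"
 shows "yhat (part t (Suc m)) k = (if k = ks t ! m then 1 / yh t k else yhat (part t m) k * Gh t (ks t ! m) powi adj (ks t ! m) k)"
proof -
 define i where "i = ks t ! m"
 have i: "i < n" "part t m = mid t i" using ks_less[OF m] pos_eq[OF m] by (simp_all add: i_def mid_def)
 have ps: "part t (Suc m) = mutate i (mid t i)" using part_Suc ksp(4) m i by (simp add: i_def)
 note v = mid_vseed[OF i(1), of t]
 show ?thesis
 using yhat_mutate_self[OF v i(1)] exch_sum_eq[OF v, of i] pos_neg_monomial[OF v, of i] neg_monomial_nz[OF v, of i] yhat_mutate(1)[OF v i(1) k] mid_col(2)[OF i(1) k, of t] by (cases "k = i") (auto simp: ps yh_def inverse_eq_divide i_def Gh_def neg_monomial_eq[symmetric] i(2) power_int_def)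
qed

lemma yhat_part:
 assumes "m <= n" and k: "k < n"
 shows "yhat (part t m) k = (if pos t k < m then 1 / yh t k * (PROD i:{i. i < n & pos t k < pos t i & pos t i < m}. Gh t i powi adj i k)
  else yhat (S t) k * (PROD i:{i. i < n & pos t i < m}. Gh t i powi adj i k))" using assms(1)
proof (induction m)
 case 0
 thus ?case by (simp add: part_def)
next
 case (Suc m)
 define j where "j = ks t ! m"
 have j: "j < n" "pos t j = m" using ks_less pos_eq Suc.prems by (simp_all add: j_def)
 have inj: "pos t i = m <-> i = j" if "i < n" for i using pos[OF that, of t] j by (auto simp: j_def)
 have inj': "m = pos t i <-> i = j" if "i < n" for i using inj[OF that] by auto
 have step: "yhat (part t (Suc m)) k = (if k = j then 1 / yh t k else yhat (part t m) k * Gh t j powi adj j k)"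
  using yhat_part_Suc[OF _ k, of m t] Suc.prems by (simp add: j_def)
 show ?case
 proof (cases "k = j")
  case True
  have e: "{i. i < n & pos t k < pos t i & pos t i < Suc m} = {}" using True j by auto
  show ?thesis unfolding step e using True j by simp
 next
  case False
  have s1: "{i. i < n & pos t i < Suc m} = insert j {i. i < n & pos t i < m}" using j(1) by (auto simp: less_Suc_eq inj inj')
  have s2: "{i. i < n & pos t k < pos t i & pos t i < Suc m} = insert j {i. i < n & pos t k < pos t i & pos t i < m}" if "pos t k < m"
   using j that by (auto simp: less_Suc_eq inj inj') (simp add: j(2))
  have f: "finite {i. i < n & pos t k < pos t i & pos t i < m}" "finite {i. i < n & pos t i < m}" by auto
  have "pos t k ~= m" using inj[OF k] False by simp
  then consider "pos t k < m" | "~ pos t k < Suc m" by linarith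
  thus ?thesis
  proof cases
   case 1
   thus ?thesis using Suc False j f unfolding step s2[OF 1] by (subst prod.insert) auto
  next
   case 2
   thus ?thesis using Suc j unfolding step s1 by (subst prod.insert) auto
  qed
 qed
qed

lemma yh_eq:
 assumes k: "k < n"
 shows "yh t k = yhat (S t) k * (PROD i<n. if ht k = ht i + 1 then Gh t i powi adj i k else 1)"
proof -
 have "(PROD i:{i. i < n & pos t i < pos t k}. Gh t i powi adj i k) = (PROD i<n. if ht k = ht i + 1 then Gh t i powi adj i k else 1)"
 proof (rule prod.mono_neutral_cong_left)
  fix i assume "i : {i. i < n & pos t i < pos t k}"
  thus "Gh t i powi adj i k = (if ht k = ht i + 1 then Gh t i powi adj i k else 1)"
   using pos_nbr[OF k, of i t] adj_nonpos(1)[of i k] by (cases "adj i k > 0") auto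
 next
  show "ALL i:{..<n} - {i. i < n & pos t i < pos t k}. (if ht k = ht i + 1 then Gh t i powi adj i k else 1) = 1"
  proof
   fix i assume "i : {..<n} - {i. i < n & pos t i < pos t k}"
   thus "(if ht k = ht i + 1 then Gh t i powi adj i k else 1) = 1"
    using pos_nbr[OF k, of i t] adj_nonpos(1)[of i k] by (cases "adj i k > 0") auto
  qed
 qed auto
 thus ?thesis using yhat_part pos(1)[OF k, of t] k by (simp add: yh_def mid_def)
qed

lemma yhat_S_Suc:
 assumes k: "k < n"
 shows "yhat (S (Suc t)) k = 1 / yh t k * (PROD i<n. if ht k = ht i + 1 then 1 else Gh t i powi adj i k)"
proof -
 have "(PROD i:{i. i < n & pos t k < pos t i & pos t i < n}. Gh t i powi adj i k) = (PROD i<n. if ht k = ht i + 1 then 1 else Gh t i powi adj i k)"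
 proof (rule prod.mono_neutral_cong_left)
  fix i assume "i : {i. i < n & pos t k < pos t i & pos t i < n}"
  thus "Gh t i powi adj i k = (if ht k = ht i + 1 then 1 else Gh t i powi adj i k)"
   using pos_nbr[OF k, of i t] adj_nonpos(1)[of i k] by (cases "adj i k > 0") auto
 next
  show "ALL i:{..<n} - {i. i < n & pos t k < pos t i & pos t i < n}. (if ht k = ht i + 1 then 1 else Gh t i powi adj i k) = 1"
  proof
   fix i assume i: "i : {..<n} - {i. i < n & pos t k < pos t i & pos t i < n}"
   hence le: "pos t i <= pos t k" using pos(1) by auto
   show "(if ht k = ht i + 1 then 1 else Gh t i powi adj i k) = 1"
   proof (cases "adj i k > 0")
    case True
    thus ?thesis using adj_self le pos(2)[OF k, of t] pos(2) i DiffD1 lessThan_iff nat_less_le pos_nbr[OF k True]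
by (smt (verit))
   qed (use adj_nonpos(1)[of i k] in auto)
  qed
 qed auto
 thus ?thesis using yhat_part pos(1)[OF k, of t] k ksp(5) by simp
qed

text \<open>Between two successive mutations at \<open>k\<close>, the first of which inverts its
  y-hat variable, each neighbour is mutated exactly once and contributes a power of
  \<open>Gh\<close>.\<close>

lemma y_system:
 assumes k: "k < n"
 shows "yh (Suc t) k * yh t k = (PROD i<n. nbr Gh t k i powi adj i k)"
proof -
 have "yh (Suc t) k * yh t k = (PROD i<n. if ht k = ht i + 1 then 1 else Gh t i powi adj i k) *
   (PROD i<n. if ht k = ht i + 1 then Gh (Suc t) i powi adj i k else 1)"
  unfolding yh_eq[OF k, of "Suc t"] yhat_S_Suc[OF k] using yh_nz[OF k, of t] by simp
 also have "... = (PROD i<n. nbr Gh t k i powi adj i k)"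
  unfolding prod.distrib[symmetric] by (intro prod.cong refl) (simp add: nbr_def)
 finally show ?thesis .
qed

lemma init_chart: "chart init_var {..<N}"
 using vseed_chart[OF initial_vseed] by (simp add: initial_seed_def)

interpretation i: chart init_var "{..<N}" by (rule init_chart)

lemma sford_Fh_Gh:
 assumes w: "weight w" and y: "sford init_var {..<N} w (yh t k) (- c * trop i k s)" and c: "c >= 0"
 shows "sford init_var {..<N} w (Fh t k) (c * tdelta i k s)" "sford init_var {..<N} w (Gh t k) (c * qdeg i k s)"
proof -
 have m: "min 0 (- c * trop i k s) = - c * tdelta i k s" "c * qdeg i k s = - c * trop i k s - min 0 (- c * trop i k s)"
  using c by (cases "c = 0"; auto simp: tdelta_def qdeg_def max_def mult_le_0_iff)+
 have 1: "sford init_var {..<N} w (1 + yh t k) (min 0 (- c * trop i k s))" by (rule i.sford_add[OF w i.sford_1[OF w] y])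
 show "sford init_var {..<N} w (Fh t k) (c * tdelta i k s)"
  using i.sford_divide[OF w i.sford_1[OF w] 1] unfolding Fh_def m(1) by simp
 show "sford init_var {..<N} w (Gh t k) (c * qdeg i k s)"
  using i.sford_divide[OF w y 1] unfolding Gh_def m(2) by simp
qed

text \<open>The weight is dual to column \<open>i\<close> of \<open>Bt\<close> up to the factor
  \<open>- c\<close>. The factor is needed because a left inverse of \<open>Bt\<close> becomes
  integral only after scaling, and \<open>c = 0\<close> admits the weights that kill all columns.
  The induction follows \<open>y_system\<close> and the second form of
  \<open>trop_rec\<close>.\<close>

lemma sford_yh:
 assumes w: "weight w" and i: "i < n" and k: "k < n" and c: "c >= 0"
  and wy: "!!k. k < n ==> w (ycol (initial_seed Bt) k) = (if k = i then - c else 0)"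
 shows "sford init_var {..<N} w (yh t k) (- c * trop i k (2 * int t + ht k - ht i))" using k
proof (induction t arbitrary: k)
 case 0
 thus ?case
 proof (induction "pos 0 k" arbitrary: k rule: less_induct)
  case less
  have g: "sford init_var {..<N} w (if ht k = ht j + 1 then Gh 0 j powi adj j k else 1) 0" if "j : {..<n}" for j
  proof (cases "ht k = ht j + 1 & adj j k > 0")
   case True
   hence "pos 0 j < pos 0 k" using pos_nbr[OF less.prems, of j 0] by auto
   from sford_Fh_Gh(2)[OF w less.hyps[OF this] c] that
   have "sford init_var {..<N} w (Gh 0 j) 0" using trop_base[OF i, of j] by (auto simp: qdeg_def)
   from i.sford_powi[OF w this, of "adj j k"] show ?thesis using True by simp
  next
   case False
   thus ?thesis using adj_nonpos(1)[of j k] i.sford_1[OF w] by (auto)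
  qed
  have k0: "keys (ycol (initial_seed Bt) k) <= {..<N}"
   using exps_keys(1)[OF initial_vseed less.prems] by blast
  have p0: "sford init_var {..<N} w (PROD j<n. if ht k = ht j + 1 then Gh 0 j powi adj j k else 1) (SUM j<n. 0)"
   by (rule i.sford_prod[OF w g])
  show ?case using i.sford_mult[OF w i.sford_mono[OF w k0] p0] wy[OF less.prems] trop_base[OF i less.prems]
   by (auto simp: yh_eq[OF less.prems] yhat_def S_0 initial_seed_def)
 qed
next
 case (Suc t)
 show ?case using Suc.prems
 proof (induction "pos (Suc t) k" arbitrary: k rule: less_induct)
  case less
  define s where "s = 2 * int t + ht k - ht i + 1"
  have g: "sford init_var {..<N} w (nbr Gh t k j powi adj j k) (c * (qdeg i j s * adj j k))" if "j : {..<n}" for j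
  proof (cases "adj j k > 0")
   case True
   have "sford init_var {..<N} w (nbr Gh t k j) (c * qdeg i j s)"
   proof (cases "ht k = ht j + 1")
    case T: True
    hence "pos (Suc t) j < pos (Suc t) k" using pos_nbr[OF less.prems True] by auto
    from sford_Fh_Gh(2)[OF w less.hyps[OF this] c] that T show ?thesis by (simp add: nbr_def s_def algebra_simps)
   next
    case F: False
    hence "ht j = ht k + 1" using height_cases[OF True] by auto
    with sford_Fh_Gh(2)[OF w Suc.IH[of j] c] that F show ?thesis by (simp add: nbr_def s_def algebra_simps)
   qed
   from i.sford_powi[OF w this, of "adj j k"] show ?thesis by (simp add: mult_ac)
  next
   case False
   thus ?thesis using adj_nonpos(1)[of j k] i.sford_1[OF w] by simp
  qed
  have "yh (Suc t) k = (PROD j<n. nbr Gh t k j powi adj j k) / yh t k"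
   using y_system[OF less.prems, of t] yh_nz[OF less.prems, of t] by (simp add: field_simps)
  moreover have "sford init_var {..<N} w ... ((SUM j<n. c * (qdeg i j s * adj j k)) - - c * trop i k (s - 1))"
   using Suc.IH[OF less.prems] by (intro i.sford_divide[OF w] i.sford_prod[OF w] g) (auto simp: s_def)
  moreover have "(SUM j<n. c * (qdeg i j s * adj j k)) - - c * trop i k (s - 1) = - c * trop i k (s + 1)"
  proof -
   have "(SUM j<n. min 0 (trop i j s) * adj j k) = - (SUM j<n. qdeg i j s * adj j k)"
    unfolding sum_negf[symmetric] by (intro sum.cong refl) (simp add: qdeg_def max_def)
   hence "c * trop i k (s + 1) = c * (- (SUM j<n. qdeg i j s * adj j k) - trop i k (s - 1))" using trop_rec(2)[OF i less.prems, of s]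
    by (auto)
   thus ?thesis unfolding sum_distrib_left[symmetric] by (simp add: right_diff_distrib)
  qed
  ultimately show ?case by (simp add: s_def algebra_simps)
 qed
qed

end

section \<open>Indexing by the belt\<close>

lemma init_var_eq_iff [simp]: "init_var i = init_var j <-> i = j"
proof
 assume "init_var i = init_var j"
 hence "keys (single (single i (1::nat)) (1::complex)) =
  keys (single (single j (1::nat)) (1::complex))" by (auto simp: init_var_def eq_fract)
 hence "keys (single i (1::nat)) = keys (single j (1::nat))" by (auto)
 thus "i = j" by simp
qed simp

lemma laurent_eval_eq: "laurent_eval y p = ev y p" by (simp add: laurent_eval_def leval_def mev_def)

context height
begin

text \<open>A coincidence would need a multiple of \<open>per\<close> with the matching twist. By
  \<open>height_diam\<close> the difference of positions stays strictly between 0 and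
  \<open>2 * per\<close> if the twist is trivial, and strictly between \<open>- per\<close> and
  \<open>per\<close> if it is \<open>kap\<close>.\<close>

lemma trop_window:
 assumes "i < n" "k < n" "t <= rC k"
 shows "tdelta i k (2 * int t + ht k - ht i) = (if t = 0 & i = k then 1 else 0)"
proof (cases "t = 0")
 case True
 thus ?thesis using trop_base[OF assms(1,2)] by (simp add: tdelta_def)
next
 case False
 define s where "s = 2 * int t + ht k - ht i"
 have kk: "kap k < n" using assms kap_less by simp
 have b: "2 * int t <= ht (kap k) - ht k + int cox" using rC[OF assms(2)] assms(3) by linarith
 have d: "\<bar>ht (kap k) - ht k\<bar> <= int cox - 2" using height_diam[OF kk assms(2)] by simp
 have "~ (s mod per = 0 & i = kap_pow (s div per) k)"
 proof
  assume *: "s mod per = 0 & i = kap_pow (s div per) k"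
  define q where "q = s div per"
  have s: "s = q * per" using * by (auto simp: q_def)
  have pp: "per > 0" by (simp add: per_def)
  show False
  proof (cases "even q")
   case True
   hence "i = k" using * by (simp add: kap_pow_def q_def)
   hence "q * per > 0" "q * per < 2 * per" using s False b d by (auto simp: s_def per_def)
   hence "q > 0" "q < 2" by (auto simp: zero_less_mult_iff)
   thus False using True by presburger
  next
   case f: False
   hence "i = kap k" using * by (simp add: kap_pow_def q_def)
   hence "- per < s" "s < per" using b d by (auto simp: s_def per_def)
   hence "- per < q * per" "q * per < per" using s by simp_all
   hence "- 1 < q" "q < 1" using mult_less_cancel_right_pos[of per "- 1" q] mult_less_cancel_right_pos[of per q 1] by auto
   thus False using f by presburger
  qed
 qed
 thus ?thesis using tdelta_eq[OF assms(1,2), of s] False by (simp add: s_def)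
qed

text \<open>The compatibility degree is invariant under the rotation \<open>\<tau>\<close>, which lowers positions by two.\<close>

definition pdeg :: "nat \<times> nat => nat \<times> nat => int" where
 "pdeg \<w> \<g> = qdeg (snd \<w>) (snd \<g>) (2 * (int (fst \<g>) - int (fst \<w>)) + ht (snd \<g>) - ht (snd \<w>))"

text \<open>The rotation \<open>tauD\<close> in terms of the computed values \<open>rC\<close> and
  \<open>kap\<close>.\<close>

definition rot :: "nat \<times> nat => nat \<times> nat" where
 "rot \<w> = (if fst \<w> = 0 then (rC (kap (snd \<w>)), kap (snd \<w>)) else (fst \<w> - 1, snd \<w>))"

text \<open>Both positions drop by 2, up to a twisted period where an index wraps around, and
  \<open>qdeg\<close> does not notice either change.\<close>

lemma pdeg_rot:
 assumes "snd \<w> < n" "snd \<g> < n"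
 shows "pdeg (rot \<w>) (rot \<g>) = pdeg \<w> \<g>"
proof -
 obtain s i t k where [simp]: "\<w> = (s, i)" "\<g> = (t, k)" by (cases \<w>; cases \<g>)
 have ik: "i < n" "k < n" "kap i < n" "kap k < n" using assms kap_less by auto
 have ri: "2 * int (rC (kap i)) = ht i - ht (kap i) + per - 2" using rC[OF ik(3)] ik by (simp add: per_def)
 have rk: "2 * int (rC (kap k)) = ht k - ht (kap k) + per - 2" using rC[OF ik(4)] ik by (simp add: per_def)
 define x where "x = 2 * (int t - int s) + ht k - ht i"
 have k1: "qdeg i (kap k) (x + per) = qdeg i k x" using qdeg_shift[OF ik(4), of i x] ik by simp
 have k2: "qdeg (kap i) k' (y - per) = qdeg i k' y" if "k' < n" for k' y using qdeg_shift_left[OF ik(1) that] .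
 show ?thesis
 proof (cases "s = 0"; cases "t = 0")
  assume st: "s = 0" "t = 0"
  have "2 * (int (rC (kap k)) - int (rC (kap i))) + ht (kap k) - ht (kap i) = (x + per) - per"
   using ri rk by (simp add: x_def st)
  thus ?thesis using k1 k2[OF ik(4), of "x + per"] by (simp add: pdeg_def rot_def st x_def)
 next
  assume st: "s = 0" "t ~= 0"
  have "pdeg (rot \<w>) (rot \<g>) = qdeg (kap i) k (2 * (int (t - 1) - int (rC (kap i))) + ht k - ht (kap i))"
   using st by (simp add: pdeg_def rot_def)
  also have "2 * (int (t - 1) - int (rC (kap i))) + ht k - ht (kap i) = x - per"
   using ri st by (simp add: x_def)
  finally show ?thesis using k2[OF ik(2), of x] by (simp add: pdeg_def x_def)
 next
  assume st: "s ~= 0" "t = 0"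
  have "pdeg (rot \<w>) (rot \<g>) = qdeg i (kap k) (2 * (int (rC (kap k)) - int (s - 1)) + ht (kap k) - ht i)"
   using st by (simp add: pdeg_def rot_def)
  also have "2 * (int (rC (kap k)) - int (s - 1)) + ht (kap k) - ht i = x + per"
   using rk st by (simp add: x_def)
  finally show ?thesis using k1 by (simp add: pdeg_def x_def)
 next
  assume st: "s ~= 0" "t ~= 0"
  thus ?thesis by (simp add: pdeg_def rot_def)
 qed
qed

definition Pi :: "(nat \<times> nat) set" where "Pi = {(s, i). i < n & s <= rC i}"

lemma finite_Pi: "finite Pi"
proof -
 have "Pi = (%(i, s). (s, i)) ` (SIGMA i:{..<n}. {..rC i})" by (auto simp: Pi_def)
 thus ?thesis by simp
qed

lemma rot_Pi: "\<w> : Pi ==> rot \<w> : Pi" by (auto simp: Pi_def rot_def kap_less)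

end

context belt
begin

text \<open>Periodicity and, below, the Laurent property are assumed here, because these results are
  applied to the principal matrix, for which both are obtained by specialization.\<close>

context
 assumes per1: "!!k. k < n ==> cvar Bt (Suc (rC k), k) = init_var (kap k)"
begin

lemma cvar_0: "cvar Bt (0, k) = init_var k" by (simp add: cvar_S S_0 initial_seed_def)

lemma return_time: "k < n ==> return_time Bt k = Suc (rC k)"
proof -
 assume k: "k < n"
 have "cvar Bt (t, k) ~: init_var ` {..<n}" if t: "0 < t" "t <= rC k" for t
 proof
  assume "cvar Bt (t, k) : init_var ` {..<n}"
  then obtain j where j: "j < n" "cvar Bt (t, k) = init_var j" by auto
  have "sford init_var {..<N} (%e. lookup e j) (init_var j) 1"
   using chart.sford_var[OF init_chart weight_lookup, of j j] j nN by simp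
  hence "trop j k (2 * int t + ht k - ht j) = 1"
   using vord_eq[OF initial_vseed weight_lookup, of j "init_var j" 1] vord_cvar[OF j(1) k, of 0 t] j
   by (simp add: S_0 initial_seed_def)
  thus False using trop_window[OF j(1) k t(2)] t(1) by (simp add: tdelta_def)
 qed
 thus ?thesis unfolding return_time_def dimc using per1[OF k] kap_less[OF k]
  by (intro Least_equality) (auto simp: not_less_eq_eq[symmetric])
qed

lemma rr: "k < n ==> rr Bt k = rC k" by (simp add: rr_def return_time)

lemma star: "k < n ==> star Bt k = kap k"
 unfolding star_def using per1 kap_less by (intro the_equality) (auto simp: rr cvar_0 dimc)

lemma PiD: "PiD Bt = Pi" by (auto simp: PiD_def Pi_def dimc rr)

lemma tauD: "\<w> : Pi ==> tauD Bt \<w> = rot \<w>"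
 by (cases \<w>) (auto simp: rot_def Pi_def star rr kap_less)

context
 assumes lau: "!!\<g>. \<g> : Pi ==> cvar Bt \<g> : ZL (initial_seed Bt)"
begin

lemma denom_exponent_cvar:
 assumes i: "i < n" and g: "(t, k) : Pi"
 shows "denom_exponent i (cvar Bt (t, k)) = - trop i k (2 * int t + ht k - ht i)"
proof -
 interpret ic: chart init_var "{..<N}" by (rule init_chart)
 let ?w = "%e. lookup e i"
 have k: "k < n" using g by (simp add: Pi_def)
 obtain p where p: "pvars {..<N} p" "cvar Bt (t, k) = leval of_int init_var p"
  using lau[OF g] by (auto simp: ZL_def Z.lring_def initial_seed_def)
 define q :: "nat laurent" where "q = Poly_Mapping.map of_int p"
 have l: "lookup q e = of_int (lookup p e)" for e by (simp add: q_def Poly_Mapping.map.rep_eq)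
 hence kq: "keys q = keys p" by (auto simp: in_keys_iff)
 have q: "ev init_var q = cvar Bt (t, k)" by (simp add: p(2) leval_def l kq scalar_of_int)
 have sf: "sford init_var {..<N} ?w (cvar Bt (t, k)) (trop i k (2 * int t + ht k - ht i))"
  using sford_cvar[OF S_seeds weight_lookup k, of 0 i t] vord_cvar[OF i k, of 0 t] by (simp add: S_0 initial_seed_def)
 obtain a b where ab: "pvars {..<N} a" "pvars {..<N} b" "a ~= 0" "b ~= 0" "cvar Bt (t, k) * leval of_int init_var b = leval of_int init_var a"
  "trop i k (2 * int t + ht k - ht i) = minw ?w a - minw ?w b" using sf unfolding sford_def by blast
 have "p * b = a" using ab p by (intro Z.indep_eq[OF ic.indep]) (auto simp: ic.lmult)
 moreover have "p ~= 0" using `p * b = a` ab by auto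
 ultimately have m: "minw ?w q = trop i k (2 * int t + ht k - ht i)"
  using minw_mult[OF weight_lookup, of p b i] ab by (simp add: minw_def kq)
 have u: "q' = q" if "ev init_var q' = cvar Bt (t, k)" for q'
  using that q C.indep_eq[OF init_var_indep[of UNIV], of q' q] by (simp add: pvars_def)
 show ?thesis unfolding denom_exponent_def laurent_eval_eq
 proof (rule the_equality)
  show "EX p. ev init_var p = cvar Bt (t, k) & - trop i k (2 * int t + ht k - ht i) = - Min (?w ` keys p)"
   using q m by (auto simp: minw_def)
 qed (use u m in "auto simp: minw_def")
qed

lemma compat_degree:
 assumes "\<w> : Pi" "\<g> : Pi"
 shows "int (compat_degree Bt \<w> \<g>) = pdeg \<w> \<g>"
proof -
 define c0 where "c0 \<w> \<g> = (if \<w> : Pi & \<g> : Pi then nat (pdeg \<w> \<g>) else 0)" for \<w> \<g>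
 have nn: "pdeg \<w> \<g> >= 0" for \<w> \<g> by (simp add: pdeg_def)
 define R where "R c <-> (ALL \<w> : PiD Bt. ALL \<g> : PiD Bt. c (tauD Bt \<w>) (tauD Bt \<g>) = c \<w> \<g>) &
  (ALL i < dim_col Bt. ALL \<g> : PiD Bt. int (c (0, i) \<g>) = max 0 (denom_exponent i (cvar Bt \<g>))) &
  (ALL \<w> \<g>. \<w> ~: PiD Bt \<or> \<g> ~: PiD Bt --> c \<w> \<g> = 0)" for c :: "nat \<times> nat => nat \<times> nat => nat"
 have R0: "R c0" unfolding R_def PiD dimc
 proof (intro conjI ballI allI impI)
  fix \<w> \<g> assume "\<w> : Pi" "\<g> : Pi"
  thus "c0 (tauD Bt \<w>) (tauD Bt \<g>) = c0 \<w> \<g>"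
   using pdeg_rot by (simp add: c0_def tauD rot_Pi) (auto simp: Pi_def)
 next
  fix i \<g> assume i: "i < n" and g: "\<g> : Pi"
  obtain t k where [simp]: "\<g> = (t, k)" by (cases \<g>)
  show "int (c0 (0, i) \<g>) = max 0 (denom_exponent i (cvar Bt \<g>))"
   using denom_exponent_cvar[OF i, of t k] i g by (simp add: c0_def Pi_def pdeg_def qdeg_def)
 qed (auto simp: c0_def)
 \<comment> \<open>The rotation lowers the first index to 0, where the values are
   prescribed.\<close>
 have R1: "c = c0" if c: "R c" for c
 proof (intro ext)
  fix \<w> \<g>
  show "c \<w> \<g> = c0 \<w> \<g>"
  proof (cases "\<w> : Pi & \<g> : Pi")
   case True
   thus ?thesis
   proof (induction "fst \<w>" arbitrary: \<w> \<g>)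
    case 0
    hence "\<w> = (0, snd \<w>)" "snd \<w> < n" by (cases \<w>; auto simp: Pi_def)+
    moreover have "int (c' (0, snd \<w>) \<g>) = max 0 (denom_exponent (snd \<w>) (cvar Bt \<g>))" if "R c'" for c'
     using that 0 \<open>snd \<w> < n\<close> unfolding R_def PiD dimc by blast
    ultimately show ?case using c R0 by (metis of_nat_eq_iff)
   next
    case (Suc s)
    hence s: "s = fst (rot \<w>)" by (simp add: rot_def)
    have "c' \<w> \<g> = c' (rot \<w>) (rot \<g>)" if "R c'" for c'
     using that Suc.prems tauD unfolding R_def PiD by metis
    thus ?case using Suc.hyps(1)[OF s] Suc.prems rot_Pi c R0 by metis
   qed
  next
   case False
   thus ?thesis by (metis c R_def PiD c0_def)
  qed
 qed
 have "compat_degree Bt = c0"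
  unfolding compat_degree_def R_def[symmetric] by (rule the_equality, rule R0, rule R1)
 thus ?thesis using assms nn by (simp add: c0_def)
qed

end

end

end

section \<open>The functions f and the exchange relations that define them\<close>

declare mutable_part.simps [simp del] tauD.simps [simp del]

context belt
begin

lemma nbr_exists:
 assumes "n ~= 1" "k < n"
 obtains i where "adj i k > 0"
proof -
 have "EX i. adj i k > 0"
 proof (rule ccontr)
  assume no: "~ ?thesis"
  have ik: "i = k" if "i < n" for i
  proof (rule connected_induct[where P = "%i. i = k" and i = k])
   fix i j assume "i = k" "adj i j > 0"
   thus "j = k" using no adj_pos_sym by blast
  qed (use that assms in auto)
  have "n <= 1" using ik[of 0] ik[of 1] by (force)
  thus False using assms by simp
 qed
 thus ?thesis using that by blast
qed

lemma frozen_monomials_eq: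
 "q : frozen_monomials Bt <-> (EX e. keys e <= {n..<N} & (ALL i. lookup e i >= 0) & q = mev init_var e)"
proof
 assume "q : frozen_monomials Bt"
 then obtain e where e: "q = (PROD i:{n..<N}. init_var i ^ e i)" by (auto simp: frozen_monomials_def dimc dimr)
 let ?e = "pvec N (%i. if i < n then 0 else int (e i))"
 have "mev init_var ?e = (PROD i:{n..<N}. init_var i powi lookup ?e i)"
  by (rule mev_superset) (auto)
 also have "... = q" unfolding e by (intro prod.cong refl) (simp)
 finally show "EX e. keys e <= {n..<N} & (ALL i. lookup e i >= 0) & q = mev init_var e"
  by (intro exI[of _ ?e]) (auto)
next
 assume "EX e. keys e <= {n..<N} & (ALL i. lookup e i >= 0) & q = mev init_var e"
 then obtain e where e: "keys e <= {n..<N}" "!!i. lookup e i >= 0" "q = mev init_var e" by blast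
 have "q = (PROD i:{n..<N}. init_var i powi lookup e i)"
  unfolding e(3) by (rule mev_superset) (use e(1) in auto)
 also have "... = (PROD i:{n..<N}. init_var i ^ nat (lookup e i))"
  using e(2) by (intro prod.cong refl) (simp add: power_int_def)
 finally show "q : frozen_monomials Bt" by (auto simp: frozen_monomials_def dimc dimr)
qed

text \<open>In rank at least two \<open>k\<close> has a neighbour, so M contains a mutable variable
  while M' is frozen. Whatever seed realizes the relation, M + M' is the product of the exchanged
  variables, and its expansion at \<open>mid t k\<close> identifies M.\<close>

lemma MM_eq:
 assumes n1: "n ~= 1" and k: "k < n" and x: "cvar Bt (tauD Bt \<g>) = cvar Bt (t, k)" "cvar Bt \<g> = cvar Bt (Suc t, k)"
  and mp: "mutable_part Bt \<g> = (PROD i<n. nbr (%t i. cvar Bt (t, i)) t k i powi adj i k)"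
 shows "MM Bt \<g> = neg_monomial (mid t k) k"
proof -
 let ?U = "mid t k"
 note v = mid_vseed[OF k, of t]
 interpret nzf "fst ?U" by (rule vseed_fam[OF v])
 define M0 where "M0 = pvec n (%i. adj i k)"
 have fr: "mev init_var e = mev (fst ?U) e" if "keys e <= {n..<N}" for e
  using vseed_frozen[OF v] that by (intro mev_cong) auto
 have mp': "mutable_part Bt \<g> = mev (fst ?U) M0" unfolding mp M0_def mev_pvec
 proof (intro prod.cong refl)
  fix i assume "i : {..<n}"
  show "nbr (%t i. cvar Bt (t, i)) t k i powi adj i k = fst ?U i powi adj i k"
   using mid_var[OF k, of i t] adj_nonpos(1)[of i k] by (cases "adj i k > 0") (auto simp: nbr_def)
 qed
 obtain j where j: "adj j k > 0" by (rule nbr_exists[OF n1 k])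
 have jn: "j < n" using adj_dom[OF j] by simp
 define good where "good M <-> (EX M'. exchange_relation Bt (cvar Bt (tauD Bt \<g>)) (cvar Bt \<g>) M M' &
   M' : frozen_monomials Bt & (EX q : frozen_monomials Bt. M = q * mutable_part Bt \<g>))" for M
 have good0: "good (neg_monomial ?U k)" unfolding good_def
 proof (intro exI[of _ "pos_monomial ?U k"] conjI bexI[of _ "mev init_var (gn t k)"])
  show "exchange_relation Bt (cvar Bt (tauD Bt \<g>)) (cvar Bt \<g>) (neg_monomial ?U k) (pos_monomial ?U k)"
   unfolding exchange_relation_def using mid_seeds[OF k] k mid_self[OF k] mid_exchange[OF k] x dimc by metis
  show "pos_monomial ?U k : frozen_monomials Bt"
   unfolding frozen_monomials_eq mid_monomials[OF k] using gp_keys gp_ge by blast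
  show "mev init_var (gn t k) : frozen_monomials Bt"
   unfolding frozen_monomials_eq using gn_keys gn_ge by blast
  show "neg_monomial ?U k = mev init_var (gn t k) * mutable_part Bt \<g>"
   unfolding mid_monomials[OF k] mp ..
 qed
 have form: "EX a b. keys a <= {n..<N} & keys b <= {n..<N} &
   M = mev (fst ?U) (a + M0) & M + mev (fst ?U) b = cvar Bt (t, k) * cvar Bt (Suc t, k)" if g: "good M" for M
 proof -
  obtain M' q where M: "exchange_relation Bt (cvar Bt (t, k)) (cvar Bt (Suc t, k)) M M'" "M' : frozen_monomials Bt"
   "q : frozen_monomials Bt" "M = q * mutable_part Bt \<g>" using g unfolding good_def x by blast
  have "M + M' = cvar Bt (t, k) * cvar Bt (Suc t, k)"
  proof -
   obtain T l where T: "T : seeds Bt" "l < n" "cvar Bt (t, k) = fst T l" "cvar Bt (Suc t, k) = fst (mutate l T) l"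
    "M + M' = pos_monomial T l + neg_monomial T l" using M(1) unfolding exchange_relation_def dimc by auto
   thus ?thesis using vseed_nz[OF seeds_vseed[OF T(1)]] by (simp add: fst_mutate exch_sum_def)
  qed
  moreover obtain a where "keys a <= {n..<N}" "q = mev init_var a" using M(3) frozen_monomials_eq by blast
  moreover obtain b where "keys b <= {n..<N}" "M' = mev init_var b" using M(2) frozen_monomials_eq by blast
  ultimately show ?thesis using fr M(4) mp' mev_add by (intro exI[of _ a] exI[of _ b]) auto
 qed
 have uniq: "M = M1" if g: "good M" "good M1" for M M1
 proof -
  obtain a b where ab: "keys a <= {n..<N}" "keys b <= {n..<N}"
   "M = mev (fst ?U) (a + M0)" "M + mev (fst ?U) b = cvar Bt (t, k) * cvar Bt (Suc t, k)"
   using form[OF g(1)] by blast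
  obtain a1 b1 where ab1: "keys a1 <= {n..<N}" "keys b1 <= {n..<N}"
   "M1 = mev (fst ?U) (a1 + M0)" "M1 + mev (fst ?U) b1 = cvar Bt (t, k) * cvar Bt (Suc t, k)"
   using form[OF g(2)] by blast
  let ?p = "%a b. single (a + M0) (1::int) + single b 1"
  have M0k: "keys M0 <= {..<N}" using nN by (auto simp: M0_def)
  have pv: "pvars {..<N} (?p a b)" if "keys a <= {n..<N}" "keys b <= {n..<N}" for a b
  proof (intro pvars_add pvars_single)
   show "keys (a + M0) <= {..<N}" using that(1) M0k Poly_Mapping.keys_add by fastforce
  qed (use that in auto)
  have "?p a b = ?p a1 b1"
   by (rule Z.indep_eq[OF vseed_indep(2)[OF v] pv pv]) (use ab ab1 in "simp_all add: Z.leval_add")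
  hence h: "hcomp (%e. lookup e j) 0 (?p a b) = hcomp (%e. lookup e j) 0 (?p a1 b1)" by simp
  have lk: "lookup (a + M0) j = adj j k" "lookup b j = 0"
   if "keys a <= {n..<N}" "keys b <= {n..<N}" for a b
   using that jn by (auto simp: M0_def in_keys_iff)
  have "single b (1::int) = single b1 1"
   using h lk[OF ab(1,2)] lk[OF ab1(1,2)] j by (simp add: hcomp_add hcomp_single)
  hence "single (a + M0) (1::int) = single (a1 + M0) 1" using `?p a b = ?p a1 b1` by simp
  from arg_cong[OF this, of "leval of_int (fst ?U)"] show ?thesis by (simp add: ab(3) ab1(3))
 qed
 have "(THE M. good M) = neg_monomial ?U k" using good0 uniq by blast
 thus ?thesis using n1 by (simp add: MM_def dimc good_def)
qed

context
 assumes f: "full_col Bt"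
begin

lemma per1: "k < n ==> cvar Bt (Suc (rC k), k) = init_var (kap k)"
 using cvar_periodic[OF f, of k 0] by (simp add: cvar_S S_0 initial_seed_def)

lemmas tauD' = tauD[OF per1] and PiD' = PiD[OF per1]

lemma mutable_prod:
 assumes k: "k < n"
 shows "(PROD i:{i. i < n & Bt $$ (i, k) > 0}. a i ^ nat (Bt $$ (i, k))) *
   (PROD i:{i. i < n & Bt $$ (k, i) > 0}. b i ^ nat (- Bt $$ (i, k))) =
  (PROD i<n. (if ht k = ht i + 1 then a i else b i :: ambient) powi adj i k)"
proof -
 have B: "(Bt $$ (i, k) > 0 <-> adj i k > 0 & ht k = ht i + 1) & (Bt $$ (k, i) > 0 <-> adj i k > 0 & ht k ~= ht i + 1) &
  (adj i k > 0 --> Bt $$ (i, k) = (if ht k = ht i + 1 then adj i k else - adj i k))" if i: "i < n" for i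
 proof -
  consider "adj i k = 0" "adj k i = 0" | "adj i k > 0" "adj k i > 0"
   using adj_nonpos adj_nonpos adj_pos_sym by blast
  thus ?thesis
  proof cases
   case 2
   thus ?thesis using height_cases[OF 2(1)] by (auto simp: Bt_entry i k)
  qed (simp add: Bt_entry i k)
 qed
 have "(PROD i:{i. i < n & Bt $$ (i, k) > 0}. a i ^ nat (Bt $$ (i, k))) = (PROD i<n. if ht k = ht i + 1 then a i powi adj i k else 1)"
 proof (rule prod.mono_neutral_cong_left)
  show "ALL i:{..<n} - {i. i < n & Bt $$ (i, k) > 0}. (if ht k = ht i + 1 then a i powi adj i k else 1) = 1"
  proof
   fix i assume i: "i : {..<n} - {i. i < n & Bt $$ (i, k) > 0}"
   thus "(if ht k = ht i + 1 then a i powi adj i k else 1) = 1"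
    using B adj_nonpos(1)[of i k] by (cases "adj i k > 0") auto
  qed
  fix i assume i: "i : {i. i < n & Bt $$ (i, k) > 0}"
  thus "a i ^ nat (Bt $$ (i, k)) = (if ht k = ht i + 1 then a i powi adj i k else 1)"
   using B by (auto simp: power_int_def)
 qed auto
 moreover have "(PROD i:{i. i < n & Bt $$ (k, i) > 0}. b i ^ nat (- Bt $$ (i, k))) = (PROD i<n. if ht k = ht i + 1 then 1 else b i powi adj i k)"
 proof (rule prod.mono_neutral_cong_left)
  show "ALL i:{..<n} - {i. i < n & Bt $$ (k, i) > 0}. (if ht k = ht i + 1 then 1 else b i powi adj i k) = 1"
  proof
   fix i assume i: "i : {..<n} - {i. i < n & Bt $$ (k, i) > 0}"
   thus "(if ht k = ht i + 1 then 1 else b i powi adj i k) = 1"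
    using B adj_nonpos(1)[of i k] by (cases "adj i k > 0") auto
  qed
  fix i assume i: "i : {i. i < n & Bt $$ (k, i) > 0}"
  thus "b i ^ nat (- Bt $$ (i, k)) = (if ht k = ht i + 1 then 1 else b i powi adj i k)"
   using B by (auto simp: power_int_def)
 qed auto
 moreover have "(PROD i<n. if ht k = ht i + 1 then a i powi adj i k else 1) * (PROD i<n. if ht k = ht i + 1 then 1 else b i powi adj i k) =
  (PROD i<n. (if ht k = ht i + 1 then a i else b i) powi adj i k)"
  unfolding prod.distrib[symmetric] by (intro prod.cong refl) simp
 ultimately show ?thesis by simp
qed

lemma mutable_part_Suc: "(Suc t, k) : Pi ==>
  mutable_part Bt (Suc t, k) = (PROD i<n. nbr (%t i. cvar Bt (t, i)) t k i powi adj i k)"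
 using mutable_prod by (simp add: Pi_def mutable_part.simps tauD.simps dimc nbr_def)

text \<open>For t = 0 the relation is the last exchange before the return. \<open>tauD\<close> wraps
  around, and by periodicity the reindexing by \<open>kap\<close> turns initial variables into those
  after \<open>Suc (rC (kap i))\<close> sweeps.\<close>

lemma mutable_part_0:
 assumes k: "k < n"
 shows "mutable_part Bt (0, kap k) = (PROD i<n. nbr (%t i. cvar Bt (t, i)) (rC k) k i powi adj i k)"
proof -
 define l where "l = kap k"
 have l: "l < n" using k kap_less by (simp add: l_def)
 have tau: "cvar Bt (tauD Bt (0, i)) = cvar Bt (rC (kap i), kap i)" if "i < n" for i
  using tauD' that by (simp add: Pi_def rot_def)
 have "mutable_part Bt (0, l) = (PROD i<n. (if ht l = ht i + 1 then cvar Bt (0, i) else cvar Bt (tauD Bt (0, i))) powi adj i l)"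
  using mutable_prod[OF l, of "%i. cvar Bt (0, i)" "%i. cvar Bt (tauD Bt (0, i))"] by (simp only: mutable_part.simps dimc)
 also have "... = (PROD i<n. nbr (%t i. cvar Bt (t, i)) (rC k) k (kap i) powi adj (kap i) k)"
 proof (intro prod.cong refl)
  fix i assume "i : {..<n}"
  hence i: "i < n" "kap i < n" using kap_less by auto
  have e: "adj (kap i) k = adj i l" using adj_kap[OF i(1) k] by (simp add: l_def)
  show "(if ht l = ht i + 1 then cvar Bt (0, i) else cvar Bt (tauD Bt (0, i))) powi adj i l =
   nbr (%t i. cvar Bt (t, i)) (rC k) k (kap i) powi adj (kap i) k"
  proof (cases "adj i l > 0")
   case True
   have c0: "cvar Bt (Suc (rC (kap i)), kap i) = cvar Bt (0, i)"
    using per1[OF i(2)] i by (simp add: cvar_S S_0 initial_seed_def)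
   have a: "adj (kap i) k > 0" "adj k (kap i) > 0" using True e adj_pos_sym[of k "kap i"] by auto
   show ?thesis using height_cases[OF a(1)] rC_step[OF i(2) k a(1)] rC_step[OF k i(2) a(2)] i
    by (auto simp: nbr_def e tau c0[symmetric] l_def)
  next
   case False
   hence "adj i l = 0" by (rule adj_nonpos)
   thus ?thesis using e by simp
  qed
 qed
 also have "... = (PROD i<n. nbr (%t i. cvar Bt (t, i)) (rC k) k i powi adj i k)"
  by (rule prod.reindex_bij_witness[of _ kap kap]) (auto simp: kap_less)
 finally show ?thesis by (simp add: l_def)
qed

lemma neg_monomial_mutate:
 assumes v: "vseed U" and k: "k < n"
 shows "neg_monomial (mutate k U) k = pos_monomial U k"
proof -
 have "nexp (mutate k U) k = pexp U k" using mutate_entry k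
by (intro pm_eqI) (simp add: nexp_def pexp_def snd_mutate vseed_dim[OF v])
 moreover have "mev (fst (mutate k U)) (pexp U k) = mev (fst U) (pexp U k)"
  using exps_keys(3)[OF v k] by (intro mev_cong) (auto simp: fst_mutate)
 ultimately show ?thesis by (simp add: neg_monomial_eq pos_monomial_eq)
qed

text \<open>Type A_1, in which M is fixed by convention: the belt consists of one exchange and its
  inverse.\<close>

lemma rank_one:
 assumes n: "n = 1"
 shows "kap 0 = 0" "rC 0 = 1" "mid 0 0 = initial_seed Bt" "mid 1 0 = mutate 0 (initial_seed Bt)"
proof -
 show k0: "kap 0 = 0" using kap_less n by simp
 have n0: "0 < n" using n by simp
 have s: "(SUM j<n. f j) = f 0" for f :: "nat => int" using n by simp
 \<comment> \<open>With \<open>adj\<close> zero, row 3 of the recursion is -1.\<close>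
 have "~ 3 <= cox" using cheb_nonneg[of 3 0 0] n0 by (auto simp: numeral_3_eq_3 cheb.simps(3) s)
 hence "cox = 2" using cox_ge_2 by simp
 thus "rC 0 = 1" using two_rC[OF n0] by (simp add: k0 per_def)
 have p: "pos t 0 = 0" for t using pos(1) n by simp
 show m0: "mid 0 0 = initial_seed Bt" by (simp add: mid_def p part_def S_0)
 have "mutate 0 (mid 0 0) = S 1" using mid_mutate ksp(5) n by (simp add: p)
 thus "mid 1 0 = mutate 0 (initial_seed Bt)" by (simp add: m0) (simp add: mid_def p part_def)
qed

text \<open>The function f of a variable belongs to the exchange that produces this variable;
  initial variables are produced when the belt returns to them.\<close>

lemma ff_Suc_0:
 shows ff_Suc: "(Suc t, k) : Pi ==> ff Bt (Suc t, k) = Fh t k"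
  and ff_0: "k < n ==> ff Bt (0, kap k) = Fh (rC k) k"
proof -
 have c0: "cvar Bt (Suc (rC k), k) = cvar Bt (0, kap k)" if "k < n" for k
  using per1[OF that] by (simp add: cvar_S S_0 initial_seed_def)
 have t1: "tauD Bt (Suc t, k) = (t, k)" by (simp add: tauD.simps)
 have t2: "tauD Bt (0, kap k) = (rC k, k)" if "k < n" for k
  using tauD' that kap_less[OF that] by (simp add: Pi_def rot_def)
 show "ff Bt (Suc t, k) = Fh t k" if g: "(Suc t, k) : Pi"
 proof (cases "n = 1")
  case False
  have k: "k < n" using g by (simp add: Pi_def)
  show ?thesis unfolding ff_def MM_eq[OF False k _ refl mutable_part_Suc[OF g], unfolded t1, OF refl] Fh_Gh_eq[OF k] by (simp add: t1)
 next
  case True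
  have "k < n" "Suc t <= rC k" using g by (auto simp: Pi_def)
  thus ?thesis using rank_one(2)[OF True] True Fh_Gh_eq(1) rank_one(3)[OF True]
by (auto simp: ff_def MM_def dimc tauD.simps)
 qed
 show "ff Bt (0, kap k) = Fh (rC k) k" if k: "k < n"
 proof (cases "n = 1")
  case False
  show ?thesis unfolding ff_def MM_eq[OF False k _ c0[OF k, symmetric] mutable_part_0[OF k], unfolded t2[OF k], OF refl] Fh_Gh_eq[OF k]
   by (simp add: t2[OF k] c0[OF k])
 next
  case True
  have k0: "k = 0" "0 < n" using k True by auto
  have "neg_monomial (mid 1 0) 0 = pos_monomial (initial_seed Bt) 0"
   unfolding rank_one(4)[OF True] by (rule neg_monomial_mutate[OF initial_vseed k0(2)])
  thus ?thesis
   using Fh_Gh_eq(1) t2[OF k] c0[OF k] rank_one(1,2)[OF True] True k0 by (simp add: ff_def MM_def dimc)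
 qed
qed

end

end

section \<open>The \<open>u\<close>-equations\<close>

lemma common_denominator:
 assumes "finite (R :: rat set)"
 shows "EX c::int. c > 0 & (ALL r:R. EX z. of_int c * r = of_int z)" using assms
proof (induction R)
 case (insert r R)
 then obtain c where c: "c > 0" "!!r. r : R ==> EX z. of_int c * r = of_int z" by blast
 obtain a b where ab: "quotient_of r = (a, b)" by fastforce
 hence b: "b > 0" "r = of_int a / of_int b" using quotient_of_denom_pos quotient_of_div by auto
 show ?case
 proof (rule exI[of _ "c * b"], intro conjI ballI)
  fix x assume "x : insert r R"
  then consider "x = r" | z where "of_int c * x = of_int z" using c by blast
  thus "EX z. of_int (c * b) * x = of_int z"
  proof cases
   case 1
   thus ?thesis using b by (intro exI[of _ "c * a"]) simp
  next
   case 2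
   thus ?thesis by (intro exI[of _ "b * z"]) (simp)
  qed
 qed (use c b in simp)
qed (auto intro: exI[of _ 1])

context seed_sizes
begin

definition full_rat :: "int mat => bool" where
 "full_rat B <-> (ALL w :: nat => rat. (ALL i<N. (SUM j<n. of_int (B $$ (i, j)) * w j) = 0) --> (ALL j<n. w j = 0))"

lemma full_rat_col: "full_rat B ==> full_col B" unfolding full_col_def
proof (intro allI impI)
 fix w :: "nat => int" and j
 assume f: "full_rat B" and w: "ALL i<N. (SUM j<n. B $$ (i, j) * w j) = 0" and j: "j < n"
 have "(SUM j<n. of_int (B $$ (i, j)) * of_int (w j)) = (0::rat)" if "i < N" for i
  using w that by (metis (mono_tags, lifting) of_int_0 of_int_mult of_int_sum sum.cong)
 hence *: "ALL i<N. (SUM j<n. of_int (B $$ (i, j)) * of_int (w j)) = (0::rat)" by blast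
 have "ALL j<n. (of_int (w j) :: rat) = 0"
  by (rule f[unfolded full_rat_def, THEN spec[of _ "%j. of_int (w j)"], THEN mp, OF *])
 thus "w j = 0" using j by simp
qed

text \<open>The Gram matrix of independent rational columns is invertible. Its inverse times the
  transpose of \<open>B\<close> is a left inverse, and \<open>c\<close> is a common
  denominator.\<close>

lemma left_inverse:
 assumes f: "full_rat B"
 obtains c :: int and P :: "nat => nat => int" where "c > 0"
  "!!k l. k < n ==> l < n ==> (SUM i<N. P k i * B $$ (i, l)) = (if k = l then c else 0)"
proof -
 define b :: "nat => nat => rat" where "b i j = of_int (B $$ (i, j))" for i j
 define M where "M k l = (SUM i<N. b i k * b i l)" for k l
 have ker: "ALL j<n. v j = 0" if v: "ALL k<n. (SUM l<n. M k l * v l) = 0" for v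
 proof -
  have "(SUM i<N. (SUM l<n. b i l * v l)\<^sup>2) = (SUM i<N. SUM k<n. SUM l<n. v k * (b i k * b i l * v l))"
   by (simp add: power2_eq_square sum_product mult_ac)
  also have "... = (SUM k<n. SUM i<N. SUM l<n. v k * (b i k * b i l * v l))" by (rule sum.swap)
  also have "... = (SUM k<n. SUM l<n. SUM i<N. v k * (b i k * b i l * v l))" by (intro sum.cong refl sum.swap)
  also have "... = (SUM k<n. v k * (SUM l<n. M k l * v l))" by (simp add: M_def sum_distrib_left mult_ac)
  also have "... = 0" using v by simp
  finally have "ALL i:{..<N}. (SUM l<n. b i l * v l)\<^sup>2 = 0" by (subst (asm) sum_nonneg_eq_0_iff) auto
  thus ?thesis using f unfolding full_rat_def b_def by simp
 qed
 obtain Q where Q: "!!i k. i < n ==> k < n ==> (SUM j<n. Q i j * M j k) = (if i = k then 1 else 0)"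
  using two_sided_inverse_exists[of n M, OF ker] by blast
 define R where "R k i = (SUM l<n. Q k l * b i l)" for k i
 have R: "(SUM i<N. R k i * b i m) = (if k = m then 1 else 0)" if "k < n" "m < n" for k m
 proof -
  have "(SUM i<N. R k i * b i m) = (SUM i<N. SUM l<n. Q k l * (b i l * b i m))" by (simp add: R_def sum_distrib_left mult_ac)
  also have "... = (SUM l<n. SUM i<N. Q k l * (b i l * b i m))" by (rule sum.swap)
  also have "... = (SUM l<n. Q k l * M l m)" by (simp add: M_def sum_distrib_left)
  finally show ?thesis using Q that by simp
 qed
 have "finite ((%(k, i). R k i) ` ({..<n} \<times> {..<N}))" by simp
 from common_denominator[OF this] obtain c :: int where c: "c > 0"
  "ALL r:(%(k, i). R k i) ` ({..<n} \<times> {..<N}). EX z. of_int c * r = of_int z" by blast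
 hence "ALL k i. EX z. k < n & i < N --> of_int c * R k i = of_int z" by force
 then obtain P where P: "!!k i. k < n ==> i < N ==> of_int c * R k i = of_int (P k i)" by metis
 have "(SUM i<N. P k i * B $$ (i, l)) = (if k = l then c else 0)" if "k < n" "l < n" for k l
 proof -
  have "of_int (SUM i<N. P k i * B $$ (i, l)) = (SUM i<N. of_int c * R k i * b i l)"
   using P that by (simp add: b_def)
  also have "... = of_int c * (SUM i<N. R k i * b i l)" by (simp add: sum_distrib_left mult_ac)
  also have "... = of_int (if k = l then c else 0)" using R[OF that] by simp
  finally show ?thesis by linarith
 qed
 thus ?thesis by (rule that[OF c(1)])
qed

end

context height
begin

definition window :: "int => (int => nat => 'x::comm_monoid_mult) => 'x" where
 "window a h = (PROD k<n. PROD p:{a..<a + per}. h p k)"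

definition belt_periodic :: "(int => nat => 'x) => bool" where
 "belt_periodic h <-> (ALL p. ALL k<n. h (p + per) k = h p (kap k))"

lemma prod_kap: "(PROD j<n. f (kap j)) = (PROD j<n. f j)"
 by (rule prod.reindex_bij_witness[of _ kap kap]) (auto simp: kap_less)

lemma per_gt_0: "per > 0" by (simp add: per_def)

text \<open>A shift by one replaces the factors at \<open>a\<close> by those at
  \<open>a + per\<close>, which are the same ones permuted by \<open>kap\<close>.\<close>

lemma window_shift:
 assumes "belt_periodic h"
 shows "window a h = window b h"
proof -
 have step: "window (a + 1) h = window a h" for a
 proof -
  have 1: "(PROD p:{a..<a + per}. h p k) = h a k * (PROD p:{a + 1..<a + per}. h p k)" for k
  proof -
   have "{a..<a + per} = insert a {a + 1..<a + per}" using per_gt_0 by auto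
   thus ?thesis by simp
  qed
  have 2: "(PROD p:{a + 1..<a + 1 + per}. h p k) = h (a + per) k * (PROD p:{a + 1..<a + per}. h p k)" for k
  proof -
   have "{a + 1..<a + 1 + per} = insert (a + per) {a + 1..<a + per}" using per_gt_0 by auto
   thus ?thesis by simp
  qed
  have "(PROD k<n. h (a + per) k) = (PROD k<n. h a (kap k))" using assms by (intro prod.cong refl) (simp add: belt_periodic_def)
  thus ?thesis by (simp add: window_def 1 2 prod.distrib prod_kap)
 qed
 have "window (a + int m) h = window a h" for a m
 proof (induction m)
  case (Suc m)
  have e: "a + int (Suc m) = (a + int m) + 1" by simp
  show ?case unfolding e step by (rule Suc.IH)
 qed simp
 from this[of a "nat (b - a)"] this[of b "nat (a - b)"] show ?thesis by (cases "a <= b") auto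
qed

text \<open>The set of mutable cluster variables is a fundamental domain for the periodicity.\<close>

lemma window_Pi:
 assumes h: "belt_periodic h" and odd: "!!p k. k < n ==> odd (p - ht k) ==> h p k = 1"
 shows "(PROD (t, k):Pi. h (2 * int t + ht k) k) = window a h"
proof -
 define m where "m = Min (ht ` {..<n})"
 have m: "m <= ht k" "ht k <= m + per" if "k < n" for k
 proof -
  show "m <= ht k" using that by (simp add: m_def)
  have "m : ht ` {..<n}" unfolding m_def using that by (intro Min_in) auto
  then obtain l where "l < n" "m = ht l" by auto
  thus "ht k <= m + per" using height_diam[OF that `l < n`] by (simp add: per_def)
 qed
 have "(PROD (t, k):Pi. h (2 * int t + ht k) k) = (PROD (k, t):(SIGMA k:{..<n}. {..rC k}). h (2 * int t + ht k) k)"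
  by (rule prod.reindex_bij_witness[of _ prod.swap prod.swap]) (auto simp: Pi_def)
 also have "... = (PROD k<n. PROD t<=rC k. h (2 * int t + ht k) k)" by (rule prod.Sigma[symmetric]) auto
 also have "... = (PROD k<n. PROD p:{ht k..<ht (kap k) + per}. h p k)"
 proof (intro prod.cong refl)
  fix k assume "k : {..<n}"
  hence k: "k < n" by simp
  have "(PROD t<=rC k. h (2 * int t + ht k) k) = (PROD p:(%t. 2 * int t + ht k) ` {..rC k}. h p k)"
   by (subst prod.reindex) (auto simp: inj_on_def)
  also have "... = (PROD p:{ht k..<ht (kap k) + per}. h p k)"
  proof (rule prod.mono_neutral_left)
   show "(%t. 2 * int t + ht k) ` {..rC k} <= {ht k..<ht (kap k) + per}"
    using rC[OF k] by (auto simp: per_def)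
   show "ALL p:{ht k..<ht (kap k) + per} - (%t. 2 * int t + ht k) ` {..rC k}. h p k = 1"
   proof
    fix p assume p: "p : {ht k..<ht (kap k) + per} - (%t. 2 * int t + ht k) ` {..rC k}"
    show "h p k = 1"
    proof (rule odd[OF k], rule ccontr)
     assume "~ odd (p - ht k)"
     hence "even (p - ht k)" by simp
     then obtain x where x: "p - ht k = 2 * x" by (rule evenE)
     have "x >= 0" "nat x <= rC k" using rC[OF k] p x by (auto simp: per_def)
     hence "p = 2 * int (nat x) + ht k" "nat x : {..rC k}" using x by auto
     thus False using p by blast
    qed
   qed
  qed auto
  finally show "(PROD t<=rC k. h (2 * int t + ht k) k) = (PROD p:{ht k..<ht (kap k) + per}. h p k)" .
 qed
 \<comment> \<open>The part of the range above \<open>m + per\<close> is folded back by one period;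
   after reindexing by \<open>kap\<close> it fills the gap between \<open>m\<close> and
   \<open>ht k\<close>.\<close>
 also have "... = (PROD k<n. (PROD p:{ht k..<m + per}. h p k) * (PROD p:{m + per..<ht (kap k) + per}. h p k))"
 proof (intro prod.cong refl)
  fix k assume "k : {..<n}"
  hence "ht k <= m + per" "m + per <= ht (kap k) + per" using m kap_less by auto
  thus "(PROD p:{ht k..<ht (kap k) + per}. h p k) = (PROD p:{ht k..<m + per}. h p k) * (PROD p:{m + per..<ht (kap k) + per}. h p k)"
   by (subst prod.union_disjoint[symmetric]) (auto simp: ivl_disj_un_two(3))
 qed
 also have "... = (PROD k<n. PROD p:{ht k..<m + per}. h p k) * (PROD k<n. PROD p:{m + per..<ht (kap k) + per}. h p k)"
  by (rule prod.distrib)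
 also have "(PROD k<n. PROD p:{m + per..<ht (kap k) + per}. h p k) = (PROD k<n. PROD p:{m..<ht (kap k)}. h p (kap k))"
 proof (rule prod.cong[OF refl])
  fix k assume "k : {..<n}"
  thus "(PROD p:{m + per..<ht (kap k) + per}. h p k) = (PROD p:{m..<ht (kap k)}. h p (kap k))"
   using h by (intro prod.reindex_bij_witness[of _ "%p. p + per" "%p. p - per"])
    (auto simp: belt_periodic_def, metis diff_add_cancel)
 qed
 also have "(PROD k<n. PROD p:{ht k..<m + per}. h p k) * (PROD k<n. PROD p:{m..<ht (kap k)}. h p (kap k)) =
   (PROD k<n. (PROD p:{m..<ht k}. h p k) * (PROD p:{ht k..<m + per}. h p k))"
  unfolding prod_kap[of "%k. PROD p:{m..<ht k}. h p k"] by (simp add: prod.distrib mult.commute)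
 also have "... = window m h" unfolding window_def
 proof (intro prod.cong refl)
  fix k assume "k : {..<n}"
  hence "m <= ht k" "ht k <= m + per" using m by auto
  thus "(PROD p:{m..<ht k}. h p k) * (PROD p:{ht k..<m + per}. h p k) = (PROD p:{m..<m + per}. h p k)"
   by (subst prod.union_disjoint[symmetric]) (auto simp: ivl_disj_un_two(3))
 qed
 finally show ?thesis using window_shift[OF h] by metis
qed

lemma window_mult: "window a (%p k. f p k * g p k) = window a f * window a g"
 by (simp add: window_def prod.distrib)

lemma window_translate: "window a (%p k. h (p + c) k) = window (a + c) h" unfolding window_def
proof (rule prod.cong[OF refl])
 fix k
 show "(PROD p:{a..<a + per}. h (p + c) k) = (PROD p:{a + c..<a + c + per}. h p k)"
  by (rule prod.reindex_bij_witness[of _ "%p. p - c" "%p. p + c"]) auto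
qed

end

context belt
begin

context
 assumes f: "full_col Bt"
begin

text \<open>The cluster variable at an arbitrary integer position, by the period \<open>per\<close>
  of \<open>cvar\<close> in the number of sweeps. Positions of the wrong parity carry 1, so that
  products may run over all positions.\<close>

definition xp :: "int => nat => ambient" where
 "xp p k = (if even (p - ht k) then cvar Bt (nat ((p - ht k) div 2 mod per), k) else 1)"

lemma cvar_mod: "k < n ==> cvar Bt (t, k) = cvar Bt (t mod nat per, k)"
proof (induction t rule: less_induct)
 case (less t)
 show ?case
 proof (cases "t < nat per")
  case False
  hence "cvar Bt (t, k) = cvar Bt (t - nat per, k)" using cvar_per[OF f less.prems, of "t - nat per"] by simp
  also have "... = cvar Bt ((t - nat per) mod nat per, k)" using False less per_gt_0 by auto
  finally show ?thesis using False by (simp add: le_mod_geq)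
 qed simp
qed

lemma cvar_mod': "k < n ==> cvar Bt (nat (int t mod per), k) = cvar Bt (t, k)"
 using cvar_mod[of k t] per_gt_0 by (simp add: nat_mod_distrib)

lemma xp_eq: "k < n ==> xp (2 * int t + ht k) k = cvar Bt (t, k)" by (simp add: xp_def cvar_mod')

lemma xp_nz: "k < n ==> xp p k ~= 0"
 using vseed_nz[OF seeds_vseed[OF S_seeds]] by (simp add: xp_def cvar_S)

lemma xp_odd: "odd (p - ht k) ==> xp p k = 1" by (simp add: xp_def)

lemma xp_periodic: "belt_periodic xp" unfolding belt_periodic_def
proof (intro allI impI)
 fix p k assume k: "k < n"
 have kk: "kap k < n" by (rule kap_less[OF k])
 have e: "p + per - ht k = (p - ht (kap k)) + 2 * (int (rC k) + 1)" using two_rC[OF k] by simp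
 show "xp (p + per) k = xp p (kap k)"
 proof (cases "even (p - ht (kap k))")
  case True
  then obtain x where x: "p - ht (kap k) = 2 * x" by (rule evenE)
  define a where "a = nat (x mod per)"
  have a: "int a = x mod per" using per_gt_0 by (simp add: a_def)
  have "int (a + rC k + 1) = x mod per + (int (rC k) + 1)" using a by simp
  hence "(p + per - ht k) div 2 mod per = int (a + rC k + 1) mod per"
   unfolding e x by (simp only: mod_add_left_eq) simp
  hence "xp (p + per) k = cvar Bt (nat (int (a + rC k + 1) mod per), k)" by (simp only: xp_def) (simp add: e x)
  hence "xp (p + per) k = cvar Bt (a + rC k + 1, k)" unfolding cvar_mod'[OF k] .
  thus ?thesis using cvar_periodic[OF f k, of a] by (simp add: xp_def x a_def)
 qed (simp add: xp_def e)
qed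

text \<open>The mutable part of \<open>Fh t i\<close>, as a function of the position \<open>p = 2 * t + ht i\<close>.\<close>

definition Mx :: "int => nat => ambient" where
 "Mx p i = (PROD j<n. xp (p + 1) j powi adj j i) / (xp p i * xp (p + 2) i)"

lemma Mx_odd: "i < n ==> odd (p - ht i) ==> Mx p i = 1"
proof -
 assume i: "i < n" and o: "odd (p - ht i)"
 have "xp (p + 1) j powi adj j i = 1" for j
 proof (cases "adj j i > 0")
  case True
  thus ?thesis using o height_cases[OF True] by (auto simp: xp_odd)
 qed (use adj_nonpos(1)[of j i] in simp)
 thus ?thesis using o by (simp add: Mx_def xp_odd)
qed

lemma Fh_Mx:
 assumes i: "i < n"
 shows "Fh t i = mev init_var (gn t i) * Mx (2 * int t + ht i) i"
  and "Gh t i = mev init_var (gp t i) / (xp (2 * int t + ht i) i * xp (2 * int t + ht i + 2) i)"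
proof -
 have "(PROD j<n. xp (2 * int t + ht i + 1) j powi adj j i) = (PROD j<n. nbr (%t i. cvar Bt (t, i)) t i j powi adj j i)"
 proof (intro prod.cong refl)
  fix j
  show "xp (2 * int t + ht i + 1) j powi adj j i = nbr (%t i. cvar Bt (t, i)) t i j powi adj j i"
  proof (cases "adj j i > 0")
   case True
   hence j: "j < n" using adj_dom by blast
   show ?thesis using height_cases[OF True] xp_eq[OF j, of t] xp_eq[OF j, of "Suc t"] by (auto simp: nbr_def algebra_simps)
  qed (use adj_nonpos(1)[of j i] in simp)
 qed
 moreover have "xp (2 * int t + ht i + 2) i = cvar Bt (Suc t, i)" using xp_eq[OF i, of "Suc t"] by (simp add: algebra_simps)
 ultimately show "Fh t i = mev init_var (gn t i) * Mx (2 * int t + ht i) i"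
  "Gh t i = mev init_var (gp t i) / (xp (2 * int t + ht i) i * xp (2 * int t + ht i + 2) i)"
  unfolding Fh_Gh_eq[OF i] mid_monomials[OF i] Mx_def by (simp_all add: xp_eq[OF i])
qed

end

end

context height
begin

definition nxt :: "nat \<times> nat => nat \<times> nat" where
 "nxt \<w> = (if fst \<w> = rC (snd \<w>) then (0, kap (snd \<w>)) else (Suc (fst \<w>), snd \<w>))"

lemma rot_nxt: "\<w> : Pi ==> nxt \<w> : Pi" "\<w> : Pi ==> rot (nxt \<w>) = \<w>" "\<w> : Pi ==> nxt (rot \<w>) = \<w>"
 by (cases \<w>; auto simp: nxt_def rot_def Pi_def kap_less)+

lemma prod_rot: "(PROD \<w>:Pi. h (rot \<w>)) = (PROD \<w>:Pi. h \<w>)"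
 by (rule prod.reindex_bij_witness[of _ nxt rot]) (auto simp: rot_nxt rot_Pi)

lemma tdelta_shift_left: "i < n ==> k < n ==> tdelta i k (s - per) = tdelta (kap i) k s"
 using trop_shift_left[of "kap i" k s] kap_less by (simp add: tdelta_def)

lemma qdeg_shift_left': "i < n ==> k < n ==> qdeg i k (s - per) = qdeg (kap i) k s"
 using qdeg_shift_left[of "kap i" k s] kap_less by simp

end

context belt
begin

context
 assumes f: "full_col Bt"
begin

lemma xp_per: "k < n ==> xp (p + per) k = xp p (kap k)"
 using xp_periodic[OF f] by (simp add: belt_periodic_def)

lemma window_delta:
 assumes k: "k < n"
 shows "window a (%p j. xp p j powi (- tdelta j k (P - p))) = 1 / xp P k"
proof -
 have "belt_periodic (%p j. xp p j powi (- tdelta j k (P - p)))" unfolding belt_periodic_def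
 proof (intro allI impI)
  fix p j assume j: "j < n"
  have "P - (p + per) = P - p - per" by simp
  thus "xp (p + per) j powi (- tdelta j k (P - (p + per))) = xp p (kap j) powi (- tdelta (kap j) k (P - p))"
   using tdelta_shift_left[OF j k, of "P - p"] by (simp only: xp_per[OF j])
 qed
 from window_shift[OF this, of a "P - per + 1"]
 have "window a (%p j. xp p j powi (- tdelta j k (P - p))) =
   (PROD j<n. PROD p:{P - per + 1..<P + 1}. xp p j powi (- tdelta j k (P - p)))" by (simp add: window_def)
 also have "... = (PROD j<n. if j = k then 1 / xp P k else 1)"
 proof (rule prod.cong[OF refl])
  fix j assume "j : {..<n}"
  hence j: "j < n" by simp
  have "(PROD p:{P - per + 1..<P + 1}. xp p j powi (- tdelta j k (P - p))) =
    (PROD p:{P - per + 1..<P + 1}. if p = P then (if j = k then 1 / xp P k else 1) else 1)"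
  by (rule prod.cong[OF refl]) (auto simp: tdelta_eq[OF j k] kap_pow_def divide_inverse)
  thus "(PROD p:{P - per + 1..<P + 1}. xp p j powi (- tdelta j k (P - p))) = (if j = k then 1 / xp P k else 1)"
   using per_gt_0 by simp
 qed
 also have "... = 1 / xp P k" using k by simp
 finally show ?thesis .
qed

text \<open>Every \<open>xp p j\<close> is collected from the three kinds of factors in which it
  occurs. By \<open>qdeg_comm\<close> and \<open>qdeg_rec\<close> its total exponent is minus two
  \<open>tdelta\<close> terms, which single out the positions \<open>P\<close> and
  \<open>P + 2\<close>.\<close>

lemma window_Mx:
 assumes k: "k < n"
 shows "window a (%p i. Mx p i powi qdeg i k (P - p)) = 1 / (xp P k * xp (P + 2) k)"
proof -
 define C where "C p i = qdeg i k (P - p)" for p i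
 have C_per: "C (p + per) i = C p (kap i)" if "i < n" for p i
  using qdeg_shift_left'[OF that k, of "P - p"] by (simp add: C_def algebra_simps)
 have psum: "(PROD i:A. x powi g i) = x powi sum g A" if "x ~= 0" for x :: ambient and g :: "nat => int" and A
  by (induction A rule: ifi) (use that in "auto simp: power_int_add")
 have ppow: "(PROD i:A. g i) powi m = (PROD i:A. g i powi m)" for g :: "nat => ambient" and A m
  by (induction A rule: ifi) (simp_all add: power_int_mult_distrib)
 have wcong: "window a h = window a h'" if "!!p j. j < n ==> h p j = h' p j" for h h' :: "int => nat => ambient"
  unfolding window_def using that by (intro prod.cong refl) auto
 define g1 where "g1 p j = xp p j powi (SUM i<n. adj j i * C (p - 1) i)" for p j
 define g2 where "g2 p j = xp p j powi (- C p j)" for p j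
 define g3 where "g3 p j = xp p j powi (- C (p - 2) j)" for p j
 have g_per: "g1 (p + per) j = g1 p (kap j)" "g3 (p + per) j = g3 p (kap j)" if j: "j < n" for p j
 proof -
  have "(SUM i<n. adj j i * C (p + per - 1) i) = (SUM i<n. adj (kap j) (kap i) * C (p - 1) (kap i))"
  proof (rule sum.cong[OF refl])
   fix i assume "i : {..<n}"
   thus "adj j i * C (p + per - 1) i = adj (kap j) (kap i) * C (p - 1) (kap i)"
    using C_per[of i "p - 1"] adj_kap_kap[OF j, of i] by (simp add: algebra_simps)
  qed
  also have "... = (SUM i<n. adj (kap j) i * C (p - 1) i)" by (rule sum_kap)
  finally show "g1 (p + per) j = g1 p (kap j)" by (simp add: g1_def xp_per[OF j])
  show "g3 (p + per) j = g3 p (kap j)" using C_per[OF j, of "p - 2"] by (simp add: g3_def xp_per[OF j] algebra_simps)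
 qed
 hence per: "belt_periodic g1" "belt_periodic g3" by (simp_all add: belt_periodic_def)
 have "window a (%p i. Mx p i powi C p i) = window a (%p i. (PROD j<n. xp (p + 1) j powi (adj j i * C p i)) * (g2 p i * g3 (p + 2) i))"
  by (rule wcong) (simp add: Mx_def[OF f] g2_def g3_def power_int_mult_distrib ppow power_int_mult power_int_minus power_int_inverse divide_inverse)
 also have "... = window a (%p i. PROD j<n. xp (p + 1) j powi (adj j i * C p i)) * (window a g2 * window a (%p i. g3 (p + 2) i))"
  by (simp only: window_mult)
 also have "window a (%p i. PROD j<n. xp (p + 1) j powi (adj j i * C p i)) = window a (%p j. g1 (p + 1) j)"
 proof -
  have "window a (%p i. PROD j<n. xp (p + 1) j powi (adj j i * C p i)) =
    (PROD i<n. PROD j<n. PROD p:{a..<a + per}. xp (p + 1) j powi (adj j i * C p i))"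
   unfolding window_def by (intro prod.cong refl prod.swap)
  also have "... = (PROD j<n. PROD i<n. PROD p:{a..<a + per}. xp (p + 1) j powi (adj j i * C p i))" by (rule prod.swap)
  also have "... = (PROD j<n. PROD p:{a..<a + per}. PROD i<n. xp (p + 1) j powi (adj j i * C p i))"
   by (intro prod.cong refl prod.swap)
  also have "... = window a (%p j. g1 (p + 1) j)"
   unfolding window_def g1_def using psum xp_nz[OF f] by (intro prod.cong refl) auto
  finally show ?thesis .
 qed
 also have "... = window a g1" unfolding window_translate by (rule window_shift[OF per(1)])
 also have "window a (%p i. g3 (p + 2) i) = window a g3" unfolding window_translate by (rule window_shift[OF per(2)])
 also have "window a g1 * (window a g2 * window a g3) =
   window a (%p j. xp p j powi (- tdelta j k (P - p)) * xp p j powi (- tdelta j k (P + 2 - p)))"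
  unfolding window_mult[symmetric]
 proof (rule wcong)
  fix p j assume j: "j < n"
  define s where "s = P - p + 1"
  have s: "P - (p - 1) = s" "P - p = s - 1" "P - (p - 2) = s + 1" "P + 2 - p = s + 1" by (simp_all add: s_def)
  have "(SUM i<n. adj j i * C (p - 1) i) - C p j - C (p - 2) j = - tdelta j k (P - p) - tdelta j k (P + 2 - p)"
   unfolding C_def s qdeg_comm[OF j k] using qdeg_rec[OF j k, of s] by simp
  moreover have "g1 p j * (g2 p j * g3 p j) = xp p j powi ((SUM i<n. adj j i * C (p - 1) i) - C p j - C (p - 2) j)"
   using xp_nz[OF f j, of p] by (simp add: g1_def g2_def g3_def power_int_diff power_int_minus divide_inverse)
  ultimately show "g1 p j * (g2 p j * g3 p j) = xp p j powi (- tdelta j k (P - p)) * xp p j powi (- tdelta j k (P + 2 - p))"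
   using xp_nz[OF f j, of p] by (simp add: power_int_diff power_int_minus divide_inverse)
 qed
 also have "... = 1 / xp P k * (1 / xp (P + 2) k)" unfolding window_mult window_delta[OF k] ..
 finally show ?thesis by (simp add: C_def)
qed

lemma yhat_weights:
 assumes fr: "full_rat Bt" and e: "keys e <= {..<N}"
  and w: "!!w c i. weight w ==> i < n ==> c >= 0 ==>
   (!!k. k < n ==> w (ycol (initial_seed Bt) k) = (if k = i then - c else 0)) ==> w e = 0"
 shows "e = 0"
proof -
 obtain c P where c: "c > 0" and P: "!!k l. k < n ==> l < n ==> (SUM i<N. P k i * Bt $$ (i, l)) = (if k = l then c else 0)"
  using left_inverse[OF fr] by blast
 let ?L = "%k e. SUM i<N. P k i * lookup e i"
 have y: "?L k (ycol (initial_seed Bt) l) = (if k = l then c else 0)" if "k < n" "l < n" for k l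
  using P[OF that] by (simp add: ycol_def initial_seed_def dimr)
 have wL: "weight (%e. - ?L k e)" for k by (simp add: weight_def distrib_left)
 have Le: "?L k e = 0" if k: "k < n" for k using w[OF wL k, of c] c y[OF k] by simp
 have "lookup e j = 0" if j: "j < N" for j
 proof -
  define w0 where "w0 e = c * lookup e j - (SUM k<n. Bt $$ (j, k) * ?L k e)" for e
  have "weight w0" by (simp add: weight_def w0_def distrib_left)
  moreover have "w0 (ycol (initial_seed Bt) l) = 0" if l: "l < n" for l
  proof -
   have "(SUM k<n. Bt $$ (j, k) * ?L k (ycol (initial_seed Bt) l)) = (SUM k<n. if k = l then Bt $$ (j, k) * c else 0)"
    using y l by (intro sum.cong refl) auto
   thus ?thesis using l j by (simp add: w0_def ycol_def initial_seed_def dimr)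
  qed
  ultimately show ?thesis using w[of w0 0 0] n_pos Le c by (auto simp: w0_def)
 qed
 thus ?thesis using e by (intro pm_eqI) (metis in_keys_iff lessThan_iff lookup_zero subset_iff)
qed

lemma Gh_eq_prod:
 assumes fr: "full_rat Bt" and k: "k < n"
 shows "Gh t0 k = (PROD (t, i):Pi. Fh t i powi qdeg i k (2 * int t0 + ht k - (2 * int t + ht i)))"
proof -
 define P where "P = 2 * int t0 + ht k"
 define C where "C t i = qdeg i k (P - (2 * int t + ht i))" for t i
 interpret ic: chart init_var "{..<N}" by (rule init_chart)
 have h: "belt_periodic (%p i. Mx p i powi qdeg i k (P - p))" unfolding belt_periodic_def
 proof (intro allI impI)
  fix p i assume i: "i < n"
  have "(PROD j<n. xp (p + 1 + per) j powi adj j i) = (PROD j<n. xp (p + 1) (kap j) powi adj (kap j) (kap i))"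
   using adj_kap_kap[OF _ i] by (intro prod.cong refl) (simp add: xp_per)
  also have "... = (PROD j<n. xp (p + 1) j powi adj j (kap i))" by (rule prod_kap[of "%j. xp (p + 1) j powi adj j (kap i)"])
  finally have "Mx (p + per) i = Mx p (kap i)"
   using xp_per[OF i, of p] xp_per[OF i, of "p + 2"] by (simp add: Mx_def[OF f] algebra_simps)
  moreover have "qdeg i k (P - (p + per)) = qdeg (kap i) k (P - p)"
   using qdeg_shift_left'[OF i k, of "P - p"] by (simp add: algebra_simps)
  ultimately show "Mx (p + per) i powi qdeg i k (P - (p + per)) = Mx p (kap i) powi qdeg (kap i) k (P - p)" by simp
 qed
 define z where "z = (SUM (t, i):Pi. frag_cmul (C t i) (gn t i)) - gp t0 k"
 have zk: "keys z <= {n..<N}"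
 proof -
  have "keys (frag_cmul (C t i) (gn t i)) <= {n..<N}" for t i using gn_keys by blast
  hence 1: "lookup (frag_cmul (C t i) (gn t i)) x = 0" if "x ~: {n..<N}" for t i x
   using that by (metis in_keys_iff subset_iff)
  have 2: "lookup (gp t0 k) x = 0" if "x ~: {n..<N}" for x using that gp_keys by (metis in_keys_iff subset_iff)
  have "lookup z x = 0" if "x ~: {n..<N}" for x
   unfolding z_def lookup_minus lookup_sum 2[OF that] using 1[OF that] by (simp add: case_prod_beta)
  thus ?thesis by (meson in_keys_iff subsetI)
 qed
 have "(PROD (t, i):Pi. Fh t i powi C t i) = (PROD (t, i):Pi. mev init_var (gn t i) powi C t i * Mx (2 * int t + ht i) i powi qdeg i k (P - (2 * int t + ht i)))"
 proof (rule prod.cong[OF refl])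
  fix x assume "x : Pi"
  then obtain t i where x: "x = (t, i)" "i < n" by (auto simp: Pi_def)
  show "(case x of (t, i) => Fh t i powi C t i) =
   (case x of (t, i) => mev init_var (gn t i) powi C t i * Mx (2 * int t + ht i) i powi qdeg i k (P - (2 * int t + ht i)))"
   unfolding x(1) case_prod_conv Fh_Mx(1)[OF f x(2)] C_def by (rule power_int_mult_distrib)
 qed
 also have "... = mev init_var (SUM (t, i):Pi. frag_cmul (C t i) (gn t i)) *
   (PROD (t, i):Pi. Mx (2 * int t + ht i) i powi qdeg i k (P - (2 * int t + ht i)))"
  by (simp add: case_prod_beta init.mev_sum init.mev_cmul)
 also have "(PROD (t, i):Pi. Mx (2 * int t + ht i) i powi qdeg i k (P - (2 * int t + ht i))) = 1 / (xp P k * xp (P + 2) k)"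
  using window_Pi[OF h, of 0] window_Mx[OF k, of 0 P] Mx_odd[OF f] by simp
 also have "1 / (xp P k * xp (P + 2) k) = Gh t0 k / mev init_var (gp t0 k)"
  unfolding Fh_Mx(2)[OF f k] P_def by simp
 finally have eq: "(PROD (t, i):Pi. Fh t i powi C t i) = mev init_var z * Gh t0 k"
  by (simp add: z_def init.mev_diff)
 have "z = 0"
 proof (rule yhat_weights[OF fr])
  show "keys z <= {..<N}" using zk by auto
  fix w :: "nat ex => int" and c i0
  assume w: "weight w" and i0: "i0 < n" and c: "c >= 0"
   and wy: "!!k. k < n ==> w (ycol (initial_seed Bt) k) = (if k = i0 then - c else 0)"
  note sy = sford_Fh_Gh[OF w sford_yh[OF w i0 _ c wy] c]
  have s1: "sford init_var {..<N} w (PROD (t, i):Pi. Fh t i powi C t i) (SUM (t, i):Pi. C t i * (c * tdelta i0 i (2 * int t + ht i - ht i0)))"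
   unfolding case_prod_beta by (rule ic.sford_prod[OF w], rule ic.sford_powi[OF w], rule sy(1)) (auto simp: Pi_def)
  have "(SUM (t, i):Pi. C t i * (c * tdelta i0 i (2 * int t + ht i - ht i0))) = (SUM x:Pi. if x = (0, i0) then C 0 i0 * c else 0)"
  proof (rule sum.cong[OF refl])
   fix x assume "x : Pi"
   then obtain t i where x: "x = (t, i)" "i < n" "t <= rC i" by (auto simp: Pi_def)
   thus "(case x of (t, i) => C t i * (c * tdelta i0 i (2 * int t + ht i - ht i0))) = (if x = (0, i0) then C 0 i0 * c else 0)"
    using trop_window[OF i0 x(2,3)] by auto
  qed
  also have "... = c * qdeg i0 k (2 * int t0 + ht k - ht i0)"
   using finite_Pi i0 by (simp add: Pi_def C_def P_def)
  finally have s2: "sford init_var {..<N} w (mev init_var z * Gh t0 k) (c * qdeg i0 k (2 * int t0 + ht k - ht i0))"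
   using s1 unfolding eq by simp
  have "sford init_var {..<N} w (mev init_var z * Gh t0 k) (w z + c * qdeg i0 k (2 * int t0 + ht k - ht i0))"
   using zk by (intro ic.sford_mult[OF w] ic.sford_mono[OF w] sy(2)[OF k]) auto
  from ic.sford_unique[OF w this s2] show "w z = 0" by simp
 qed
 thus ?thesis using eq by (simp add: C_def P_def)
qed

lemma ff_eq_Fh: "\<w> : Pi ==> ff Bt \<w> = Fh (fst (rot \<w>)) (snd (rot \<w>))"
proof (cases \<w>)
 case (Pair t k)
 assume o: "\<w> : Pi"
 show ?thesis
 proof (cases t)
  case 0
  thus ?thesis using o ff_0[OF f, of "kap k"] kap_less Pair by (simp add: rot_def Pi_def)
 qed (use o Pair ff_Suc[OF f] in "simp add: rot_def")
qed

lemma ff_nz: "\<w> : Pi ==> ff Bt \<w> ~= 0"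
 using ff_eq_Fh Fh_Gh(2) rot_Pi[of \<w>] by (cases "rot \<w>") (auto simp: Pi_def)

lemma u_equation:
 assumes fr: "full_rat Bt" and g: "\<g> : Pi"
 shows "ff Bt \<g> + (PROD \<w>:Pi. ff Bt \<w> ^ nat (pdeg \<w> \<g>)) = 1"
proof -
 obtain t0 k where tk: "rot \<g> = (t0, k)" by fastforce
 hence k: "k < n" using rot_Pi[OF g] by (simp add: Pi_def)
 have "(PROD \<w>:Pi. ff Bt \<w> ^ nat (pdeg \<w> \<g>)) = (PROD \<w>:Pi. Fh (fst (rot \<w>)) (snd (rot \<w>)) powi pdeg (rot \<w>) (rot \<g>))"
 proof (rule prod.cong[OF refl])
  fix \<w> assume o: "\<w> : Pi"
  have "pdeg \<w> \<g> = pdeg (rot \<w>) (rot \<g>)" using pdeg_rot o g by (auto simp: Pi_def)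
  moreover have "pdeg (rot \<w>) (rot \<g>) >= 0" by (simp add: pdeg_def)
  ultimately show "ff Bt \<w> ^ nat (pdeg \<w> \<g>) = Fh (fst (rot \<w>)) (snd (rot \<w>)) powi pdeg (rot \<w>) (rot \<g>)"
   by (simp add: ff_eq_Fh[OF o] power_int_def)
 qed
 also have "... = (PROD \<w>:Pi. Fh (fst \<w>) (snd \<w>) powi pdeg \<w> (rot \<g>))" by (rule prod_rot)
 also have "... = Gh t0 k"
  unfolding Gh_eq_prod[OF fr k] by (intro prod.cong refl) (auto simp: pdeg_def tk algebra_simps)
 finally show ?thesis using Fh_Gh(1)[OF k, of t0] ff_eq_Fh[OF g] by (simp add: tk)
qed

end

end

section \<open>The two exchange matrices\<close>

lemma full_rank_kernel:
 fixes w :: "nat => rat"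
 assumes Bt: "Bt : carrier_mat N n" and r: "full_rank Bt"
  and w: "!!i. i < N ==> (SUM j<n. of_int (Bt $$ (i, j)) * w j) = 0" and j: "j < n"
 shows "w j = 0"
proof (rule ccontr)
 assume wj: "w j ~= 0"
 interpret V: vec_space "TYPE(rat)" N .
 define A :: "rat mat" where "A = map_mat of_int Bt"
 have A: "A : carrier_mat N n" using Bt by (simp add: A_def)
 have rk: "V.rank A = n" using r Bt by (simp add: full_rank_def A_def)
 \<comment> \<open>Repeated columns are excluded first, since linear dependence is formulated for
   the set of columns.\<close>
 have d: "distinct (cols A)"
 proof (rule ccontr)
  assume nd: "~ distinct (cols A)"
  obtain S where S: "maximal S (%T. T <= set (cols A) & V.lin_indpt T)"
   using maximal_exists[of "(%T. T <= set (cols A) & V.lin_indpt T)" "card (set (cols A))" "{}"]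
   by (meson List.finite_set card_mono empty_iff empty_subsetI V.finite_lin_indpt2 rev_finite_subset)
  hence "card S <= card (set (cols A))" by (simp add: card_mono maximal_def)
  also have "... < n" using nd A card_distinct card_length cols_length by (metis carrier_matD(2) nat_less_le)
  finally show False using V.rank_card_indpt[OF A S] rk by simp
 qed
 have "V.lin_dep (set (cols A))"
 proof (rule V.lin_depI[OF A _ _ _ d])
  show "vec n w ~= 0\<^sub>v n" using wj j by (metis index_vec index_zero_vec(1))
  show "A *\<^sub>v vec n w = 0\<^sub>v N"
   using w Bt by (intro eq_vecI) (auto simp: scalar_prod_def A_def atLeast0LessThan)
 qed simp
 thus False using V.full_rank_lin_indpt[OF A rk d] by simp
qed

lemma (in belt) full_rank_full_rat: "full_rank Bt ==> full_rat Bt"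
 unfolding full_rat_def using full_rank_kernel[OF Bt] by blast

text \<open>One height function serves both matrices, so that their belts have the same
  positions.\<close>

lemma belt_exists:
 assumes c: "connected_finite_type_cartan n A" and o: "orientation n A E"
 obtains ht where "!!m Bt. extends_matrix n m (exchange_matrix n A E) Bt ==> belt n A ht (n + m) Bt"
  "belt n A ht n (exchange_matrix n A E)"
proof -
 interpret cartan n A by unfold_locales (rule c)
 obtain ht where phi: "!!i j. (i, j) : E ==> ht j = ht i + (1::int)" by (rule height_exists[OF o]) blast
 have E: "(i, j) : E \<or> (j, i) : E" if "adj i j > 0" for i j
  using that o by (auto simp: adj_def orientation_def split: if_splits)
 have h: "height n A ht"
 proof unfold_locales
  fix i j assume "adj i j > 0"
  thus "\<bar>ht i - ht j\<bar> = 1" using E phi by fastforce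
 qed
 have ent: "exchange_matrix n A E $$ (i, j) = (ht j - ht i) * adj i j" if ij: "i < n" "j < n" for i j
 proof -
  consider "(i, j) : E" | "(i, j) ~: E" "(j, i) : E" | "(i, j) ~: E" "(j, i) ~: E" by blast
  thus ?thesis
  proof cases
   case 1
   hence "i ~= j" using o by (auto simp: orientation_def)
   thus ?thesis using 1 phi[OF 1] ij by (simp add: exchange_matrix_def adj_def)
  next
   case 2
   hence "i ~= j" by auto
   thus ?thesis using 2 phi[OF 2(2)] ij by (simp add: exchange_matrix_def adj_def)
  next
   case 3
   hence "adj i j = 0" using E adj_nonneg by (smt (verit))
   thus ?thesis using 3 ij by (simp add: exchange_matrix_def)
  qed
 qed
 show ?thesis
 proof (rule that[of ht])
  show "belt n A ht (n + m) Bt" if e: "extends_matrix n m (exchange_matrix n A E) Bt" for m Bt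
   using h ent e by (auto simp: belt_def belt_axioms_def extends_matrix_def)
  show "belt n A ht n (exchange_matrix n A E)"
   using h ent by (auto simp: belt_def belt_axioms_def) (simp add: exchange_matrix_def)
 qed
qed

context belt
begin

text \<open>The belt of the principal exchange matrix arises by setting the frozen variables to \<open>1\<close>.\<close>

definition unfrozen :: "nat => ambient" where "unfrozen i = (if i < n then init_var i else 1)"

interpretation u: nzf unfrozen by unfold_locales (simp add: unfrozen_def)

text \<open>Specialization as a relation between values; it is single valued because the initial
  variables are independent.\<close>

definition spec :: "ambient => ambient => bool" where
 "spec z z' <-> (EX p. pvars {..<N} p & leval of_int init_var p = z & leval of_int unfrozen p = z')"

lemma spec_unique: "spec z a ==> spec z b ==> a = b"
 unfolding spec_def using Z.indep_eq[OF chart.indep[OF init_chart]] by metis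

lemma spec_mult: "spec z a ==> spec z' b ==> spec (z * z') (a * b)" unfolding spec_def
 by (metis (no_types, lifting) Z.leval_mult[OF init.nzf_axioms] Z.leval_mult[OF u.nzf_axioms] pvars_mult)

lemma spec_add: "spec z a ==> spec z' b ==> spec (z + z') (a + b)"
 unfolding spec_def by (metis (no_types, lifting) Z.leval_add pvars_add)

lemma spec_mono: "keys e <= {..<N} ==> spec (mev init_var e) (mev unfrozen e)"
 unfolding spec_def by (intro exI[of _ "single e 1"]) (simp add: pvars_single)

lemma spec_powi: "spec z a ==> m >= 0 ==> spec (z powi m) (a powi m)"
proof -
 assume z: "spec z a" and m: "m >= 0"
 have "spec (z ^ j) (a ^ j)" for j using spec_mono[of 0] by (induction j) (auto intro: spec_mult z)
 thus ?thesis using m by (simp add: power_int_def)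
qed

lemma spec_prod: "(!!i. i : I ==> spec (g i) (h i)) ==> spec (prod g I) (prod h I)"
 using spec_mono[of 0] by (induction I rule: ifi) (auto intro: spec_mult)

lemma spec_frozen: "keys e <= {n..<N} ==> spec (mev init_var e) 1"
 using spec_mono[of e] by (subgoal_tac "mev unfrozen e = 1")
  (auto simp: mev_def unfrozen_def subset_iff intro!: prod.neutral)

text \<open>The exchange relations of the two belts correspond. Dividing by the old variable is
  legitimate, because the Laurent property of \<open>Bt\<close> already provides some specialization
  of the new one.\<close>

lemma spec_cvar:
 assumes B: "belt n A ht n B" and f: "full_col Bt" and k: "k < n"
 shows "spec (cvar Bt (t, k)) (cvar B (t, k))" using k
proof (induction t arbitrary: k)
 case 0
 interpret b: belt n A ht n B by (rule B)
 show ?case using spec_mono[of "single k 1"] 0 nN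
  by (simp add: cvar_S S_0 b.cvar_S b.S_0 initial_seed_def unfrozen_def)
next
 case (Suc t)
 interpret b: belt n A ht n B by (rule B)
 show ?case using Suc.prems
 proof (induction "pos t k" arbitrary: k rule: less_induct)
  case less
  have n0: "spec (nbr (%t i. cvar Bt (t, i)) t k i powi adj i k) (b.nbr (%t i. cvar B (t, i)) t k i powi adj i k)" for i
  proof (cases "adj i k > 0")
   case True
   have "spec (nbr (%t i. cvar Bt (t, i)) t k i) (b.nbr (%t i. cvar B (t, i)) t k i)"
    using less.hyps Suc.IH adj_dom[OF True] pos_nbr[OF less.prems True, of t]
by (auto simp: b.nbr_def)
   thus ?thesis by (rule spec_powi) simp
  qed (use adj_nonpos(1)[of i k] spec_mono[of 0] in simp)
  have e0: "e = 0" if "keys e <= {n..<n}" for e :: "nat ex" using that by simp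
  have bx: "cvar B (Suc t, k) * cvar B (t, k) = 1 + (PROD i<n. b.nbr (%t i. cvar B (t, i)) t k i powi adj i k)"
   using b.exchange_eq[OF less.prems, of t] e0[OF b.gp_keys[of t k]] e0[OF b.gn_keys[of t k]]
   by (simp add: b.mid_monomials[OF less.prems])
  have "spec (cvar Bt (Suc t, k) * cvar Bt (t, k)) (1 + 1 * (PROD i<n. b.nbr (%t i. cvar B (t, i)) t k i powi adj i k))"
   unfolding exchange_eq[OF less.prems] mid_monomials[OF less.prems]
   by (intro spec_add spec_mult spec_frozen spec_prod n0 gp_keys gn_keys)
  hence s: "spec (cvar Bt (Suc t, k) * cvar Bt (t, k)) (cvar B (Suc t, k) * cvar B (t, k))" by (simp add: bx)
  have "cvar Bt (Suc t, k) : upper (S (Suc t))"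
   using var_in_upper[OF seeds_vseed[OF S_seeds], of k "Suc t"] less.prems nN by (simp add: cvar_S)
  hence "cvar Bt (Suc t, k) : ZL (initial_seed Bt)"
   using seeds_closed(3)[OF initial_vseed S_seeds f] by (auto simp: upper_def)
  then obtain p where "pvars {..<N} p" "leval of_int init_var p = cvar Bt (Suc t, k)"
   by (auto simp: ZL_def Z.lring_def initial_seed_def)
  hence z': "spec (cvar Bt (Suc t, k)) (leval of_int unfrozen p)" unfolding spec_def by blast
  from spec_unique[OF s spec_mult[OF z' Suc.IH[OF less.prems]]]
  show ?case using z' b.vseed_nz[OF b.seeds_vseed[OF b.S_seeds], of t k] by (simp add: b.cvar_S)
 qed
qed

lemma spec_lring: "spec z z' ==> z' : Z.lring init_var {..<n}"
proof -
 assume "spec z z'"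
 then obtain p where p: "pvars {..<N} p" "leval of_int unfrozen p = z'" by (auto simp: spec_def)
 have "mev unfrozen e = mev init_var (pvec n (lookup e))" if "e : keys p" for e
 proof -
  have "mev unfrozen e = (PROD i<N. unfrozen i powi lookup e i)"
   by (rule mev_superset) (use p(1) that in "auto simp: pvars_def")
  also have "... = (PROD i<n. init_var i powi lookup e i)"
   by (rule prod.mono_neutral_cong_right) (use nN in "auto simp: unfrozen_def")
  finally show ?thesis by (simp add: mev_pvec)
 qed
 hence "z' = leval of_int init_var (SUM e:keys p. single (pvec n (lookup e)) (lookup p e))"
  unfolding p(2)[symmetric] by (simp add: leval_def[of _ unfrozen] Z.leval_sum)
 also have "... : Z.lring init_var {..<n}" by (intro Z.lring_memI pvars_sum pvars_single) (auto)
 finally show ?thesis .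
qed

text \<open>Periodicity and the Laurent property of \<open>B\<close> are specializations of those of
  \<open>Bt\<close>, whatever the rank of \<open>B\<close>.\<close>

lemma principal_index:
 assumes B: "belt n A ht n B" and f: "full_col Bt"
 shows "PiD B = Pi" and "!!\<w> \<g>. \<w> : Pi ==> \<g> : Pi ==> compat_degree B \<w> \<g> = nat (pdeg \<w> \<g>)"
proof -
 interpret b: belt n A ht n B by (rule B)
 have per: "cvar B (Suc (rC k), k) = init_var (kap k)" if k: "k < n" for k
 proof -
  have "spec (init_var (kap k)) (init_var (kap k))"
   using spec_mono[of "single (kap k) 1"] kap_less[OF k] nN by (simp add: unfrozen_def)
  thus ?thesis using spec_cvar[OF B f k, of "Suc (rC k)"] per1[OF f k] spec_unique by simp
 qed
 show "PiD B = Pi" using b.PiD[OF per] .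
 have lau: "cvar B \<g> : b.ZL (initial_seed B)" if "\<g> : Pi" for \<g>
  using that spec_lring[OF spec_cvar[OF B f]] by (cases \<g>) (auto simp: Pi_def b.ZL_def initial_seed_def)
 show "compat_degree B \<w> \<g> = nat (pdeg \<w> \<g>)" if "\<w> : Pi" "\<g> : Pi" for \<w> \<g>
  using b.compat_degree[OF per lau that] by simp
qed

end

section \<open>The ideal of relations\<close>

context height
begin

lemma tdelta_sym: "i < n ==> k < n ==> tdelta i k s = tdelta k i (- s)"
proof -
 assume ik: "i < n" "k < n"
 have "tdelta i k s = tdelta i k (- s)" using trop_minus[OF ik, of s] by (simp add: tdelta_def)
 also have "... = tdelta k i (- s)"
  unfolding tdelta_eq[OF ik] tdelta_eq[OF ik(2,1)] using ik by (auto simp: kap_pow_def)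
 finally show ?thesis .
qed

lemma tdelta_Pi:
 assumes "(s, i) : Pi" "(t, k) : Pi"
 shows "tdelta i k (2 * (int t - int s) + ht k - ht i) = (if (s, i) = (t, k) then 1 else 0)"
proof (cases "s <= t")
 case True
 thus ?thesis using trop_window[of i k "t - s"] assms by (auto simp: Pi_def)
next
 case False
 have ik: "i < n" "k < n" using assms by (auto simp: Pi_def)
 have "- (2 * (int t - int s) + ht k - ht i) = 2 * int (s - t) + ht i - ht k" using False by simp
 hence "tdelta i k (2 * (int t - int s) + ht k - ht i) = tdelta k i (2 * int (s - t) + ht i - ht k)"
  by (metis tdelta_sym[OF ik])
 thus ?thesis using trop_window[OF ik(2,1), of "s - t"] assms False by (auto simp: Pi_def)
qed

text \<open>Exponent vectors of the monomials \<open>u\<^sub>\<g>\<close>, \<open>1 - u\<^sub>\<g>\<close> and of their quotient, at the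
 exchange \<open>(t, k)\<close>, which produces the variable \<open>\<g> = nxt (t, k)\<close>.\<close>

definition bvec :: "(nat => nat => int => int) => nat => nat => (nat \<times> nat \<Rightarrow>\<^sub>0 int)" where
 "bvec q t k = (SUM \<w>:Pi. single (nxt \<w>) (q (snd \<w>) k (2 * (int t - int (fst \<w>)) + ht k - ht (snd \<w>))))"

definition yy :: "nat => nat => (nat \<times> nat \<Rightarrow>\<^sub>0 int)" where "yy t k = bvec qdeg t k - bvec tdelta t k"

lemma bvec_tdelta: "(t, k) : Pi ==> bvec tdelta t k = single (nxt (t, k)) 1"
proof -
 assume g: "(t, k) : Pi"
 have "bvec tdelta t k = (SUM \<w>:Pi. if \<w> = (t, k) then single (nxt (t, k)) 1 else 0)"
  unfolding bvec_def using tdelta_Pi[OF _ g] by (intro sum.cong refl) auto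
 thus ?thesis using g finite_Pi by simp
qed

lemma bvec_keys: "keys (bvec q t k) <= Pi"
 unfolding bvec_def by (rule order_trans[OF keys_sum]) (auto simp: rot_nxt)

lemma bvec_qdeg: "\<g> : Pi ==> bvec qdeg (fst (rot \<g>)) (snd (rot \<g>)) = (SUM \<w>:Pi. single \<w> (pdeg \<w> \<g>))"
proof -
 assume g: "\<g> : Pi"
 have "bvec qdeg (fst (rot \<g>)) (snd (rot \<g>)) = (SUM \<w>:Pi. single (nxt \<w>) (pdeg \<w> (rot \<g>)))"
  by (simp add: bvec_def pdeg_def)
 also have "... = (SUM \<w>:Pi. single \<w> (pdeg (rot \<w>) (rot \<g>)))"
  by (rule sum.reindex_bij_witness[of _ rot nxt]) (auto simp: rot_nxt rot_Pi)
 also have "... = (SUM \<w>:Pi. single \<w> (pdeg \<w> \<g>))"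
  using g by (intro sum.cong refl arg_cong2[of _ _ _ _ single] pdeg_rot) (auto simp: Pi_def)
 finally show ?thesis .
qed

end

context belt
begin

text \<open>By \<open>qdeg_rec\<close> the Y-system already holds for exponent vectors, as an
  identity of monomials before any relation is imposed.\<close>

lemma yy_rec:
 assumes k: "k < n"
 shows "yy (Suc t) k = (SUM j<n. frag_cmul (adj j k) (nbr (bvec qdeg) t k j)) - yy t k"
proof (rule pm_eqI)
 fix x
 show "lookup (yy (Suc t) k) x = lookup ((SUM j<n. frag_cmul (adj j k) (nbr (bvec qdeg) t k j)) - yy t k) x"
 proof (cases "x : Pi")
  case False
  hence z: "lookup (bvec q t j) x = 0" for q t j using bvec_keys[of q t j] by (auto simp: in_keys_iff)
  thus ?thesis by (simp add: yy_def nbr_def)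
 next
  case True
  obtain s i where si: "rot x = (s, i)" by fastforce
  hence i: "i < n" using rot_Pi[OF True] by (simp add: Pi_def)
  have lk: "lookup (bvec q t j) x = q i j (2 * (int t - int s) + ht j - ht i)" for q t j
  proof -
   have "lookup (bvec q t j) x = (SUM \<w>:Pi. if \<w> = rot x then q i j (2 * (int t - int s) + ht j - ht i) else 0)"
    unfolding bvec_def lookup_sum
   proof (rule sum.cong[OF refl])
    fix \<w> assume "\<w> : Pi"
    hence "nxt \<w> = x <-> \<w> = rot x" using rot_nxt(2) rot_nxt(3)[OF True] by metis
    thus "lookup (single (nxt \<w>) (q (snd \<w>) j (2 * (int t - int (fst \<w>)) + ht j - ht (snd \<w>)))) x =
     (if \<w> = rot x then q i j (2 * (int t - int s) + ht j - ht i) else 0)" by (auto simp: si)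
   qed
   thus ?thesis using rot_Pi[OF True] finite_Pi by simp
  qed
  define p where "p = 2 * (int t - int s) + ht k - ht i + 1"
  have p: "2 * (int (Suc t) - int s) + ht k - ht i = p + 1" "2 * (int t - int s) + ht k - ht i = p - 1" by (simp_all add: p_def)
  have "(SUM j<n. lookup (frag_cmul (adj j k) (nbr (bvec qdeg) t k j)) x) = (SUM j<n. qdeg i j p * adj j k)"
  proof (rule sum.cong[OF refl])
   fix j
   show "lookup (frag_cmul (adj j k) (nbr (bvec qdeg) t k j)) x = qdeg i j p * adj j k"
   proof (cases "adj j k > 0")
    case True
    thus ?thesis using height_cases[OF True] by (auto simp: nbr_def lk p_def algebra_simps)
   qed (use adj_nonpos(1)[of j k] in simp)
  qed
  thus ?thesis using qdeg_rec[OF i k, of p] unfolding yy_def lookup_minus lk p by simp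
 qed
qed

text \<open>The formula \<open>yh_eq\<close> at t = 0, solved for the y-hat variable of the initial
  seed: this monomial in the u evaluates to it by \<open>mono_base\<close>.\<close>

definition base :: "nat => (nat \<times> nat \<Rightarrow>\<^sub>0 int)" where
 "base k = yy 0 k - (SUM j<n. if ht k = ht j + 1 then frag_cmul (adj j k) (bvec qdeg 0 j) else 0)"

definition Lam :: "(nat \<times> nat \<Rightarrow>\<^sub>0 int) set" where
 "Lam = {SUM k<n. frag_cmul (c k) (base k) | c. True}"

lemma Lam_closed: "0 : Lam" "a : Lam ==> b : Lam ==> a + b : Lam" "k < n ==> base k : Lam"
proof -
 show "0 : Lam" unfolding Lam_def by (intro CollectI exI[of _ "%_. 0"]) simp
 show "a + b : Lam" if ab: "a : Lam" "b : Lam"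
 proof -
  obtain c d where "a = (SUM k<n. frag_cmul (c k) (base k))" "b = (SUM k<n. frag_cmul (d k) (base k))" using ab by (auto simp: Lam_def)
  hence "a + b = (SUM k<n. frag_cmul (c k + d k) (base k))" by (simp add: sum.distrib frag_cmul_distrib)
  thus ?thesis unfolding Lam_def by (intro CollectI exI[of _ "%k. c k + d k"]) simp
 qed
 show "base k : Lam" if "k < n"
 proof -
  have "base k = (SUM j<n. frag_cmul (if j = k then 1 else 0) (base j))"
   using that by (simp add: if_distrib[of "%c. frag_cmul c _"] cong: if_cong)
  thus ?thesis unfolding Lam_def by (intro CollectI exI[of _ "%j. if j = k then 1 else 0"]) simp
 qed
qed

lemma Lam_keys: "a : Lam ==> keys a <= Pi"
proof -
 assume "a : Lam"
 then obtain c where a: "a = (SUM k<n. frag_cmul (c k) (base k))" by (auto simp: Lam_def)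
 have z: "lookup (bvec q t j) x = 0" if "x ~: Pi" for q t j x using bvec_keys[of q t j] that by (auto simp: in_keys_iff)
 have s: "lookup (if P then frag_cmul b (bvec q t j) else 0) x = 0" if "x ~: Pi" for P b q t j x
  using z[OF that] by simp
 have "lookup a x = 0" if "x ~: Pi" for x by (simp add: a base_def yy_def z[OF that])
 thus ?thesis by (meson in_keys_iff subsetI)
qed

abbreviation lamp :: "(nat \<times> nat) laurent => bool" where "lamp p \<equiv> keys p <= Lam"

lemma lamp_closed: "lamp a ==> lamp b ==> lamp (a + b)" "lamp a ==> lamp b ==> lamp (a * b)" "lamp (single 0 c)" "lamp a ==> pvars Pi a"
 using Poly_Mapping.keys_add[of a b] keys_mult Lam_closed Lam_keys by (auto simp: pvars_def) blast+

text \<open>Modulo the relations, every Laurent polynomial is a fraction of Laurent polynomials in the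
 monomials \<open>base k\<close>, with an invertible denominator.\<close>

lemma fraction_mod_relations:
 assumes I: "!!a b. a : I ==> b : I ==> a + b : I" "!!a b. a : I ==> pvars Pi b ==> a * b : I"
  and rel: "!!\<g>. \<g> : Pi ==> single (single \<g> 1) 1 +
   single (SUM \<w>:Pi. single \<w> (pdeg \<w> \<g>)) 1 - 1 : I"
  and p: "pvars Pi p"
 shows "EX a b b'. lamp a & lamp b & pvars Pi b' & b * b' - 1 : I & p * b - a : I"
proof -
 let ?m = "%e. single e (1::complex)"
 define E where "E a b <-> a - b : I" for a b :: "(nat \<times> nat) laurent"
 \<comment> \<open>\<open>un\<close> is invertibility modulo \<open>I\<close>, for the congruence
   \<open>E\<close>; \<open>G\<close> below consists of the fractions and is to contain all Laurent
   polynomials.\<close>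
 define un where "un a <-> pvars Pi a & (EX b. pvars Pi b & E (a * b) 1)" for a
 have "n > 0" using n_pos by simp
 hence I0: "0 : I" using I(2)[OF rel, of _ 0] by (auto simp: Pi_def)
 have E0: "E a a" for a by (simp add: E_def I0)
 have Etr: "E a c" if "E a b" "E b c" for a b c using I(1)[OF that[unfolded E_def]] by (simp add: E_def)
 have Esym: "E b a" if "E a b" for a b
  using I(2)[OF that[unfolded E_def], of "- 1"] by (simp add: E_def pvars_uminus)
 have Em: "E (a * c) (b * c)" if "E a b" "pvars Pi c" for a b c
  using I(2)[OF that(1)[unfolded E_def] that(2)] by (simp add: E_def left_diff_distrib)
 have Emm: "E (a * c) (b * d)" if "E a b" "E c d" "pvars Pi b" "pvars Pi c" for a b c d
  using Etr[OF Em[OF that(1,4)]] Em[OF that(2,3)] by (simp add: mult.commute)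
 have Ea: "E (a + c) (b + d)" if "E a b" "E c d" for a b c d
  using I(1)[OF that[unfolded E_def]] by (simp add: E_def algebra_simps)
 have um: "un (a * b)" if uab: "un a" "un b" for a b
 proof -
  obtain a' b' where ab: "pvars Pi a'" "E (a * a') 1" "pvars Pi b'" "E (b * b') 1" using uab by (auto simp: un_def)
  have "E (a * a' * (b * b')) (1 * 1)" using ab that by (intro Emm) (auto simp: un_def)
  thus ?thesis using ab that pvars_mult by (auto simp: mult_ac un_def)
 qed
 have uE: "un b" if "un a" "E a b" "pvars Pi b" for a b
  using that Em[OF Esym[OF that(2)]] Etr unfolding un_def by blast
 have mono_un: "un (?m e)" if "keys e <= Pi" for e
  unfolding un_def using that E0 by (intro conjI exI[of _ "?m (- e)"] pvars_single) (auto)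
 define G where "G = {p. pvars Pi p & (EX a b. lamp a & lamp b & un b & E (p * b) a)}"
 have G1: "p : G" if "lamp p" for p
  using that mono_un[of 0] lamp_closed(3)[of 1] lamp_closed(4)[OF that] E0 unfolding G_def by (intro CollectI conjI exI[of _ p] exI[of _ 1]) auto
 have Gm: "a * b : G" and Gadd: "a + b : G" if ab: "a : G" "b : G" for a b
 proof -
  obtain x y where a: "pvars Pi a" "lamp x" "lamp y" "un y" "E (a * y) x" using ab(1) by (auto simp: G_def)
  obtain z w where b: "pvars Pi b" "lamp z" "lamp w" "un w" "E (b * w) z" using ab(2) by (auto simp: G_def)
  have "E (a * y * (b * w)) (x * z)" using a b lamp_closed(4) by (intro Emm) auto
  hence "E (a * b * (y * w)) (x * z)" by (simp add: mult_ac)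
  thus "a * b : G" unfolding G_def using a b um lamp_closed(2) by (intro CollectI conjI exI[of _ "x * z"] exI[of _ "y * w"]) auto
  have "E (a * y * w + b * w * y) (x * w + z * y)" using a b lamp_closed(4) by (intro Ea Em)
  hence "E ((a + b) * (y * w)) (x * w + z * y)" by (simp add: algebra_simps)
  thus "a + b : G" unfolding G_def using a b um lamp_closed(1,2) by (intro CollectI conjI exI[of _ "x * w + z * y"] exI[of _ "y * w"]) auto
 qed
 have Gi: "b : G" if ab: "a : G" "E (a * b) 1" "pvars Pi b" for a b
 proof -
  obtain x y where a: "pvars Pi a" "lamp x" "lamp y" "un y" "E (a * y) x" using ab(1) by (auto simp: G_def)
  have "un x" using ab(2,3) uE[OF um a(5)] a lamp_closed(4) by (auto simp: un_def)
  have "E (x * b) (a * y * b)" using Em[OF Esym[OF a(5)] ab(3)] .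
  moreover have "E (a * b * y) (1 * y)" by (rule Em[OF ab(2) lamp_closed(4)[OF a(3)]])
  ultimately have "E (b * x) y" using Etr by (simp add: mult_ac)
  thus ?thesis unfolding G_def using a ab `un x` by blast
 qed
 have G1e: "?m e : G" if "e : Lam" for e using that by (intro G1) simp
 have Ginv: "?m (- e) : G" if "?m e : G" "keys e <= Pi" for e
  using Gi[OF that(1), of "?m (- e)"] that(2) E0 by (simp add: pvars_single)
 have Gcm: "?m (frag_cmul c e) : G" if "?m e : G" "keys e <= Pi" for c e
 proof -
  have nat: "?m (frag_cmul (int j) e) : G" if "?m e : G" for j e
  proof (induction j)
   case (Suc j)
   show ?case using Gm[OF that Suc] by (auto simp: frag_cmul_distrib)
  qed (use G1e[OF Lam_closed(1)] in simp)
  show ?thesis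
  proof (cases "c >= 0")
   case False
   have "frag_cmul (- c) (- e) = frag_cmul c e" by (rule pm_eqI) simp
   thus ?thesis using nat[OF Ginv[OF that], of "nat (- c)"] False by simp
  qed (use nat[OF that(1), of "nat c"] in simp)
 qed
 have Gsum: "?m (sum g A) : G" if "!!j. j : A ==> ?m (g j) : G" for g and A :: "nat set" using that
 proof (induction A rule: ifi)
  case (insert x A)
  hence "?m (g x) * ?m (sum g A) : G" by (intro Gm) auto
  thus ?case using insert by simp
 qed (use G1e[OF Lam_closed(1)] in simp_all)
 \<comment> \<open>The relation reads u + v = 1 with v = yy u, so u is the inverse of 1 + yy, and v
   follows.\<close>
 have bq: "?m (bvec qdeg t k) : G & ?m (bvec tdelta t k) : G" if Y: "?m (yy t k) : G" and g: "(t, k) : Pi" for t k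
 proof -
  define \<g> where "\<g> = nxt (t, k)"
  have gP: "\<g> : Pi" "rot \<g> = (t, k)" using rot_nxt g by (auto simp: \<g>_def)
  let ?u = "bvec tdelta t k" and ?v = "bvec qdeg t k"
  have r: "E (?m ?u + ?m ?v) 1"
   using rel[OF gP(1)] bvec_qdeg[OF gP(1)] bvec_tdelta[OF g] by (simp add: gP(2) E_def \<g>_def[symmetric])
  have kk: "keys ?u <= Pi" "keys (yy t k) <= Pi" using bvec_keys Y by (auto simp: G_def pvars_def)
  have inv: "E ((1 + ?m (yy t k)) * ?m ?u) 1" using r by (simp add: distrib_right yy_def)
  have "1 + ?m (yy t k) : G" using Gadd[OF G1e[OF Lam_closed(1)] Y] by simp
  from Gi[OF this inv] have "?m ?u : G" using kk pvars_single by blast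
  moreover have "?m ?v = ?m (yy t k) * ?m ?u" by (simp add: yy_def)
  ultimately show ?thesis using Gm[OF Y] by metis
 qed
 \<comment> \<open>Induction by sweeps and, within a sweep, by the order of mutation;
   \<open>rC_step\<close> keeps the neighbours that occur inside \<open>Pi\<close>, where relations
   are available.\<close>
 have Y: "?m (yy t k) : G" if "(t, k) : Pi" for t k using that
 proof (induction t arbitrary: k)
  case 0
  thus ?case
  proof (induction "pos 0 k" arbitrary: k rule: less_induct)
   case less
   hence k: "k < n" by (simp add: Pi_def)
   have "?m (if ht k = ht j + 1 then frag_cmul (adj j k) (bvec qdeg 0 j) else 0) : G" if "j < n" for j
   proof (cases "adj j k > 0 & ht k = ht j + 1")
    case True
    thus ?thesis using pos_nbr[OF k, of j 0] bq[OF less.hyps] that Gcm bvec_keys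
by (auto simp: Pi_def)
   next
    case False
    thus ?thesis using adj_nonpos(1)[of j k] G1e[OF Lam_closed(1)] by auto
   qed
   hence "?m (base k) * ?m (SUM j<n. if ht k = ht j + 1 then frag_cmul (adj j k) (bvec qdeg 0 j) else 0) : G"
    by (intro Gm[OF G1e[OF Lam_closed(3)[OF k]] Gsum]) auto
   thus ?case by (simp add: base_def)
  qed
 next
  case (Suc t)
  show ?case using Suc.prems
  proof (induction "pos (Suc t) k" arbitrary: k rule: less_induct)
   case less
   hence k: "k < n" "Suc t <= rC k" by (auto simp: Pi_def)
   have "?m (frag_cmul (adj j k) (nbr (bvec qdeg) t k j)) : G" if j: "j < n" for j
   proof (cases "adj j k > 0")
    case a: True
    have "?m (nbr (bvec qdeg) t k j) : G"
    proof (cases "ht k = ht j + 1")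
     case True
     hence "pos (Suc t) j < pos (Suc t) k" "(Suc t, j) : Pi"
      using pos_nbr[OF k(1) a, of "Suc t"] rC_step[OF j k(1) a True] k j by (auto simp: Pi_def)
     thus ?thesis using bq[OF less.hyps] True by (simp add: nbr_def)
    next
     case False
     thus ?thesis using height_cases[OF a] rC_step[OF k(1) j] a adj_pos_sym k j bq[OF Suc.IH]
by (auto simp: Pi_def nbr_def)
    qed
    thus ?thesis using Gcm bvec_keys by (simp add: nbr_def)
   qed (use adj_nonpos(1)[of j k] G1e[OF Lam_closed(1)] in simp)
   hence s: "?m (SUM j<n. frag_cmul (adj j k) (nbr (bvec qdeg) t k j)) : G" by (intro Gsum) auto
   have "?m (- yy t k) : G" using Suc.IH k by (intro Ginv) (auto simp: Pi_def G_def pvars_def)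
   from Gm[OF s this] show ?case by (simp add: yy_rec[OF k(1)])
  qed
 qed
 have Gsingle: "single e c : G" if "keys e <= Pi" for e c
 proof -
  have u: "?m (single \<g> 1) : G" if g: "\<g> : Pi" for \<g>
  proof -
   obtain t k where tk: "rot \<g> = (t, k)" by fastforce
   thus ?thesis using rot_Pi[OF g] rot_nxt(3)[OF g] bq[OF Y] bvec_tdelta by (auto)
  qed
  have "?m (SUM \<g>:A. single \<g> (lookup e \<g>)) : G" if "A <= Pi" for A
   using finite_subset[OF that finite_Pi] that
  proof (induction A rule: finite_induct)
   case (insert x A)
   have "single x (lookup e x) = frag_cmul (lookup e x) (single x 1)" by (rule pm_eqI) (simp)
   hence "?m (single x (lookup e x)) : G" using Gcm[OF u[of x]] insert by simp
   from Gm[OF this, of "?m (SUM \<g>:A. single \<g> (lookup e \<g>))"] insert show ?case by simp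
  qed (use G1e[OF Lam_closed(1)] in simp)
  from this[OF that] have "?m e : G" by (simp add: pm_decomp[symmetric])
  from Gm[OF this G1[OF lamp_closed(3)[of c]]] show ?thesis by simp
 qed
 have "(SUM e:A. single e (lookup p e)) : G" if "A <= keys p" for A
  using finite_subset[OF that finite_keys] that
 using Gsingle[of 0 0] p Gadd Gsingle by (induction A rule: finite_induct) (auto simp: pvars_def)
 hence "p : G" using pm_decomp by (metis order_refl)
 thus ?thesis unfolding G_def un_def E_def by blast
qed

end

section \<open>Subrings of type-class rings\<close>

definition subr :: "'a::comm_ring_1 set => bool" where
 "subr R <-> 1 : R & (ALL a:R. ALL b:R. a + b : R & a * b : R) & (ALL a:R. - a : R)"

abbreviation sub_ring :: "'a::comm_ring_1 set => 'a ring" where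
 "sub_ring R \<equiv> ring_of_type_algebra \<lparr> carrier := R \<rparr>"

lemma sub_ring_simps [simp]:
 "carrier (sub_ring R) = R" "a \<otimes>\<^bsub>sub_ring R\<^esub> b = a * b" "a \<oplus>\<^bsub>sub_ring R\<^esub> b = a + b" "\<one>\<^bsub>sub_ring R\<^esub> = 1" "\<zero>\<^bsub>sub_ring R\<^esub> = 0"
 by (simp_all add: ring_of_type_algebra_def)

lemma ambient_ring_simps [simp]:
 "carrier (ring_of_type_algebra :: 'a::comm_ring_1 ring) = UNIV" "\<one>\<^bsub>ring_of_type_algebra :: 'a ring\<^esub> = 1"
 "a \<otimes>\<^bsub>ring_of_type_algebra\<^esub> b = a * (b::'a)" "a \<oplus>\<^bsub>ring_of_type_algebra\<^esub> b = a + (b::'a)"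
 by (simp_all add: ring_of_type_algebra_def)

lemma subr_closed: "subr R ==> 1 : R" "subr R ==> a : R ==> b : R ==> a + b : R"
 "subr R ==> a : R ==> b : R ==> a * b : R" "subr R ==> a : R ==> - a : R" "subr R ==> 0 : R"
 "subr R ==> a : R ==> b : R ==> a - b : R" "subr R ==> a : R ==> a ^ m : R"
proof -
 show *: "subr R ==> 1 : R" "!!a b. subr R ==> a : R ==> b : R ==> a + b : R"
  "!!a b. subr R ==> a : R ==> b : R ==> a * b : R" "!!a. subr R ==> a : R ==> - a : R" unfolding subr_def by auto
 show "subr R ==> 0 : R" using *(1,4) *(2)[of 1 "- 1"] by simp
 show "subr R ==> a : R ==> b : R ==> a - b : R" using *(2)[of a "- b"] *(4) by simp
 show "subr R ==> a : R ==> a ^ m : R" by (induction m) (simp_all add: *)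
qed

lemma subr_sum: "subr R ==> (!!i. i : I ==> f i : R) ==> sum f I : R"
 by (induction I rule: ifi) (auto intro: subr_closed)

lemma subr_prod: "subr R ==> (!!i. i : I ==> f i : R) ==> prod f I : R"
 by (induction I rule: ifi) (auto intro: subr_closed)

lemma cring_sub_ring: "subr R ==> cring (sub_ring R)"
proof -
 assume R: "subr R"
 show ?thesis
 proof (intro cringI abelian_groupI comm_monoidI)
  fix x assume "x : carrier (sub_ring R)"
  thus "EX y:carrier (sub_ring R). y \<oplus>\<^bsub>sub_ring R\<^esub> x = \<zero>\<^bsub>sub_ring R\<^esub>"
   using subr_closed(4)[OF R] by (intro bexI[of _ "- x"]) auto
 qed (use subr_closed[OF R] in "auto simp: algebra_simps")
qed

lemma domain_sub_ring: "subr R ==> domain (sub_ring (R :: 'a::idom set))"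
 by (intro domain.intro cring_sub_ring) (auto simp: domain_axioms_def)

lemma a_inv_sub_ring: "subr R ==> a : R ==> \<ominus>\<^bsub>sub_ring R\<^esub> a = - a"
proof -
 assume R: "subr R" and a: "a : R"
 interpret cring "sub_ring R" by (rule cring_sub_ring[OF R])
 show ?thesis using minus_equality subr_closed(4)[OF R a] a by simp
qed

lemma a_inv_ambient: "\<ominus>\<^bsub>ring_of_type_algebra\<^esub> (a :: 'a::comm_ring_1) = - a"
 using a_inv_sub_ring[of "UNIV :: 'a set" a] by (simp add: subr_def ring_of_type_algebra_def)

lemma ideal_sub_ring:
 assumes R: "subr R" and I: "I <= R" "0 : I" "!!a b. a : I ==> b : I ==> a + b : I" "!!a b. a : I ==> b : R ==> a * b : I"
 shows "ideal I (sub_ring R)"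
proof -
 interpret cring "sub_ring R" by (rule cring_sub_ring[OF R])
 have m: "- a : I" if "a : I" for a using I(4)[OF that, of "- 1"] subr_closed(1,4)[OF R] by simp
 show ?thesis
 proof (rule idealI[OF ring_axioms])
  show "subgroup I (add_monoid (sub_ring R))"
   using I m a_inv_sub_ring[OF R] by (intro add.subgroupI) (auto)
 qed (use I in "auto simp: mult.commute")
qed

lemma idealD_sub_ring:
 assumes "ideal I (sub_ring R)"
 shows "I <= R" "0 : I" "a : I ==> b : I ==> a + b : I" "a : I ==> b : R ==> a * b : I"
proof -
 interpret ideal I "sub_ring R" by (rule assms)
 show "I <= R" using a_subset by simp
 note as = ideal.axioms(1)[OF assms]
 show "0 : I" using additive_subgroup.zero_closed[OF as] by simp
 show "a : I ==> b : I ==> a + b : I" using additive_subgroup.a_closed[OF as, of a b] by simp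
 show "a : I ==> b : R ==> a * b : I" using I_r_closed by simp
qed

lemma subr_generate_ring: "subr (generate_ring ring_of_type_algebra (H :: 'a::comm_ring_1 set))"
 unfolding subr_def
 using generate_ring.one[of ring_of_type_algebra H] generate_ring.a_inv[of _ ring_of_type_algebra H]
  generate_ring.eng_add[of _ ring_of_type_algebra H] generate_ring.eng_mult[of _ ring_of_type_algebra H]
 by (simp add: a_inv_ambient)

lemma generate_ring_subset: "subr R ==> H <= R ==> generate_ring ring_of_type_algebra (H :: 'a::comm_ring_1 set) <= R"
proof
 fix x assume R: "subr R" "H <= R" and "x : generate_ring ring_of_type_algebra H"
 from this(3) show "x : R" by induction (use R subr_closed in "auto simp: a_inv_ambient")
qed

section \<open>The coordinate ring of the cluster configuration space\<close>

lemma sum_single_inj: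
 fixes p :: "'a \<Rightarrow>\<^sub>0 'c::comm_monoid_add"
 assumes "inj_on g (keys p)" "(SUM e:keys p. single (g e) (lookup p e)) = 0"
 shows "p = 0"
proof (rule pm_eqI)
 fix e
 show "lookup p e = lookup 0 e"
 proof (cases "e : keys p")
  case True
  have "0 = lookup (SUM e':keys p. single (g e') (lookup p e')) (g e)" by (simp add: assms(2))
  also have "... = (SUM e':keys p. if e' = e then lookup p e' else 0)"
   unfolding lookup_sum using assms(1) True by (intro sum.cong refl) (auto dest: inj_onD)
  finally show ?thesis using True by simp
 qed (simp add: in_keys_iff)
qed

context belt
begin

text \<open>Here, as for \<open>y0\<close>, the value 1 off the index set makes the family nowhere
  zero.\<close>

definition Fv :: "nat \<times> nat => ambient" where "Fv \<w> = (if \<w> : Pi then ff Bt \<w> else 1)"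

definition R0 :: "ambient set" where "R0 = C.lring Fv Pi"

definition y0 :: "nat => ambient" where "y0 k = (if k < n then yhat (initial_seed Bt) k else 1)"

context
 assumes fr: "full_rat Bt"
begin

lemmas fc = full_rat_col[OF fr]

lemma Fv_fam: "nzf Fv" using ff_nz[OF fc] by unfold_locales (simp add: Fv_def)

interpretation F: nzf Fv by (rule Fv_fam)

lemma y0_fam: "nzf y0" using yhat_nz[OF initial_vseed] by unfold_locales (simp add: y0_def)

interpretation y: nzf y0 by (rule y0_fam)

lemma R0_subr: "subr R0" unfolding subr_def R0_def
using C.lring_coeff[of 1 Fv Pi] C.lring_add C.lring_mult[OF Fv_fam] C.lring_uminus by auto

lemma Fv_nxt: "(t, k) : Pi ==> Fv (nxt (t, k)) = Fh t k"
 using rot_nxt ff_eq_Fh[OF fc, of "nxt (t, k)"] by (simp add: Fv_def)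

lemma mono_bvec:
 shows "k < n ==> mev Fv (bvec qdeg t k) = Gh t k" and "(t, k) : Pi ==> mev Fv (bvec tdelta t k) = Fh t k"
proof -
 assume k: "k < n"
 have "mev Fv (bvec qdeg t k) = (PROD \<w>:Pi. Fv (nxt \<w>) powi qdeg (snd \<w>) k (2 * (int t - int (fst \<w>)) + ht k - ht (snd \<w>)))"
  by (simp add: bvec_def F.mev_sum)
 also have "... = Gh t k"
  unfolding Gh_eq_prod[OF fc fr k] using Fv_nxt by (intro prod.cong refl) (auto simp: algebra_simps)
 finally show "mev Fv (bvec qdeg t k) = Gh t k" .
next
 assume "(t, k) : Pi"
 thus "mev Fv (bvec tdelta t k) = Fh t k" by (simp add: bvec_tdelta Fv_nxt)
qed

lemma mono_base: "k < n ==> mev Fv (base k) = y0 k"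
proof -
 assume k: "k < n"
 hence k0: "(0, k) : Pi" by (simp add: Pi_def)
 have "(PROD j<n. mev Fv (if ht k = ht j + 1 then frag_cmul (adj j k) (bvec qdeg 0 j) else 0)) =
   (PROD j<n. if ht k = ht j + 1 then Gh 0 j powi adj j k else 1)"
  by (intro prod.cong refl) (auto simp: F.mev_cmul mono_bvec)
 moreover have "mev Fv (yy 0 k) = yh 0 k"
  using mono_bvec(1)[OF k, of 0] mono_bvec(2)[OF k0] yh_nz[OF k, of 0] by (simp add: yy_def F.mev_diff Gh_def Fh_def)
 moreover have "(PROD j<n. if ht k = ht j + 1 then Gh 0 j powi adj j k else 1) ~= 0"
  using Fh_Gh(3) by auto
 ultimately show "mev Fv (base k) = y0 k"
  using yh_eq[OF k, of 0] k by (simp add: base_def F.mev_diff F.mev_sum y0_def S_0)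
qed

lemma y0_eval: "mev y0 e = mev init_var (SUM k:keys e. frag_cmul (lookup e k) (ycol (initial_seed Bt) k))"
 if "keys e <= {..<n}" unfolding init.mev_sum init.mev_cmul mev_def[of y0] using that
 by (intro prod.cong refl arg_cong2[of _ _ _ _ "(powi)"]) (auto simp: y0_def yhat_def initial_seed_def)

text \<open>Independent columns of \<open>Bt\<close> turn distinct exponents of \<open>y0\<close>
  into distinct monomials in the initial variables.\<close>

lemma y0_indep: "C.indep y0 {..<n}" unfolding C.indep_def
proof (intro allI impI)
 fix p :: "nat laurent" assume p: "pvars {..<n} p" "ev y0 p = 0"
 define g where "g e = (SUM k:keys e. frag_cmul (lookup e k) (ycol (initial_seed Bt) k))" for e
 have gl: "lookup (g e) i = (SUM k<n. Bt $$ (i, k) * lookup e k)" if "keys e <= {..<n}" "i < N" for e i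
 proof -
  have "lookup (g e) i = (SUM k:keys e. Bt $$ (i, k) * lookup e k)"
   using that by (simp add: g_def ycol_def initial_seed_def dimr mult.commute)
  also have "... = (SUM k<n. Bt $$ (i, k) * lookup e k)"
   using that by (intro sum.mono_neutral_left) (auto simp: in_keys_iff)
  finally show ?thesis .
 qed
 have "inj_on g (keys p)"
 proof (rule inj_onI)
  fix a b assume ab: "a : keys p" "b : keys p" "g a = g b"
  hence k: "keys a <= {..<n}" "keys b <= {..<n}" using p(1) by (auto simp: pvars_def)
  define w where "w k = lookup a k - lookup b k" for k
  have "(SUM k<n. Bt $$ (i, k) * w k) = 0" if "i < N" for i
   using gl[OF k(1) that] gl[OF k(2) that] ab(3) by (simp add: w_def right_diff_distrib sum_subtractf)
  hence w: "w k = 0" if "k < n" for k using fc that unfolding full_col_def by blast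
  show "a = b"
  proof (rule pm_eqI)
   fix i show "lookup a i = lookup b i"
    using w k by (cases "i < n") (simp add: w_def, metis in_keys_iff lessThan_iff subsetD)
  qed
 qed
 moreover have "(SUM e:keys p. single (g e) (lookup p e)) = 0"
 using p(1) init_var_indep[of UNIV] p(2) by (auto simp: C.leval_sum leval_def[of _ y0] g_def y0_eval pvars_def C.indep_def)
 ultimately show "p = 0" by (rule sum_single_inj)
qed

lemma lamp_eval:
 assumes "lamp a"
 obtains q where "pvars {..<n} q" "ev Fv a = ev y0 q" "q = 0 ==> a = 0"
proof -
 have "EX d. keys d <= {..<n} & e = (SUM k<n. frag_cmul (lookup d k) (base k))" if e: "e : Lam" for e
 proof -
  obtain c where "e = (SUM k<n. frag_cmul (c k) (base k))" using e by (auto simp: Lam_def)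
  thus ?thesis by (intro exI[of _ "pvec n c"]) (auto)
 qed
 then obtain d where d: "!!e. e : Lam ==> keys (d e) <= {..<n}"
  "!!e. e : Lam ==> e = (SUM k<n. frag_cmul (lookup (d e) k) (base k))" by metis
 define q where "q = (SUM e:keys a. single (d e) (lookup a e))"
 have "mev Fv e = mev y0 (d e)" if e: "e : Lam" for e
 proof -
  have "mev Fv e = (PROD k<n. y0 k powi lookup (d e) k)"
   by (subst d(2)[OF e]) (simp add: F.mev_sum F.mev_cmul mono_base)
  thus ?thesis using mev_superset[of "{..<n}" "d e" y0] d(1)[OF e] by simp
 qed
 hence ev: "ev Fv a = ev y0 q"
  using assms unfolding q_def C.leval_sum leval_def[of _ Fv] by (intro sum.cong refl) auto
 have pq: "pvars {..<n} q" unfolding q_def using d(1) assms by (intro pvars_sum pvars_single) auto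
 have "inj_on d (keys a)" using d(2) assms by (intro inj_onI) (metis subsetD)
 hence "q = 0 ==> a = 0" using sum_single_inj by (simp add: q_def)
 from that[OF pq ev this] show ?thesis .
qed

lemma rel_eval:
 assumes g: "\<g> : Pi"
 shows "ev Fv (single (single \<g> 1) 1 +
   single (SUM \<w>:Pi. single \<w> (pdeg \<w> \<g>)) 1 - 1) = 0"
using u_equation[OF fc fr g] g by (auto simp: Fv_def power_int_def pdeg_def C.leval_diff C.leval_add F.mev_sum)

lemma rel_pvars:
 assumes g: "\<g> : Pi"
 shows "pvars Pi (single (single \<g> 1) (1::complex) +
   single (SUM \<w>:Pi. single \<w> (pdeg \<w> \<g>)) 1 - 1)"
proof -
 have "keys (SUM \<w>:Pi. single \<w> (pdeg \<w> \<g>)) <= Pi"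
  by (rule order_trans[OF keys_sum]) (auto)
 thus ?thesis using g by (intro pvars_add pvars_single pvars_diff pvars_1) auto
qed

lemma R0_fraction:
 assumes "r : R0"
 shows "EX a b. pvars {..<n} a & pvars {..<n} b & ev y0 b : R0 & inverse (ev y0 b) : R0 &
  ev y0 b ~= 0 & r * ev y0 b = ev y0 a"
proof -
 obtain p where p: "pvars Pi p" "r = ev Fv p" using assms by (auto simp: R0_def C.lring_def)
 define I where "I = {p. pvars Pi p & ev Fv p = 0}"
 have rel: "single (single \<g> 1) 1 +
   single (SUM \<w>:Pi. single \<w> (pdeg \<w> \<g>)) 1 - 1 : I" if "\<g> : Pi" for \<g>
  using rel_eval[OF that] rel_pvars[OF that] by (simp add: I_def)
 have "EX a b b'. lamp a & lamp b & pvars Pi b' & b * b' - 1 : I & p * b - a : I"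
  by (rule fraction_mod_relations[OF _ _ rel p(1)]) (auto simp: I_def C.leval_add C.leval_mult[OF Fv_fam])
 then obtain a b b' where ab: "lamp a" "lamp b" "pvars Pi b'" "b * b' - 1 : I" "p * b - a : I" by blast
 have e: "ev Fv b * ev Fv b' = 1" "r * ev Fv b = ev Fv a"
  using ab(4,5) by (simp_all add: I_def C.leval_diff C.leval_mult[OF Fv_fam] p(2))
 obtain qa where qa: "pvars {..<n} qa" "ev Fv a = ev y0 qa" using lamp_eval[OF ab(1)] by blast
 obtain qb where qb: "pvars {..<n} qb" "ev Fv b = ev y0 qb" using lamp_eval[OF ab(2)] by blast
 have "ev Fv b : R0" "ev Fv b' : R0"
  using ab(3) lamp_closed(4)[OF ab(2)] C.lring_memI by (auto simp: R0_def)
 moreover have "inverse (ev Fv b) = ev Fv b'" using e(1) by (simp add: inverse_unique)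
 ultimately show ?thesis using e qa qb by (intro exI[of _ qa] exI[of _ qb]) auto
qed

lemma y0_R0: "k < n ==> y0 k : R0" "k < n ==> inverse (y0 k) : R0"
 using C.lring_mev[of "base k" Pi Fv] C.lring_mev[of "- base k" Pi Fv] Lam_keys[OF Lam_closed(3), of k]
 by (auto simp: R0_def mono_base F.mev_uminus)

lemma config_iso:
 assumes B: "belt n A ht n B"
 shows "EX \<Phi> : algebra_iso (config_ring B) (config_scalar B) (sub_ring R0) scalar. ALL \<g> : PiD B. \<Phi> (config_var B \<g>) = ff Bt \<g>"
proof -
 note idx = principal_index[OF B fc]
 define L :: "(nat \<times> nat) laurent ring" where "L = laurent_ring Pi"
 have L: "L = sub_ring {p. pvars Pi p}" by (simp add: L_def laurent_ring_def pvars_def)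
 have sL: "subr {p :: (nat \<times> nat) laurent. pvars Pi p}" by (auto simp: subr_def)
 interpret L: cring L unfolding L by (rule cring_sub_ring[OF sL])
 interpret R: cring "sub_ring R0" by (rule cring_sub_ring[OF R0_subr])
 let ?\<rho> = "ev Fv"
 have hom: "?\<rho> : Ring.ring_hom L (sub_ring R0)"
  by (rule ring_hom_memI) (auto simp: L C.leval_add C.leval_mult[OF Fv_fam] R0_def C.lring_memI)
 interpret h: ring_hom_ring L "sub_ring R0" ?\<rho>
  by (rule ring_hom_ringI2[OF L.ring_axioms R.ring_axioms hom])
 have rel: "config_relation B \<g> = single (single \<g> 1) 1 +
   single (SUM \<w>:Pi. single \<w> (pdeg \<w> \<g>)) 1 - 1" if g: "\<g> : Pi" for \<g>
 proof -
  have pw: "laurent_var \<w> ^ j = single (single \<w> (int j)) 1" for \<w> :: "nat \<times> nat" and j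
   by (induction j) (simp_all add: laurent_var_def single_add[symmetric])
  have "(PROD \<w>:Pi. laurent_var \<w> ^ compat_degree B \<w> \<g>) = (PROD \<w>:Pi. single (single \<w> (pdeg \<w> \<g>)) 1)"
   using g by (intro prod.cong refl) (simp add: idx(2) pw pdeg_def)
  also have "... = single (SUM \<w>:A. single \<w> (pdeg \<w> \<g>)) 1" if "A = Pi" for A
   unfolding that[symmetric] by (induction A rule: ifi) (simp_all)
  finally show ?thesis by (simp add: config_relation_def idx(1) laurent_var_def)
 qed
 have relL: "config_relation B ` Pi <= carrier L" using rel rel_pvars by (auto simp: L)
 define I where "I = config_ideal B"
 have I: "I = Idl\<^bsub>L\<^esub> (config_relation B ` Pi)" by (simp add: I_def config_ideal_def idx(1) L_def)
 have idI: "ideal I L" unfolding I by (rule L.genideal_ideal[OF relL])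
 have ker: "a_kernel L (sub_ring R0) ?\<rho> = {p. pvars Pi p & ?\<rho> p = 0}" unfolding a_kernel_def' unfolding L sub_ring_simps by blast
 have Iker: "I <= a_kernel L (sub_ring R0) ?\<rho>" unfolding I
 proof (rule L.genideal_minimal[OF h.kernel_is_ideal], rule subsetI)
  fix x assume x: "x : config_relation B ` Pi"
  then obtain \<g> where g: "\<g> : Pi" "x = config_relation B \<g>" by blast
  thus "x : a_kernel L (sub_ring R0) ?\<rho>" unfolding ker using rel[OF g(1)] rel_pvars[OF g(1)] rel_eval[OF g(1)] by simp
 qed
 have "I = a_kernel L (sub_ring R0) ?\<rho>"
 proof (rule antisym[OF Iker])
  show "a_kernel L (sub_ring R0) ?\<rho> <= I"
  proof
   fix p assume "p : a_kernel L (sub_ring R0) ?\<rho>"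
   hence p: "pvars Pi p" "?\<rho> p = 0" by (auto simp: ker)
   note Id = idealD_sub_ring[OF idI[unfolded L]]
   have "EX a b b'. lamp a & lamp b & pvars Pi b' & b * b' - 1 : I & p * b - a : I"
   proof (rule fraction_mod_relations[OF _ _ _ p(1)])
    fix \<g> assume g: "\<g> : Pi"
    thus "single (single \<g> 1) 1 +
     single (SUM \<w>:Pi. single \<w> (pdeg \<w> \<g>)) 1 - 1 : I"
     unfolding rel[OF g, symmetric] I using L.genideal_self[OF relL] by blast
   qed (use Id in auto)
   then obtain a b b' where ab: "lamp a" "lamp b" "pvars Pi b'" "b * b' - 1 : I" "p * b - a : I" by blast
   \<comment> \<open>\<open>a\<close> involves only the independent monomials and evaluates to 0, so
     it is 0; since \<open>b\<close> is invertible modulo \<open>I\<close>, this puts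
     \<open>p\<close> into \<open>I\<close>.\<close>
   have "?\<rho> a = 0" using ab(5) Iker p by (auto simp: ker C.leval_diff C.leval_mult[OF Fv_fam])
   moreover obtain q where "pvars {..<n} q" "?\<rho> a = ev y0 q" "q = 0 ==> a = 0" using lamp_eval[OF ab(1)] by blast
   ultimately have "a = 0" using y0_indep unfolding C.indep_def by metis
   hence "p * b * b' : I" using Id(4) ab by simp
   moreover have "(b * b' - 1) * (- p) : I" using Id(4)[OF ab(4), of "- p"] p(1) by (simp add: pvars_uminus)
   ultimately have "p * b * b' + (b * b' - 1) * (- p) : I" by (rule Id(3))
   thus "p : I" by (simp add: algebra_simps)
  qed
 qed
 hence quot: "config_ring B = L Quot (a_kernel L (sub_ring R0) ?\<rho>)"
  and cls: "config_class B p = a_kernel L (sub_ring R0) ?\<rho> +>\<^bsub>L\<^esub> p" for p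
  by (simp_all add: config_ring_def config_class_def I_def idx(1) L_def)
 let ?\<Phi> = "%x. the_elem (?\<rho> ` x)"
 have val: "?\<Phi> (config_class B p) = ?\<rho> p" if "pvars Pi p" for p
  unfolding cls using h.the_elem_simp that by (simp add: L)
 have "?\<rho> ` carrier L = carrier (sub_ring R0)" by (auto simp: L R0_def C.lring_def)
 hence "?\<Phi> : ring_iso (config_ring B) (sub_ring R0)" unfolding quot by (rule h.FactRing_iso_set)
 hence "?\<Phi> : algebra_iso (config_ring B) (config_scalar B) (sub_ring R0) scalar"
  by (simp add: algebra_iso_def config_scalar_def val laurent_const_def pvars_single)
 moreover have "?\<Phi> (config_var B \<g>) = ff Bt \<g>" if "\<g> : Pi" for \<g>
  using that by (simp add: config_var_def val laurent_var_def pvars_single Fv_def)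
 ultimately show ?thesis unfolding idx(1) by (intro bexI[of _ ?\<Phi>]) auto
qed

end

end

section \<open>The torus of cluster automorphisms\<close>

lemma lring_subset:
 assumes R: "subr R" and c: "!!c. scalar c : R" and y: "!!v. v : V ==> y v : R" "!!v. v : V ==> inverse (y v) : R"
 shows "C.lring y V <= R"
proof
 have pw: "y v powi m : R" if "v : V" for v m
  using subr_closed(7)[OF R y(1)[OF that]] subr_closed(7)[OF R y(2)[OF that]] by (simp add: power_int_def)
 have mono: "mev y e : R" if "keys e <= V" for e
  unfolding mev_def using that by (intro subr_prod[OF R] pw) auto
 fix z assume "z : C.lring y V"
 then obtain p where "pvars V p" "z = ev y p" by (auto simp: C.lring_def)
 thus "z : R" unfolding leval_def by (auto simp: pvars_def intro!: subr_sum[OF R] subr_closed(3)[OF R] c mono)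
qed

lemma lring_int_subset: "Z.lring y V <= C.lring y V"
proof
 fix z assume "z : Z.lring y V"
 then obtain p where p: "pvars V p" "z = leval of_int y p" by (auto simp: Z.lring_def)
 define q :: "('a \<Rightarrow>\<^sub>0 int) \<Rightarrow>\<^sub>0 complex" where "q = Poly_Mapping.map of_int p"
 have l: "lookup q e = of_int (lookup p e)" for e by (simp add: q_def Poly_Mapping.map.rep_eq)
 hence kq: "keys q = keys p" by (auto simp: in_keys_iff)
 have "z = ev y q" by (simp add: p(2) leval_def l kq scalar_of_int)
 thus "z : C.lring y V" using p(1) kq by (auto simp: C.lring_def pvars_def)
qed

text \<open>Extension of an injective ring homomorphism to fractions, as a relation.\<close>

locale frac_ext =
 fixes D :: "ambient set" and h :: "ambient => ambient"
 assumes D: "subr D" and h_1: "h 1 = 1"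
  and h_add: "!!a b. a : D ==> b : D ==> h (a + b) = h a + h b"
  and h_mult: "!!a b. a : D ==> b : D ==> h (a * b) = h a * h b"
  and h_inj: "!!a. a : D ==> h a = 0 ==> a = 0"
begin

definition T :: "ambient => ambient => bool" where
 "T g g' <-> (EX a:D. EX s:D. s ~= 0 & g = a / s & g' = h a / h s)"

lemma T_unique: "T g a ==> T g b ==> a = b"
proof -
 assume "T g a" "T g b"
 then obtain x s x' s' where *: "x : D" "s : D" "s ~= 0" "g = x / s" "a = h x / h s"
  "x' : D" "s' : D" "s' ~= 0" "g = x' / s'" "b = h x' / h s'" unfolding T_def by metis
 hence "h x * h s' = h x' * h s" using h_mult h_mult[of x' s] by (simp add: field_simps)
 moreover have "h s ~= 0" "h s' ~= 0" using h_inj * by auto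
 ultimately show "a = b" using * by (simp add: frac_eq_eq)
qed

lemma T_of: "a : D ==> T a (h a)"
 unfolding T_def using subr_closed(1)[OF D] h_1 by (intro bexI[of _ a] bexI[of _ 1]) auto

lemma T_1: "T 1 1" using T_of[OF subr_closed(1)[OF D]] by (simp add: h_1)

lemma T_mult: "T g g' ==> T k k' ==> T (g * k) (g' * k')"
proof -
 assume "T g g'" "T k k'"
 then obtain x s x' s' where *: "x : D" "s : D" "s ~= 0" "g = x / s" "g' = h x / h s"
  "x' : D" "s' : D" "s' ~= 0" "k = x' / s'" "k' = h x' / h s'" unfolding T_def by metis
 thus ?thesis unfolding T_def
  using subr_closed(3)[OF D] by (intro bexI[of _ "x * x'"] bexI[of _ "s * s'"]) (auto simp: h_mult)
qed

lemma T_add: "T g g' ==> T k k' ==> T (g + k) (g' + k')"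
proof -
 assume "T g g'" "T k k'"
 then obtain x s x' s' where *: "x : D" "s : D" "s ~= 0" "g = x / s" "g' = h x / h s"
  "x' : D" "s' : D" "s' ~= 0" "k = x' / s'" "k' = h x' / h s'" unfolding T_def by metis
 have "h s ~= 0" "h s' ~= 0" using h_inj * by auto
 thus ?thesis unfolding T_def
  using * subr_closed(2,3)[OF D] by (intro bexI[of _ "x * s' + x' * s"] bexI[of _ "s * s'"]) (auto simp: h_mult h_add add_frac_eq)
qed

lemma T_inverse: "T g g' ==> g ~= 0 ==> T (inverse g) (inverse g')"
 unfolding T_def by (metis divide_eq_0_iff inverse_divide)

lemma T_powi: "T g g' ==> g ~= 0 ==> T (g powi m) (g' powi m)"
proof -
 assume g: "T g g'" "g ~= 0"
 have nat: "T (x ^ j) (x' ^ j)" if "T x x'" for x x' j by (induction j) (auto intro: T_1 T_mult that)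
 thus ?thesis using g T_inverse[OF g] by (simp add: power_int_def)
qed

lemma T_prod: "(!!i. i : A ==> T (f i) (g i)) ==> T (prod f A) (prod g A)"
 by (induction A rule: ifi) (auto intro: T_1 T_mult)

lemma T_mev: "(!!v. v : keys e ==> y v ~= 0 & T (y v) (y' v)) ==> T (mev y e) (mev y' e)"
 unfolding mev_def by (intro T_prod T_powi) auto

lemma T_leval_fixed:
 assumes c: "!!c. T (scalar c) (scalar c)" and y: "!!v. v : V ==> y v ~= 0 & T (y v) (y v)" and r: "r : C.lring y V"
 shows "T r r"
proof -
 obtain p where p: "pvars V p" "r = ev y p" using r by (auto simp: C.lring_def)
 have "T (SUM e:A. scalar (lookup p e) * mev y e) (SUM e:A. scalar (lookup p e) * mev y e)"
  if "A <= keys p" for A using finite_subset[OF that finite_keys] that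
 proof (induction A rule: finite_induct)
  case empty
  thus ?case using c[of 0] by simp
 next
  case (insert e A)
  thus ?case using p(1) y by (auto intro!: T_add T_mult c T_mev simp: pvars_def)
 qed
 thus ?thesis using p by (simp add: leval_def)
qed

end

context belt
begin

abbreviation "CA \<equiv> carrier (cluster_algebra Bt)"
abbreviation "Lo \<equiv> carrier (localized_cluster_algebra Bt)"

lemma mutable_var: "U : seeds Bt ==> k < n ==> fst U k : mutable_variables Bt"
 unfolding mutable_variables_def dimc by blast

lemma frozen_var: "f : {n..<N} ==> init_var f : frozen_variables Bt"
 by (auto simp: frozen_variables_def dimc dimr)

lemma CA_eq: "cluster_algebra Bt = sub_ring CA" and CA_subr: "subr CA"
 and Lo_eq: "localized_cluster_algebra Bt = sub_ring Lo" and Lo_subr: "subr Lo"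
 by (simp_all add: cluster_algebra_def localized_cluster_algebra_def subr_generate_ring)

lemma CA_gens: "scalar c : CA" "x : mutable_variables Bt ==> x : CA" "x : frozen_variables Bt ==> x : CA"
 "x : frozen_variables Bt ==> inverse x : CA"
 unfolding cluster_algebra_def by (auto intro: generate_ring.incl)

lemma CA_subset: "subr R ==> (!!c. scalar c : R) ==> (!!x. x : mutable_variables Bt ==> x : R) ==>
  (!!x. x : frozen_variables Bt ==> x : R & inverse x : R) ==> CA <= R"
 unfolding cluster_algebra_def sub_ring_simps by (rule generate_ring_subset) auto

lemma Lo_gens: "x : CA ==> x : Lo" "x : mutable_variables Bt ==> inverse x : Lo"
 unfolding localized_cluster_algebra_def by (auto intro: generate_ring.incl)

lemma Lo_subset: "subr R ==> CA <= R ==> (!!x. x : mutable_variables Bt ==> inverse x : R) ==> Lo <= R"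
 unfolding localized_cluster_algebra_def sub_ring_simps by (rule generate_ring_subset) auto

lemma mutable_nz: "x : mutable_variables Bt ==> x ~= 0"
 using vseed_nz[OF seeds_vseed] by (auto simp: mutable_variables_def)

lemma seed_Lo: "U : seeds Bt ==> C.lring (fst U) {..<N} <= Lo"
proof (rule lring_subset[OF Lo_subr Lo_gens(1)[OF CA_gens(1)]])
 fix v assume s: "U : seeds Bt" and v: "v : {..<N}"
 show "fst U v : Lo" "inverse (fst U v) : Lo"
  using mutable_var[OF s, of v] frozen_var vseed_frozen[OF seeds_vseed[OF s], of v] v CA_gens Lo_gens
  by (cases "v < n"; force)+
qed

lemma denom_props: "s : denominators Bt ==> s ~= 0 & s : CA" "s : denominators Bt ==> s' : denominators Bt ==> s * s' : denominators Bt"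
 "1 : denominators Bt" "x : mutable_variables Bt ==> x : denominators Bt"
proof -
 show "s : denominators Bt ==> s ~= 0 & s : CA"
 proof -
  assume "s : denominators Bt"
  then obtain xs where xs: "s = prod_list xs" "set xs <= mutable_variables Bt" by (auto simp: denominators_def)
  show ?thesis unfolding xs(1) using xs(2)
   by (induction xs) (simp_all add: subr_closed(1,3)[OF CA_subr] CA_gens(2) mutable_nz)
 qed
 show "s * s' : denominators Bt" if ss: "s : denominators Bt" "s' : denominators Bt"
 proof -
  obtain xs ys where "s = prod_list xs" "set xs <= mutable_variables Bt" "s' = prod_list ys" "set ys <= mutable_variables Bt"
   using ss by (auto simp: denominators_def)
  thus ?thesis unfolding denominators_def by (intro CollectI exI[of _ "xs @ ys"]) auto
 qed
 show "1 : denominators Bt" unfolding denominators_def by (intro CollectI exI[of _ "[]"]) simp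
 show "x : mutable_variables Bt ==> x : denominators Bt" unfolding denominators_def by (intro CollectI exI[of _ "[x]"]) simp
qed

lemma Lo_fraction:
 assumes "g : Lo"
 obtains a s where "a : CA" "s : denominators Bt" "g = a / s"
proof -
 define Q where "Q = {a / s | a s. a : CA & s : denominators Bt}"
 have QI: "a / s : Q" if "a : CA" "s : denominators Bt" for a s using that by (auto simp: Q_def)
 have "subr Q" unfolding subr_def
 proof (intro conjI ballI)
  show "1 : Q" using QI[OF subr_closed(1)[OF CA_subr] denom_props(3)] by simp
  fix x assume "x : Q"
  then obtain a s where x: "a : CA" "s : denominators Bt" "x = a / s" by (auto simp: Q_def)
  thus "- x : Q" using QI[OF subr_closed(4)[OF CA_subr x(1)] x(2)] by simp
  fix y assume "y : Q"
  then obtain b u where y: "b : CA" "u : denominators Bt" "y = b / u" by (auto simp: Q_def)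
  have "x + y = (a * u + b * s) / (s * u)" using x y denom_props(1) by (simp add: add_frac_eq)
  thus "x + y : Q" using QI x y denom_props subr_closed(2,3)[OF CA_subr] by simp
  show "x * y : Q" using QI x y denom_props subr_closed(3)[OF CA_subr] by simp
 qed
 moreover have "CA <= Q" using QI[OF _ denom_props(3)] by auto
 moreover have "inverse x : Q" if "x : mutable_variables Bt" for x
  using QI[OF subr_closed(1)[OF CA_subr] denom_props(4)[OF that]] by (simp add: inverse_eq_divide)
 ultimately have "Lo <= Q" by (rule Lo_subset)
 thus ?thesis using assms that by (auto simp: Q_def)
qed

context
 fixes h assumes h: "h : cluster_torus Bt"
begin

lemma torus_scalar: "h (scalar c) = scalar c"
 and torus_var: "x : mutable_variables Bt \<union> frozen_variables Bt ==> EX \<z>. \<z> ~= 0 & h x = scalar \<z> * x"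
 using h by (simp_all add: cluster_torus_def algebra_iso_def)

lemma torus_frac_ext: "frac_ext CA h"
proof -
 have r: "h : ring_iso (sub_ring CA) (sub_ring CA)" using h CA_eq unfolding cluster_torus_def algebra_iso_def by (metis (no_types, lifting) mem_Collect_eq)
 show ?thesis
 proof
  show "h a = 0 ==> a = 0" if "a : CA" for a
   using r that torus_scalar[of 0] CA_gens(1)[of 0] inj_onD[of h CA a 0] by (auto simp: ring_iso_def bij_betw_def)
 qed (use r CA_subr in "auto simp: ring_iso_def Ring.ring_hom_def")
qed

text \<open>The description inside \<open>torus_act\<close> is proper: the extension to fractions is
  single valued, and every element of the localization has an admissible denominator.\<close>

lemma torus_act_T:
 assumes g: "g : Lo"
 shows "frac_ext.T CA h g (torus_act Bt h g)"
proof -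
 interpret e: frac_ext CA h by (rule torus_frac_ext)
 obtain a s where as: "a : CA" "s : denominators Bt" "g = a / s" by (rule Lo_fraction[OF g])
 have T: "e.T g k" if "EX a:CA. EX s:denominators Bt. g = a / s & k = h a / h s" for k
  using that denom_props(1) unfolding e.T_def by blast
 have "(EX a:CA. EX s:denominators Bt. g = a / s & k = h a / h s) <-> k = h a / h s" for k
  using T T e.T_unique as by blast
 thus ?thesis using T by (auto simp: torus_act_def)
qed

end

end

lemma scalar_powi: "scalar (a powi m) = scalar a powi m"
proof -
 have nat: "scalar (a ^ j) = scalar a ^ j" for a j by (induction j) (simp_all)
 have inv: "scalar (inverse a) = inverse (scalar a)" for a
 proof (cases "a = 0")
  case False
  hence "scalar (inverse a) * scalar a = 1" by (simp add: scalar_hom(4)[symmetric])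
  thus ?thesis by (metis inverse_unique mult.commute)
 qed (simp add: scalar_hom)
 show ?thesis by (simp add: power_int_def nat inv)
qed

lemma scalar_nz [simp]: "scalar a = 0 <-> a = 0"
 by (simp add: scalar_def Zero_fract_def eq_fract) (metis lookup_single_eq single_zero)

lemma mev_scale: "mev (%v. scalar (\<chi> v) * y v) e = scalar (mev \<chi> e) * mev y e"
proof -
 have "scalar (PROD v:A. f v) = (PROD v:A. scalar (f v))" for f :: "'a => complex" and A
  by (induction A rule: ifi) (simp_all)
 thus ?thesis by (simp add: mev_def power_int_mult_distrib scalar_powi)
qed

context belt
begin

lemma cvar_mutable: "k < n ==> cvar Bt (t, k) : mutable_variables Bt"
 using mutable_var[OF S_seeds] by (simp add: cvar_S)

context
 assumes fr: "full_rat Bt"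
begin

lemmas fcol = full_rat_col[OF fr]

text \<open>The automorphism scales the product of the exchanged variables by one scalar. The two
  monomials of the exchange relation are distinct, hence independent, so each of them is scaled by
  the same scalar.\<close>

lemma torus_Fh:
 assumes h: "h : cluster_torus Bt" and k: "k < n"
 shows "frac_ext.T CA h (Fh t k) (Fh t k)"
proof -
 interpret e: frac_ext CA h by (rule torus_frac_ext[OF h])
 note s = mid_seeds[OF k, of t] and v = mid_vseed[OF k, of t]
 let ?y = "fst (mid t k)" and ?x = "cvar Bt (t, k) * cvar Bt (Suc t, k)"
 have T: "EX \<z>. \<z> ~= 0 & e.T x (scalar \<z> * x)" if "x : mutable_variables Bt \<union> frozen_variables Bt" for x
  using torus_var[OF h that] e.T_of[of x] CA_gens that by auto
 have "ALL i:{..<N}. EX \<z>. \<z> ~= 0 & e.T (?y i) (scalar \<z> * ?y i)"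
 proof
  fix i assume i: "i : {..<N}"
  show "EX \<z>. \<z> ~= 0 & e.T (?y i) (scalar \<z> * ?y i)"
   using T mutable_var[OF s, of i] frozen_var vseed_frozen[OF v, of i] i by (cases "i < n") auto
 qed
 then obtain \<z> where z: "!!i. i < N ==> e.T (?y i) (scalar (\<z> i) * ?y i)" by (metis lessThan_iff)
 have mono: "e.T (mev ?y a) (scalar (mev \<z> a) * mev ?y a)" if "keys a <= {..<N}" for a
  unfolding mev_scale[symmetric] using z that vseed_nz[OF v] by (intro e.T_mev) auto
 obtain z1 z2 where zz: "z1 ~= 0" "e.T (cvar Bt (t, k)) (scalar z1 * cvar Bt (t, k))" "z2 ~= 0" "e.T (cvar Bt (Suc t, k)) (scalar z2 * cvar Bt (Suc t, k))"
  using T cvar_mutable[OF k] by blast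
 define c where "c = z1 * z2"
 have Tx: "e.T ?x (scalar c * ?x)" using e.T_mult[OF zz(2,4)] by (simp add: c_def mult_ac)
 have ks: "keys (nexp (mid t k) k) <= {..<N}" "keys (pexp (mid t k) k) <= {..<N}"
  using exps_keys(2,3)[OF v k] by blast+
 have xx: "?x = neg_monomial (mid t k) k + pos_monomial (mid t k) k" using exchange_eq[OF k, of t] by (simp add: mult.commute)
 let ?a = "nexp (mid t k) k" and ?b = "pexp (mid t k) k"
 define q where "q = single ?a (c - mev \<z> ?a) + single ?b (c - mev \<z> ?b)"
 have "e.T ?x (scalar (mev \<z> ?a) * mev ?y ?a + scalar (mev \<z> ?b) * mev ?y ?b)"
  unfolding xx neg_monomial_eq pos_monomial_eq by (intro e.T_add mono ks)
 hence "scalar c * ?x = scalar (mev \<z> ?a) * mev ?y ?a + scalar (mev \<z> ?b) * mev ?y ?b"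
  using e.T_unique Tx by blast
 hence "ev ?y q = 0"
  by (simp add: q_def C.leval_add xx neg_monomial_eq pos_monomial_eq C.hom_add[of c "- _", simplified] C.hom_uminus algebra_simps)
 moreover have "pvars {..<N} q" unfolding q_def using ks by (intro pvars_add pvars_single)
 ultimately have q0: "q = 0" using vseed_indep(1)[OF v] unfolding C.indep_def by blast
 have "?a ~= ?b"
 proof
  assume "?a = ?b"
  hence y0: "ycol (mid t k) k = 0" by (simp add: pexp_eq)
  define w :: "nat => int" where "w j = of_bool (j = k)" for j
  have "snd (mid t k) $$ (i, k) = 0" if "i < N" for i
   using arg_cong[OF y0, of "%e. lookup e i"] that by (simp add: ycol_def vseed_dim[OF v])
  hence "(SUM j<n. snd (mid t k) $$ (i, j) * w j) = 0" if "i < N" for i using that by (intro sum.neutral) (auto simp: w_def)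
  moreover have "full_col (snd (mid t k))" using seeds_closed(2)[OF initial_vseed s fcol] .
  ultimately have "w k = 0" using k unfolding full_col_def by blast
  thus False by (simp add: w_def)
 qed
 hence "c = mev \<z> ?a" using arg_cong[OF q0, of "%q. lookup q ?a"] by (simp add: q_def)
 hence "e.T (neg_monomial (mid t k) k) (scalar c * neg_monomial (mid t k) k)" using mono[OF ks(1)] by (simp add: neg_monomial_eq)
 moreover have "?x ~= 0" using mutable_nz[OF cvar_mutable[OF k]] by simp
 ultimately have T1: "e.T (neg_monomial (mid t k) k * inverse ?x) (scalar c * neg_monomial (mid t k) k * inverse (scalar c * ?x))"
  by (intro e.T_mult[OF _ e.T_inverse[OF Tx]])
 have "scalar c * a * inverse (scalar c * b) = a * inverse b" for a b using zz
  by (auto simp: c_def field_simps)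
 thus ?thesis using T1 unfolding Fh_Gh_eq(1)[OF k] divide_inverse by metis
qed

lemma Fv_Fh: "\<g> : Pi ==> EX t k. k < n & Fv \<g> = Fh t k"
 using ff_eq_Fh[OF fcol] rot_Pi[of \<g>] by (cases "rot \<g>") (auto simp: Fv_def Pi_def)

lemma R0_invariant:
 assumes h: "h : cluster_torus Bt" and r: "r : R0"
 shows "frac_ext.T CA h r r"
proof -
 interpret e: frac_ext CA h by (rule torus_frac_ext[OF h])
 show ?thesis using r unfolding R0_def
  by (rule e.T_leval_fixed[rotated 2]) (use e.T_of[OF CA_gens(1)] torus_scalar[OF h] Fv_Fh torus_Fh[OF h] nzf.nz[OF Fv_fam[OF fr]] in "auto, metis")
qed

lemma R0_Lo: "R0 <= Lo" unfolding R0_def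
proof (rule lring_subset[OF Lo_subr Lo_gens(1)[OF CA_gens(1)]])
 fix \<g> assume "\<g> : Pi"
 then obtain t k where k: "k < n" "Fv \<g> = Fh t k" using Fv_Fh by blast
 note s = mid_seeds[OF k(1), of t]
 have ks: "keys (nexp (mid t k) k) <= {..<N}" using exps_keys(2)[OF mid_vseed[OF k(1)] k(1)] by blast
 have "neg_monomial (mid t k) k : Lo" "inverse (neg_monomial (mid t k) k) : Lo"
  using seed_Lo[OF s] C.lring_mev[OF ks, of "fst (mid t k)"] C.lring_mev[of "- nexp (mid t k) k" "{..<N}" "fst (mid t k)"] ks
   nzf.mev_uminus[OF vseed_fam[OF mid_vseed[OF k(1)]]] by (auto simp: neg_monomial_eq)
 moreover have "cvar Bt (t', k) : Lo" "inverse (cvar Bt (t', k)) : Lo" for t'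
  using cvar_mutable[OF k(1)] Lo_gens CA_gens(2) by auto
 ultimately show "Fv \<g> : Lo" "inverse (Fv \<g>) : Lo"
  unfolding k(2) Fh_Gh_eq(1)[OF k(1)] by (auto simp: divide_inverse intro!: subr_closed(3)[OF Lo_subr])
qed

text \<open>A character trivial on the columns fixes the initial y-hat variables, hence inductively
  those of all seeds. Both monomials of every exchange relation are then scaled alike, so all
  cluster variables are merely scaled.\<close>

lemma torus_of_character:
 assumes nz: "!!i. \<chi> i ~= 0" and triv: "!!k. k < n ==> mev \<chi> (ycol (initial_seed Bt) k) = 1"
 obtains h where "h : cluster_torus Bt" "!!i. i < N ==> h (init_var i) = scalar (\<chi> i) * init_var i"
proof -
 define LL where "LL = C.lring init_var {..<N}"
 define y' where "y' i = scalar (\<chi> i) * init_var i" for i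
 \<comment> \<open>Substitution on the Laurent ring of the initial cluster; the chosen expansion is
   unique by independence.\<close>
 define h where "h z = ev y' (SOME p. pvars {..<N} p & ev init_var p = z)" for z
 have fam: "nzf y'" using nz by unfold_locales (simp add: y'_def)
 have h_eval: "h (ev init_var p) = ev y' p" if p: "pvars {..<N} p" for p
 proof -
  have "q = p" if "pvars {..<N} q & ev init_var q = ev init_var p" for q
   using C.indep_eq[OF init_var_indep, of "{..<N}" q p] that p by simp
  hence "(SOME q. pvars {..<N} q & ev init_var q = ev init_var p) = p" using p by blast
  thus ?thesis by (simp add: h_def)
 qed
 have LLE: "EX p. pvars {..<N} p & z = ev init_var p" if "z : LL" for z using that by (auto simp: LL_def C.lring_def)
 have LL: "subr LL" unfolding subr_def LL_def
using C.lring_coeff[of 1 init_var] C.lring_add C.lring_mult[OF init.nzf_axioms] C.lring_uminus by auto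
 have inj0: "a = 0" if a: "a : LL" "h a = 0" for a
 proof -
  obtain p where p: "pvars {..<N} p" "a = ev init_var p" using LLE[OF a(1)] by blast
  define q where "q = (SUM e:keys p. single e (lookup p e * mev \<chi> e))"
  have "ev init_var q = ev y' p"
   unfolding y'_def[abs_def] by (simp add: q_def C.leval_sum leval_def[of _ "%i. scalar (\<chi> i) * init_var i"] mev_scale mult.assoc)
  moreover have "pvars {..<N} q" unfolding q_def using p(1) by (intro pvars_sum pvars_single) (auto simp: pvars_def)
  ultimately have q0: "q = 0" using a h_eval[OF p(1)] p(2) init_var_indep unfolding C.indep_def by metis
  have "lookup p e = 0" for e
  proof (cases "e : keys p")
   case True
   have "0 = lookup q e" by (simp add: q0)
   also have "... = lookup p e * mev \<chi> e" using True by (simp add: q_def)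
   finally show ?thesis using nz nzf.mev_nz[of \<chi> e] by (simp add: nzf_def)
  qed (simp add: in_keys_iff)
  hence "p = 0" by (intro pm_eqI) simp
  thus ?thesis using p(2) by simp
 qed
 interpret e: frac_ext LL h
 proof
  show "subr LL" by (rule LL)
  show "h 1 = 1" using h_eval[of 1] by simp
  fix a b assume "a : LL" "b : LL"
  then obtain p q where "pvars {..<N} p" "a = ev init_var p" "pvars {..<N} q" "b = ev init_var q" using LLE by metis
  thus "h (a + b) = h a + h b" "h (a * b) = h a * h b"
   using h_eval[of "p + q"] h_eval[of "p * q"] h_eval
   by (auto simp: C.leval_add C.leval_mult[OF init.nzf_axioms] C.leval_mult[OF fam])
 qed (rule inj0)
 have hvar: "init_var i : LL & inverse (init_var i) : LL & h (init_var i) = scalar (\<chi> i) * init_var i" if "i < N" for i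
  using h_eval[of "single (single i 1) 1"] C.lring_var[of i "{..<N}" init_var] C.lring_inverse_var[of i "{..<N}" init_var] that
  by (simp add: y'_def LL_def pvars_single)
 have hsc: "h (scalar c) = scalar c" "scalar c : LL" for c
  using h_eval[of "single 0 c"] C.lring_coeff by (simp_all add: pvars_single LL_def)
 have scaled: "vseed U & (ALL i<N. EX \<z>. \<z> ~= 0 & e.T (fst U i) (scalar \<z> * fst U i)) & (ALL k<n. e.T (yhat U k) (yhat U k))"
  if "U : seeds Bt" for U using that
 proof induction
  case initial
  have "e.T (init_var i) (scalar (\<chi> i) * init_var i)" if "i < N" for i using e.T_of[of "init_var i"] hvar[OF that] by simp
  moreover have "e.T (yhat (initial_seed Bt) k) (yhat (initial_seed Bt) k)" if k: "k < n" for k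
  proof -
   have "e.T (mev init_var (ycol (initial_seed Bt) k)) (mev y' (ycol (initial_seed Bt) k))"
    using exps_keys(1)[OF initial_vseed k] calculation by (intro e.T_mev) (auto simp: y'_def)
   thus ?thesis using triv[OF k] mev_scale[of \<chi> init_var "ycol (initial_seed Bt) k"]
    unfolding yhat_def y'_def[abs_def] by (simp add: initial_seed_def)
  qed
  ultimately show ?case using initial_vseed nz unfolding initial_seed_def by auto
 next
  case (mutation U k)
  have k: "k < n" "k < N" using mutation(2) nN by (auto simp: dimc)
  have v: "vseed U" and yT: "!!k. k < n ==> e.T (yhat U k) (yhat U k)" using mutation.IH by auto
  obtain \<z> where z: "!!i. i < N ==> \<z> i ~= 0 & e.T (fst U i) (scalar (\<z> i) * fst U i)" using mutation.IH by metis
  define c where "c = mev (%i. if i < N then \<z> i else 1) (nexp U k)"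
  have c0: "c ~= 0" unfolding c_def using z by (intro nzf.mev_nz) (simp add: nzf_def)
  have neg: "e.T (neg_monomial U k) (scalar c * neg_monomial U k)"
   unfolding neg_monomial_eq c_def mev_scale[symmetric]
   using z exps_keys(2)[OF v k(1)] vseed_nz[OF v] by (intro e.T_mev) auto
  have p: "e.T (pos_monomial U k) (scalar c * pos_monomial U k)"
   using e.T_mult[OF neg yT[OF k(1)]] by (simp add: pos_neg_monomial[OF v] mult.assoc)
  have ex: "e.T (exch_sum U k) (scalar c * exch_sum U k)"
   using e.T_add[OF p neg] by (simp add: exch_sum_def distrib_left)
  have div: "e.T (a / b) (a / b)" if "e.T a (scalar c * a)" "e.T b (scalar c * b)" "b ~= 0" for a b
   using e.T_mult[OF that(1) e.T_inverse[OF that(2,3)]] c0 by (simp add: divide_inverse mult_ac)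
  have pw: "e.T (a ^ m) (a ^ m)" if "e.T a a" for a m by (induction m) (auto intro: e.T_1 e.T_mult that)
  have "e.T (fst (mutate k U) k) (scalar (c / \<z> k) * fst (mutate k U) k)"
  proof -
   have "scalar c * exch_sum U k * inverse (scalar (\<z> k) * fst U k) = scalar (c / \<z> k) * fst (mutate k U) k" using z[OF k(2)] vseed_nz[OF v, of k]
    by (auto simp: scalar_hom(4)[symmetric] fst_mutate field_simps)
   moreover have "fst (mutate k U) k = exch_sum U k * inverse (fst U k)" by (simp add: fst_mutate divide_inverse)
   ultimately show ?thesis
    using e.T_mult[OF ex e.T_inverse[of "fst U k"]] z[OF k(2)] vseed_nz[OF v, of k] by metis
  qed
  moreover have "e.T (yhat (mutate k U) l) (yhat (mutate k U) l)" if l: "l < n" for l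
  proof (cases "l = k")
   case True
   thus ?thesis using e.T_inverse[OF yT[OF k(1)]] yhat_nz[OF v] by (simp add: yhat_mutate_self[OF v k(1)])
  next
   case False
   thus ?thesis
    using yhat_mutate[OF v k(1) l] e.T_mult[OF yT[OF l] pw] div p neg ex exch_sum_nz[OF v k(1)] neg_monomial_nz[OF v, of k]
    by (cases "snd U $$ (k, l) >= 0") auto
  qed
  ultimately show ?case
   using vseed_mutate[OF v k(1)] z c0 by (auto simp: fst_mutate) (metis divide_eq_0_iff)
 qed
 have MV: "x : LL & (EX \<z>. \<z> ~= 0 & h x = scalar \<z> * x)" if x: "x : mutable_variables Bt" for x
 proof -
  obtain U k where s: "U : seeds Bt" "k < n" "x = fst U k" using x by (auto simp: mutable_variables_def dimc)
  have "x : upper (initial_seed Bt)"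
   using var_in_upper[OF seeds_vseed[OF s(1)], of k] seeds_closed(3)[OF initial_vseed s(1) fcol] s nN by simp
  hence xL: "x : LL" using lring_int_subset by (auto simp: upper_def ZL_def initial_seed_def LL_def)
  obtain \<z> where "\<z> ~= 0" "e.T x (scalar \<z> * x)" using scaled[OF s(1)] s nN by (metis less_le_trans)
  thus ?thesis using e.T_unique[OF e.T_of[OF xL]] xL by blast
 qed
 have FV: "x : LL & inverse x : LL & (EX \<z>. \<z> ~= 0 & h x = scalar \<z> * x & h (inverse x) = scalar (1 / \<z>) * inverse x)" if x: "x : frozen_variables Bt" for x
 proof -
  obtain f where f: "f < N" "x = init_var f" using x by (auto simp: frozen_variables_def dimr)
  have "h (x * inverse x) = h x * h (inverse x)" using hvar[OF f(1)] f(2) by (intro e.h_mult) auto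
  hence "scalar (\<chi> f) * x * h (inverse x) = 1" using hvar[OF f(1)] f(2) e.h_1 by simp
  moreover have "scalar (1 / \<chi> f) * scalar (\<chi> f) = 1" using nz by (simp add: scalar_hom(4)[symmetric])
  moreover have "x * inverse x = 1" using f(2) by simp
  ultimately show ?thesis using mult.assoc mult.commute mult_1 hvar[OF f(1)] f(2) nz
   by (smt (verit))
 qed
 have CL: "CA <= LL" using CA_subset[OF LL hsc(2)] MV FV by blast
 have h0: "h 0 = 0" using hsc(1)[of 0] by simp
 have hm: "h (- a) = - h a" if "a : LL" for a
  using e.h_add[OF that subr_closed(4)[OF LL that]] h0 by (simp add: eq_neg_iff_add_eq_0 add.commute)
 \<comment> \<open>The elements of the cluster algebra that have image and preimage in it. They form
   a subring that contains the generators, which gives surjectivity.\<close>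
 define W where "W = {z : CA. h z : CA & z : h ` CA}"
 have eig: "x : W" if x: "x : CA" "h x = scalar \<z> * x" "\<z> ~= 0" for x \<z>
 proof -
  have i: "scalar (1 / \<z>) * x : CA" "scalar \<z> * x : CA" using x CA_gens(1) subr_closed(3)[OF CA_subr] by blast+
  have "h (scalar (1 / \<z>) * x) = scalar (1 / \<z>) * (scalar \<z> * x)"
   using x CL hsc e.h_mult by auto
  also have "... = x" using x by (simp add: scalar_hom(4)[symmetric])
  finally show ?thesis using x i unfolding W_def by (simp add: image_iff) metis
 qed
 have "subr W" unfolding subr_def
 proof (intro conjI ballI)
  note C = subr_closed[OF CA_subr]
  show "1 : W" unfolding W_def using e.h_1 C(1) by (simp add: image_iff) metis
  fix x assume "x : W"
  then obtain a where a: "x : CA" "h x : CA" "a : CA" "x = h a" unfolding W_def by blast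
  have "h (- x) = - h x" "h (- a) = - x" using hm CL a by auto
  thus "- x : W" unfolding W_def using C(4)[OF a(1)] C(4)[OF a(2)] C(4)[OF a(3)] by (simp add: image_iff) metis
  fix y assume "y : W"
  then obtain b where b: "y : CA" "h y : CA" "b : CA" "y = h b" unfolding W_def by blast
  have "h (x + y) = h x + h y" "h (x * y) = h x * h y" "h (a + b) = x + y" "h (a * b) = x * y"
   using e.h_add e.h_mult CL a b by (auto simp: subset_iff)
  thus "x + y : W" "x * y : W"
   unfolding W_def using C(2,3)[OF a(1) b(1)] C(2,3)[OF a(2) b(2)] C(2,3)[OF a(3) b(3)] by (simp_all add: image_iff) metis+
 qed
 hence "CA <= W"
 proof (rule CA_subset)
  show "scalar c : W" for c using eig[of "scalar c" 1] hsc CA_gens(1) by simp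
  show "x : W" if "x : mutable_variables Bt" for x using MV[OF that] eig CA_gens(2)[OF that] by blast
  show "x : W & inverse x : W" if x: "x : frozen_variables Bt" for x
   using FV[OF x] eig[OF CA_gens(3)[OF x]] eig[OF CA_gens(4)[OF x]] by (metis divide_eq_0_iff zero_neq_one)
 qed
 hence sur: "h ` CA = CA" unfolding W_def by blast
 have "inj_on h CA"
 proof (rule inj_onI)
  fix a b assume ab: "a : CA" "b : CA" "h a = h b"
  have m: "a : LL" "b : LL" "- b : LL" using ab CL subr_closed(4)[OF LL] by blast+
  hence "h (a + - b) = 0" using e.h_add[OF m(1,3)] hm ab(3) by simp
  hence "a + - b = 0" by (rule inj0[OF subr_closed(2)[OF LL m(1,3)]])
  thus "a = b" by simp
 qed
 hence "h : ring_iso (sub_ring CA) (sub_ring CA)"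
  unfolding ring_iso_def using sur e.h_add[OF subsetD[OF CL] subsetD[OF CL]] e.h_mult[OF subsetD[OF CL] subsetD[OF CL]]
  by (auto simp: bij_betw_def e.h_1 Ring.ring_hom_def)
 hence "h : ring_iso (cluster_algebra Bt) (cluster_algebra Bt)" by (metis CA_eq)
 hence "h : cluster_torus Bt"
  unfolding cluster_torus_def algebra_iso_def using hsc(1) MV FV by blast
 thus ?thesis using that hvar by blast
qed

end

end

section \<open>Invariants of the torus\<close>

context belt
begin

context
 assumes fr: "full_rat Bt"
begin

interpretation F: nzf Fv by (rule Fv_fam[OF fr])

lemmas Rc = subr_closed[OF R0_subr[OF fr]]

lemma scalar_minus: "scalar (a - b) = scalar a - scalar b"
 using C.hom_add[of a "- b"] by (simp add: C.hom_uminus)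

text \<open>An integral functional that a modulus \<open>d\<close> divides on the columns but not on
  \<open>e\<close> gives a character with values in the d-th roots of unity. If the left inverse
  \<open>P\<close> detects \<open>e\<close> modulo \<open>c\<close>, its rows serve as
  functionals.\<close>

lemma separating_character:
 assumes e: "keys e <= {..<N}" and out: "!!w. e ~= (SUM k<n. frag_cmul (w k) (ycol (initial_seed Bt) k))"
 obtains \<chi> :: "nat => complex" where "!!i. \<chi> i ~= 0" "!!k. k < n ==> mev \<chi> (ycol (initial_seed Bt) k) = 1" "mev \<chi> e ~= 1"
proof -
 obtain c P where c: "c > 0" and P: "!!k l. k < n ==> l < n ==> (SUM i<N. P k i * Bt $$ (i, l)) = (if k = l then c else 0)"
  by (rule left_inverse[OF fr]) blast
 define v where "v k = (SUM i<N. P k i * lookup e i)" for k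
 have yk: "keys (ycol (initial_seed Bt) k) <= {..<N}" if "k < n" for k
  using exps_keys(1)[OF initial_vseed that] by blast
 have yl: "lookup (ycol (initial_seed Bt) k) i = Bt $$ (i, k)" if "i < N" for i k
  using that by (simp add: ycol_def initial_seed_def dimr)
 have "EX a d. d > 0 & (ALL l<n. d dvd (SUM i<N. a i * Bt $$ (i, l))) & ~ d dvd (SUM i<N. a i * lookup e i)"
 proof (cases "ALL k<n. c dvd v k")
  case False
  then obtain k where "k < n" "~ c dvd v k" by blast
  thus ?thesis using c P by (intro exI[of _ "P k"] exI[of _ c]) (simp add: v_def)
 next
  case True
  define w where "w k = v k div c" for k
  have wv: "c * w k = v k" if "k < n" for k using True that by (simp add: w_def)
  have "EX j<N. lookup e j ~= (SUM k<n. w k * Bt $$ (j, k))"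
  proof (rule ccontr)
   assume n: "~ (EX j<N. lookup e j ~= (SUM k<n. w k * Bt $$ (j, k)))"
   have "lookup e j = lookup (SUM k<n. frag_cmul (w k) (ycol (initial_seed Bt) k)) j" for j
   proof (cases "j < N")
    case True
    thus ?thesis using n by (simp add: yl)
   next
    case False
    moreover have "lookup d j = 0" if "keys d <= {..<N}" "~ j < N" for d :: "nat ex"
     using that by (metis in_keys_iff lessThan_iff subsetD)
    ultimately have "lookup e j = 0" "!!k. k < n ==> lookup (ycol (initial_seed Bt) k) j = 0"
     using e yk by blast+
    thus ?thesis by simp
   qed
   thus False using out[of w] by (auto intro: pm_eqI)
  qed
  then obtain j where j: "j < N" "lookup e j ~= (SUM k<n. w k * Bt $$ (j, k))" by blast
  \<comment> \<open>This functional kills all columns and detects the defect of \<open>e\<close> in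
    row \<open>j\<close>; any modulus larger than the absolute value \<open>\<bar>u\<bar>\<close>
    will do.\<close>
  define a where "a i = (if i = j then c else 0) - (SUM k<n. Bt $$ (j, k) * P k i)" for i
  have sa: "(SUM i<N. a i * f i) = c * f j - (SUM k<n. Bt $$ (j, k) * (SUM i<N. P k i * f i))" for f
  proof -
   have "(SUM i<N. (SUM k<n. Bt $$ (j, k) * P k i) * f i) = (SUM k<n. Bt $$ (j, k) * (SUM i<N. P k i * f i))"
    unfolding sum_distrib_left sum_distrib_right by (subst sum.swap) (simp add: mult_ac)
   moreover have "(SUM i<N. (if i = j then c else 0) * f i) = c * f j"
    using j(1) by (simp add: if_distrib[of "%x. x * _"] cong: if_cong)
   ultimately show ?thesis unfolding a_def left_diff_distrib sum_subtractf by simp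
  qed
  define u where "u = (SUM i<N. a i * lookup e i)"
  have "u = c * (lookup e j - (SUM k<n. w k * Bt $$ (j, k)))"
   unfolding u_def sa v_def[symmetric] right_diff_distrib sum_distrib_left using wv by (auto simp: mult.assoc[symmetric] mult.commute)
  hence "~ \<bar>u\<bar> + 1 dvd u" using j(2) c dvd_imp_le_int[of u "\<bar>u\<bar> + 1"] by auto
  moreover have "(SUM i<N. a i * Bt $$ (i, l)) = 0" if l: "l < n" for l
  proof -
   have "(SUM k<n. Bt $$ (j, k) * (SUM i<N. P k i * Bt $$ (i, l))) = (SUM k<n. if k = l then Bt $$ (j, k) * c else 0)"
    using P l by (intro sum.cong refl) simp
   thus ?thesis unfolding sa using l by simp
  qed
  ultimately show ?thesis by (intro exI[of _ a] exI[of _ "\<bar>u\<bar> + 1"]) (simp add: u_def)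
 qed
 then obtain a d where d: "d > 0" "!!l. l < n ==> d dvd (SUM i<N. a i * Bt $$ (i, l))" "~ d dvd (SUM i<N. a i * lookup e i)" by blast
 define z where "z = cis (2 * pi / of_int d)"
 have z1: "z powi m = 1 <-> d dvd m" for m
 proof -
  have "z powi m = cis (2 * pi * of_int m / of_int d)" by (simp add: z_def cis_power_int mult_ac)
  hence "z powi m = 1 <-> (EX q::int. 2 * pi * of_int m / of_int d = 2 * pi * of_int q)"
   using cos_one_2pi_int[of "2 * pi * of_int m / of_int d"] cis_multiple_2pi
   by (auto  dest: arg_cong[of _ _ Re])
  also have "... <-> (EX q::int. real_of_int m = of_int (d * q))" using d(1) by (simp add: field_simps)
  also have "... <-> d dvd m" by (simp only: of_int_eq_iff dvd_def)
  finally show ?thesis .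
 qed
 have ev: "mev (%i. z powi a i) f = z powi (SUM i<N. a i * lookup f i)" if "keys f <= {..<N}" for f
 proof -
  have "(PROD i:I. (z powi a i) powi lookup f i) = z powi (SUM i:I. a i * lookup f i)" for I
   by (induction I rule: ifi) (simp_all add: power_int_mult[symmetric] power_int_add z_def)
  thus ?thesis unfolding mev_superset[OF finite_lessThan that] .
 qed
 show ?thesis
 proof (rule that[of "%i. z powi a i"])
  show "z powi a i ~= 0" for i by (simp add: z_def)
  show "mev (%i. z powi a i) (ycol (initial_seed Bt) l) = 1" if "l < n" for l
   using ev[OF yk[OF that]] d(2)[OF that] yl by (simp add: z1)
  show "mev (%i. z powi a i) e ~= 1" using ev[OF e] d(3) by (simp add: z1)
 qed
qed

text \<open>The multiplicative group generated by the f and the initial variables. Since it contains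
  every mutable cluster variable, the localized algebra is spanned by monomials over
  \<open>R0\<close>.\<close>

definition Gm :: "ambient set" where
 "Gm = {mev Fv a * mev init_var e | a e. keys a <= Pi & keys e <= {..<N}}"

lemma Gm_memI: "keys a <= Pi ==> mev Fv a : Gm" "keys e <= {..<N} ==> mev init_var e : Gm"
 unfolding Gm_def by (rule CollectI, rule exI[of _ a], rule exI[of _ 0], simp) (rule CollectI, rule exI[of _ 0], rule exI[of _ e], simp)

lemma Gm_mult: "x : Gm ==> y : Gm ==> x * y : Gm"
proof -
 assume "x : Gm" "y : Gm"
 then obtain a e a' e' where xy: "x = mev Fv a * mev init_var e" "y = mev Fv a' * mev init_var e'"
  "keys a <= Pi" "keys e <= {..<N}" "keys a' <= Pi" "keys e' <= {..<N}" unfolding Gm_def by blast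
 have "keys (a + a') <= Pi" "keys (e + e') <= {..<N}"
  using xy(3-6) order_trans[OF Poly_Mapping.keys_add[of a a']] order_trans[OF Poly_Mapping.keys_add[of e e']] by auto
 thus ?thesis unfolding Gm_def using xy(1,2)
  by (intro CollectI exI[of _ "a + a'"] exI[of _ "e + e'"]) (simp add: F.mev_add init.mev_add)
qed

lemma Gm_inverse: "x : Gm ==> inverse x : Gm"
proof -
 assume "x : Gm"
 then obtain a e where *: "x = mev Fv a * mev init_var e" "keys a <= Pi" "keys e <= {..<N}"
  unfolding Gm_def by blast
 thus ?thesis unfolding Gm_def
  by (intro CollectI exI[of _ "- a"] exI[of _ "- e"]) (simp add: F.mev_uminus init.mev_uminus)
qed

lemma Gm_prod: "(!!i. i : J ==> f i : Gm) ==> prod f J : Gm"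
 using Gm_memI(1)[of 0] by (induction J rule: ifi) (auto intro: Gm_mult)

lemma Gm_powi: "x : Gm ==> x powi m : Gm"
proof -
 have "x ^ j : Gm" if "x : Gm" for x j using Gm_memI(1)[of 0] that by (induction j) (auto intro: Gm_mult)
 thus "x : Gm ==> x powi m : Gm" by (simp add: power_int_def Gm_inverse)
qed

text \<open>The formula of \<open>Fh\<close> is solved for the new variable, by induction on its
  position; the sum of absolute heights keeps the measure nonnegative. Beyond the return time,
  periodicity leads back to a lower position.\<close>

lemma cvar_Gm: "k < n ==> cvar Bt (t, k) : Gm"
proof (induction "nat (2 * int t + ht k + (SUM i<n. \<bar>ht i\<bar>))" arbitrary: t k rule: less_induct)
 case less
 have ge: "- ht i <= (SUM i<n. \<bar>ht i\<bar>)" if "i < n" for i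
  using member_le_sum[of i "{..<n}" "%i. \<bar>ht i\<bar>"] that by simp
 have IH: "cvar Bt (t', k') : Gm" if "k' < n" "2 * int t' + ht k' < 2 * int t + ht k" for t' k'
  using less(1) that ge[OF that(1)] by simp
 note k = less(2)
 show ?case
 proof (cases t)
  case 0
  thus ?thesis using k nN Gm_memI(2)[of "single k 1"] by (simp add: cvar_S S_0 initial_seed_def)
 next
  case (Suc s)
  show ?thesis
  proof (cases "s <= rC k")
   case True
   hence sp: "(s, k) : Pi" using k by (simp add: Pi_def)
   have "nbr (%t i. cvar Bt (t, i)) s k i powi adj i k : Gm" if i: "i < n" for i
   proof (cases "adj i k > 0")
    case True
    hence "nbr (%t i. cvar Bt (t, i)) s k i : Gm" using height_cases[OF True] IH[OF i] Suc by (auto simp: nbr_def)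
    thus ?thesis by (rule Gm_powi)
   next
    case False
    thus ?thesis using adj_nonpos(1)[of i k] Gm_memI(1)[of 0] by simp
   qed
   moreover have "keys (gn s k) <= {..<N}" by (auto simp: gn_def)
   ultimately have ng: "neg_monomial (mid s k) k : Gm"
    unfolding mid_monomials[OF k] by (intro Gm_mult Gm_prod Gm_memI(2)) auto
   have fg: "Fh s k : Gm"
    using Gm_memI(1)[of "single (nxt (s, k)) 1"] Fv_nxt[OF fr sp] sp rot_nxt by simp
   have "cvar Bt (s, k) : Gm" using IH[OF k] Suc by simp
   hence "neg_monomial (mid s k) k * inverse (Fh s k * cvar Bt (s, k)) : Gm" using ng fg by (intro Gm_mult Gm_inverse)
   moreover have "cvar Bt (t', k) ~= 0" for t' using mutable_nz[OF cvar_mutable[OF k]] .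
   moreover have "neg_monomial (mid s k) k ~= 0" using neg_monomial_nz[OF mid_vseed[OF k]] .
   ultimately show ?thesis unfolding Fh_Gh_eq(1)[OF k] Suc by simp
  next
   case False
   hence t: "t = (s - rC k) + rC k + 1" using Suc by simp
   have "cvar Bt (s - rC k, kap k) : Gm"
    using IH[OF kap_less[OF k], of "s - rC k"] two_rC[OF k] per_pos t by simp
   thus ?thesis using cvar_periodic[OF full_rat_col[OF fr] k, of "s - rC k"] by (subst t) simp
  qed
 qed
qed

lemma mutable_Gm: "x : mutable_variables Bt ==> x : Gm"
proof -
 assume "x : mutable_variables Bt"
 then obtain t e where e: "keys e <= {..<N}" "x = mev (fst (S t)) e"
  by (rule mutable_is_belt_monomial[OF full_rat_col[OF fr]])
 have "fst (S t) i : Gm" if "i < N" for i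
  using cvar_Gm vseed_frozen[OF seeds_vseed[OF S_seeds], of i t] that Gm_memI(2)[of "single i 1"]
  by (cases "i < n") (auto simp: cvar_S)
 thus "x : Gm" unfolding e(2) mev_def using e(1) by (intro Gm_prod Gm_powi) auto
qed

text \<open>The first argument bounds the number of terms.\<close>

inductive Sp :: "nat => ambient => bool" where
 Sp_0: "Sp 0 0"
| Sp_Suc: "r : R0 ==> keys e <= {..<N} ==> Sp j s ==> Sp (Suc j) (r * mev init_var e + s)"

lemma Sp_add: "Sp i a ==> Sp j b ==> Sp (i + j) (a + b)"
 by (induction rule: Sp.induct) (auto intro: Sp_Suc simp: add.assoc)

lemma Sp_scale: "Sp j a ==> r : R0 ==> keys e <= {..<N} ==> Sp j (r * mev init_var e * a)"
proof (induction rule: Sp.induct)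
 case (Sp_Suc r' e' j s)
 have "keys (e + e') <= {..<N}" using Sp_Suc Poly_Mapping.keys_add[of e e'] by blast
 hence "Sp (Suc j) ((r * r') * mev init_var (e + e') + r * mev init_var e * s)"
  using Sp_Suc Rc(3) by (intro Sp.Sp_Suc) auto
 thus ?case by (simp add: init.mev_add algebra_simps)
qed (simp add: Sp_0)

lemma Sp_mult: "Sp i a ==> Sp j b ==> EX l. Sp l (a * b)"
proof (induction rule: Sp.induct)
 case (Sp_Suc r e j' s)
 then obtain l where "Sp l (s * b)" by blast
 from Sp_add[OF Sp_scale[OF Sp_Suc(5,1,2)] this] show ?case by (auto simp: distrib_right)
qed (auto intro: Sp_0)

lemma Sp_1: "r : R0 ==> keys e <= {..<N} ==> Sp 1 (r * mev init_var e)"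
 using Sp_Suc[OF _ _ Sp_0] by simp

lemma scalar_R0: "scalar c : R0" unfolding R0_def by (rule C.lring_coeff)

lemma Lo_Sp: "g : Lo ==> EX j. Sp j g"
proof -
 have sub: "subr {g. EX j. Sp j g}" unfolding subr_def
 proof (intro conjI ballI)
  show "1 : {g. EX j. Sp j g}" using Sp_1[OF Rc(1), of 0] by auto
  fix a assume a: "a : {g. EX j. Sp j g}"
  show "- a : {g. EX j. Sp j g}" using a Sp_scale[OF _ Rc(4)[OF Rc(1)], of _ _ 0] by fastforce
  fix b assume "b : {g. EX j. Sp j g}"
  with a show "a + b : {g. EX j. Sp j g}" "a * b : {g. EX j. Sp j g}" using Sp_add Sp_mult by blast+
 qed
 have Gm: "Sp 1 x" if x: "x : Gm" for x
 proof -
  obtain a e where ae: "x = mev Fv a * mev init_var e" "keys a <= Pi" "keys e <= {..<N}"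
   using x unfolding Gm_def by blast
  show ?thesis unfolding ae(1) using C.lring_mev[OF ae(2)] ae(3) by (intro Sp_1) (auto simp: R0_def)
 qed
 have c: "Sp 1 (scalar c)" for c using Sp_1[OF scalar_R0, of 0 c] by simp
 have fz: "x : Gm" if "x : frozen_variables Bt" for x
  using that Gm_memI(2)[of "single _ 1"] by (force simp: frozen_variables_def dimr)
 have "CA <= {g. EX j. Sp j g}"
  by (rule CA_subset[OF sub]) (use c Gm mutable_Gm fz Gm_inverse in blast)+
 hence "Lo <= {g. EX j. Sp j g}" by (rule Lo_subset[OF sub]) (use Gm mutable_Gm Gm_inverse in blast)
 thus "g : Lo ==> EX j. Sp j g" by blast
qed

context
 fixes h \<chi>
 assumes h: "h : cluster_torus Bt" and x: "!!i. i < N ==> h (init_var i) = scalar (\<chi> i) * init_var i"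
begin

interpretation e: frac_ext CA h by (rule torus_frac_ext[OF h])

lemma torus_mono:
 assumes a: "keys a <= {..<N}"
 shows "e.T (mev init_var a) (scalar (mev \<chi> a) * mev init_var a)"
proof -
 have xc: "init_var i : CA" if "i < N" for i
  using CA_gens(2)[OF cvar_mutable[of i 0]] CA_gens(3)[OF frozen_var[of i]] that by (cases "i < n") (auto simp: cvar_S S_0 initial_seed_def)
 have "e.T (init_var i) (scalar (\<chi> i) * init_var i)" if "i < N" for i using e.T_of[OF xc[OF that]] x[OF that] by simp
 thus ?thesis unfolding mev_scale[symmetric] using a by (intro e.T_mev) auto
qed

text \<open>An element and its image expand over the same exponents, so linear combinations of the
  two need no more terms.\<close>

lemma Sp_torus: "Sp j s ==> EX s'. e.T s s' & (ALL c. Sp j (scalar c * s - s'))"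
proof (induction rule: Sp.induct)
  case Sp_0
  thus ?case using e.T_of[OF CA_gens(1)[of 0]] torus_scalar[OF h, of 0] Sp.Sp_0 by (intro exI[of _ 0]) (simp)
 next
  case (Sp_Suc r a j s)
  then obtain s' where s': "e.T s s'" "!!c. Sp j (scalar c * s - s')" by blast
  let ?s' = "r * (scalar (mev \<chi> a) * mev init_var a) + s'"
  have "e.T (r * mev init_var a + s) ?s'"
   using e.T_add[OF e.T_mult[OF R0_invariant[OF fr h Sp_Suc(1)] torus_mono[OF Sp_Suc(2)]] s'(1)] .
  moreover have "Sp (Suc j) (scalar c * (r * mev init_var a + s) - ?s')" for c
  proof -
   have "r * scalar (c - mev \<chi> a) : R0" using Rc(3)[OF Sp_Suc(1) scalar_R0] .
   from Sp.Sp_Suc[OF this Sp_Suc(2) s'(2)[of c]] show ?thesis by (simp add: scalar_minus algebra_simps)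
  qed
  ultimately show ?case by blast
qed

end

text \<open>A term whose exponent lies outside the column lattice of \<open>Bt\<close> is moved by some character; the invariance
 of the sum expresses it by fewer terms.\<close>

lemma invariant_R0:
 assumes "Sp j g" "!!h. h : cluster_torus Bt ==> frac_ext.T CA h g g"
 shows "g : R0" using assms
proof (induction j arbitrary: g)
 case 0
 thus ?case using Rc(5) by (auto elim: Sp.cases)
next
 case (Suc j)
 from Suc.prems(1) obtain r e s where g: "g = r * mev init_var e + s" and r: "r : R0" and e: "keys e <= {..<N}" and s: "Sp j s"
  by (auto elim: Sp.cases)
 show ?case
 proof (cases "EX w. e = (SUM k<n. frag_cmul (w k) (ycol (initial_seed Bt) k))")
  case True
  then obtain w where w: "e = (SUM k<n. frag_cmul (w k) (ycol (initial_seed Bt) k))" by blast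
  have "mev init_var e = (PROD k<n. y0 k powi w k)"
   unfolding w init.mev_sum init.mev_cmul by (intro prod.cong refl) (simp add: y0_def yhat_def initial_seed_def)
  also have "... : R0"
   using y0_R0[OF fr] Rc(7) by (intro subr_prod[OF R0_subr[OF fr]]) (auto simp: power_int_def)
  finally have m: "r * mev init_var e : R0" using r Rc(3) by blast
  have "s : R0"
  proof (rule Suc.IH[OF s])
   fix h assume h: "h : cluster_torus Bt"
   interpret e: frac_ext CA h by (rule torus_frac_ext[OF h])
   have "e.T (g + - (r * mev init_var e)) (g + - (r * mev init_var e))"
    by (intro e.T_add Suc.prems(2)[OF h] R0_invariant[OF fr h] Rc(4)[OF m])
   thus "e.T s s" by (simp add: g)
  qed
  thus ?thesis unfolding g using m Rc(2) by blast
 next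
  case False
  then obtain \<chi> :: "nat => complex" where ch: "!!i. \<chi> i ~= 0" "!!k. k < n ==> mev \<chi> (ycol (initial_seed Bt) k) = 1" "mev \<chi> e ~= 1"
   using separating_character[OF e, of thesis] by blast
  obtain h where h: "h : cluster_torus Bt" "!!i. i < N ==> h (init_var i) = scalar (\<chi> i) * init_var i"
   by (rule torus_of_character[OF fr, of \<chi>]) (use ch(1,2) in auto)
  interpret e: frac_ext CA h by (rule torus_frac_ext[OF h(1)])
  obtain s' where s': "e.T s s'" "!!c. Sp j (scalar c * s - s')" using Sp_torus[OF h s] by blast
  let ?c = "mev \<chi> e"
  \<comment> \<open>This scalar cancels the term of exponent \<open>e\<close> and leaves
    \<open>j\<close> terms; \<open>?c ~= 1\<close> permits the division.\<close>
  have "scalar ?c * g - g = scalar ?c * s - s'" using e.T_add[OF e.T_mult[OF R0_invariant[OF fr h(1) r] torus_mono[OF h e]] s'(1)] e.T_unique Suc.prems(2)[OF h(1)] g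
by (auto simp: algebra_simps)
  moreover have "scalar ?c * g - g = scalar (?c - 1) * g" by (simp add: scalar_minus algebra_simps)
  ultimately have "Sp j (scalar (?c - 1) * g)" using s'(2) by simp
  from Sp_scale[OF this scalar_R0, of 0 "1 / (?c - 1)"]
  have "Sp j (scalar (1 / (?c - 1)) * (scalar (?c - 1) * g))" by simp
  moreover have "scalar (1 / (?c - 1)) * scalar (?c - 1) = 1" using ch(3) by (simp add: scalar_hom(4)[symmetric])
  ultimately have "Sp j g" by (simp add: mult.assoc[symmetric])
  thus ?thesis by (rule Suc.IH) (rule Suc.prems(2))
 qed
qed

lemma invariant_ring_eq: "invariant_ring Bt = sub_ring R0"
proof -
 have "g : R0" if g: "g : Lo" "ALL h:cluster_torus Bt. torus_act Bt h g = g" for g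
  using Lo_Sp[OF g(1)] invariant_R0 torus_act_T[OF _ g(1)] g(2) by metis
 moreover have "torus_act Bt h g = g" if "g : R0" "h : cluster_torus Bt" for g h
  using frac_ext.T_unique[OF torus_frac_ext[OF that(2)] torus_act_T[OF that(2)] R0_invariant[OF fr that(2,1)]] R0_Lo[OF fr] that(1) by blast
 ultimately have "{g : Lo. ALL h:cluster_torus Bt. torus_act Bt h g = g} = R0" using R0_Lo[OF fr] by blast
 thus ?thesis unfolding invariant_ring_def by simp
qed

end

end

section \<open>Smoothness\<close>

text \<open>The system is padded by zero rows to a square one, whose matrix then has no right
  inverse.\<close>

lemma underdetermined:
 fixes c :: "'e => 'v => 'a::field"
 assumes E: "finite E" and V: "finite V" and less: "card E < card V"
 obtains l where "EX v:V. l v ~= 0" "!!e. e : E ==> (SUM v:V. c e v * l v) = 0"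
proof -
 obtain f where f: "bij_betw f {..<card E} E" using ex_bij_betw_nat_finite[OF E] by (auto simp: lessThan_atLeast0)
 obtain g where g: "bij_betw g {..<card V} V" using ex_bij_betw_nat_finite[OF V] by (auto simp: lessThan_atLeast0)
 define M where "M i j = (if i < card E then c (f i) (g j) else 0)" for i j
 have "EX v. (EX j<card V. v j ~= 0) & (ALL i<card V. (SUM j<card V. M i j * v j) = 0)"
 proof (rule ccontr)
  assume "\<nexists>v. (EX j<card V. v j ~= 0) & (ALL i<card V. (SUM j<card V. M i j * v j) = 0)"
  hence "ALL j<card V. v j = 0" if "ALL i<card V. (SUM j<card V. M i j * v j) = 0" for v using that by blast
  from two_sided_inverse_exists[of "card V" M, OF this]
  obtain P where "ALL i<card V. ALL k<card V. (SUM j<card V. M i j * P j k) = (if i = k then 1 else 0)" by blast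
  hence "(SUM j<card V. M (card E) j * P j (card E)) = 1" using less by auto
  thus False by (simp add: M_def)
 qed
 then obtain v where v: "EX j<card V. v j ~= 0" "!!i. i < card V ==> (SUM j<card V. M i j * v j) = 0" by blast
 define l where "l w = v (inv_into {..<card V} g w)" for w
 have lg: "l (g j) = v j" if "j < card V" for j using that g by (simp add: l_def bij_betw_def)
 show ?thesis
 proof (rule that[of l])
  show "EX v:V. l v ~= 0" using v(1) lg g by (metis bij_betwE lessThan_iff)
  fix e assume "e : E"
  then obtain i where i: "i < card E" "e = f i" using f by (metis bij_betw_imp_surj_on imageE lessThan_iff)
  have "(SUM v:V. c e v * l v) = (SUM j<card V. c e (g j) * l (g j))" by (rule sum.reindex_bij_betw[OF g, symmetric])
  also have "... = (SUM j<card V. M i j * v j)" using i lg by (simp add: M_def)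
  finally show "(SUM v:V. c e v * l v) = 0" using v(2) i less by simp
 qed
qed

lemma laurent_dependence:
 fixes q :: "'i => 'v laurent"
 assumes K: "finite K" and J: "finite J" "card K < card J" and q: "!!j. j : J ==> keys (q j) <= K"
 obtains l where "EX j:J. l j ~= 0" "!!y. (SUM j:J. scalar (l j) * ev y (q j)) = 0"
proof -
 obtain l where l: "EX j:J. l j ~= 0" "!!e. e : K ==> (SUM j:J. lookup (q j) e * l j) = 0"
  by (rule underdetermined[OF K J(1) J(2), of "%e j. lookup (q j) e"]) blast
 show ?thesis
 proof (rule that[OF l(1)])
  fix y
  have "(SUM j:J. scalar (l j) * ev y (q j)) = (SUM e:K. (SUM j:J. scalar (l j) * scalar (lookup (q j) e)) * mev y e)"
   unfolding sum_distrib_right using C.leval_superset[OF K q, of _ y] by (subst sum.swap) (simp add: sum_distrib_left mult.assoc)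
  also have "... = (SUM e:K. scalar (SUM j:J. lookup (q j) e * l j) * mev y e)"
  proof -
   have "scalar (sum f J) = (SUM j:J. scalar (f j))" for f :: "'i => complex"
    by (induction J rule: ifi) (simp_all)
   thus ?thesis by (simp add: mult.commute)
  qed
  finally show "(SUM j:J. scalar (l j) * ev y (q j)) = 0" using l(2) by simp
 qed
qed

text \<open>Localizations of the Laurent ring in \<open>n\<close> independent units at elements that
  are units of \<open>R\<close>. The finite family \<open>F\<close> gives finite generation, and its
  countable index type bounds the dimension for \<open>nullstellensatz\<close>.\<close>

locale rational_algebra =
 fixes R :: "ambient set" and F :: "'v::countable => ambient" and V :: "'v set" and y :: "nat => ambient" and n :: nat
 assumes F: "nzf F" and V: "finite V" and R_eq: "R = C.lring F V"
  and y_fam: "nzf y" and y_R: "!!k. k < n ==> y k : R" "!!k. k < n ==> inverse (y k) : R"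
  and y_indep: "C.indep y {..<n}"
  and fraction: "!!r. r : R ==> EX a b. pvars {..<n} a & pvars {..<n} b & ev y b : R &
   inverse (ev y b) : R & ev y b ~= 0 & r * ev y b = ev y a"
begin

definition frac :: "ambient => nat laurent => nat laurent => bool" where
 "frac r a b <-> pvars {..<n} a & pvars {..<n} b & ev y b : R &
   inverse (ev y b) : R & ev y b ~= 0 & r * ev y b = ev y a"

lemma R: "subr R" unfolding subr_def R_eq
using C.lring_coeff[of 1 F V] C.lring_add C.lring_mult[OF F] C.lring_uminus by auto

lemma scalar_R: "scalar c : R" unfolding R_eq by (rule C.lring_coeff)

lemma y_lring_R: "C.lring y {..<n} <= R" by (rule lring_subset[OF R scalar_R]) (use y_R in auto)

lemma lv_R: "pvars {..<n} p ==> ev y p : R" using y_lring_R C.lring_memI by blast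

lemma frac_in_R: "frac r a b ==> r : R"
proof -
 assume f: "frac r a b"
 hence "r = ev y a * inverse (ev y b)" by (simp add: frac_def field_simps)
 thus ?thesis using f lv_R subr_closed(3)[OF R] by (auto simp: frac_def)
qed

lemma frac_ops:
 shows frac_add: "frac r a b ==> frac s c d ==> frac (r + s) (a * d + c * b) (b * d)"
  and frac_mult: "frac r a b ==> frac s c d ==> frac (r * s) (a * c) (b * d)"
proof -
 assume *: "frac r a b" "frac s c d"
 have u: "ev y (b * d) : R" "inverse (ev y (b * d)) : R" "ev y (b * d) ~= 0" "pvars {..<n} (b * d)"
  using * subr_closed(3)[OF R] by (auto simp: frac_def C.leval_mult[OF y_fam])
 have e: "r * ev y b = ev y a" "s * ev y d = ev y c" using * by (simp_all add: frac_def)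
 show "frac (r + s) (a * d + c * b) (b * d)" "frac (r * s) (a * c) (b * d)"
  using u * by (auto simp: frac_def C.leval_add C.leval_mult[OF y_fam] e[symmetric] algebra_simps)
qed

lemma frac_lv: "pvars {..<n} p ==> frac (ev y p) p 1"
 using subr_closed(1)[OF R] by (simp add: frac_def)

lemma frac_unique: "frac r a b ==> frac r c d ==> a * d = c * b"
proof -
 assume *: "frac r a b" "frac r c d"
 hence e: "ev y a = r * ev y b" "ev y c = r * ev y d" by (simp_all add: frac_def)
 have "ev y (a * d) = ev y (c * b)" by (simp add: C.leval_mult[OF y_fam] e)
 thus ?thesis using * by (intro C.indep_eq[OF y_indep]) (auto simp: frac_def)
qed

context
 fixes M assumes M: "maximalideal M (sub_ring R)"
begin

lemma M_ideal: "ideal M (sub_ring R)" using M by (rule maximalideal.axioms(1))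

lemmas M_closed = idealD_sub_ring[OF M_ideal]

lemma M_minus: "a : M ==> - a : M" using M_closed(4)[of a "- 1"] subr_closed(1,4)[OF R] by simp

lemma M_sum: "(!!i. i : I ==> f i : M) ==> sum f I : M"
 by (induction I rule: ifi) (auto intro: M_closed)

lemma M_1: "1 ~: M" using M_closed(4)[of 1] maximalideal.I_notcarr[OF M] M_closed(1) by (auto)

lemma M_unit: "u : M ==> inverse u : R ==> u ~= 0 ==> False"
 using M_closed(4)[of u "inverse u"] M_1 by simp

lemma M_scalar: "scalar c : M ==> c = 0"
proof (rule ccontr)
 assume c: "scalar c : M" "c ~= 0"
 hence "scalar c * scalar (1 / c) = 1" by (simp add: scalar_hom(4)[symmetric])
 thus False using M_closed(4)[OF c(1) scalar_R[of "1 / c"]] M_1 by simp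
qed

lemma M_prime: "a : R ==> b : R ==> a * b : M ==> a : M \<or> b : M"
 using primeideal.I_prime[OF cring.maximalideal_prime[OF cring_sub_ring[OF R] M], of a b] by simp

lemma M_inverse:
 assumes x: "x : R" "x ~: M"
 shows "EX t:R. x * t - 1 : M"
proof -
 define J where "J = {m + x * t | m t. m : M & t : R}"
 have JI: "m + x * t : J" if "m : M" "t : R" for m t using that by (auto simp: J_def)
 have MJ: "M <= J" using JI[OF _ subr_closed(5)[OF R]] by auto
 have "ideal J (sub_ring R)"
 proof (rule ideal_sub_ring[OF R])
  show "J <= R" using M_closed(1) subr_closed[OF R] x by (auto simp: J_def)
  show "0 : J" using MJ M_closed(2) by blast
  fix u assume "u : J"
  then obtain m t where u: "m : M" "t : R" "u = m + x * t" by (auto simp: J_def)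
  show "u * b : J" if "b : R" for b
   using JI[OF M_closed(4)[OF u(1) that] subr_closed(3)[OF R u(2) that]] by (simp add: u(3) algebra_simps)
  fix v assume "v : J"
  then obtain m' t' where v: "m' : M" "t' : R" "v = m' + x * t'" by (auto simp: J_def)
  show "u + v : J" using JI[OF M_closed(3)[OF u(1) v(1)] subr_closed(2)[OF R u(2) v(2)]] by (simp add: u(3) v(3) algebra_simps)
 qed
 moreover have "x : J" using JI[OF M_closed(2) subr_closed(1)[OF R]] by simp
 ultimately have "1 : J" using maximalideal.I_maximal[OF M, of J] MJ x idealD_sub_ring(1) subr_closed(1)[OF R]
  by (auto)
 then obtain m t where t: "m : M" "t : R" "1 = m + x * t" unfolding J_def by blast
 have "x * t - 1 = - m" unfolding t(3) by simp
 thus ?thesis using M_minus[OF t(1)] t(2) by metis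
qed

text \<open>Otherwise the inverses of \<open>s - c\<close> modulo M would be uncountably many linearly independent elements of a
 space of countable dimension.\<close>

lemma nullstellensatz:
 assumes s: "s : R"
 shows "EX c. s - scalar c : M"
proof (rule ccontr)
 assume "\<nexists>c. s - scalar c : M"
 hence n: "s - scalar c ~: M" for c by blast
 have sR: "s - scalar c : R" for c using subr_closed(6)[OF R s scalar_R] .
 have "EX p. pvars V p & (s - scalar c) * ev F p - 1 : M" for c
  using M_inverse[OF sR n] unfolding R_eq C.lring_def by blast
 then obtain p where p: "!!c. pvars V (p c)" "!!c. (s - scalar c) * ev F (p c) - 1 : M" by metis
 \<comment> \<open>There are only countably many supports, so infinitely many of the inverses share
   one, and more of them than its size are linearly dependent.\<close>
 define K where "K c = keys (p c)" for c
 define gr where "gr e = {(k, v). v ~= 0 & lookup e k = v}" for e :: "'v ex"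
 have "inj gr" by (intro injI pm_eqI) (simp add: gr_def set_eq_iff, metis)
 moreover have "finite (gr e)" for e
  by (rule finite_subset[of _ "(%k. (k, lookup e k)) ` keys e"]) (auto simp: gr_def in_keys_iff)
 hence "countable (range gr)" by (intro countable_subset[OF _ countable_Collect_finite]) auto
 ultimately have "countable (UNIV :: 'v ex set)" using countable_image_inj_on by blast
 hence "countable (range K)"
  by (rule countable_subset[OF _ countable_Collect_finite_subset, rotated]) (auto simp: K_def)
 moreover have "(UNIV :: complex set) = (UN k:range K. {c. K c = k})" by auto
 ultimately obtain K0 where "infinite {c. K c = K0}"
  using uncountable_UNIV_complex countable_UN countable_finite by (metis (no_types, lifting))
 then obtain g :: "nat => complex" where g: "inj g" "!!j. K (g j) = K0" unfolding infinite_iff_countable_subset by blast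
 define m where "m = card K0"
 have fK: "finite K0" using g(2)[of 0] by (auto simp: K_def)
 obtain l where l: "EX j:{..m}. l j ~= 0" "!!y. (SUM j<=m. scalar (l j) * ev y (p (g j))) = 0"
  by (rule laurent_dependence[OF fK, of "{..m}" "%j. p (g j)"]) (use g(2) in "auto simp: m_def K_def")
 define t where "t j = ev F (p (g j))" for j
 define pe where "pe q = poly (map_poly scalar q) s" for q
 have pe_simps: "pe 0 = 0" "pe (pCons c q) = scalar c + s * pe q" for c q by (simp_all add: pe_def map_poly_pCons)
 have pe_smult: "pe (smult c q) = scalar c * pe q" for c q by (induction q) (simp_all add: pe_simps algebra_simps)
 have pe_add: "pe (q + q') = pe q + pe q'" for q q' by (induction q q' rule: poly_induct2) (simp_all add: pe_simps algebra_simps)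
 have pe_sum: "pe (sum f I) = (SUM i:I. pe (f i))" for f and I :: "nat set"
  by (induction I rule: ifi) (simp_all add: pe_add pe_simps)
 have pe_mult: "pe (q * q') = pe q * pe q'" for q q'
  by (induction q) (simp_all add: pe_simps pe_add pe_smult algebra_simps)
 have pe_R: "pe q : R" for q by (induction q) (auto simp: pe_simps intro!: subr_closed[OF R] scalar_R s)
 have lin: "pe [:- c, 1:] = s - scalar c" for c by (simp add: pe_simps C.hom_uminus)
 \<comment> \<open>Nonzero polynomials split into linear factors, and the prime ideal
   \<open>M\<close> contains no \<open>s - scalar c\<close>.\<close>
 have root: "pe q ~: M" if "q ~= 0" for q using that
 proof (induction "degree q" arbitrary: q rule: less_induct)
  case less
  show ?case
  proof (cases "degree q = 0")
   case True
   then obtain c where "q = [:c:]" "c ~= 0" using less(2) by (metis degree_eq_zeroE pCons_0_0)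
   thus ?thesis using M_scalar by (auto simp: pe_simps)
  next
   case False
   then obtain r where "poly q r = 0" using alg_closed_imp_poly_has_root by blast
   then obtain q' where q': "q = [:- r, 1:] * q'" by (auto simp: poly_eq_0_iff_dvd)
   moreover from this have "q' ~= 0" using less(2) by auto
   ultimately have "degree q' < degree q" "q' ~= 0" using degree_mult_eq[of "[:- r, 1:]" q'] by simp_all
   thus ?thesis by (metis less(1) M_prime[OF sR pe_R] n q' pe_mult lin)
  qed
 qed
 have pe_1: "pe 1 = 1" by (simp add: one_pCons pe_simps)
 define Pr where "Pr j = (PROD i:{..m} - {j}. [:- g i, 1:])" for j
 \<comment> \<open>The linear relation between the inverses, cleared of denominators: it puts
   \<open>Q\<close> at \<open>s\<close> into \<open>M\<close>, while the value of \<open>Q\<close>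
   at a suitable \<open>g j\<close> is nonzero.\<close>
 define Q where "Q = (SUM j<=m. smult (l j) (Pr j))"
 have peP: "pe (PROD i:I. [:- g i, 1:]) = (PROD i:I. s - scalar (g i))" for I
  by (induction I rule: ifi) (simp_all add: pe_1 pe_mult lin del: mult_pCons_left)
 define D where "D = (PROD i<=m. s - scalar (g i))"
 have D: "D = (s - scalar (g j)) * pe (Pr j)" if "j <= m" for j
  unfolding D_def Pr_def peP using that by (simp add: prod.remove)
 have "pe Q = (SUM j<=m. scalar (l j) * pe (Pr j))" by (simp add: Q_def pe_sum pe_smult)
 also have "... = (SUM j<=m. - (((s - scalar (g j)) * t j - 1) * (scalar (l j) * pe (Pr j)))) + D * (SUM j<=m. scalar (l j) * t j)"
  unfolding sum_distrib_left sum.distrib[symmetric] 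
 proof (intro sum.cong refl)
  fix j assume "j : {..m}"
  hence j: "j <= m" by simp
  show "scalar (l j) * pe (Pr j) = - (((s - scalar (g j)) * t j - 1) * (scalar (l j) * pe (Pr j))) + D * (scalar (l j) * t j)"
   unfolding D[OF j] by (simp add: algebra_simps)
 qed
 also have "(SUM j<=m. scalar (l j) * t j) = 0" using l(2) by (simp add: t_def)
 finally have "pe Q = (SUM j<=m. - (((s - scalar (g j)) * t j - 1) * (scalar (l j) * pe (Pr j))))" by simp
 moreover have "... : M"
  using p(2) subr_closed(3)[OF R scalar_R pe_R] by (intro M_sum M_minus M_closed(4)) (auto simp: t_def)
 ultimately have "Q = 0" using root by metis
 obtain j where j: "j <= m" "l j ~= 0" using l(1) by auto
 have "poly (Pr i) (g j) = 0" if "i <= m" "i ~= j" for i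
  using that j(1) by (auto simp: Pr_def poly_prod)
 hence "poly Q (g j) = l j * poly (Pr j) (g j)"
  unfolding Q_def poly_sum using j(1) by (subst sum.remove[of _ j]) (auto)
 moreover have "poly (Pr j) (g j) ~= 0" using g(1) by (auto simp: Pr_def poly_prod dest: injD)
 ultimately show False using `Q = 0` j(2) by simp
qed

end

end

context rational_algebra
begin

lemma point_exists:
 assumes M: "maximalideal M (sub_ring R)"
 obtains a where "!!k. a k ~= 0" "!!k. k < n ==> y k - scalar (a k) : M"
proof -
 have "EX c. c ~= 0 & (k < n --> y k - scalar c : M)" for k
 proof (cases "k < n")
  case True
  obtain c where c: "y k - scalar c : M" using nullstellensatz[OF M y_R(1)[OF True]] by blast
  have "c ~= 0" using M_unit[OF M, of "y k"] c y_R(2)[OF True] nzf.nz[OF y_fam] by auto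
  thus ?thesis using c by blast
 qed (auto intro: exI[of _ 1])
 thus ?thesis using that by metis
qed

context
 fixes M and a :: "nat => complex"
 assumes M: "maximalideal M (sub_ring R)" and a0: "!!k. a k ~= 0" and ya: "!!k. k < n ==> y k - scalar (a k) : M"
begin

text \<open>The first \<open>j\<close> coordinates are specialized to the point, the others stay
  generic; the kernels of these evaluations form a chain of primes from zero to
  \<open>M\<close>.\<close>

definition zz :: "nat => nat => ambient" where "zz j i = (if i < j then scalar (a i) else y i)"

abbreviation "pt \<equiv> %i. scalar (a i)"

lemma zz_fam: "nzf (zz j)" using a0 nzf.nz[OF y_fam] by unfold_locales (simp add: zz_def)

lemma pt_fam: "nzf pt" using a0 by unfold_locales simp

lemma inverse_scalar: "inverse (scalar c) = scalar (inverse c)" using scalar_powi[of c "-1"] by simp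

lemma eval_pt:
 obtains c where "ev pt p = scalar c"
proof -
 have "subr (range scalar)"
  unfolding subr_def by (auto simp: scalar_hom(4)[symmetric] C.hom_add[symmetric] C.hom_uminus[symmetric] simp del: scalar_hom) (metis scalar_hom(2) rangeI)
 hence "C.lring pt UNIV <= range scalar" by (rule lring_subset) (auto simp: inverse_scalar)
 moreover have "ev pt p : C.lring pt UNIV" by (rule C.lring_memI) (simp add: pvars_def)
 ultimately show ?thesis using that by blast
qed

lemma eval_mod:
 assumes p: "pvars {..<n} p"
 shows "ev y p - ev pt p : M"
proof -
 note Mc = M_closed[OF M]
 define cg where "cg u v <-> u : R & v : R & u - v : M" for u v
 have cg_mult: "cg (u * u') (v * v')" if "cg u v" "cg u' v'" for u v u' v'
 proof -
  have "(u - v) * u' + (u' - v') * v : M" using that Mc(3,4) by (simp add: cg_def)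
  thus ?thesis using that subr_closed(3)[OF R] by (simp add: cg_def algebra_simps)
 qed
 have cg_c: "cg (scalar c) (scalar c)" for c using Mc(2) by (simp add: cg_def scalar_R)
 have cg_pow: "cg (u ^ j) (v ^ j)" if "cg u v" for u v j
  using cg_c[of 1] cg_mult that by (induction j) (simp_all)
 have var: "cg (y k powi m) (pt k powi m)" if k: "k < n" for k m
 proof -
  have "(y k - pt k) * (- (inverse (y k) * inverse (pt k))) : M"
   unfolding inverse_scalar by (intro Mc(4) ya[OF k] subr_closed[OF R] y_R(2)[OF k] scalar_R)
  moreover have "(y k - pt k) * (- (inverse (y k) * inverse (pt k))) = inverse (y k) - inverse (pt k)"
   using a0 nzf.nz[OF y_fam, of k] by (simp add: field_simps)
  ultimately show ?thesis by (metis y_R k ya scalar_R cg_pow cg_def inverse_scalar power_int_def)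
 qed
 have mono: "cg (mev y e) (mev pt e)" if e: "keys e <= {..<n}" for e
 proof -
  have "cg (PROD k:I. y k powi lookup e k) (PROD k:I. pt k powi lookup e k)" if "finite I" "I <= {..<n}" for I
   using that cg_c[of 1] var by (induction I) (auto intro!: cg_mult)
  thus ?thesis using e by (simp add: mev_def)
 qed
 have "ev y p - ev pt p = (SUM e:keys p. scalar (lookup p e) * mev y e - scalar (lookup p e) * mev pt e)"
  by (simp add: leval_def sum_subtractf)
 also have "... : M" using cg_mult[OF cg_c mono] p by (intro M_sum[OF M]) (auto simp: cg_def pvars_def)
 finally show ?thesis .
qed

lemma eval_M: "pvars {..<n} p ==> ev y p : M <-> ev pt p = 0"
proof
 assume p: "pvars {..<n} p" "ev y p : M"
 obtain c where c: "ev pt p = scalar c" by (rule eval_pt)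
 have "ev y p + - (ev y p - ev pt p) : M" by (intro M_closed(3)[OF M] p M_minus[OF M] eval_mod)
 thus "ev pt p = 0" using M_scalar[OF M, of c] c by simp
next
 assume "pvars {..<n} p" "ev pt p = 0"
 thus "ev y p : M" using eval_mod by force
qed

text \<open>Vanishing after \<open>j\<close> specializations is an identity in the other
  coordinates, which are independent; so it survives further specialization.\<close>

lemma eval_zz:
 assumes p: "pvars {..<n} p" "ev (zz j) p = 0" and j: "j <= j'"
 shows "ev (zz j') p = 0"
proof -
 define ex where "ex e = pvec n (%i. if i < j then 0 else lookup e i)" for e :: "nat ex"
 define cf where "cf e = (PROD i<n. if i < j then a i powi lookup e i else 1)" for e :: "nat ex"
 define q where "q = (SUM e:keys p. single (ex e) (lookup p e * cf e))"
 have ev: "ev w q = ev w' p" if w: "!!i. w' i = (if i < j then scalar (a i) else w i)" for w w'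
 proof -
  have sp: "scalar (PROD i:I. f i) = (PROD i:I. scalar (f i))" for f :: "nat => complex" and I
   by (induction I rule: ifi) (simp_all)
  have "mev w' e = scalar (cf e) * mev w (ex e)" if e: "keys e <= {..<n}" for e
   unfolding mev_superset[OF finite_lessThan e] ex_def mev_pvec cf_def sp prod.distrib[symmetric]
by (intro prod.cong refl) (simp add: w scalar_powi)
  thus ?thesis using p(1) unfolding q_def C.leval_sum leval_def[of _ w'] by (intro sum.cong refl) (simp add: pvars_def)
 qed
 have "ev y q = 0" using ev[of "zz j" y] p(2) by (simp add: zz_def)
 moreover have "pvars {..<n} q" unfolding q_def ex_def by (intro pvars_sum pvars_single) (auto)
 ultimately have "q = 0" using y_indep unfolding C.indep_def by blast
 thus ?thesis using ev[of "zz j'" "zz j'"] j by (simp add: zz_def)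
qed

lemma zz_n: "pvars {..<n} p ==> ev (zz n) p = ev pt p" by (rule C.leval_cong) (auto simp: zz_def)

lemma unit_pt: "frac r p q ==> ev pt q ~= 0"
 using eval_M M_unit[OF M, of "ev y q"] unfolding frac_def by blast

lemma unit_zz: "frac r p q ==> j <= n ==> ev (zz j) q ~= 0"
 using unit_pt eval_zz[of q j n] zz_n unfolding frac_def by metis

definition PP :: "nat => ambient set" where
 "PP j = {r. EX p q. frac r p q & ev (zz j) p = 0}"

lemma PP_prime:
 assumes j: "j <= n"
 shows "primeideal (PP j) (sub_ring R)"
proof (rule primeidealI)
 have PPI: "r : PP j" if "frac r p q" "ev (zz j) p = 0" for r p q using that by (auto simp: PP_def)
 note zm = C.leval_mult[OF zz_fam]
 have fr: "EX p q. frac r p q" if "r : R" for r using fraction[OF that] unfolding frac_def by blast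
 show "ideal (PP j) (sub_ring R)"
 proof (rule ideal_sub_ring[OF R])
  show "PP j <= R" using frac_in_R by (auto simp: PP_def)
  show "0 : PP j" using PPI[OF frac_lv[of 0]] by simp
  fix r s assume r: "r : PP j"
  then obtain p q where p: "frac r p q" "ev (zz j) p = 0" by (auto simp: PP_def)
  { assume "s : PP j"
   then obtain p' q' where "frac s p' q'" "ev (zz j) p' = 0" by (auto simp: PP_def)
   thus "r + s : PP j" using PPI[OF frac_add[OF p(1)]] p(2) by (simp add: C.leval_add zm) }
  { assume "s : R"
   then obtain p' q' where "frac s p' q'" using fr by blast
   thus "r * s : PP j" using PPI[OF frac_mult[OF p(1)]] p(2) by (simp add: zm) }
 qed
 show "cring (sub_ring R)" by (rule cring_sub_ring[OF R])
 have "1 ~: PP j"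
 proof
  assume "1 : PP j"
  then obtain p q where p: "frac 1 p q" "ev (zz j) p = 0" by (auto simp: PP_def)
  hence "p = q" using frac_unique[OF p(1) frac_lv[of 1, simplified]] by simp
  thus False using unit_zz[OF p(1) j] p(2) by simp
 qed
 thus "carrier (sub_ring R) ~= PP j" using subr_closed(1)[OF R] by auto
 fix r s assume rs: "r : carrier (sub_ring R)" "s : carrier (sub_ring R)" "r \<otimes>\<^bsub>sub_ring R\<^esub> s : PP j"
 then obtain p q where p: "frac (r * s) p q" "ev (zz j) p = 0" by (auto simp: PP_def)
 obtain p1 q1 p2 q2 where f: "frac r p1 q1" "frac s p2 q2" using fr rs by (metis sub_ring_simps(1))
 have "p * (q1 * q2) = (p1 * p2) * q" by (rule frac_unique[OF p(1) frac_mult[OF f]])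
 from arg_cong[OF this, of "ev (zz j)"]
 show "r : PP j \<or> s : PP j" using p(2) unit_zz[OF p(1) j] PPI f by (auto simp: zm)
qed

lemma PP_strict:
 assumes j: "j < n"
 shows "PP j \<subset> PP (Suc j)"
proof
 show "PP j <= PP (Suc j)" using eval_zz by (fastforce simp: PP_def frac_def)
 define p :: "nat laurent" where "p = single (single j 1) 1 - single 0 (a j)"
 have p: "pvars {..<n} p" unfolding p_def using j by (intro pvars_diff pvars_single) auto
 have e: "ev w p = w j - scalar (a j)" for w by (simp add: p_def C.leval_diff)
 have "y j - scalar (a j) : PP (Suc j)"
  using frac_lv[OF p] e e unfolding PP_def by (auto simp: zz_def)
 moreover have "y j - scalar (a j) ~: PP j"
 proof
  assume "y j - scalar (a j) : PP j"
  then obtain u v where u: "frac (y j - scalar (a j)) u v" "ev (zz j) u = 0" by (auto simp: PP_def)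
  have "u * 1 = p * v" using frac_unique[OF u(1) frac_lv[OF p, unfolded e]] .
  from arg_cong[OF this, of "ev (zz j)"] have "ev (zz j) p = 0"
   using u(2) unit_zz[OF u(1)] j by (simp add: C.leval_mult[OF zz_fam])
  hence "p = 0" using y_indep p by (auto simp: e zz_def C.indep_def)
  from arg_cong[OF this, of "%p. lookup p (single j 1)"]
  show False by (simp add: p_def)
 qed
 ultimately show "PP j ~= PP (Suc j)" by blast
qed

lemma M_frac: "frac r p q ==> r : M <-> ev pt p = 0"
proof -
 assume f: "frac r p q"
 hence e: "ev y p = r * ev y q" "ev y q : R" "ev y q ~: M" "r : R" "pvars {..<n} p"
  using M_unit[OF M, of "ev y q"] frac_in_R[OF f] unfolding frac_def by auto
 thus ?thesis using M_closed(4)[OF M, of r] M_prime[OF M, of r] eval_M[OF e(5)] by (auto)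
qed

lemma PP_n: "PP n = M"
proof -
 have "r : PP n <-> r : M" for r
 proof
  assume "r : PP n"
  then obtain p q where "frac r p q" "ev (zz n) p = 0" by (auto simp: PP_def)
  thus "r : M" using M_frac zz_n by (auto simp: frac_def)
 next
  assume r: "r : M"
  then obtain p q where f: "frac r p q" using fraction M_closed(1)[OF M] unfolding frac_def by blast
  thus "r : PP n" using M_frac[OF f] r zz_n[of p] unfolding PP_def frac_def by auto
 qed
 thus ?thesis by blast
qed

end

end

section \<open>The dimension of local rings, by counting monomials\<close>

lemma card_box:
 fixes J :: "int set" and m :: nat
 assumes J: "finite J"
 defines "Bx \<equiv> {e :: nat ex. keys e <= {..<m} & (ALL v<m. lookup e v : J)}"
 shows "finite Bx" "card Bx = card J ^ m"
proof -
 have "bij_betw (pvec m) (PiE {..<m} (%_. J)) Bx"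
 proof (rule bij_betw_byWitness[where f' = "%e. restrict (lookup e) {..<m}"])
  show "ALL e:Bx. pvec m (restrict (lookup e) {..<m}) = e"
   by (auto simp: Bx_def in_keys_iff intro!: pm_eqI)
  show "ALL f:PiE {..<m} (%_. J). restrict (lookup (pvec m f)) {..<m} = f"
  using PiE_arb by (intro ballI ext) (auto)
  show "pvec m ` PiE {..<m} (%_. J) <= Bx" by (rule image_subsetI) (auto simp: Bx_def)
  show "(%e. restrict (lookup e) {..<m}) ` Bx <= PiE {..<m} (%_. J)"
   by (intro image_subsetI) (simp add: Bx_def)
 qed
 moreover have "finite (PiE {..<m} (%_. J))" using J by (intro finite_PiE) auto
 ultimately show "finite Bx" "card Bx = card J ^ m"
  using bij_betw_finite[of "pvec m" "PiE {..<m} (%_. J)" Bx] bij_betw_same_card[of "pvec m" "PiE {..<m} (%_. J)" Bx]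
  by (simp_all add: card_PiE)
qed

definition bd :: "nat => nat laurent => bool" where
 "bd L p <-> (ALL e:keys p. ALL i. \<bar>lookup e i\<bar> <= int L)"

lemma bd_exists: "EX L. bd L p"
proof -
 define L where "L = (SUM e:keys p. SUM i:keys e. \<bar>lookup e i\<bar>)"
 have "\<bar>lookup e i\<bar> <= L" if e: "e : keys p" for e i
 proof (cases "i : keys e")
  case True
  have "\<bar>lookup e i\<bar> <= (SUM i:keys e. \<bar>lookup e i\<bar>)"
   using True by (intro member_le_sum) auto
  also have "... <= L" unfolding L_def by (rule member_le_sum[OF e]) (auto)
  finally show ?thesis .
 next
  case False
  moreover have "0 <= L" unfolding L_def by (intro sum_nonneg) auto
  ultimately show ?thesis by (simp add: in_keys_iff)
 qed
 thus ?thesis by (intro exI[of _ "nat L"]) (force simp: bd_def)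
qed

lemma bd_mono: "bd L p ==> L <= L' ==> bd L' p" unfolding bd_def by (meson of_nat_mono order_trans)

lemma bd_mult: "bd L p ==> bd L' q ==> bd (L + L') (p * q)" unfolding bd_def
proof (intro ballI allI)
 fix e i assume *: "ALL e:keys p. ALL i. \<bar>lookup e i\<bar> <= int L" "ALL e:keys q. ALL i. \<bar>lookup e i\<bar> <= int L'"
  and "e : keys (p * q)"
 then obtain u v where "e = u + v" "u : keys p" "v : keys q" using Poly_Mapping.keys_mult by blast
 thus "\<bar>lookup e i\<bar> <= int (L + L')" using *(1)[rule_format, of u i] *(2)[rule_format, of v i] by simp
qed

lemma bd_power: "bd L p ==> bd (j * L) (p ^ j)"
 by (induction j) (auto simp: bd_mult, simp add: bd_def)

lemma bd_prod: "(!!i. i : I ==> bd L (f i)) ==> bd (card I * L) (prod f I)"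
 by (induction I rule: ifi) (auto simp: bd_mult, simp_all add: bd_def)

context rational_algebra
begin

text \<open>Counting: the monomials of degree below \<open>D\<close> in each of \<open>n + 1\<close> elements lie in a space whose
 dimension grows like \<open>D ^ n\<close>.\<close>

lemma algebraically_dependent:
 fixes A :: "nat => nat laurent"
 assumes A: "!!i. i < Suc n ==> pvars {..<n} (A i)" "!!i. i < Suc n ==> ev y (A i) = x i"
 obtains p where "pvars {..<Suc n} p" "p ~= 0" "!!e i. e : keys p ==> lookup e i >= 0" "ev x p = 0"
proof -
 have "ALL i. EX L. bd L (A i)" using bd_exists by blast
 then obtain LA where LA: "!!i. bd (LA i) (A i)" by metis
 define L where "L = (SUM i<Suc n. LA i)"
 have L: "bd L (A i)" if "i < Suc n" for i
  using bd_mono[OF LA] member_le_sum[of i "{..<Suc n}" LA] that by (auto simp: L_def)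
 \<comment> \<open>Since \<open>2 * K + 1\<close> is at most \<open>D * (2 * Suc n * L + 1)\<close>,
   this \<open>D\<close> makes the \<open>D ^ Suc n\<close> monomials outnumber the
   \<open>(2 * K + 1) ^ n\<close> available exponents.\<close>
 define D where "D = (2 * Suc n * L + 1) ^ n + 1"
 define K where "K = Suc n * (D * L)"
 define BK where "BK = {e :: nat ex. keys e <= {..<n} & (ALL v<n. lookup e v : {- int K..int K})}"
 define BD where "BD = {e :: nat ex. keys e <= {..<Suc n} & (ALL v<Suc n. lookup e v : {0..<int D})}"
 have cards: "finite BK" "card BK = (2 * K + 1) ^ n" "finite BD" "card BD = D ^ Suc n"
  using card_box[of "{- int K..int K}" n] card_box[of "{0..<int D}" "Suc n"] by (auto simp: BK_def BD_def nat_add_distrib nat_mult_distrib)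
 have "2 * K + 1 <= D * (2 * Suc n * L + 1)" by (simp add: K_def D_def algebra_simps)
 hence "(2 * K + 1) ^ n <= (D * (2 * Suc n * L + 1)) ^ n" by (rule power_mono) simp
 also have "... < D ^ n * D" unfolding power_mult_distrib by (rule mult_strict_left_mono) (simp_all add: D_def)
 finally have less: "card BK < card BD" using cards by (simp add: mult.commute)
 define q where "q e = (PROD i<Suc n. A i ^ nat (lookup e i))" for e
 have e_range: "0 <= lookup e i & nat (lookup e i) <= D" if "e : BD" "i < Suc n" for e i
  using that by (force simp: BD_def)
 have q: "keys (q e) <= BK" if e: "e : BD" for e
 proof -
  have "bd (D * L) (A i ^ nat (lookup e i))" if "i < Suc n" for i
   using bd_mono[OF bd_power[OF L[OF that]]] e_range[OF e that] by simp
  hence "bd (card {..<Suc n} * (D * L)) (q e)" unfolding q_def by (intro bd_prod) auto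
  moreover have "pvars {..<n} (PROD i:I. A i ^ nat (lookup e i))" if "I <= {..<Suc n}" for I
   using that A(1) by (induction I rule: ifi) auto
  ultimately have "bd K (q e)" "pvars {..<n} (q e)" by (simp_all add: K_def q_def del: prod.lessThan_Suc)
  thus ?thesis unfolding BK_def bd_def pvars_def by (auto simp: abs_le_iff minus_le_iff)
 qed
 obtain l where l: "EX e:BD. l e ~= 0" "!!y. (SUM e:BD. scalar (l e) * ev y (q e)) = 0"
  by (rule laurent_dependence[OF cards(1,3) less q]) blast+
 define p where "p = (SUM e:BD. single e (l e))"
 have lk: "lookup p e = (if e : BD then l e else 0)" for e using cards(3) by (simp add: p_def)
 show ?thesis
 proof (rule that[of p])
  show "pvars {..<Suc n} p" unfolding p_def by (intro pvars_sum pvars_single) (auto simp: BD_def)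
  show "p ~= 0" using l(1) lk by (metis lookup_zero)
  show "lookup e i >= 0" if "e : keys p" for e i
  proof -
   have "e : BD" using that lk by (auto simp: in_keys_iff split: if_splits)
   moreover have "lookup e i = 0" if "~ i < Suc n"
    using that `e : BD` unfolding BD_def by (metis (no_types, lifting) in_keys_iff lessThan_iff mem_Collect_eq subsetD)
   ultimately show ?thesis using e_range by (cases "i < Suc n") auto
  qed
  have "ev y (PROD i:I. A i ^ nat (lookup e i)) = (PROD i:I. x i powi lookup e i)"
   if "e : BD" "I <= {..<Suc n}" for e I using that(2) e_range[OF that(1)] A(2)
   by (induction I rule: ifi) (auto simp: C.leval_mult[OF y_fam] C.leval_power[OF y_fam] power_int_def)
  hence "ev y (q e) = mev x e" if "e : BD" for e
   using mev_superset[of "{..<Suc n}" e x] that by (simp add: q_def BD_def del: prod.lessThan_Suc)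
  thus "ev x p = 0" using l(2)[of y] by (simp add: p_def C.leval_sum)
 qed
qed

text \<open>From a longer chain choose elements of \<open>Q (Suc i)\<close> outside
  \<open>Q i\<close> for \<open>i <= n\<close>. An algebraic relation between them lies in
  \<open>Q 0\<close> and is pushed up the chain, losing one variable per step, until a nonzero
  constant lies in a prime.\<close>

lemma prime_chain_le:
 assumes Q: "!!i. i <= k ==> primeideal (Q i) (sub_ring R)" and str: "!!i. i < k ==> Q i \<subset> Q (Suc i)"
 shows "k <= n"
proof (rule ccontr)
 assume "~ k <= n"
 hence kn: "Suc n <= k" by simp
 note Qid = idealD_sub_ring[OF primeideal.axioms(1)[OF Q]]
 have Qp: "u : Q i \<or> v : Q i" if "i <= k" "u : R" "v : R" "u * v : Q i" for i u v
  using primeideal.I_prime[OF Q[OF that(1)], of u v] that by simp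
 have Q1: "1 ~: Q i" if "i <= k" for i
 using Qid(1,4)[OF that] primeideal.I_notcarr[OF Q[OF that]] by force
 \<comment> \<open>Denominators are units of \<open>R\<close>, so the separating elements may be
   replaced by their numerators, to which the counting applies.\<close>
 have "EX p. pvars {..<n} p & ev y p ~= 0 & (i < Suc n --> ev y p : Q (Suc i) & ev y p ~: Q i)" for i
 proof (cases "i < Suc n")
  case True
  hence i: "i <= k" "Suc i <= k" using kn by auto
  then obtain u where u: "u : Q (Suc i)" "u ~: Q i" using str[of i] by auto
  then obtain p q where "frac u p q" using fraction Qid(1)[OF i(2)] unfolding frac_def by blast
  hence f: "pvars {..<n} p" "ev y p = u * ev y q" "ev y q : R" "inverse (ev y q) : R"
   "u = ev y p * inverse (ev y q)" by (auto simp: frac_def field_simps)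
  have "ev y p : Q (Suc i)" "ev y p ~: Q i" using Qid(4)[OF i(2) u(1) f(3)] Qid(4)[OF i(1) _ f(4)] f(2,5) u(2) by metis+
  thus ?thesis using f(1) Qid(2)[OF i(1)] by metis
 qed (auto intro: exI[of _ 1])
 then obtain A where A: "!!i. pvars {..<n} (A i)" "!!i. ev y (A i) ~= 0"
  "!!i. i < Suc n ==> ev y (A i) : Q (Suc i) & ev y (A i) ~: Q i" by metis
 define x where "x i = ev y (A i)" for i
 note x = A(2,3)[folded x_def]
 have xR: "x i : R" if "i < Suc n" for i using x(2)[OF that] Qid(1)[of "Suc i"] kn that by auto
 have xf: "nzf x" using x(1) by unfold_locales
 note xm = C.leval_mult[OF xf]
 let ?nn = "%p :: nat laurent. ALL e:keys p. ALL i. lookup e i >= 0"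
 have nnR: "ev x p : R" if p: "pvars {..<Suc n} p" "?nn p" for p
 proof -
  have "mev x e : R" if e: "e : keys p" for e unfolding mev_def
  proof (rule subr_prod[OF R])
   fix v assume "v : keys e"
   hence "v < Suc n" using p(1) e by (auto simp: pvars_def)
   thus "x v powi lookup e v : R" using p(2) e subr_closed(7)[OF R xR] by (simp add: power_int_def)
  qed
  thus ?thesis unfolding leval_def by (intro subr_sum[OF R] subr_closed(3)[OF R] scalar_R)
 qed
 have "EX p. pvars {i..<Suc n} p & p ~= 0 & ?nn p & ev x p : Q i" if "i <= Suc n" for i using that
 proof (induction i)
  case 0
  obtain p where "pvars {..<Suc n} p" "p ~= 0" "!!e i. e : keys p ==> lookup e i >= 0" "ev x p = 0"
   using algebraically_dependent[of A x, OF A(1) x_def[symmetric], of thesis] by blast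
  thus ?case using Qid(2) by (intro exI[of _ p]) (auto simp: atLeast0LessThan)
 next
  case (Suc i)
  then obtain p where p: "pvars {i..<Suc n} p" "p ~= 0" "?nn p" "ev x p : Q i" by auto
  have i: "i < Suc n" "i <= k" "Suc i <= k" using Suc(2) kn by auto
  let ?w = "%e. lookup e i"
  \<comment> \<open>The largest power of \<open>x i\<close> is factored out, which is allowed as
    \<open>x i\<close> is not in the prime \<open>Q i\<close>. The terms still containing
    \<open>x i\<close> lie in \<open>Q (Suc i)\<close>, hence so does the rest \<open>G\<close>,
    which is nonzero and free of \<open>x i\<close>.\<close>
  define d where "d = minw ?w p"
  define f where "f = single i (- d)"
  have s1: "single f (1::complex) ~= 0" by (metis lookup_single_eq lookup_zero zero_neq_one)
  define p0 where "p0 = p * single f 1"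
  have k0: "EX a:keys p. e = a + f" if "e : keys p0" for e
   using that Poly_Mapping.keys_mult[of p "single f 1"] by (auto simp: p0_def)
  have "minw ?w p0 = 0"
   unfolding p0_def using p(2) s1 by (subst minw_mult[OF weight_lookup]) (auto simp: d_def f_def)
  moreover have p00: "p0 ~= 0" using p(2) s1 by (simp add: p0_def)
  ultimately obtain e0 where e0: "e0 : keys p0" "?w e0 = 0" using minw_attained[of p0 ?w] by auto
  have nn0: "?nn p0"
  proof (intro ballI allI)
   fix e j assume "e : keys p0"
   then obtain a where a: "a : keys p" "e = a + f" using k0 by blast
   thus "lookup e j >= 0" using p(3) minw_le[OF a(1), of ?w] by (auto simp: f_def d_def)
  qed
  have "keys f <= {i..<Suc n}" using i(1) by (simp add: f_def)
  hence pv0: "pvars {i..<Suc n} p0" unfolding p0_def by (intro pvars_mult p(1) pvars_single)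
  define G where "G = hcomp ?w 0 p0"
  define H where "H = (p0 - G) * single (single i (- 1)) 1"
  have kH: "EX a:keys p0. ?w a ~= 0 & e = a + single i (- 1)" if "e : keys H" for e
  proof -
   have "keys (p0 - G) <= {a : keys p0. ?w a ~= 0}"
    by (auto simp: in_keys_iff G_def lookup_hcomp split: if_splits)
   moreover have "EX a:keys (p0 - G). e = a + single i (- 1)"
    using that Poly_Mapping.keys_mult[of "p0 - G" "single (single i (- 1)) 1"] unfolding H_def by auto
   ultimately show ?thesis by blast
  qed
  have nnH: "?nn H" using kH nn0 by force
  have pvG: "pvars {i..<Suc n} G" unfolding G_def using pv0 by blast
  have nnG: "?nn G" using nn0 by (auto simp: G_def keys_hcomp)
  have pvH: "pvars {i..<Suc n} H" unfolding H_def using i(1) by (intro pvars_mult pvars_diff pv0 pvG pvars_single) simp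
  have sub: "{i..<Suc n} <= {..<Suc n}" by auto
  note R' = nnR[OF pvars_mono[OF pv0 sub] nn0] nnR[OF pvars_mono[OF pvG sub] nnG] nnR[OF pvars_mono[OF pvH sub] nnH]
  have "p * 1 = p0 * single (- f) 1" by (simp add: p0_def)
  hence "ev x p = ev x p0 * mev x (- f)" using xm by simp
  moreover have "d >= 0" using p(3) minw_attained[OF p(2), of ?w] unfolding d_def by metis
  hence "mev x (- f) = x i ^ nat d" by (simp add: nzf.mev_uminus[OF xf] f_def power_int_minus) (simp add: power_int_def)
  ultimately have "ev x p0 * x i ^ nat d : Q i" using p(4) by simp
  moreover have "x i ^ j ~: Q i" for j
  proof (induction j)
   case (Suc j)
   thus ?case using Qp[OF i(2) xR[OF i(1)] subr_closed(7)[OF R xR[OF i(1)]]] x(2)[OF i(1)] by auto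
  qed (simp add: Q1[OF i(2)])
  ultimately have q0: "ev x p0 : Q (Suc i)" using Qp[OF i(2) R'(1) subr_closed(7)[OF R xR[OF i(1)]]] str[of i] i
   by (auto)
  have "x i * ev x H : Q (Suc i)" using Qid(4)[OF i(3) _ R'(3)] x(2)[OF i(1)] by blast
  moreover have "ev x H = (ev x p0 - ev x G) * inverse (x i)" by (simp add: H_def xm C.leval_diff)
  ultimately have "ev x p0 - ev x G : Q (Suc i)" using x(1) by (simp add: mult.commute mult.assoc[symmetric])
  from Qid(3)[OF i(3) q0 Qid(4)[OF i(3) this, of "- 1"]] have "ev x G : Q (Suc i)"
   using subr_closed(1,4)[OF R] by simp
  moreover have "G ~= 0" using e0 lookup_hcomp[of ?w 0 p0 e0] by (auto simp: G_def)
  moreover have "pvars {Suc i..<Suc n} G" unfolding pvars_def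
  proof (intro ballI subsetI)
   fix e v assume e: "e : keys G" "v : keys e"
   hence "v : {i..<Suc n}" using pvG unfolding pvars_def by blast
   moreover have "v ~= i" using e by (auto simp: G_def keys_hcomp)
   ultimately show "v : {Suc i..<Suc n}" by auto
  qed
  ultimately show ?case using nnG by blast
 qed
 then obtain p where p: "pvars {} p" "p ~= 0" "ev x p : Q (Suc n)" by force
 have "p = single 0 (lookup p 0)" using p(1) by (intro pm_eqI) (auto simp: pvars_def in_keys_iff)
 then obtain c where c: "p = single 0 c" by blast
 hence "scalar c : Q (Suc n)" "c ~= 0" using p(2,3) by auto
 moreover have "scalar c * scalar (1 / c) = 1" using `c ~= 0` by (simp add: scalar_hom(4)[symmetric])
 ultimately show False using Qid(4)[OF kn _ scalar_R[of "1 / c"], of "scalar c"] Q1[OF kn] by simp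
qed

lemma local_dim_eq:
 assumes M: "maximalideal M (sub_ring R)"
 shows "local_dim (sub_ring R) M = enat n"
proof -
 obtain a where a: "!!k. a k ~= 0" "!!k. k < n ==> y k - scalar (a k) : M" using point_exists[OF M] by blast
 show ?thesis unfolding local_dim_def
 proof (intro antisym Sup_least Sup_upper)
  show "enat n : {enat k |k. EX Q. (ALL i<=k. primeideal (Q i) (sub_ring R)) & (ALL i<k. Q i \<subset> Q (Suc i)) & Q k = M}"
   using PP_prime[OF M a] PP_strict[OF M a] PP_n[OF M a] by (intro CollectI exI[of _ n] conjI refl exI[of _ "PP a"]) auto
  fix e assume "e : {enat k |k. EX Q. (ALL i<=k. primeideal (Q i) (sub_ring R)) & (ALL i<k. Q i \<subset> Q (Suc i)) & Q k = M}"
  then obtain k Q where "e = enat k" "ALL i<=k. primeideal (Q i) (sub_ring R)" "ALL i<k. Q i \<subset> Q (Suc i)" by blast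
  thus "e <= enat n" using prime_chain_le[of k Q] by simp
 qed
qed

end

section \<open>Cotangent spaces\<close>

context rational_algebra
begin

context
 fixes M and a :: "nat => complex"
 assumes M: "maximalideal M (sub_ring R)" and a0: "!!k. a k ~= 0" and ya: "!!k. k < n ==> y k - scalar (a k) : M"
begin

lemmas mpt = pt_fam[OF M a0 ya]

text \<open>The logarithmic derivative y_k d/dy_k at the point: it suits Laurent monomials and
  differs from the partial derivative by the nonzero factor \<open>a k\<close>.\<close>

definition dv :: "nat => nat laurent => ambient" where
 "dv k p = (SUM e:keys p. of_int (lookup e k) * (scalar (lookup p e) * mev (pt a) e))"

lemma dv_add: "dv k (p + q) = dv k p + dv k q"
proof -
 define T where "T = keys p \<union> keys q"
 have "dv k r = (SUM e:T. of_int (lookup e k) * (scalar (lookup r e) * mev (pt a) e))" if "keys r <= T" for r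
  unfolding dv_def using that by (intro sum.mono_neutral_left) (auto simp: T_def in_keys_iff)
 thus ?thesis using Poly_Mapping.keys_add[of p q] by (simp add: T_def distrib_left distrib_right)
qed

lemma dv_single: "dv k (single e c) = of_int (lookup e k) * (scalar c * mev (pt a) e)"
 by (simp add: dv_def)

lemma dv_0: "dv k 0 = 0" by (simp add: dv_def)

lemma dv_sum: "dv k (sum f I) = (SUM i:I. dv k (f i))"
 by (induction I rule: ifi) (simp_all add: dv_add dv_0)

lemma dv_mult: "dv k (p * q) = dv k p * ev (pt a) q + ev (pt a) p * dv k q"
proof (induction p rule: pm_induct)
 case (single e c)
 show ?case by (induction q rule: pm_induct)
(simp_all add: dv_0 dv_single dv_add C.leval_add nzf.mev_add[OF mpt] algebra_simps)
qed (simp_all add: dv_0 dv_add C.leval_add algebra_simps)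

abbreviation "M2 \<equiv> ideal_prod (sub_ring R) M M"

lemma M2_ideal: "ideal M2 (sub_ring R)"
 using ring.ideal_prod_is_ideal[OF cring.axioms(1)[OF cring_sub_ring[OF R]] M_ideal[OF M] M_ideal[OF M]] .

lemmas M2_closed = idealD_sub_ring[OF M2_ideal]

lemma M2_mult: "u : M ==> v : M ==> u * v : M2"
 using ideal_prod.prod[of u M v M "sub_ring R"] by simp

lemma M2_minus: "u : M2 ==> - u : M2" using M2_closed(4)[of u "- 1"] subr_closed(1,4)[OF R] by simp

lemma M2_M: "u : M2 ==> u : M" by (induction rule: ideal_prod.induct) (use M_closed[OF M] in auto)

text \<open>By the Leibniz rule the numerator of a product of two functions vanishing at the point
  has zero derivative there.\<close>

lemma M2_dv: "r : M2 ==> EX p q. frac r p q & ev (pt a) p = 0 & dv k p = 0"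
proof (induction rule: ideal_prod.induct)
 case (prod u v)
 have "EX p q. frac w p q & ev (pt a) p = 0" if w: "w : M" for w
 proof -
  obtain p q where f: "frac w p q" using fraction M_closed(1)[OF M] w unfolding frac_def by blast
  thus ?thesis using M_frac[OF M a0 ya f] w by blast
 qed
 then obtain p q p' q' where "frac u p q" "ev (pt a) p = 0" "frac v p' q'" "ev (pt a) p' = 0" using prod by metis
 thus ?case using frac_mult by (intro exI[of _ "p * p'"] exI[of _ "q * q'"]) (simp add: dv_mult C.leval_mult[OF mpt])
next
 case (sum u v)
 then obtain p q p' q' where "frac u p q" "ev (pt a) p = 0" "dv k p = 0" "frac v p' q'" "ev (pt a) p' = 0" "dv k p' = 0" by metis
 thus ?case using frac_add
  by (intro exI[of _ "p * q' + p' * q"] exI[of _ "q * q'"]) (simp add: dv_mult dv_add C.leval_mult[OF mpt] C.leval_add)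
qed

definition lc :: "(nat => complex) => nat => ambient" where
 "lc c j = (SUM k<j. scalar (c k) * (y k - pt a k))"

lemma lc_indep:
 assumes l: "lc c j : M2" and j: "j <= n" and k: "k < j"
 shows "c k = 0"
proof -
 define L :: "nat laurent" where "L = (SUM k<j. single (single k 1) (c k) + single 0 (- (c k * a k)))"
 have ev: "ev w L = (SUM k<j. scalar (c k) * (w k - pt a k))" for w
  by (simp add: L_def C.leval_sum C.leval_add C.hom_uminus sum_subtractf sum_negf algebra_simps)
 have pL: "pvars {..<n} L" unfolding L_def using j by (intro pvars_sum pvars_add pvars_single) auto
 obtain p q where f: "frac (lc c j) p q" "dv k p = 0" using M2_dv[OF l] by blast
 have "frac (lc c j) L 1" using frac_lv[OF pL] by (simp only: ev lc_def)
 from frac_unique[OF f(1) this] have "p * 1 = L * q" .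
 hence "dv k L = 0" using f(2) unit_pt[OF M a0 ya f(1)] by (auto simp: dv_mult ev)
 moreover have "dv k L = (SUM l<j. if l = k then scalar (c k * a k) else 0)"
  unfolding L_def dv_sum dv_add dv_single by (intro sum.cong refl) (auto)
 ultimately show ?thesis using k a0 by simp
qed

lemma lc_simps: "lc (%k. c k + d k) j = lc c j + lc d j" "lc (%k. b * c k) j = scalar b * lc c j" "lc (%k. 0) j = 0"
 "l < j ==> lc (%k. if k = l then 1 else 0) j = y l - pt a l"
proof -
 show "lc (%k. if k = l then 1 else 0) j = y l - pt a l" if "l < j"
 proof -
  have "lc (%k. if k = l then 1 else 0) j = (SUM k<j. if k = l then y l - pt a l else 0)"
   unfolding lc_def by (intro sum.cong refl) (auto)
  thus ?thesis using that by simp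
 qed
qed (simp_all add: lc_def scalar_hom distrib_right sum.distrib sum_distrib_left mult.assoc)

lemma lc_M: "j <= n ==> lc c j : M"
 unfolding lc_def using M_closed(4)[OF M ya scalar_R] by (intro M_sum[OF M]) (simp add: mult.commute)

text \<open>The elements that equal a constant plus a linear form modulo \<open>M2\<close> form a
  subring closed under inverses of units; it contains the \<open>y k\<close>, hence all
  fractions.\<close>

lemma lc_span:
 assumes r: "r : M"
 shows "EX c. r - lc c n : M2"
proof -
 define H where "H = {r : R. EX d c. r - scalar d - lc c n : M2}"
 have HI: "r : H" if "r : R" "r - scalar d - lc c n : M2" for r d c using that by (auto simp: H_def)
 have lM: "lc c n : M" "lc c n : R" for c using lc_M M_closed(1)[OF M] by auto
 have H1: "scalar d : H" for d using HI[of "scalar d" d "%_. 0"] M2_closed(2) by (simp add: scalar_R lc_simps)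
 have Hm: "u * v : H" if uv: "u : H" "v : H" for u v
 proof -
  obtain d c where u: "u : R" "u - scalar d - lc c n : M2" using uv by (auto simp: H_def)
  obtain d' c' where v: "v : R" "v - scalar d' - lc c' n : M2" using uv by (auto simp: H_def)
  have "lc c n * lc c' n + (u - scalar d - lc c n) * v + (v - scalar d' - lc c' n) * (scalar d + lc c n) : M2"
   by (intro M2_closed(3,4) M2_mult lM u v subr_closed(2)[OF R] scalar_R)
  thus ?thesis
   using HI[of "u * v" "d * d'" "%k. d * c' k + d' * c k"] subr_closed(3)[OF R u(1) v(1)]
   by (simp add: lc_simps algebra_simps)
 qed
 have H: "subr H" unfolding subr_def
 proof (intro conjI ballI)
  show "1 : H" using H1[of 1] by simp
  fix u assume u: "u : H"
  show "- u : H" using Hm[OF u H1[of "- 1"]] by (simp add: C.hom_uminus)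
  fix v assume v: "v : H"
  show "u * v : H" by (rule Hm[OF u v])
  obtain d c d' c' where "u : R" "u - scalar d - lc c n : M2" "v : R" "v - scalar d' - lc c' n : M2" using u v by (auto simp: H_def)
  thus "u + v : H"
   using HI[of "u + v" "d + d'" "%k. c k + c' k"] subr_closed(2)[OF R, of u v] M2_closed(3)[of "u - scalar d - lc c n" "v - scalar d' - lc c' n"]
   by (simp add: lc_simps algebra_simps)
 qed
 have yH: "y k : H" if "k < n" for k
  using HI[of "y k" "a k" "%l. if l = k then 1 else 0"] y_R(1)[OF that] M2_closed(2) by (simp add: lc_simps(4)[OF that])
 have Hi: "inverse u : H" if u: "u : H" "inverse u : R" "u ~= 0" for u
 proof -
  obtain d c where d: "u : R" "u - scalar d - lc c n : M2" using u by (auto simp: H_def)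
  let ?l = "lc c n" and ?m = "u - scalar d - lc c n" and ?v = "inverse u"
  have d0: "d ~= 0"
  proof
   assume "d = 0"
   hence "u = ?m + ?l" by simp
   hence "u : M" using M_closed(3)[OF M M2_M[OF d(2)] lM(1)] by metis
   thus False using M_unit[OF M] u by blast
  qed
  \<comment> \<open>First-order expansion of the inverse: modulo \<open>M2\<close>, the inverse of d
    + l is s - s^2 l.\<close>
  define s where "s = scalar (1 / d)"
  have s: "s * scalar d = 1" using d0 by (simp add: s_def scalar_hom(4)[symmetric])
  have sR: "s : R" "?v * s : R" using scalar_R subr_closed(3)[OF R u(2)] by (simp_all add: s_def)
  have "s * (?v * (scalar d + ?l + ?m)) = s" using u by (auto)
  hence "s * (?v * scalar d) + s * (?v * (?l + ?m)) = s" unfolding add.assoc distrib_left .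
  moreover have "s * (?v * scalar d) = ?v" using s by simp
  ultimately have e: "?v = s - s * ?v * (?l + ?m)" using add_diff_cancel_right' mult.assoc
   by (smt (verit))
  have "- ((?l + ?m) * (?v * s)) : M"
   by (intro M_minus[OF M] M_closed(4)[OF M] M_closed(3)[OF M] lM M2_M d sR)
  also have "- ((?l + ?m) * (?v * s)) = ?v - s" using e by (simp add: algebra_simps)
  finally have vs: "?v - s : M" .
  have "- ((?v - s) * ?l * s) + - (?m * (?v * s)) : M2"
   by (intro M2_closed(3,4) M2_minus M2_mult vs lM d sR)
  moreover have "- ((?v - s) * ?l * s) + - (?m * (?v * s)) = ?v - s - (- s * s) * ?l"
   using e by (simp add: algebra_simps)
  ultimately show ?thesis using HI[of ?v "1 / d" "%k. - (1 / d * (1 / d)) * c k"] u(2)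
   by (simp only: lc_simps(2) C.hom_uminus scalar_hom(4) s_def[symmetric]) simp
 qed
 have LH: "C.lring y {..<n} <= H"
  by (rule lring_subset[OF H H1]) (use yH Hi y_R(2) nzf.nz[OF y_fam] in auto)
 have "R <= H"
 proof
  fix r assume "r : R"
  then obtain p q where f: "frac r p q" using fraction unfolding frac_def by blast
  hence "r = ev y p * inverse (ev y q)" by (simp add: frac_def field_simps)
  moreover have "ev y p : H" "ev y q : H" using f LH C.lring_memI unfolding frac_def by blast+
  ultimately show "r : H" using Hm Hi f unfolding frac_def by blast
 qed
 then obtain d c where d: "r - scalar d - lc c n : M2" using r M_closed(1)[OF M] unfolding H_def by blast
 have "scalar d = r + (- lc c n + - (r - scalar d - lc c n))" by simp
 moreover have "... : M" by (intro M_closed(3)[OF M] r M_minus[OF M] lM M2_M d)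
 ultimately have "d = 0" using M_scalar[OF M] by metis
 thus ?thesis using d by auto
qed

text \<open>\<open>dimension\<close> is defined by adjoining one vector at a time, so the span of
  the \<open>y k - pt a k\<close> is built up coordinate by coordinate.\<close>

lemma cotangent_dim_eq: "cotangent_dim (sub_ring R) scalar M n"
proof -
 let ?Q = "sub_ring R Quot M2" and ?cs = "%u. M2 +>\<^bsub>sub_ring R\<^esub> u"
 define K where "K = range (%c. ?cs (scalar c))"
 define E where "E j = ?cs ` {lc c j | c. True}" for j
 interpret I: ideal M2 "sub_ring R" by (rule M2_ideal)
 interpret Q: ring ?Q by (rule I.quotient_is_ring)
 have Qm: "?cs u \<otimes>\<^bsub>?Q\<^esub> ?cs v = ?cs (u * v)" and Qa: "?cs u \<oplus>\<^bsub>?Q\<^esub> ?cs v = ?cs (u + v)" if "u : R" "v : R" for u v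
  using I.rcoset_mult_add I.a_rcos_sum that by (simp_all add: FactRing_def)
 have Qc: "?cs u : carrier ?Q" if "u : R" for u using that by (auto simp: FactRing_def A_RCOSETS_def')
 have Qeq: "?cs u = ?cs v <-> u - v : M2" if "u : R" "v : R" for u v
 using a_inv_sub_ring[OF R that(2)] I.quotient_eq_iff_same_a_r_cos[OF M2_ideal, of u v] that by (auto simp: a_minus_def)
 have lR: "lc c j : R" if "j <= n" for c j using lc_M[OF that] M_closed(1)[OF M] by blast
 have "Q.dimension j K (E j)" if "j <= n" for j using that
 proof (induction j)
  case 0
  have "lc c 0 = 0" for c by (simp add: lc_def)
  thus ?case using I.a_rcos_const[OF M2_closed(2)] Q.zero_dim by (auto simp: E_def FactRing_def)
 next
  case (Suc j)
  let ?v = "?cs (y j - pt a j)"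
  have vM: "y j - pt a j : R" using ya M_closed(1)[OF M] Suc(2) by auto
  have lSuc: "lc c (Suc j) = scalar (c j) * (y j - pt a j) + lc c j" for c by (simp add: lc_def)
  have "?v ~: E j"
  proof
   assume "?v : E j"
   then obtain c where "?v = ?cs (lc c j)" by (auto simp: E_def)
   hence "lc c j - (y j - pt a j) : M2" using Qeq[OF lR[of j c] vM] Suc(2) by simp
   moreover have "lc c j - (y j - pt a j) = lc (c(j := - 1)) (Suc j)" by (simp add: lc_def C.hom_uminus)
   ultimately have "(c(j := - 1)) j = 0" using lc_indep[of "c(j := - 1)" "Suc j" j] Suc(2) by simp
   thus False by simp
  qed
  hence "Q.dimension (Suc j) K (Q.line_extension K ?v (E j))"
   using Q.Suc_dim[OF Qc[OF vM]] Suc by simp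
  moreover have "Q.line_extension K ?v (E j) = E (Suc j)"
  proof -
   have step: "?cs (scalar d) \<otimes>\<^bsub>?Q\<^esub> ?v \<oplus>\<^bsub>?Q\<^esub> ?cs (lc c j) = ?cs (lc (c(j := d)) (Suc j))" for c d
   proof -
    have "lc (c(j := d)) (Suc j) = scalar d * (y j - pt a j) + lc c j" by (simp add: lc_def)
    thus ?thesis using Qm[OF scalar_R vM] Qa[OF subr_closed(3)[OF R scalar_R vM] lR] Suc(2) by simp
   qed
   have upd: "lc c (Suc j) = lc (c(j := c j)) (Suc j)" for c by simp
   have "Q.line_extension K ?v (E j) = {k \<otimes>\<^bsub>?Q\<^esub> ?v \<oplus>\<^bsub>?Q\<^esub> e | k e. k : K & e : E j}"
    unfolding Q.line_extension_def r_coset_def set_add_def' by auto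
   also have "... = {?cs (lc (c(j := d)) (Suc j)) | c d. True}" unfolding step[symmetric] K_def E_def by auto
   also have "... = E (Suc j)" unfolding E_def by (auto) (metis upd)
   finally show ?thesis .
  qed
  ultimately show ?case by simp
 qed
 moreover have "E n = ?cs ` M"
 proof
  show "E n <= ?cs ` M" using lc_M by (auto simp: E_def)
  show "?cs ` M <= E n"
  proof
   fix u assume "u : ?cs ` M"
   then obtain r where r: "r : M" "u = ?cs r" by blast
   obtain c where "r - lc c n : M2" using lc_span[OF r(1)] by blast
   hence "u = ?cs (lc c n)" using Qeq lR[of n] r M_closed(1)[OF M] by auto
   thus "u : E n" by (auto simp: E_def)
  qed
 qed
 ultimately show ?thesis unfolding cotangent_dim_def K_def by (metis order_refl)
qed

end

lemma smooth: "smooth_affine_variety (sub_ring R) scalar"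
proof -
 let ?G = "F ` V \<union> (%v. inverse (F v)) ` V"
 define H where "H = generate_ring (sub_ring R) (range scalar \<union> ?G)"
 have GR: "?G <= R" using C.lring_var C.lring_inverse_var by (auto simp: R_eq)
 have HR: "H <= R" unfolding H_def
  using ring.generate_ring_in_carrier[OF cring.axioms(1)[OF cring_sub_ring[OF R]], of "range scalar \<union> ?G"] GR scalar_R by auto
 have Hm: "- u : H" if "u : H" for u
  using generate_ring.a_inv[of u "sub_ring R" "range scalar \<union> ?G"] a_inv_sub_ring[OF R, of u] that HR by (auto simp: H_def)
 have "subr H" unfolding subr_def
  using generate_ring.one[of "sub_ring R" "range scalar \<union> ?G"] generate_ring.eng_add[of _ "sub_ring R" "range scalar \<union> ?G"]
   generate_ring.eng_mult[of _ "sub_ring R" "range scalar \<union> ?G"] Hm by (simp add: H_def)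
 moreover have "x : H" if "x : range scalar \<union> ?G" for x unfolding H_def using that by (rule generate_ring.incl)
 ultimately have "R <= H" unfolding R_eq by (intro lring_subset) auto
 hence "finitely_generated_algebra (sub_ring R) scalar"
  unfolding finitely_generated_algebra_def using HR GR V by (intro exI[of _ ?G]) (auto simp: H_def)
 moreover have "EX d. cotangent_dim (sub_ring R) scalar M d & local_dim (sub_ring R) M = enat d" if M: "maximalideal M (sub_ring R)" for M
 using point_exists[OF M] cotangent_dim_eq[OF M] local_dim_eq[OF M] by (auto)
 moreover have "scalar : Ring.ring_hom (ring_of_type_algebra :: complex ring) (sub_ring R)"
  by (rule ring_hom_memI) (auto simp: scalar_R)
 ultimately show ?thesis unfolding smooth_affine_variety_def using domain_sub_ring[OF R] by blast
qed

end

theorem theorem4p2: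
 fixes n m :: nat and A B Bt :: "int mat" and E :: "(nat \<times> nat) set"
 assumes "connected_finite_type_cartan n A"
  and "orientation n A E"
  and "B = exchange_matrix n A E"
  and "extends_matrix n m B Bt"
  and "full_rank Bt"
 shows "smooth_affine_variety (invariant_ring Bt) scalar \<and>
  (\<exists>\<Phi> \<in> algebra_iso (config_ring B) (config_scalar B) (invariant_ring Bt) scalar.
   \<forall>\<gamma> \<in> PiD B. \<Phi> (config_var B \<gamma>) = ff Bt \<gamma>)"
proof -
 obtain ht where p: "belt n A ht (n + m) Bt" "belt n A ht n B" using belt_exists assms by metis
 interpret belt n A ht "n + m" Bt by (rule p(1))
 have fr: "full_rat Bt" using full_rank_full_rat assms by metis
 interpret rational_algebra R0 Fv Pi y0 n
  by (rule rational_algebra.intro[OF Fv_fam[OF fr] finite_Pi R0_def y0_fam[OF fr] y0_R0[OF fr] y0_indep[OF fr] R0_fraction[OF fr]])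
 show ?thesis using smooth config_iso[OF fr p(2)] unfolding invariant_ring_eq[OF fr] by blast
qed

end
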